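(* Let $N\in(U_8)$ be a stratified submanifold (germ) of a symplectic space $(\mathbb R^{2n},\omega)$, with associated subspaces $W,\ell_1,\ell_2,V$ and invariants $Lt,L_{1,2},L_3$. If $N$ belongs to one of the classes below, then $(N,\omega)$ satisfies the corresponding conditions (for $(U_8)^0$ and $(U_8)^1$, according to the parameters of the normal form to which $[\omega]_N$ is diffeomorphic): - $(U_8)^0$, with $[\theta_1+c_1\theta_2+c_2\theta_3]_{U_8}$, $c_1\ne0$: $\omega|_V\ne0$ and $\omega|_{\ell_1+\ell_2}\ne0$. - $(U_8)^0$, with $[\theta_1+c_2\theta_3]_{U_8}$: $\omega|_V\ne0$ and $\omega|_{\ell_1+\ell_2}=0$. - $(U_8)^1$, with $[\pm\theta_2+c_1\theta_3+c_2\theta_4]_{U_8}$, $c_2\ne2c_1$: $\omega|_V=0$, $\omega|_{\ell_1+\ell_2}\ne0$ and $L_3=5$. - $(U_8)^1$, with $[\pm\theta_2+c_1\theta_3+2c_1\theta_4]_{U_8}$: $\omega|_V=0$, $\omega|_{\ell_1+\ell_2}\ne0$ and $L_3=\infty$. - $(U_8)^2$: $\ker\omega=\ell_2$ and $L_3=5$. - $(U_8)^{3,0}_5$: $\ker\omega=\ell_2$ and $L_3=5$. - $(U_8)^{3,0}_\infty$: $\ker\omega=\ell_2$ and $L_3=\infty$. - $(U_8)^{3,1}$: $\omega|_W=0$, $L_{1,2}=\infty$ and $Lt=L_3=5$. - $(U_8)^4$: $\omega|_W=0$, $L_{1,2}=\infty$, $Lt=6$ and $L_3=\infty$. - $(U_8)^5$: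 $\omega|_W=0$, $L_{1,2}=\infty$, $Lt=7$ and $L_3=\infty$. - $(U_8)^6$: $\omega|_W=0$, $L_{1,2}=\infty$, $Lt=8$ and $L_3=\infty$. - $(U_8)^7$: $\omega|_W=0$, $L_{1,2}=\infty$, $Lt=9$ and $L_3=\infty$. - $(U_8)^8$: $\omega|_W=0$, $L_{1,2}=\infty$ and $N$ is contained in a smooth Lagrangian submanifold.
   Context: $U_8=\{x\in\mathbb R^{2n}: x_1^2+x_2x_3=x_1x_2+x_1x_3^2=x_{\ge4}=0\}$, $2n\ge4$; $(U_8)$ is the class of germs at $0$ of subsets of the symplectic space that are images of $U_8$ under a germ of a diffeomorphism. Such $N$ is a union of three branches: for $N=U_8$, $B_1$ is the $x_2$-axis, $B_2$ the $x_3$-axis (both smooth) and $B_3$ the singular branch $(x_1,x_2,x_3)=(t^3,-t^4,t^2)$. Subspaces: $W$ is the tangent space at $0$ to a nonsingular $3$-manifold containing $N$; $\ell_1$ the tangent line at $0$ to $B_1$; $\ell_2$ the tangent line at $0$ to $B_2$ (also tangent to $B_3$); $V$ the $2$-space tangent at $0$ to $B_3$. For $N=U_8$: $W=\mathrm{span}(\partial_{x_1},\partial_{x_2},\partial_{x_3})$, $\ell_1=\mathrm{span}(\partial_{x_2})$, $\ell_2=\mathrm{span}(\partial_{x_3})$, $V=\mathrm{span}(\partial_{x_1},\partial_{x_3})$ (for general $N$, transport by the differential of a diffeomorphism taking $U_8$ to $N$). $\ker\omega$ denotes the kernel of $\omega|_W$. Algebraic restrictions: $[\omega]_N=[\tilde\omega]_N$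 if $\omega-\tilde\omega=\alpha+d\beta$ with $\alpha$ a $2$-form and $\beta$ a $1$-form both vanishing at every point of $N$. $[\omega]_N$ and $[\tilde\omega]_{\tilde N}$ are diffeomorphic if there is a germ of a diffeomorphism $\Phi$ with $\Phi(\tilde N)=N$ and $[\Phi^*\omega]_{\tilde N}=[\tilde\omega]_{\tilde N}$. Forms: $\theta_1=dx_1\wedge dx_3$, $\theta_2=dx_2\wedge dx_3$, $\theta_3=dx_1\wedge dx_2$, $\theta_4=x_3dx_1\wedge dx_3$, $\theta_5=x_1dx_1\wedge dx_3$, $\theta_6=x_3^2dx_1\wedge dx_3$, $\theta_7=x_1x_3dx_1\wedge dx_3$, $\theta_8=x_3^3dx_1\wedge dx_3$. A class consists of those $N\in(U_8)$ such that $[\omega]_N$ is diffeomorphic to some member (some real parameters and sign) of the normal form with the same superscript/subscript: $[U_8]^0=[\theta_1+c_1\theta_2+c_2\theta_3]_{U_8}$; $[U_8]^1=[\pm\theta_2+c_1\theta_3+c_2\theta_4]_{U_8}$; $[U_8]^2=[\theta_3+c_1\theta_4+c_2\theta_5]_{U_8}$ with $c_1\ne2$, $c_1\ne-\frac13$; $[U_8]^{3,0}_5=[\theta_3-\frac13\theta_4+c_1\theta_5+c_2\theta_6]_{U_8}$; $[U_8]^{3,0}_\infty=[\theta_3+2\theta_4+c_1\theta_5+c_2\theta_7]_{U_8}$; $[U_8]^{3,1}=[\theta_4+c\theta_5]_{U_8}$; $[U_8]^4=[\pm\theta_5+c\theta_6]_{U_8}$; $[U_8]^5=[\theta_6+c\theta_7]_{U_8}$;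 $[U_8]^6=[\pm\theta_7+c\theta_8]_{U_8}$; $[U_8]^7=[\theta_8]_{U_8}$; $[U_8]^8=[0]_{U_8}$. Lagrangian tangency orders: for a smooth Lagrangian submanifold germ $L$ with regular equations $H_1=\dots=H_n=0$, $t(f,L)$ is the minimum of the orders of vanishing at $0$ of $H_j\circ f$; $Lt=\max_L\min_{i=1,2,3}t(B_i,L)$, $L_{1,2}=\max_L\min\{t(B_1,L),t(B_2,L)\}$, $L_3=\max_Lt(B_3,L)$, maxima over all smooth Lagrangian $L$. *)

theory Defs
  imports "HOL-Analysis.Analysis" "HOL-Library.Extended_Nat" "HOL-Library.Numeral_Type"
begin

text \<open>The space of dimension 2n is \<open>real ^ 'n bit0\<close> with \<open>n = CARD('n)\<close>.  Its coordinates are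
  \<open>x $ 1\<close>, \<open>x $ 2\<close>, \<open>x $ 3\<close>, ..., where the index type is the ring of integers modulo 2n, so that
  the last coordinate is \<open>x $ 0\<close>.  The indices 1, 2, 3 are distinct as soon as n is at least 2.
  All objects are germs at 0: only their behaviour on some neighbourhood of 0 matters.\<close>

type_synonym 'n space = "(real, 'n bit0) vec"
type_synonym 'n form1 = "'n space \<Rightarrow> 'n space \<Rightarrow> real"
type_synonym 'n form2 = "'n space \<Rightarrow> 'n space \<Rightarrow> 'n space \<Rightarrow> real"

fun Ck_on :: "nat \<Rightarrow> 'a::real_normed_vector set \<Rightarrow> ('a \<Rightarrow> 'b::real_normed_vector) \<Rightarrow> bool" where
  "Ck_on 0 S f \<longleftrightarrow> continuous_on S f"
| "Ck_on (Suc k) S f \<longleftrightarrow> (\<forall>x\<in>S. f differentiable (at x)) \<and>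
     (\<forall>v. Ck_on k S (\<lambda>x. frechet_derivative f (at x) v))"

text \<open>Only used for open sets \<open>S\<close>.\<close>
definition smooth_on :: "'a::real_normed_vector set \<Rightarrow> ('a \<Rightarrow> 'b::real_normed_vector) \<Rightarrow> bool" where
  "smooth_on S f \<longleftrightarrow> (\<forall>k. Ck_on k S f)"

text \<open>\<open>\<Phi>\<close> is a germ at 0 of a diffeomorphism fixing 0, and it maps the set germ \<open>M\<close> onto the set
  germ \<open>N\<close>.\<close>
definition diffeo_germ_onto :: "('n::finite space \<Rightarrow> 'n space) \<Rightarrow> 'n space set \<Rightarrow> 'n space set \<Rightarrow> bool"
  where
  "diffeo_germ_onto \<Phi> M N \<longleftrightarrow> \<Phi> 0 = 0 \<and>
     (\<exists>U V \<Psi>. open U \<and> open V \<and> 0 \<in> U \<and> homeomorphism U V \<Phi> \<Psi> \<and>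
        smooth_on U \<Phi> \<and> smooth_on V \<Psi> \<and> \<Phi> ` (M \<inter> U) = N \<inter> V)"

definition form1_on :: "'n::finite space set \<Rightarrow> 'n form1 \<Rightarrow> bool" where
  "form1_on U \<beta> \<longleftrightarrow> (\<forall>x\<in>U. linear (\<beta> x)) \<and> (\<forall>u. smooth_on U (\<lambda>x. \<beta> x u))"

definition form2_on :: "'n::finite space set \<Rightarrow> 'n form2 \<Rightarrow> bool" where
  "form2_on U \<omega> \<longleftrightarrow> (\<forall>x\<in>U. bilinear (\<omega> x) \<and> (\<forall>u. \<omega> x u u = 0)) \<and>
     (\<forall>u v. smooth_on U (\<lambda>x. \<omega> x u v))"

text \<open>Exterior derivatives, evaluated on constant vector fields.\<close>

definition d_form1 :: "'n::finite form1 \<Rightarrow> 'n form2" where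
  "d_form1 \<beta> x u v =
     frechet_derivative (\<lambda>y. \<beta> y v) (at x) u - frechet_derivative (\<lambda>y. \<beta> y u) (at x) v"

definition d_form2 :: "'n::finite form2 \<Rightarrow> 'n space \<Rightarrow> 'n space \<Rightarrow> 'n space \<Rightarrow> 'n space \<Rightarrow> real" where
  "d_form2 \<omega> x u v w =
     frechet_derivative (\<lambda>y. \<omega> y v w) (at x) u + frechet_derivative (\<lambda>y. \<omega> y w u) (at x) v
     + frechet_derivative (\<lambda>y. \<omega> y u v) (at x) w"

definition pullback :: "('n::finite space \<Rightarrow> 'n space) \<Rightarrow> 'n form2 \<Rightarrow> 'n form2" where
  "pullback \<Phi> \<omega> x u v =
     \<omega> (\<Phi> x) (frechet_derivative \<Phi> (at x) u) (frechet_derivative \<Phi> (at x) v)"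

definition symplectic_germ :: "'n::finite form2 \<Rightarrow> bool" where
  "symplectic_germ \<omega> \<longleftrightarrow> (\<exists>U. open U \<and> 0 \<in> U \<and> form2_on U \<omega> \<and>
     (\<forall>x\<in>U. (\<forall>u v w. d_form2 \<omega> x u v w = 0) \<and>
             (\<forall>u. (\<forall>v. \<omega> x u v = 0) \<longrightarrow> u = 0)))"

definition same_alg_restriction :: "'n::finite space set \<Rightarrow> 'n form2 \<Rightarrow> 'n form2 \<Rightarrow> bool" where
  "same_alg_restriction N \<omega> \<omega>' \<longleftrightarrow>
     (\<exists>U \<alpha> \<beta>. open U \<and> 0 \<in> U \<and> form2_on U \<alpha> \<and> form1_on U \<beta> \<and>
        (\<forall>x\<in>U. \<forall>u v. \<omega> x u v - \<omega>' x u v = \<alpha> x u v + d_form1 \<beta> x u v) \<and>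
        (\<forall>x\<in>N \<inter> U. (\<forall>u v. \<alpha> x u v = 0) \<and> (\<forall>u. \<beta> x u = 0)))"

definition alg_restrictions_diffeomorphic ::
  "'n::finite form2 \<Rightarrow> 'n space set \<Rightarrow> 'n form2 \<Rightarrow> 'n space set \<Rightarrow> bool" where
  "alg_restrictions_diffeomorphic \<omega> N \<omega>' N' \<longleftrightarrow>
     (\<exists>\<Phi>. diffeo_germ_onto \<Phi> N' N \<and> same_alg_restriction N' (pullback \<Phi> \<omega>) \<omega>')"

definition U8 :: "'n::finite space set" where
  "U8 = {x. (x $ 1)^2 + x $ 2 * x $ 3 = 0 \<and> x $ 1 * x $ 2 + x $ 1 * (x $ 3)^2 = 0 \<and>
            (\<forall>i. i \<notin> {1, 2, 3} \<longrightarrow> x $ i = 0)}"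

text \<open>In the following definitions \<open>\<Phi>\<close> is a diffeomorphism germ taking \<open>U8\<close> to the germ \<open>N\<close>
  under consideration; branches of \<open>N\<close> are represented by parametrizations.\<close>

definition branch1 :: "('n::finite space \<Rightarrow> 'n space) \<Rightarrow> real \<Rightarrow> 'n space" where
  "branch1 \<Phi> t = \<Phi> (axis 2 t)"

definition branch2 :: "('n::finite space \<Rightarrow> 'n space) \<Rightarrow> real \<Rightarrow> 'n space" where
  "branch2 \<Phi> t = \<Phi> (axis 3 t)"

definition branch3 :: "('n::finite space \<Rightarrow> 'n space) \<Rightarrow> real \<Rightarrow> 'n space" where
  "branch3 \<Phi> t = \<Phi> (axis 1 (t^3) + axis 2 (- (t^4)) + axis 3 (t^2))"

definition W_space :: "('n::finite space \<Rightarrow> 'n space) \<Rightarrow> 'n space set" where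
  "W_space \<Phi> = frechet_derivative \<Phi> (at 0) ` span {axis 1 1, axis 2 1, axis 3 1}"

definition line1 :: "('n::finite space \<Rightarrow> 'n space) \<Rightarrow> 'n space set" where
  "line1 \<Phi> = frechet_derivative \<Phi> (at 0) ` span {axis 2 1}"

definition line2 :: "('n::finite space \<Rightarrow> 'n space) \<Rightarrow> 'n space set" where
  "line2 \<Phi> = frechet_derivative \<Phi> (at 0) ` span {axis 3 1}"

definition V_space :: "('n::finite space \<Rightarrow> 'n space) \<Rightarrow> 'n space set" where
  "V_space \<Phi> = frechet_derivative \<Phi> (at 0) ` span {axis 1 1, axis 3 1}"

definition lines_sum :: "('n::finite space \<Rightarrow> 'n space) \<Rightarrow> 'n space set" where
  "lines_sum \<Phi> = {a + b | a b. a \<in> line1 \<Phi> \<and> b \<in> line2 \<Phi>}"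

definition zero_on :: "'n::finite form2 \<Rightarrow> 'n space set \<Rightarrow> bool" where
  "zero_on \<omega> S \<longleftrightarrow> (\<forall>u\<in>S. \<forall>v\<in>S. \<omega> 0 u v = 0)"

definition ker_on :: "'n::finite form2 \<Rightarrow> 'n space set \<Rightarrow> 'n space set" where
  "ker_on \<omega> S = {u \<in> S. \<forall>v\<in>S. \<omega> 0 u v = 0}"

text \<open>\<open>H\<close> collects n regular equations \<open>H x $ j = 0\<close> of a submanifold germ at 0 (of dimension n)
  whose tangent spaces, the kernels of the differentials of \<open>H\<close>, are isotropic.\<close>
definition lagrangian_germ :: "'n::finite form2 \<Rightarrow> ('n space \<Rightarrow> real ^ 'n) \<Rightarrow> bool" where
  "lagrangian_germ \<omega> H \<longleftrightarrow> H 0 = 0 \<and> surj (frechet_derivative H (at 0)) \<and>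
     (\<exists>U. open U \<and> 0 \<in> U \<and> smooth_on U H \<and>
        (\<forall>x\<in>U. H x = 0 \<longrightarrow>
           (\<forall>u v. frechet_derivative H (at x) u = 0 \<longrightarrow> frechet_derivative H (at x) v = 0 \<longrightarrow>
                  \<omega> x u v = 0)))"

text \<open>The order is infinite for functions that are flat at 0, the infimum of the empty set
  being \<open>\<infinity>\<close>.\<close>
definition vanishing_order :: "(real \<Rightarrow> real) \<Rightarrow> enat" where
  "vanishing_order g = (INF k\<in>{k. (deriv ^^ k) g 0 \<noteq> 0}. enat k)"

definition tangency_order :: "(real \<Rightarrow> 'n::finite space) \<Rightarrow> ('n space \<Rightarrow> real ^ 'n) \<Rightarrow> enat" where
  "tangency_order f H = (MIN j. vanishing_order (\<lambda>t. H (f t) $ j))"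

text \<open>Genuine maxima: a value (also \<open>\<infinity>\<close>) has to be attained by some Lagrangian submanifold.\<close>

definition Lt :: "'n::finite form2 \<Rightarrow> ('n space \<Rightarrow> 'n space) \<Rightarrow> enat" where
  "Lt \<omega> \<Phi> = (GREATEST k. \<exists>H. lagrangian_germ \<omega> H \<and>
     k = Min {tangency_order (branch1 \<Phi>) H, tangency_order (branch2 \<Phi>) H,
              tangency_order (branch3 \<Phi>) H})"

definition L12 :: "'n::finite form2 \<Rightarrow> ('n space \<Rightarrow> 'n space) \<Rightarrow> enat" where
  "L12 \<omega> \<Phi> = (GREATEST k. \<exists>H. lagrangian_germ \<omega> H \<and>
     k = min (tangency_order (branch1 \<Phi>) H) (tangency_order (branch2 \<Phi>) H))"

definition L3 :: "'n::finite form2 \<Rightarrow> ('n space \<Rightarrow> 'n space) \<Rightarrow> enat" where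
  "L3 \<omega> \<Phi> = (GREATEST k. \<exists>H. lagrangian_germ \<omega> H \<and> k = tangency_order (branch3 \<Phi>) H)"

definition contained_in_lagrangian :: "'n::finite form2 \<Rightarrow> 'n space set \<Rightarrow> bool" where
  "contained_in_lagrangian \<omega> N \<longleftrightarrow>
     (\<exists>H. lagrangian_germ \<omega> H \<and> (\<forall>\<^sub>F x in nhds 0. x \<in> N \<longrightarrow> H x = 0))"

definition dx_wedge :: "'n::finite bit0 \<Rightarrow> 'n bit0 \<Rightarrow> 'n form2" where
  "dx_wedge i j x u v = u $ i * v $ j - u $ j * v $ i"

definition theta1 :: "'n::finite form2" where
  "theta1 x u v = dx_wedge 1 3 x u v"

definition theta2 :: "'n::finite form2" where
  "theta2 x u v = dx_wedge 2 3 x u v"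

definition theta3 :: "'n::finite form2" where
  "theta3 x u v = dx_wedge 1 2 x u v"

definition theta4 :: "'n::finite form2" where
  "theta4 x u v = x $ 3 * dx_wedge 1 3 x u v"

definition theta5 :: "'n::finite form2" where
  "theta5 x u v = x $ 1 * dx_wedge 1 3 x u v"

definition theta6 :: "'n::finite form2" where
  "theta6 x u v = (x $ 3)^2 * dx_wedge 1 3 x u v"

definition theta7 :: "'n::finite form2" where
  "theta7 x u v = x $ 1 * x $ 3 * dx_wedge 1 3 x u v"

definition theta8 :: "'n::finite form2" where
  "theta8 x u v = (x $ 3)^3 * dx_wedge 1 3 x u v"

abbreviation has_normal_form :: "'n::finite form2 \<Rightarrow> 'n space set \<Rightarrow> 'n form2 \<Rightarrow> bool" where
  "has_normal_form \<omega> N \<theta> \<equiv> alg_restrictions_diffeomorphic \<omega> N \<theta> U8"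

definition class_2 :: "'n::finite form2 \<Rightarrow> 'n space set \<Rightarrow> bool" where
  "class_2 \<omega> N \<longleftrightarrow> (\<exists>c1 c2. c1 \<noteq> 2 \<and> c1 \<noteq> - 1 / 3 \<and>
     has_normal_form \<omega> N (\<lambda>x u v. theta3 x u v + c1 * theta4 x u v + c2 * theta5 x u v))"

definition class_3_0_5 :: "'n::finite form2 \<Rightarrow> 'n space set \<Rightarrow> bool" where
  "class_3_0_5 \<omega> N \<longleftrightarrow> (\<exists>c1 c2. has_normal_form \<omega> N
     (\<lambda>x u v. theta3 x u v - 1 / 3 * theta4 x u v + c1 * theta5 x u v + c2 * theta6 x u v))"

definition class_3_0_inf :: "'n::finite form2 \<Rightarrow> 'n space set \<Rightarrow> bool" where
  "class_3_0_inf \<omega> N \<longleftrightarrow> (\<exists>c1 c2. has_normal_form \<omega> N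
     (\<lambda>x u v. theta3 x u v + 2 * theta4 x u v + c1 * theta5 x u v + c2 * theta7 x u v))"

definition class_3_1 :: "'n::finite form2 \<Rightarrow> 'n space set \<Rightarrow> bool" where
  "class_3_1 \<omega> N \<longleftrightarrow> (\<exists>c. has_normal_form \<omega> N (\<lambda>x u v. theta4 x u v + c * theta5 x u v))"

definition class_4 :: "'n::finite form2 \<Rightarrow> 'n space set \<Rightarrow> bool" where
  "class_4 \<omega> N \<longleftrightarrow> (\<exists>s\<in>{1, -1}. \<exists>c. has_normal_form \<omega> N
     (\<lambda>x u v. s * theta5 x u v + c * theta6 x u v))"

definition class_5 :: "'n::finite form2 \<Rightarrow> 'n space set \<Rightarrow> bool" where
  "class_5 \<omega> N \<longleftrightarrow> (\<exists>c. has_normal_form \<omega> N (\<lambda>x u v. theta6 x u v + c * theta7 x u v))"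

definition class_6 :: "'n::finite form2 \<Rightarrow> 'n space set \<Rightarrow> bool" where
  "class_6 \<omega> N \<longleftrightarrow> (\<exists>s\<in>{1, -1}. \<exists>c. has_normal_form \<omega> N
     (\<lambda>x u v. s * theta7 x u v + c * theta8 x u v))"

definition class_7 :: "'n::finite form2 \<Rightarrow> 'n space set \<Rightarrow> bool" where
  "class_7 \<omega> N \<longleftrightarrow> has_normal_form \<omega> N theta8"

definition class_8 :: "'n::finite form2 \<Rightarrow> 'n space set \<Rightarrow> bool" where
  "class_8 \<omega> N \<longleftrightarrow> has_normal_form \<omega> N (\<lambda>x u v. 0)"

end

theory Submission
  imports Defs
begin

text \<open>In a suitable chart the symplectic form is \<open>d\<eta> + d\<beta>\<close>, with \<open>\<eta>\<close> an explicit polynomial 1-form and \<open>\<beta>\<close>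
  vanishing on \<open>U8\<close>: the part of an algebraic restriction that is not a differential is absorbed by the
  Poincare homotopy along the quasihomogeneous contraction, which preserves \<open>U8\<close>.

  A Lagrangian germ \<open>H = 0\<close> gives a primitive of the symplectic form that is bounded by a multiple of \<open>H\<close>
  (relative Poincare lemma), and this primitive is \<open>\<eta> + \<beta> + dF\<close>. Hence tangency of order \<open>k\<close> to a branch forces
  \<open>\<eta> + dF\<close> to vanish to order \<open>k\<close> along it, and comparing the jets of \<open>F\<close> along the branches bounds \<open>k\<close>.

  Conversely, let \<open>\<sigma>\<close> be a primitive vanishing at 0 whose differential at 0 vanishes on a subspace \<open>M\<close>. A Moser
  isotopy produces a Lagrangian germ whose equations restrict on \<open>M\<close> to components of \<open>\<sigma>\<close>. With
  \<open>M = W\<close>, or \<open>M\<close> a plane that contains the cuspidal branch after straightening \<open>x\<^sub>2 = - x\<^sub>3\<^sup>2\<close>, the bounds are attained.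

  Finally, a local diffeomorphism that preserves \<open>U8\<close> preserves each branch up to reparametrization,
  so neither the subspaces nor the tangency orders depend on the chart.\<close>

section \<open>Smooth maps\<close>

text \<open>The numbers 5 to 9 are the exponents of \<open>x1 x3\<close>, \<open>x1^2\<close>,
  \<open>x1 x3^2\<close>, \<open>x1^2 x3\<close>, \<open>x1 x3^3\<close> along the cusp
  \<open>(t^3, -t^4, t^2)\<close>: up to constants, these monomials times \<open>dx3\<close> are
  primitives of \<open>theta4\<close> to \<open>theta8\<close>. The obstacle to reading orders off
  them is the freedom to add dF. It is real: \<open>theta3 + 2 theta4\<close> is the differential of
  \<open>-(x2 + x3^2) dx1\<close>, which vanishes on the cusp, and \<open>theta5\<close> to
  \<open>theta8\<close> have primitives vanishing there too. So in the absence of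
  \<open>theta1\<close> only t^5 matters for \<open>L3\<close>, with coefficient the
  \<open>theta4\<close> coefficient minus twice the \<open>theta3\<close> coefficient; hence the
  special values \<open>c1 = 2\<close> and \<open>c2 = 2 * c1\<close>. When one F has to serve all
  three branches, the other exponents become visible again, in \<open>Lt\<close>. This is why two
  primitives of the same form occur, one adapted to the cusp and one to the smooth branches. As the
  maxima must be attained, each bound also needs an actual Lagrangian germ, hence the Moser argument
  and, behind it, flows that depend smoothly on the initial point.\<close>

abbreviation fd :: "('a::real_normed_vector \<Rightarrow> 'b::real_normed_vector) \<Rightarrow> 'a \<Rightarrow> 'a \<Rightarrow> 'b" where
  "fd f x \<equiv> frechet_derivative f (at x)"

lemma fd_eqI: "(f has_derivative f') (at x) \<Longrightarrow> fd f x = f'"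
  by (metis frechet_derivative_at)

lemma fd_cong:
  assumes "open S" "x \<in> S" "\<And>y. y \<in> S \<Longrightarrow> f y = g y"
  shows "fd f x = fd g x"
proof -
  have "(f has_derivative f') (at x) \<longleftrightarrow> (g has_derivative f') (at x)" for f'
    using assms has_derivative_transform_within_open[of f f' x UNIV S g]
      has_derivative_transform_within_open[of g f' x UNIV S f] by auto
  thus ?thesis by (simp add: frechet_derivative_def)
qed

lemma differentiable_cong_open:
  assumes "open S" "x \<in> S" "\<And>y. y \<in> S \<Longrightarrow> f y = g y"
  shows "f differentiable (at x) \<longleftrightarrow> g differentiable (at x)"
  using assms has_derivative_transform_within_open[of f _ x UNIV S g]
      has_derivative_transform_within_open[of g _ x UNIV S f]
  by (auto simp: differentiable_def)

lemma Ck_on_cong: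
  assumes "open S" "\<And>x. x \<in> S \<Longrightarrow> f x = g x"
  shows "Ck_on k S f \<longleftrightarrow> Ck_on k S g"
  using assms(2)
proof (induction k arbitrary: f g)
  case 0 thus ?case using continuous_on_cong by (metis Ck_on.simps(1))
next
  case (Suc k)
  have "Ck_on k S (\<lambda>x. fd f x v) \<longleftrightarrow> Ck_on k S (\<lambda>x. fd g x v)" for v
    by (rule Suc.IH) (use fd_cong[OF assms(1)] Suc.prems in metis)
  moreover have "\<forall>x\<in>S. f differentiable (at x) \<longleftrightarrow> g differentiable (at x)"
    using differentiable_cong_open[OF assms(1)] Suc.prems by blast
  ultimately show ?case by auto
qed

lemma Ck_on_subset: "Ck_on k S f \<Longrightarrow> T \<subseteq> S \<Longrightarrow> Ck_on k T f"
  by (induction k arbitrary: f) (auto intro: continuous_on_subset)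

lemma Ck_on_imp_continuous_on: "Ck_on k S f \<Longrightarrow> continuous_on S f"
proof (cases k)
  case (Suc j)
  thus "Ck_on k S f \<Longrightarrow> ?thesis"
    using continuous_at_imp_continuous_on differentiable_imp_continuous_within by fastforce
qed simp

lemma Ck_on_SucD: "Ck_on (Suc k) S f \<Longrightarrow> Ck_on k S f"
proof (induction k arbitrary: f)
  case 0 show ?case using Ck_on_imp_continuous_on[OF 0] by simp
next
  case (Suc k) thus ?case by simp
qed

lemma Ck_on_le: "Ck_on k S f \<Longrightarrow> j \<le> k \<Longrightarrow> Ck_on j S f"
  by (induction k) (auto simp: le_Suc_eq dest: Ck_on_SucD simp del: Ck_on.simps(2))

text \<open>Lets an explicit formula \<open>D\<close> for the derivative take the place of
  \<open>frechet_derivative\<close>; most closure properties below are proved through it.\<close>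

lemma Ck_on_SucI:
  assumes "open S" "\<And>x. x \<in> S \<Longrightarrow> (f has_derivative D x) (at x)" "\<And>v. Ck_on k S (\<lambda>x. D x v)"
  shows "Ck_on (Suc k) S f"
proof -
  have "fd f x = D x" if "x \<in> S" for x by (rule fd_eqI) (rule assms(2)[OF that])
  hence "Ck_on k S (\<lambda>x. fd f x v)" for v
    using assms(3)[of v] Ck_on_cong[OF assms(1), of "\<lambda>x. fd f x v" "\<lambda>x. D x v"] by simp
  thus ?thesis using assms(2) by (auto simp: differentiable_def)
qed

lemma Ck_on_SucE:
  assumes "Ck_on (Suc k) S f"
  shows "x \<in> S \<Longrightarrow> (f has_derivative fd f x) (at x)" "Ck_on k S (\<lambda>x. fd f x v)"
  using assms by (auto simp: frechet_derivative_works[symmetric])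

lemma Ck_on_const: "Ck_on k S (\<lambda>x. c)"
  by (induction k arbitrary: c) auto

lemma Ck_on_bounded_linear: "open S \<Longrightarrow> bounded_linear h \<Longrightarrow> Ck_on k S h"
proof (cases k)
  case 0 thus "bounded_linear h \<Longrightarrow> ?thesis" by (simp add: linear_continuous_on)
next
  case (Suc j)
  thus "open S \<Longrightarrow> bounded_linear h \<Longrightarrow> ?thesis"
    unfolding Suc by (intro Ck_on_SucI[where D="\<lambda>x. h"] Ck_on_const bounded_linear_imp_has_derivative)
qed

lemma Ck_on_bl_comp:
  assumes "open S" "bounded_linear h" "Ck_on k S f"
  shows "Ck_on k S (\<lambda>x. h (f x))"
  using assms(3)
proof (induction k arbitrary: f)
  case 0 thus ?case using bounded_linear.continuous_on[OF assms(2)] by auto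
next
  case (Suc k)
  note f = Ck_on_SucE[OF Suc.prems]
  show ?case
    by (rule Ck_on_SucI[OF assms(1), where D="\<lambda>x v. h (fd f x v)"])
      (rule bounded_linear.has_derivative[OF assms(2) f(1)] Suc.IH[OF f(2)], assumption?)+
qed

lemma Ck_on_add:
  assumes "open S" "Ck_on k S f" "Ck_on k S g"
  shows "Ck_on k S (\<lambda>x. f x + g x)"
  using assms(2,3)
proof (induction k arbitrary: f g)
  case 0 thus ?case by (auto intro: continuous_intros)
next
  case (Suc k)
  note f = Ck_on_SucE[OF Suc.prems(1)] and g = Ck_on_SucE[OF Suc.prems(2)]
  show ?case
    by (rule Ck_on_SucI[OF assms(1), where D="\<lambda>x v. fd f x v + fd g x v"])
      (rule has_derivative_add[OF f(1) g(1)] Suc.IH[OF f(2) g(2)], assumption?, assumption?)+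
qed

lemma Ck_on_bilinear:
  assumes B: "bounded_bilinear B" and "open S" "Ck_on k S f" "Ck_on k S g"
  shows "Ck_on k S (\<lambda>x. B (f x) (g x))"
  using assms(3,4)
proof (induction k arbitrary: f g)
  case 0 thus ?case using bounded_bilinear.continuous_on[OF B] by auto
next
  case (Suc k)
  show ?case
  proof (rule Ck_on_SucI[where D="\<lambda>x v. B (f x) (fd g x v) + B (fd f x v) (g x)"])
    show "Ck_on k S (\<lambda>x. B (f x) (fd g x v) + B (fd f x v) (g x))" for v
      using Suc Ck_on_SucE(2)[OF Suc.prems(1)] Ck_on_SucE(2)[OF Suc.prems(2)]
      by (intro Ck_on_add[OF assms(2)] Suc.IH) (auto dest: Ck_on_SucD simp del: Ck_on.simps)
  qed (use assms(2) bounded_bilinear.FDERIV[OF B Ck_on_SucE(1)[OF Suc.prems(1)]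
      Ck_on_SucE(1)[OF Suc.prems(2)]] in blast)+
qed

lemma Ck_on_sum:
  assumes "open S" "\<And>i. i \<in> I \<Longrightarrow> Ck_on k S (f i)"
  shows "Ck_on k S (\<lambda>x. \<Sum>i\<in>I. f i x)"
  using assms(2)
  by (induction I rule: infinite_finite_induct) (auto intro: Ck_on_const Ck_on_add[OF assms(1)])

text \<open>\<open>Ck_on\<close> controls derivatives in fixed directions only. A derivative applied
  to a direction that itself varies is reduced to these by linearity, as a finite sum of
  products.\<close>

lemma fd_basis_expand:
  fixes f :: "'a::euclidean_space \<Rightarrow> 'b::real_normed_vector"
  assumes "f differentiable (at x)"
  shows "fd f x w = (\<Sum>b\<in>Basis. (w \<bullet> b) *\<^sub>R fd f x b)"
proof -
  interpret bounded_linear "fd f x"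
    using assms frechet_derivative_works has_derivative_bounded_linear by blast
  have "fd f x (\<Sum>b\<in>Basis. (w \<bullet> b) *\<^sub>R b) = (\<Sum>b\<in>Basis. (w \<bullet> b) *\<^sub>R fd f x b)"
    by (simp add: sum scaleR)
  thus ?thesis by (simp add: euclidean_representation)
qed

text \<open>Induction on the order with f generalized and g fixed: by the chain rule the derivative
  of the composite is a sum of products of components of the derivative of g and of directional
  derivatives of f composed with g, and the latter are of one order less.\<close>

lemma Ck_on_compose:
  fixes f :: "'b::euclidean_space \<Rightarrow> 'c::real_normed_vector"
  assumes "open S" "Ck_on k T f" "Ck_on k S g" "g ` S \<subseteq> T"
  shows "Ck_on k S (\<lambda>x. f (g x))"
  using assms(2,3)
proof (induction k arbitrary: f)
  case 0 thus ?case using assms(4) by (auto intro: continuous_on_compose2)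
next
  case (Suc k)
  note f = Ck_on_SucE[OF Suc.prems(1)] and g = Ck_on_SucE[OF Suc.prems(2)]
  have gT: "g x \<in> T" if "x \<in> S" for x using assms(4) that by auto
  have eq: "fd f (g x) (fd g x v) = (\<Sum>b\<in>Basis. (fd g x v \<bullet> b) *\<^sub>R fd f (g x) b)" if "x \<in> S" for x v
    by (rule fd_basis_expand) (use Suc.prems(1) gT[OF that] in auto)
  show ?case
  proof (rule Ck_on_SucI[where D="\<lambda>x v. \<Sum>b\<in>Basis. (fd g x v \<bullet> b) *\<^sub>R fd f (g x) b"])
    fix x assume x: "x \<in> S"
    have "((\<lambda>x. f (g x)) has_derivative (\<lambda>v. fd f (g x) (fd g x v))) (at x)"
      using has_derivative_compose[OF g(1)[OF x] f(1)[OF gT[OF x]]] .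
    thus "((\<lambda>x. f (g x)) has_derivative (\<lambda>v. \<Sum>b\<in>Basis. (fd g x v \<bullet> b) *\<^sub>R fd f (g x) b)) (at x)"
      by (simp add: eq[OF x])
  next
    show "Ck_on k S (\<lambda>x. \<Sum>b\<in>Basis. (fd g x v \<bullet> b) *\<^sub>R fd f (g x) b)" for v
      by (intro Ck_on_sum[OF assms(1)] Ck_on_bilinear[OF bounded_bilinear_scaleR assms(1)]
          Ck_on_bl_comp[OF assms(1) bounded_linear_inner_left] Suc.IH g(2) f(2)
          Ck_on_SucD[OF Suc.prems(2)])
  qed (rule assms(1))
qed

lemma Ck_on_inverse:
  fixes f :: "'a::real_normed_vector \<Rightarrow> real"
  assumes "open S" "Ck_on k S f" "\<And>x. x \<in> S \<Longrightarrow> f x \<noteq> 0"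
  shows "Ck_on k S (\<lambda>x. inverse (f x))"
  using assms(2)
proof (induction k)
  case 0 thus ?case using assms(3) by (auto intro!: continuous_intros)
next
  case (Suc k)
  note f = Ck_on_SucE[OF Suc.prems(1)]
  note IH = Suc.IH[OF Ck_on_SucD[OF Suc.prems]]
  show ?case
  proof (rule Ck_on_SucI[where D="\<lambda>x v. - (inverse (f x) * fd f x v * inverse (f x))"])
    show "Ck_on k S (\<lambda>x. - (inverse (f x) * fd f x v * inverse (f x)))" for v
      by (intro Ck_on_bl_comp[OF assms(1) bounded_linear_minus[OF bounded_linear_ident]]
          Ck_on_bilinear[OF bounded_bilinear_mult assms(1)] IH f(2))
    show "((\<lambda>x. inverse (f x)) has_derivative (\<lambda>v. - (inverse (f x) * fd f x v * inverse (f x)))) (at x)"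
      if "x \<in> S" for x
      using Deriv.has_derivative_inverse[OF assms(3)[OF that] f(1)[OF that]] .
  qed (rule assms(1))
qed

lemma smooth_onD: "smooth_on S f \<Longrightarrow> Ck_on k S f"
  by (simp add: smooth_on_def)

lemma smooth_on_has_derivative: "smooth_on S f \<Longrightarrow> x \<in> S \<Longrightarrow> (f has_derivative fd f x) (at x)"
  using Ck_on_SucE(1)[of 0 S f x] by (simp only: smooth_on_def)

lemma smooth_on_differentiable: "smooth_on S f \<Longrightarrow> x \<in> S \<Longrightarrow> f differentiable (at x)"
  using smooth_on_has_derivative differentiable_def by blast

lemma smooth_on_linear_fd: "smooth_on S f \<Longrightarrow> x \<in> S \<Longrightarrow> bounded_linear (fd f x)"
  using smooth_on_has_derivative has_derivative_bounded_linear by blast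

lemma smooth_on_fd: "smooth_on S f \<Longrightarrow> smooth_on S (\<lambda>x. fd f x v)"
  unfolding smooth_on_def using Ck_on_SucE(2) by blast

lemma smooth_on_continuous_on: "smooth_on S f \<Longrightarrow> continuous_on S f"
  by (rule Ck_on_imp_continuous_on[of 0]) (simp only: smooth_on_def)

lemma smooth_on_subset: "smooth_on S f \<Longrightarrow> T \<subseteq> S \<Longrightarrow> smooth_on T f"
  unfolding smooth_on_def using Ck_on_subset by blast

lemma smooth_on_cong: "open S \<Longrightarrow> (\<And>x. x \<in> S \<Longrightarrow> f x = g x) \<Longrightarrow> smooth_on S f \<longleftrightarrow> smooth_on S g"
  unfolding smooth_on_def using Ck_on_cong by blast

named_theorems smooth_intros

lemma smooth_on_const [smooth_intros]: "smooth_on S (\<lambda>x. c)"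
  by (simp add: smooth_on_def Ck_on_const)

lemma smooth_on_bounded_linear: "open S \<Longrightarrow> bounded_linear h \<Longrightarrow> smooth_on S h"
  by (simp add: smooth_on_def Ck_on_bounded_linear)

lemma smooth_on_ident [smooth_intros]: "open S \<Longrightarrow> smooth_on S (\<lambda>x. x)"
  by (simp add: smooth_on_bounded_linear)

lemma smooth_on_bl_comp: "open S \<Longrightarrow> bounded_linear h \<Longrightarrow> smooth_on S f \<Longrightarrow> smooth_on S (\<lambda>x. h (f x))"
  by (simp add: smooth_on_def Ck_on_bl_comp)

lemma smooth_on_linear_comp:
  fixes h :: "'b::euclidean_space \<Rightarrow> 'c::real_normed_vector"
  shows "linear h \<Longrightarrow> open S \<Longrightarrow> smooth_on S f \<Longrightarrow> smooth_on S (\<lambda>x. h (f x))"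
  by (simp add: smooth_on_bl_comp linear_conv_bounded_linear)

lemma smooth_on_add [smooth_intros]:
  "open S \<Longrightarrow> smooth_on S f \<Longrightarrow> smooth_on S g \<Longrightarrow> smooth_on S (\<lambda>x. f x + g x)"
  by (simp add: smooth_on_def Ck_on_add)

lemma smooth_on_bilinear:
  "bounded_bilinear B \<Longrightarrow> open S \<Longrightarrow> smooth_on S f \<Longrightarrow> smooth_on S g \<Longrightarrow> smooth_on S (\<lambda>x. B (f x) (g x))"
  by (simp add: smooth_on_def Ck_on_bilinear)

lemma smooth_on_minus [smooth_intros]: "open S \<Longrightarrow> smooth_on S f \<Longrightarrow> smooth_on S (\<lambda>x. - f x)"
  by (rule smooth_on_bl_comp[OF _ bounded_linear_minus[OF bounded_linear_ident]])

lemma smooth_on_diff [smooth_intros]: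
  "open S \<Longrightarrow> smooth_on S f \<Longrightarrow> smooth_on S g \<Longrightarrow> smooth_on S (\<lambda>x. f x - g x)"
  using smooth_on_add[of S f "\<lambda>x. - g x"] smooth_on_minus by force

lemma smooth_on_mult [smooth_intros]:
  fixes f g :: "_ \<Rightarrow> real"
  shows "open S \<Longrightarrow> smooth_on S f \<Longrightarrow> smooth_on S g \<Longrightarrow> smooth_on S (\<lambda>x. f x * g x)"
  by (rule smooth_on_bilinear[OF bounded_bilinear_mult])

lemma smooth_on_scaleR [smooth_intros]:
  "open S \<Longrightarrow> smooth_on S f \<Longrightarrow> smooth_on S g \<Longrightarrow> smooth_on S (\<lambda>x. f x *\<^sub>R g x)"
  by (rule smooth_on_bilinear[OF bounded_bilinear_scaleR])

lemma smooth_on_inner [smooth_intros]: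
  "open S \<Longrightarrow> smooth_on S f \<Longrightarrow> smooth_on S g \<Longrightarrow> smooth_on S (\<lambda>x. f x \<bullet> g x)"
  by (rule smooth_on_bilinear[OF bounded_bilinear_inner])

lemma smooth_on_sum [smooth_intros]:
  "open S \<Longrightarrow> (\<And>i. i \<in> I \<Longrightarrow> smooth_on S (f i)) \<Longrightarrow> smooth_on S (\<lambda>x. \<Sum>i\<in>I. f i x)"
  by (simp add: smooth_on_def Ck_on_sum)

lemma smooth_on_power [smooth_intros]:
  fixes f :: "_ \<Rightarrow> real"
  shows "open S \<Longrightarrow> smooth_on S f \<Longrightarrow> smooth_on S (\<lambda>x. f x ^ n)"
  by (induction n) (simp_all add: smooth_on_const smooth_on_mult)

lemma smooth_on_prod [smooth_intros]:
  fixes f :: "_ \<Rightarrow> _ \<Rightarrow> real"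
  shows "open S \<Longrightarrow> (\<And>i. i \<in> I \<Longrightarrow> smooth_on S (f i)) \<Longrightarrow> smooth_on S (\<lambda>x. \<Prod>i\<in>I. f i x)"
  by (induction I rule: infinite_finite_induct) (simp_all add: smooth_on_const smooth_on_mult)

lemma smooth_on_vec_nth [smooth_intros]:
  "open S \<Longrightarrow> smooth_on S f \<Longrightarrow> smooth_on S (\<lambda>x. f x $ i)"
  by (rule smooth_on_bl_comp[OF _ bounded_linear_vec_nth])

lemma smooth_on_fst [smooth_intros]: "open S \<Longrightarrow> smooth_on S f \<Longrightarrow> smooth_on S (\<lambda>x. fst (f x))"
  by (rule smooth_on_bl_comp[OF _ bounded_linear_fst])

lemma smooth_on_snd [smooth_intros]: "open S \<Longrightarrow> smooth_on S f \<Longrightarrow> smooth_on S (\<lambda>x. snd (f x))"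
  by (rule smooth_on_bl_comp[OF _ bounded_linear_snd])

lemma smooth_on_Pair [smooth_intros]:
  assumes "open S" "smooth_on S f" "smooth_on S g"
  shows "smooth_on S (\<lambda>x. (f x, g x))"
proof -
  have "bounded_linear (\<lambda>a. (a, 0))" "bounded_linear (\<lambda>b. (0, b))"
    by (auto intro!: bounded_linear_Pair bounded_linear_ident bounded_linear_zero)
  hence "smooth_on S (\<lambda>x. (f x, 0) + (0, g x))"
    using assms by (intro smooth_on_add smooth_on_bl_comp[where h="\<lambda>a. (a, 0)"]
        smooth_on_bl_comp[where h="\<lambda>b. (0, b)"])
  thus ?thesis by simp
qed

lemma Ck_on_componentwise:
  fixes f :: "_ \<Rightarrow> 'b::euclidean_space"
  assumes "open S" "\<And>b. b \<in> Basis \<Longrightarrow> Ck_on k S (\<lambda>x. f x \<bullet> b)"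
  shows "Ck_on k S f"
proof -
  have "Ck_on k S (\<lambda>x. \<Sum>b\<in>Basis. (f x \<bullet> b) *\<^sub>R b)"
    using assms by (intro Ck_on_sum Ck_on_bl_comp[OF _ bounded_linear_scaleR_left])
  thus ?thesis by (simp add: euclidean_representation)
qed

lemma Ck_on_vec:
  fixes f :: "_ \<Rightarrow> real ^ 'n"
  assumes "open S" "\<And>i. Ck_on k S (\<lambda>x. f x $ i)"
  shows "Ck_on k S f"
proof (rule Ck_on_componentwise[OF assms(1)])
  fix b :: "real ^ 'n" assume "b \<in> Basis"
  then obtain i where "b = axis i 1" by (auto simp: Basis_vec_def)
  thus "Ck_on k S (\<lambda>x. f x \<bullet> b)" using assms(2)[of i] by (simp add: inner_axis)
qed

lemma smooth_on_vec [smooth_intros]: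
  fixes f :: "_ \<Rightarrow> _ \<Rightarrow> real"
  assumes "open S" "\<And>i. smooth_on S (\<lambda>x. f i x)"
  shows "smooth_on S (\<lambda>x. \<chi> i. f i x)"
  unfolding smooth_on_def by (intro allI Ck_on_vec assms(1)) (use assms(2) in \<open>simp add: smooth_on_def\<close>)

lemma smooth_on_compose:
  fixes f :: "'b::euclidean_space \<Rightarrow> 'c::real_normed_vector"
  assumes "smooth_on T f" "open S" "smooth_on S g" "\<And>x. x \<in> S \<Longrightarrow> g x \<in> T"
  shows "smooth_on S (\<lambda>x. f (g x))"
proof -
  have "g ` S \<subseteq> T" using assms(4) by auto
  thus ?thesis using Ck_on_compose[OF assms(2), of _ T f g] assms(1,3) by (simp add: smooth_on_def)
qed

lemma fd_compose:
  fixes f :: "'b::euclidean_space \<Rightarrow> 'c::real_normed_vector"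
  assumes "smooth_on T f" "smooth_on S g" "x \<in> S" "g x \<in> T"
  shows "fd (\<lambda>x. f (g x)) x v = fd f (g x) (fd g x v)"
  using fd_eqI[OF has_derivative_compose[OF smooth_on_has_derivative[OF assms(2,3)]
        smooth_on_has_derivative[OF assms(1,4)]]] by simp

section \<open>Symmetry of second derivatives\<close>

lemma smooth_on_second_difference:
  fixes f :: "'a::euclidean_space \<Rightarrow> real"
  assumes f: "smooth_on (ball x r) f" and h: "0 < h" "h * norm u < r / 2" "h * norm v < r / 2"
  obtains a b where "0 \<le> a" "a \<le> h" "0 \<le> b" "b \<le> h"
    "f (x + h *\<^sub>R u + h *\<^sub>R v) - f (x + h *\<^sub>R u) - f (x + h *\<^sub>R v) + f x
      = h * (h * fd (\<lambda>y. fd f y u) (x + a *\<^sub>R u + b *\<^sub>R v) v)"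
proof -
  have in_ball: "x + a *\<^sub>R u + b *\<^sub>R v \<in> ball x r" if "0 \<le> a" "a \<le> h" "0 \<le> b" "b \<le> h" for a b
  proof -
    have "norm (a *\<^sub>R u + b *\<^sub>R v) \<le> a * norm u + b * norm v"
      using norm_triangle_ineq[of "a *\<^sub>R u" "b *\<^sub>R v"] that by simp
    also have "\<dots> \<le> h * norm u + h * norm v"
      by (intro add_mono mult_right_mono that norm_ge_zero)
    also have "\<dots> < r" using h by simp
    finally have "norm (- (a *\<^sub>R u + b *\<^sub>R v)) < r" by (simp only: norm_minus_cancel)
    thus ?thesis by (simp add: dist_norm algebra_simps)
  qed
  have d: "((\<lambda>s. g (p + s *\<^sub>R w)) has_real_derivative fd g (p + s *\<^sub>R w) w) (at s)"
    if "smooth_on (ball x r) g" "p + s *\<^sub>R w \<in> ball x r" for g :: "'a \<Rightarrow> real" and p w s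
  proof -
    have "((\<lambda>s. p + s *\<^sub>R w) has_vector_derivative w) (at s)"
      by (auto intro!: derivative_eq_intros simp: has_vector_derivative_def)
    from vector_derivative_diff_chain_within[OF this, of g "fd g (p + s *\<^sub>R w)"]
    show ?thesis using smooth_on_has_derivative[OF that]
      by (simp add: has_real_derivative_iff_has_vector_derivative o_def has_derivative_at_withinI)
  qed
  \<comment> \<open>The second difference is the increment over \<open>[0, h]\<close> of the first
    difference in direction v. The mean value theorem is applied to it, and then once more to the
    derivative in direction u.\<close>
  let ?\<phi> = "\<lambda>s. f ((x + h *\<^sub>R v) + s *\<^sub>R u) - f (x + s *\<^sub>R u)"
  have "\<exists>a>0. a < h \<and> ?\<phi> h - ?\<phi> 0 = (h - 0) * (fd f ((x + h *\<^sub>R v) + a *\<^sub>R u) u - fd f (x + a *\<^sub>R u) u)"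
  proof (rule MVT2[OF h(1)])
    fix s assume "0 \<le> s" "s \<le> h"
    thus "(?\<phi> has_real_derivative (fd f ((x + h *\<^sub>R v) + s *\<^sub>R u) u - fd f (x + s *\<^sub>R u) u)) (at s)"
      using in_ball[of s h] in_ball[of s 0] h by (intro DERIV_diff d[OF f]) (auto simp: algebra_simps)
  qed
  then obtain a where a: "0 < a" "a < h"
    "?\<phi> h - ?\<phi> 0 = h * (fd f ((x + h *\<^sub>R v) + a *\<^sub>R u) u - fd f (x + a *\<^sub>R u) u)" by auto
  let ?\<psi> = "\<lambda>t. fd f ((x + a *\<^sub>R u) + t *\<^sub>R v) u"
  have "\<exists>b>0. b < h \<and> ?\<psi> h - ?\<psi> 0 = (h - 0) * fd (\<lambda>y. fd f y u) ((x + a *\<^sub>R u) + b *\<^sub>R v) v"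
  proof (rule MVT2[OF h(1)])
    fix t assume "0 \<le> t" "t \<le> h"
    thus "(?\<psi> has_real_derivative fd (\<lambda>y. fd f y u) ((x + a *\<^sub>R u) + t *\<^sub>R v) v) (at t)"
      using in_ball[of a t] a by (intro d smooth_on_fd[OF f]) auto
  qed
  then obtain b where b: "0 < b" "b < h"
    "?\<psi> h - ?\<psi> 0 = h * fd (\<lambda>y. fd f y u) ((x + a *\<^sub>R u) + b *\<^sub>R v) v" by auto
  show ?thesis
    by (rule that[of a b]) (use a b in \<open>simp_all add: algebra_simps\<close>)
qed

text \<open>The second difference does not change when u and v are exchanged, so the two iterated
  derivatives agree at pairs of points tending to \<open>x\<close>; continuity passes the equality
  on to \<open>x\<close>.\<close>

lemma smooth_on_fd_commute_real:
  fixes f :: "'a::euclidean_space \<Rightarrow> real"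
  assumes f: "smooth_on S f" "open S" "x \<in> S"
  shows "fd (\<lambda>y. fd f y u) x v = fd (\<lambda>y. fd f y v) x u"
proof -
  obtain r where r: "r > 0" "ball x r \<subseteq> S" using assms open_contains_ball by blast
  have fr: "smooth_on (ball x r) f" using f(1) r(2) smooth_on_subset by blast
  define M where "M = norm u + norm v + 1"
  have M: "M > 0" "norm u < M" "norm v < M"
    using norm_ge_zero[of u] norm_ge_zero[of v] by (auto simp: M_def add_strict_increasing2 simp del: norm_ge_zero)
  \<comment> \<open>The denominators keep both displacements below \<open>r / 2\<close>, and
    \<open>h n\<close> tends to 0.\<close>
  define h where "h n = r / (2 * M) / (Suc n)" for n
  have h: "0 < h n" "h n * norm u < r / 2" "h n * norm v < r / 2" for n
  proof -
    have "h n \<le> r / (2 * M) / 1" unfolding h_def using r M by (intro divide_left_mono) auto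
    hence *: "h n * M \<le> r / 2" using M by (simp add: field_simps)
    show "0 < h n" using r M by (simp add: h_def)
    hence "h n * norm u < h n * M" "h n * norm v < h n * M" using M by simp_all
    thus "h n * norm u < r / 2" "h n * norm v < r / 2" using * by linarith+
  qed
  have h0: "h \<longlonglongrightarrow> 0"
    unfolding h_def by (intro LIMSEQ_Suc[OF lim_const_over_n])
  have ev: "\<exists>a b c d. 0 \<le> a \<and> a \<le> h n \<and> 0 \<le> b \<and> b \<le> h n \<and> 0 \<le> c \<and> c \<le> h n \<and> 0 \<le> d \<and> d \<le> h n \<and>
      fd (\<lambda>y. fd f y u) (x + a *\<^sub>R u + b *\<^sub>R v) v = fd (\<lambda>y. fd f y v) (x + c *\<^sub>R v + d *\<^sub>R u) u" for n
  proof -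
    obtain a b where ab: "0 \<le> a" "a \<le> h n" "0 \<le> b" "b \<le> h n"
      "f (x + h n *\<^sub>R u + h n *\<^sub>R v) - f (x + h n *\<^sub>R u) - f (x + h n *\<^sub>R v) + f x
        = h n * (h n * fd (\<lambda>y. fd f y u) (x + a *\<^sub>R u + b *\<^sub>R v) v)"
      by (rule smooth_on_second_difference[OF fr h])
    obtain c d where cd: "0 \<le> c" "c \<le> h n" "0 \<le> d" "d \<le> h n"
      "f (x + h n *\<^sub>R v + h n *\<^sub>R u) - f (x + h n *\<^sub>R v) - f (x + h n *\<^sub>R u) + f x
        = h n * (h n * fd (\<lambda>y. fd f y v) (x + c *\<^sub>R v + d *\<^sub>R u) u)"
      by (rule smooth_on_second_difference[OF fr h(1,3,2)])
    have "h n * (h n * fd (\<lambda>y. fd f y u) (x + a *\<^sub>R u + b *\<^sub>R v) v)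
        = h n * (h n * fd (\<lambda>y. fd f y v) (x + c *\<^sub>R v + d *\<^sub>R u) u)"
      using ab(5) cd(5) by (simp add: algebra_simps)
    thus ?thesis using h(1)[of n] ab cd by (intro exI[of _ a] exI[of _ b] exI[of _ c] exI[of _ d]) auto
  qed
  then obtain a b c d where abcd: "\<And>n. 0 \<le> a n" "\<And>n. a n \<le> h n" "\<And>n. 0 \<le> b n" "\<And>n. b n \<le> h n"
      "\<And>n. 0 \<le> c n" "\<And>n. c n \<le> h n" "\<And>n. 0 \<le> d n" "\<And>n. d n \<le> h n"
      and eq: "\<And>n. fd (\<lambda>y. fd f y u) (x + a n *\<^sub>R u + b n *\<^sub>R v) v
        = fd (\<lambda>y. fd f y v) (x + c n *\<^sub>R v + d n *\<^sub>R u) u" by metis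
  have lim0: "e \<longlonglongrightarrow> 0" if "\<And>n. 0 \<le> e n" "\<And>n. e n \<le> h n" for e
    using tendsto_sandwich[of "\<lambda>_. 0" e sequentially h 0] that h0 by simp
  have l1: "(\<lambda>n. x + a n *\<^sub>R u + b n *\<^sub>R v) \<longlonglongrightarrow> x + 0 *\<^sub>R u + 0 *\<^sub>R v"
    by (intro tendsto_intros lim0 abcd)
  have l2: "(\<lambda>n. x + c n *\<^sub>R v + d n *\<^sub>R u) \<longlonglongrightarrow> x + 0 *\<^sub>R v + 0 *\<^sub>R u"
    by (intro tendsto_intros lim0 abcd)
  have ct: "isCont (\<lambda>y. fd (\<lambda>y. fd f y p) y q) x" for p q
    using smooth_on_continuous_on[OF smooth_on_fd[OF smooth_on_fd[OF f(1)]]] f(2,3)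
    by (simp add: continuous_on_eq_continuous_at)
  have "(\<lambda>n. fd (\<lambda>y. fd f y u) (x + a n *\<^sub>R u + b n *\<^sub>R v) v) \<longlonglongrightarrow> fd (\<lambda>y. fd f y u) x v"
    using isCont_tendsto_compose[OF ct, OF l1[simplified]] by simp
  moreover have "(\<lambda>n. fd (\<lambda>y. fd f y u) (x + a n *\<^sub>R u + b n *\<^sub>R v) v) \<longlonglongrightarrow> fd (\<lambda>y. fd f y v) x u"
    unfolding eq using isCont_tendsto_compose[OF ct, OF l2[simplified]] by simp
  ultimately show ?thesis by (rule LIMSEQ_unique)
qed

lemma fd_inner:
  assumes "f differentiable (at x)"
  shows "fd (\<lambda>y. f y \<bullet> b) x v = fd f x v \<bullet> b"
  using fd_eqI[OF has_derivative_inner_left[OF assms[unfolded frechet_derivative_works]]] by simp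

lemma smooth_on_fd_commute:
  fixes f :: "'a::euclidean_space \<Rightarrow> 'b::euclidean_space"
  assumes f: "smooth_on S f" "open S" "x \<in> S"
  shows "fd (\<lambda>y. fd f y u) x v = fd (\<lambda>y. fd f y v) x u"
proof (rule euclidean_eqI)
  fix b :: 'b assume "b \<in> Basis"
  have s: "smooth_on S (\<lambda>y. f y \<bullet> b)" by (intro smooth_intros f)
  have i: "fd (\<lambda>y. fd f y p) x q \<bullet> b = fd (\<lambda>y. fd (\<lambda>y. f y \<bullet> b) y p) x q" for p q
  proof -
    have "fd (\<lambda>y. fd f y p) x q \<bullet> b = fd (\<lambda>y. fd f y p \<bullet> b) x q"
      using fd_inner smooth_on_differentiable[OF smooth_on_fd[OF f(1)] f(3)] by metis
    also have "\<dots> = fd (\<lambda>y. fd (\<lambda>y. f y \<bullet> b) y p) x q"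
      by (rule fun_cong[OF fd_cong[OF f(2,3)]]) (simp add: fd_inner smooth_on_differentiable[OF f(1)])
    finally show ?thesis .
  qed
  show "fd (\<lambda>y. fd f y u) x v \<bullet> b = fd (\<lambda>y. fd f y v) x u \<bullet> b"
    unfolding i by (rule smooth_on_fd_commute_real[OF s f(2,3)])
qed

section \<open>Linear systems with smooth coefficients and smooth local inverses\<close>

lemma smooth_on_det [smooth_intros]:
  fixes A :: "_ \<Rightarrow> 'n::finite \<Rightarrow> 'n \<Rightarrow> real"
  assumes "open S" "\<And>i j. smooth_on S (\<lambda>x. A x i j)"
  shows "smooth_on S (\<lambda>x. det (\<chi> i j. A x i j))"
  unfolding det_def vec_lambda_beta by (intro smooth_intros assms)

lemma Ck_on_mult:
  fixes f g :: "_ \<Rightarrow> real"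
  shows "open S \<Longrightarrow> Ck_on k S f \<Longrightarrow> Ck_on k S g \<Longrightarrow> Ck_on k S (\<lambda>x. f x * g x)"
  by (rule Ck_on_bilinear[OF bounded_bilinear_mult])

lemma Ck_on_prod:
  fixes f :: "_ \<Rightarrow> _ \<Rightarrow> real"
  shows "open S \<Longrightarrow> (\<And>i. i \<in> I \<Longrightarrow> Ck_on k S (f i)) \<Longrightarrow> Ck_on k S (\<lambda>x. \<Prod>i\<in>I. f i x)"
  by (induction I rule: infinite_finite_induct)
    (simp_all add: Ck_on_const Ck_on_mult del: Ck_on.simps)

lemma Ck_on_det:
  fixes A :: "_ \<Rightarrow> 'n::finite \<Rightarrow> 'n \<Rightarrow> real"
  assumes "open S" "\<And>i j. Ck_on k S (\<lambda>x. A x i j)"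
  shows "Ck_on k S (\<lambda>x. det (\<chi> i j. A x i j))"
  unfolding det_def
  by (intro Ck_on_sum Ck_on_mult Ck_on_const Ck_on_prod assms) (simp add: assms)

text \<open>Cramer's rule: the solution is a quotient of determinants in the data, so it inherits
  their regularity although nothing is known about \<open>w\<close> beforehand. It serves the
  inverse function theorem and the vector field of the Moser method.\<close>

lemma Ck_on_solve:
  fixes A :: "_ \<Rightarrow> 'n::finite \<Rightarrow> 'n \<Rightarrow> real" and w :: "_ \<Rightarrow> real ^ 'n"
  assumes S: "open S" and A: "\<And>i j. Ck_on k S (\<lambda>x. A x i j)" and b: "\<And>i. Ck_on k S (\<lambda>x. b x i)"
    and det: "\<And>x. x \<in> S \<Longrightarrow> det (\<chi> i j. A x i j) \<noteq> 0"
    and eq: "\<And>x i. x \<in> S \<Longrightarrow> (\<Sum>j\<in>UNIV. A x i j * w x $ j) = b x i"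
  shows "Ck_on k S w"
proof (rule Ck_on_vec[OF S])
  fix l
  have "w x $ l = det (\<chi> i j. if j = l then b x i else A x i j) * inverse (det (\<chi> i j. A x i j))"
    if "x \<in> S" for x
  proof -
    have "(\<chi> i j. A x i j) *v w x = (\<chi> i. b x i)"
      using eq[OF that] by (simp add: matrix_vector_mult_def)
    hence "w x = (\<chi> k. det (\<chi> i j. if j = k then (\<chi> i. b x i) $ i else (\<chi> i j. A x i j) $ i $ j)
        / det (\<chi> i j. A x i j))"
      using cramer[OF det[OF that]] by blast
    thus ?thesis by (metis (no_types, lifting) divide_inverse vec_lambda_beta vec_lambda_unique)
  qed
  moreover have "Ck_on k S (\<lambda>x. det (\<chi> i j. if j = l then b x i else A x i j) * inverse (det (\<chi> i j. A x i j)))"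
  proof (intro Ck_on_mult Ck_on_inverse Ck_on_det S det A)
    show "Ck_on k S (\<lambda>x. if j = l then b x i else A x i j)" for i j
      by (cases "j = l") (simp_all add: A b del: Ck_on.simps)
  qed
  ultimately show "Ck_on k S (\<lambda>x. w x $ l)"
    using Ck_on_cong[OF S, of "\<lambda>x. w x $ l"] by simp
qed

lemma smooth_on_solve:
  fixes A :: "_ \<Rightarrow> 'n::finite \<Rightarrow> 'n \<Rightarrow> real" and w :: "_ \<Rightarrow> real ^ 'n"
  assumes "open S" "\<And>i j. smooth_on S (\<lambda>x. A x i j)" "\<And>i. smooth_on S (\<lambda>x. b x i)"
    and "\<And>x. x \<in> S \<Longrightarrow> det (\<chi> i j. A x i j) \<noteq> 0"
    and "\<And>x i. x \<in> S \<Longrightarrow> (\<Sum>j\<in>UNIV. A x i j * w x $ j) = b x i"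
  shows "smooth_on S w"
  using assms Ck_on_solve[of S _ A b w] by (simp add: smooth_on_def)

lemma vec_linear_expand:
  fixes h :: "real ^ 'n::finite \<Rightarrow> 'b::real_vector"
  assumes "linear h"
  shows "h w = (\<Sum>j\<in>UNIV. (w $ j) *\<^sub>R h (axis j 1))"
proof -
  interpret linear h by fact
  have "h w = h (\<Sum>j\<in>UNIV. (w $ j) *\<^sub>R axis j 1)"
    by (simp add: basis_expansion scalar_mult_eq_scaleR[symmetric])
  thus ?thesis by (simp add: sum scaleR)
qed

lemma det_nonzero_if_inj:
  fixes h :: "real ^ 'n::finite \<Rightarrow> real ^ 'n"
  assumes "linear h" "\<And>w. h w = 0 \<Longrightarrow> w = 0"
  shows "det (\<chi> i j. h (axis j 1) $ i) \<noteq> 0"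
proof -
  have "inj h" using assms linear_injective_0 by blast
  moreover have "(\<chi> i j. h (axis j 1) $ i) = matrix h" by (simp add: matrix_def)
  ultimately show ?thesis
    using det_nz_iff_inj[OF assms(1)] by simp
qed

text \<open>Bootstrapping. The derivative of g solves a linear system with matrix
  \<open>fd f (g y)\<close>, whose coefficients are as regular as g. If g is of class k, so is its
  derivative, and g is of class k + 1.\<close>

lemma Ck_on_local_inverse:
  fixes f g :: "real ^ 'n::finite \<Rightarrow> real ^ 'n"
  assumes V: "open V" and f: "smooth_on U f" and gU: "\<And>y. y \<in> V \<Longrightarrow> g y \<in> U"
    and dg: "\<And>y. y \<in> V \<Longrightarrow> (g has_derivative g' y) (at y)"
    and inj: "\<And>y w. y \<in> V \<Longrightarrow> fd f (g y) w = 0 \<Longrightarrow> w = 0"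
    and inv: "\<And>y v. y \<in> V \<Longrightarrow> fd f (g y) (g' y v) = v"
  shows "Ck_on k V g"
proof (induction k)
  case 0
  show ?case using has_derivative_continuous[OF dg]
    by (simp add: continuous_at_imp_continuous_on)
next
  case (Suc k)
  show ?case
  proof (rule Ck_on_SucI[OF V dg])
    fix v
    have lin: "linear (fd f (g y))" if "y \<in> V" for y
      using smooth_on_linear_fd[OF f gU[OF that]] bounded_linear.linear by blast
    show "Ck_on k V (\<lambda>y. g' y v)"
    proof (rule Ck_on_solve[OF V, where A="\<lambda>y i j. fd f (g y) (axis j 1) $ i" and b="\<lambda>y i. v $ i"])
      have "Ck_on k V (\<lambda>y. fd f (g y) (axis j 1))" for j
        by (rule Ck_on_compose[OF V _ Suc.IH, where T=U]) (use smooth_on_fd[OF f] gU in \<open>auto simp: smooth_on_def\<close>)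
      thus "Ck_on k V (\<lambda>y. fd f (g y) (axis j 1) $ i)" for i j
        by (rule Ck_on_bl_comp[OF V bounded_linear_vec_nth])
      show "det (\<chi> i j. fd f (g y) (axis j 1) $ i) \<noteq> 0" if "y \<in> V" for y
        by (rule det_nonzero_if_inj[OF lin[OF that] inj[OF that]])
      fix y i assume y: "y \<in> V"
      have "v $ i = (\<Sum>j\<in>UNIV. g' y v $ j *\<^sub>R fd f (g y) (axis j 1)) $ i"
        using vec_linear_expand[OF lin[OF y], of "g' y v"] inv[OF y] by simp
      thus "(\<Sum>j\<in>UNIV. fd f (g y) (axis j 1) $ i * g' y v $ j) = v $ i"
        by (simp add: mult.commute)
    qed (rule Ck_on_const)
  qed
qed

text \<open>Continuity of the derivative as an operator, obtained from continuity in each basis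
  direction; the inverse function theorem asks for it in this form.\<close>

lemma blinfun_fd_continuous:
  fixes f :: "'a::euclidean_space \<Rightarrow> 'b::real_normed_vector"
  assumes "smooth_on S f"
  shows "continuous_on S (\<lambda>x. Blinfun (fd f x))"
proof (rule continuous_on_blinfun_componentwise)
  fix i :: 'a assume "i \<in> Basis"
  have "continuous_on S (\<lambda>x. fd f x i)" by (rule smooth_on_continuous_on[OF smooth_on_fd[OF assms]])
  moreover have "blinfun_apply (Blinfun (fd f x)) i = fd f x i" if "x \<in> S" for x
    using bounded_linear_Blinfun_apply[OF smooth_on_linear_fd[OF assms that]] by simp
  ultimately show "continuous_on S (\<lambda>x. blinfun_apply (Blinfun (fd f x)) i)"
    using continuous_on_cong by (metis (no_types, lifting))
qed

text \<open>The neighbourhoods, the inverse and its first derivative come from the classical inverse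
  function theorem; smoothness of the inverse then follows by bootstrapping.\<close>

lemma smooth_inverse_function:
  fixes f :: "real ^ 'n::finite \<Rightarrow> real ^ 'n"
  assumes U: "open U" "x0 \<in> U" and f: "smooth_on U f" and inj: "\<And>w. fd f x0 w = 0 \<Longrightarrow> w = 0"
  obtains U' V g where "open U'" "U' \<subseteq> U" "x0 \<in> U'" "open V" "f x0 \<in> V" "homeomorphism U' V f g"
    "smooth_on V g"
proof -
  define f' where "f' x = Blinfun (fd f x)" for x
  have f': "blinfun_apply (f' x) = fd f x" if "x \<in> U" for x
    unfolding f'_def using bounded_linear_Blinfun_apply[OF smooth_on_linear_fd[OF f that]] .
  have "linear (fd f x0)" using smooth_on_linear_fd[OF f U(2)] bounded_linear.linear by blast
  moreover from this have "inj (fd f x0)" using inj linear_injective_0 by blast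
  ultimately obtain k where k: "linear k" "k \<circ> fd f x0 = id"
    using linear_injective_left_inverse by blast
  have invf: "Blinfun k o\<^sub>L f' x0 = id_blinfun"
    by (rule blinfun_eqI)
      (use k f'[OF U(2)] in \<open>simp add: linear_conv_bounded_linear bounded_linear_Blinfun_apply fun_eq_iff\<close>)
  obtain U' V g g' where *: "open U'" "U' \<subseteq> U" "x0 \<in> U'" "open V" "f x0 \<in> V" "homeomorphism U' V f g"
    "\<And>y. y \<in> V \<Longrightarrow> (g has_derivative (g' y)) (at y)"
    "\<And>y. y \<in> V \<Longrightarrow> g' y = inv (blinfun_apply (f'(g y)))"
    "\<And>y. y \<in> V \<Longrightarrow> bij (blinfun_apply (f'(g y)))"
  proof (rule inverse_function_theorem[where f=f and f'=f' and ?x0.0=x0 and U=U and invf="Blinfun k"])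
    show "(f has_derivative blinfun_apply (f' x)) (at x)" if "x \<in> U" for x
      unfolding f'[OF that] by (rule smooth_on_has_derivative[OF f that])
    show "continuous_on U f'" unfolding f'_def by (rule blinfun_fd_continuous[OF f])
  qed (use U invf in blast)+
  have gU: "g y \<in> U" if "y \<in> V" for y
    using *(2,6) that by (auto simp: homeomorphism_def)
  have "Ck_on k V g" for k
  proof (rule Ck_on_local_inverse[OF *(4) f gU *(7)])
    fix y assume y: "y \<in> V"
    have b: "bij (fd f (g y))" using *(9)[OF y] f'[OF gU[OF y]] by simp
    show "w = 0" if "fd f (g y) w = 0" for w
    proof -
      have "fd f (g y) 0 = 0" using smooth_on_linear_fd[OF f gU[OF y]] linear_0 bounded_linear.linear by blast
      thus ?thesis using b that bij_is_inj injD by metis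
    qed
    show "fd f (g y) (g' y v) = v" for v
      unfolding *(8)[OF y] f'[OF gU[OF y]] using b bij_is_surj surj_f_inv_f by metis
  qed
  thus ?thesis using that[OF *(1-6)] by (simp add: smooth_on_def)
qed

section \<open>Differential forms and primitives\<close>

text \<open>Differentiation under the integral sign. An open \<open>W\<close> around
  \<open>{0..1} \<times> U\<close> appears because smoothness refers to open sets while the interval
  of integration is closed.\<close>

lemma has_derivative_integral_param:
  fixes g :: "real \<times> 'a::euclidean_space \<Rightarrow> 'b::euclidean_space"
  assumes g: "smooth_on W g" and W: "open W" "{0..1} \<times> U \<subseteq> W" and U: "open U" "y \<in> U"
  shows "((\<lambda>y. integral {0..1} (\<lambda>s. g (s, y))) has_derivative
    (\<lambda>v. integral {0..1} (\<lambda>s. fd g (s, y) (0, v)))) (at y)"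
proof -
  obtain r where r: "r > 0" "ball y r \<subseteq> U" using U open_contains_ball by blast
  define fx where "fx x s = Blinfun (\<lambda>v. fd g (s, x) (0, v))" for x s
  have inW: "(s, x) \<in> W" if "x \<in> ball y r" "s \<in> {0..1}" for x s
    using that r(2) W(2) by (meson mem_Sigma_iff subsetD)
  have bl: "bounded_linear (\<lambda>v. fd g (s, x) (0, v))" if "x \<in> ball y r" "s \<in> {0..1}" for x s
    by (rule bounded_linear_compose[OF smooth_on_linear_fd[OF g inW[OF that]]])
      (intro bounded_linear_Pair bounded_linear_ident bounded_linear_zero)
  have fx: "blinfun_apply (fx x s) = (\<lambda>v. fd g (s, x) (0, v))" if "x \<in> ball y r" "s \<in> {0..1}" for x s
    unfolding fx_def by (rule bounded_linear_Blinfun_apply[OF bl[OF that]])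
  have cont_v: "continuous_on (ball y r \<times> {0..1}) (\<lambda>(x, s). fd g (s, x) (0, v))" for v
    unfolding split_def
    by (rule continuous_on_compose2[OF smooth_on_continuous_on[OF smooth_on_fd[OF g]],
          where f="\<lambda>p. (snd p, fst p)"])
      (use inW in \<open>auto intro!: continuous_intros\<close>)
  have cont: "continuous_on (ball y r \<times> cbox 0 1) (\<lambda>(x, s). fx x s)"
    unfolding split_def
  proof (rule continuous_on_blinfun_componentwise)
    fix i :: 'a
    have "continuous_on (ball y r \<times> cbox 0 1) (\<lambda>(x, s). fd g (s, x) (0, i))"
      using cont_v by simp
    thus "continuous_on (ball y r \<times> cbox 0 1) (\<lambda>p. blinfun_apply (fx (fst p) (snd p)) i)"
      by (rule continuous_on_cong[THEN iffD1, rotated -1]) (auto simp: fx)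
  qed
  have "((\<lambda>y. integral (cbox 0 1) (\<lambda>s. g (s, y))) has_derivative
      blinfun_apply (integral (cbox 0 1) (fx y))) (at y within ball y r)"
  proof (rule leibniz_rule[OF _ _ cont])
    fix x s assume x: "x \<in> ball y r" and s: "s \<in> cbox (0::real) 1"
    have "((\<lambda>x. (s, x)) has_derivative (\<lambda>v. (0, v))) (at x within ball y r)"
      by (intro has_derivative_Pair has_derivative_const has_derivative_ident)
    from has_derivative_compose[OF this smooth_on_has_derivative[OF g inW]]
    show "((\<lambda>x. g (s, x)) has_derivative blinfun_apply (fx x s)) (at x within ball y r)"
      using x s fx by simp
  next
    fix x assume x: "x \<in> ball y r"
    have "continuous_on (cbox 0 1) (\<lambda>s. g (s, x))"
      by (rule continuous_on_compose2[OF smooth_on_continuous_on[OF g]])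
        (use inW[OF x] in \<open>auto intro!: continuous_intros\<close>)
    thus "(\<lambda>s. g (s, x)) integrable_on cbox 0 1" by (rule integrable_continuous)
  qed (use r in auto)
  moreover have "blinfun_apply (integral (cbox 0 1) (fx y)) = (\<lambda>v. integral {0..1} (\<lambda>s. fd g (s, y) (0, v)))"
  proof
    fix v
    have "continuous_on (cbox 0 1) (fx y)"
    proof -
      have "(\<lambda>s. (y, s)) ` cbox 0 1 \<subseteq> ball y r \<times> cbox 0 1" using r(1) by auto
      from continuous_on_compose2[OF cont continuous_on_Pair[OF continuous_on_const continuous_on_id] this]
      show ?thesis by simp
    qed
    hence "blinfun_apply (integral (cbox 0 1) (fx y)) v = integral (cbox 0 1) (\<lambda>s. blinfun_apply (fx y s) v)"
      by (intro blinfun_apply_integral integrable_continuous)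
    also have "\<dots> = integral (cbox 0 1) (\<lambda>s. fd g (s, y) (0, v))"
      by (rule integral_cong) (use r(1) in \<open>simp add: fx\<close>)
    finally show "blinfun_apply (integral (cbox 0 1) (fx y)) v = integral {0..1} (\<lambda>s. fd g (s, y) (0, v))"
      by simp
  qed
  moreover have "at y within ball y r = at y" using r(1) by (intro at_within_open) simp_all
  ultimately show ?thesis by (simp only: box_real)
qed

text \<open>The derivative of the integral is again the integral of a smooth function over the same
  interval, so the induction on the order runs with the integrand generalized.\<close>

lemma smooth_on_integral_param:
  fixes g :: "real \<times> 'a::euclidean_space \<Rightarrow> 'b::euclidean_space"
  assumes "smooth_on W g" "open W" "{0..1} \<times> U \<subseteq> W" "open U"
  shows "smooth_on U (\<lambda>y. integral {0..1} (\<lambda>s. g (s, y)))"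
  unfolding smooth_on_def
proof
  fix k show "Ck_on k U (\<lambda>y. integral {0..1} (\<lambda>s. g (s, y)))"
    using assms(1)
  proof (induction k arbitrary: g)
    case 0
    show ?case
      using has_derivative_continuous[OF has_derivative_integral_param[OF 0 assms(2-4)]]
      by (simp add: continuous_at_imp_continuous_on)
  next
    case (Suc k)
    show ?case
      by (rule Ck_on_SucI[OF assms(4) has_derivative_integral_param[OF Suc.prems assms(2-4)]])
        (assumption, rule Suc.IH[OF smooth_on_fd[OF Suc.prems]])
  qed
qed

section \<open>Exterior calculus with moving arguments\<close>

lemma form1_onD:
  assumes "form1_on U \<beta>"
  shows "x \<in> U \<Longrightarrow> linear (\<beta> x)" "smooth_on U (\<lambda>x. \<beta> x u)"
  using assms by (auto simp: form1_on_def)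

lemma form2_onD:
  assumes "form2_on U \<omega>"
  shows "x \<in> U \<Longrightarrow> bilinear (\<omega> x)" "x \<in> U \<Longrightarrow> \<omega> x u u = 0" "smooth_on U (\<lambda>x. \<omega> x u v)"
    "x \<in> U \<Longrightarrow> linear (\<omega> x u)" "x \<in> U \<Longrightarrow> linear (\<lambda>u. \<omega> x u v)"
  using assms by (auto simp: form2_on_def bilinear_def)

lemma form2_antisym:
  assumes "form2_on U \<omega>" "x \<in> U"
  shows "\<omega> x u v = - \<omega> x v u"
proof -
  note b = form2_onD(1)[OF assms]
  have "\<omega> x (u + v) (u + v) = \<omega> x u u + \<omega> x u v + \<omega> x v u + \<omega> x v v"
    by (simp add: bilinear_ladd[OF b] bilinear_radd[OF b])
  thus ?thesis using form2_onD(2)[OF assms] by simp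
qed

lemma form2_imp_form1: "form2_on U \<omega> \<Longrightarrow> form1_on U (\<lambda>x. \<omega> x u)"
  by (auto simp: form1_on_def dest: form2_onD)

lemma fd_add: "f differentiable (at x) \<Longrightarrow> g differentiable (at x) \<Longrightarrow>
    fd (\<lambda>y. f y + g y) x v = fd f x v + fd g x v"
  by (subst fd_eqI[OF has_derivative_add]) (auto simp: frechet_derivative_works)

lemma fd_diff: "f differentiable (at x) \<Longrightarrow> g differentiable (at x) \<Longrightarrow>
    fd (\<lambda>y. f y - g y) x v = fd f x v - fd g x v"
  by (subst fd_eqI[OF has_derivative_diff]) (auto simp: frechet_derivative_works)

lemma fd_minus: "f differentiable (at x) \<Longrightarrow> fd (\<lambda>y. - f y) x v = - fd f x v"
  by (subst fd_eqI[OF has_derivative_minus]) (auto simp: frechet_derivative_works)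

lemma fd_cmult:
  fixes f :: "_ \<Rightarrow> real"
  shows "f differentiable (at x) \<Longrightarrow> fd (\<lambda>y. c * f y) x v = c * fd f x v"
  by (subst fd_eqI[OF has_derivative_mult_right]) (auto simp: frechet_derivative_works)

text \<open>Linearity in the vector slot holds on a whole neighbourhood, so it survives
  differentiation in the base point.\<close>

lemma form1_fd_linear:
  assumes "form1_on U \<beta>" "open U" "x \<in> U"
  shows "linear (\<lambda>w. fd (\<lambda>y. \<beta> y w) x v)"
proof -
  note d = smooth_on_differentiable[OF form1_onD(2)[OF assms(1)] assms(3)]
  have "fd (\<lambda>y. \<beta> y (a + b)) x = fd (\<lambda>y. \<beta> y a + \<beta> y b) x" for a b
    by (rule fd_cong[OF assms(2,3)]) (simp add: linear_add[OF form1_onD(1)[OF assms(1)]])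
  moreover have "fd (\<lambda>y. \<beta> y (c *\<^sub>R a)) x = fd (\<lambda>y. c * \<beta> y a) x" for a c
    by (rule fd_cong[OF assms(2,3)]) (simp add: linear_scale[OF form1_onD(1)[OF assms(1)]])
  ultimately show ?thesis
    by (intro linearI) (simp_all add: fd_add d fd_cmult)
qed

text \<open>By definition a form is smooth for constant vectors only. For a moving vector
  \<open>w x\<close> it is expanded in the coordinate basis; the outcome is a product rule with one
  term for the base point and one for the vector.\<close>

lemma form1_has_derivative:
  fixes g w :: "'a::real_normed_vector \<Rightarrow> 'n::finite space"
  assumes \<beta>: "form1_on U \<beta>" "open U" and S: "open S" "x \<in> S" "\<And>x. x \<in> S \<Longrightarrow> g x \<in> U"
    and g: "(g has_derivative g') (at x)" and w: "(w has_derivative w') (at x)"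
  shows "((\<lambda>x. \<beta> (g x) (w x)) has_derivative
    (\<lambda>v. fd (\<lambda>y. \<beta> y (w x)) (g x) (g' v) + \<beta> (g x) (w' v))) (at x)"
proof -
  have "((\<lambda>x. \<Sum>i\<in>UNIV. w x $ i * \<beta> (g x) (axis i 1)) has_derivative
      (\<lambda>v. \<Sum>i\<in>UNIV. w x $ i * fd (\<lambda>y. \<beta> y (axis i 1)) (g x) (g' v) + w' v $ i * \<beta> (g x) (axis i 1))) (at x)"
  proof (rule has_derivative_sum)
    fix i
    have "((\<lambda>x. \<beta> (g x) (axis i 1)) has_derivative (\<lambda>v. fd (\<lambda>y. \<beta> y (axis i 1)) (g x) (g' v))) (at x)"
      by (rule has_derivative_compose[OF g smooth_on_has_derivative[OF form1_onD(2)[OF \<beta>(1)] S(3)[OF S(2)]]])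
    moreover have "((\<lambda>x. w x $ i) has_derivative (\<lambda>v. w' v $ i)) (at x)"
      by (rule bounded_linear.has_derivative[OF bounded_linear_vec_nth w])
    ultimately show "((\<lambda>x. w x $ i * \<beta> (g x) (axis i 1)) has_derivative
      (\<lambda>v. w x $ i * fd (\<lambda>y. \<beta> y (axis i 1)) (g x) (g' v) + w' v $ i * \<beta> (g x) (axis i 1))) (at x)"
      by (intro has_derivative_mult)
  qed
  moreover have "(\<Sum>i\<in>UNIV. w x $ i * \<beta> (g x) (axis i 1)) = \<beta> (g x) (w x)" if "x \<in> S" for x
    using vec_linear_expand[OF form1_onD(1)[OF \<beta>(1) S(3)[OF that]], of "w x"] by simp
  ultimately have "((\<lambda>x. \<beta> (g x) (w x)) has_derivative
      (\<lambda>v. \<Sum>i\<in>UNIV. w x $ i * fd (\<lambda>y. \<beta> y (axis i 1)) (g x) (g' v) + w' v $ i * \<beta> (g x) (axis i 1))) (at x)"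
    using has_derivative_transform_within_open S(1,2) by (metis (no_types, lifting))
  moreover have "(\<Sum>i\<in>UNIV. w x $ i * fd (\<lambda>y. \<beta> y (axis i 1)) (g x) (g' v) + w' v $ i * \<beta> (g x) (axis i 1))
      = fd (\<lambda>y. \<beta> y (w x)) (g x) (g' v) + \<beta> (g x) (w' v)" for v
    using vec_linear_expand[OF form1_onD(1)[OF \<beta>(1) S(3)[OF S(2)]], of "w' v"]
      vec_linear_expand[OF form1_fd_linear[OF \<beta> S(3)[OF S(2)], of "g' v"], of "w x"]
    by (simp add: sum.distrib)
  ultimately show ?thesis by simp
qed

lemma form1_smooth_along:
  fixes g w :: "'a::real_normed_vector \<Rightarrow> 'n::finite space"
  assumes \<beta>: "form1_on U \<beta>" and S: "open S" "\<And>x. x \<in> S \<Longrightarrow> g x \<in> U" "smooth_on S g" "smooth_on S w"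
  shows "smooth_on S (\<lambda>x. \<beta> (g x) (w x))"
proof -
  have "smooth_on S (\<lambda>x. \<Sum>i\<in>UNIV. w x $ i * \<beta> (g x) (axis i 1))"
    by (intro smooth_intros S smooth_on_compose[OF form1_onD(2)[OF \<beta>] S(1,3,2)])
  moreover have "(\<Sum>i\<in>UNIV. w x $ i * \<beta> (g x) (axis i 1)) = \<beta> (g x) (w x)" if "x \<in> S" for x
    using vec_linear_expand[OF form1_onD(1)[OF \<beta> S(2)[OF that]], of "w x"] by simp
  ultimately show ?thesis using smooth_on_cong[OF S(1)] by (metis (no_types, lifting))
qed

lemma form2_expand:
  assumes "form2_on U \<omega>" "x \<in> U"
  shows "\<omega> x u v = (\<Sum>i\<in>UNIV. u $ i * \<omega> x (axis i 1) v)"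
  using vec_linear_expand[OF form2_onD(5)[OF assms], of u v] by simp

lemma form2_fd_linear:
  assumes "form2_on U \<omega>" "open U" "x \<in> U"
  shows "linear (\<lambda>u. fd (\<lambda>y. \<omega> y u v) x a)"
proof -
  have "form1_on U (\<lambda>x u. \<omega> x u v)" using assms(1) by (auto simp: form1_on_def dest: form2_onD)
  from form1_fd_linear[OF this assms(2,3)] show ?thesis .
qed

lemma form2_has_derivative:
  fixes g w z :: "'a::real_normed_vector \<Rightarrow> 'n::finite space"
  assumes \<omega>: "form2_on U \<omega>" "open U" and S: "open S" "x \<in> S" "\<And>x. x \<in> S \<Longrightarrow> g x \<in> U"
    and g: "(g has_derivative g') (at x)" and w: "(w has_derivative w') (at x)"
    and z: "(z has_derivative z') (at x)"
  shows "((\<lambda>x. \<omega> (g x) (w x) (z x)) has_derivative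
    (\<lambda>v. fd (\<lambda>y. \<omega> y (w x) (z x)) (g x) (g' v) + \<omega> (g x) (w' v) (z x) + \<omega> (g x) (w x) (z' v))) (at x)"
proof -
  have "((\<lambda>x. \<Sum>i\<in>UNIV. w x $ i * \<omega> (g x) (axis i 1) (z x)) has_derivative
      (\<lambda>v. \<Sum>i\<in>UNIV. w x $ i * (fd (\<lambda>y. \<omega> y (axis i 1) (z x)) (g x) (g' v) + \<omega> (g x) (axis i 1) (z' v))
        + w' v $ i * \<omega> (g x) (axis i 1) (z x))) (at x)"
  proof (rule has_derivative_sum)
    fix i
    have "((\<lambda>x. w x $ i) has_derivative (\<lambda>v. w' v $ i)) (at x)"
      by (rule bounded_linear.has_derivative[OF bounded_linear_vec_nth w])
    thus "((\<lambda>x. w x $ i * \<omega> (g x) (axis i 1) (z x)) has_derivative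
      (\<lambda>v. w x $ i * (fd (\<lambda>y. \<omega> y (axis i 1) (z x)) (g x) (g' v) + \<omega> (g x) (axis i 1) (z' v))
        + w' v $ i * \<omega> (g x) (axis i 1) (z x))) (at x)"
      by (intro has_derivative_mult form1_has_derivative[OF form2_imp_form1[OF \<omega>(1)] \<omega>(2) S g z])
  qed
  moreover have "(\<Sum>i\<in>UNIV. w x $ i * \<omega> (g x) (axis i 1) (z x)) = \<omega> (g x) (w x) (z x)" if "x \<in> S" for x
    using form2_expand[OF \<omega>(1) S(3)[OF that], of "w x"] by simp
  ultimately have "((\<lambda>x. \<omega> (g x) (w x) (z x)) has_derivative
      (\<lambda>v. \<Sum>i\<in>UNIV. w x $ i * (fd (\<lambda>y. \<omega> y (axis i 1) (z x)) (g x) (g' v) + \<omega> (g x) (axis i 1) (z' v))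
        + w' v $ i * \<omega> (g x) (axis i 1) (z x))) (at x)"
    using has_derivative_transform_within_open S(1,2) by (metis (no_types, lifting))
  moreover have "(\<Sum>i\<in>UNIV. w x $ i * (fd (\<lambda>y. \<omega> y (axis i 1) (z x)) (g x) (g' v) + \<omega> (g x) (axis i 1) (z' v))
        + w' v $ i * \<omega> (g x) (axis i 1) (z x))
      = fd (\<lambda>y. \<omega> y (w x) (z x)) (g x) (g' v) + \<omega> (g x) (w' v) (z x) + \<omega> (g x) (w x) (z' v)" for v
    using form2_expand[OF \<omega>(1) S(3)[OF S(2)], of "w' v"] form2_expand[OF \<omega>(1) S(3)[OF S(2)], of "w x"]
      vec_linear_expand[OF form2_fd_linear[OF \<omega> S(3)[OF S(2)], of "z x" "g' v"], of "w x"]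
    by (simp add: sum.distrib distrib_left)
  ultimately show ?thesis by simp
qed

lemma form2_smooth_along:
  fixes g w z :: "'a::real_normed_vector \<Rightarrow> 'n::finite space"
  assumes \<omega>: "form2_on U \<omega>" and S: "open S" "\<And>x. x \<in> S \<Longrightarrow> g x \<in> U" "smooth_on S g"
    "smooth_on S w" "smooth_on S z"
  shows "smooth_on S (\<lambda>x. \<omega> (g x) (w x) (z x))"
proof -
  have "smooth_on S (\<lambda>x. \<Sum>i\<in>UNIV. w x $ i * \<omega> (g x) (axis i 1) (z x))"
    by (intro smooth_intros S form1_smooth_along[OF form2_imp_form1[OF \<omega>(1)] S(1,2,3,5)])
  moreover have "(\<Sum>i\<in>UNIV. w x $ i * \<omega> (g x) (axis i 1) (z x)) = \<omega> (g x) (w x) (z x)" if "x \<in> S" for x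
    using form2_expand[OF \<omega>(1) S(2)[OF that], of "w x"] by simp
  ultimately show ?thesis using smooth_on_cong[OF S(1)] by (metis (no_types, lifting))
qed

lemma form2_on_d_form1:
  assumes "form1_on U \<beta>" "open U"
  shows "form2_on U (d_form1 \<beta>)"
proof -
  have "linear (\<lambda>v. fd (\<lambda>y. \<beta> y v) x u - fd (\<lambda>y. \<beta> y u) x v)" if "x \<in> U" for x u
    by (rule linear_compose_sub[OF form1_fd_linear[OF assms that]])
      (use smooth_on_linear_fd[OF form1_onD(2)[OF assms(1)] that] bounded_linear.linear in blast)
  moreover have "linear (\<lambda>u. fd (\<lambda>y. \<beta> y v) x u - fd (\<lambda>y. \<beta> y u) x v)" if "x \<in> U" for x v
    by (rule linear_compose_sub[OF _ form1_fd_linear[OF assms that]])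
      (use smooth_on_linear_fd[OF form1_onD(2)[OF assms(1)] that] bounded_linear.linear in blast)
  moreover have "smooth_on U (\<lambda>x. fd (\<lambda>y. \<beta> y v) x u - fd (\<lambda>y. \<beta> y u) x v)" for u v
    by (intro smooth_intros smooth_on_fd form1_onD(2)[OF assms(1)] assms(2))
  ultimately show ?thesis by (auto simp: form2_on_def d_form1_def bilinear_def)
qed

text \<open>The six second derivatives that occur cancel in pairs by their symmetry.\<close>

lemma d_form2_d_form1:
  assumes "form1_on U \<beta>" "open U" "x \<in> U"
  shows "d_form2 (d_form1 \<beta>) x u v w = 0"
proof -
  note s = form1_onD(2)[OF assms(1)]
  have e: "fd (\<lambda>y. d_form1 \<beta> y v w) x u = fd (\<lambda>y. fd (\<lambda>y. \<beta> y w) y v) x u - fd (\<lambda>y. fd (\<lambda>y. \<beta> y v) y w) x u"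
    for u v w unfolding d_form1_def
    by (rule fd_diff) (intro smooth_on_differentiable[OF smooth_on_fd[OF s] assms(3)])+
  note c = smooth_on_fd_commute[OF s assms(2,3)]
  show ?thesis
    unfolding d_form2_def e using c[of w v u] c[of v w u] c[of u v w] by linarith
qed

definition pullback1 :: "('n::finite space \<Rightarrow> 'n space) \<Rightarrow> 'n form1 \<Rightarrow> 'n form1" where
  "pullback1 \<Phi> \<beta> x u = \<beta> (\<Phi> x) (fd \<Phi> x u)"

lemma form1_on_pullback1:
  assumes "form1_on U \<beta>" "open S" "smooth_on S \<Phi>" "\<And>x. x \<in> S \<Longrightarrow> \<Phi> x \<in> U"
  shows "form1_on S (pullback1 \<Phi> \<beta>)"
  unfolding form1_on_def pullback1_def
proof (intro conjI ballI allI)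
  fix x assume "x \<in> S"
  thus "linear (\<lambda>u. \<beta> (\<Phi> x) (fd \<Phi> x u))"
    using linear_compose[OF bounded_linear.linear[OF smooth_on_linear_fd[OF assms(3)]]
        form1_onD(1)[OF assms(1) assms(4)]] by (simp add: o_def)
qed (intro form1_smooth_along[OF assms(1,2,4,3)] smooth_on_fd assms)

text \<open>The product rule produces terms with the second derivative of \<Phi>; being symmetric,
  they cancel in the antisymmetrization.\<close>

lemma d_form1_pullback1:
  assumes "form1_on U \<beta>" "open U" "open S" "smooth_on S \<Phi>" "\<And>x. x \<in> S \<Longrightarrow> \<Phi> x \<in> U" "x \<in> S"
  shows "d_form1 (pullback1 \<Phi> \<beta>) x u v = pullback \<Phi> (d_form1 \<beta>) x u v"
proof -
  have "fd (\<lambda>y. pullback1 \<Phi> \<beta> y v) x u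
      = fd (\<lambda>y. \<beta> y (fd \<Phi> x v)) (\<Phi> x) (fd \<Phi> x u) + \<beta> (\<Phi> x) (fd (\<lambda>y. fd \<Phi> y v) x u)" for u v
    unfolding pullback1_def
    using fd_eqI[OF form1_has_derivative[OF assms(1-3,6,5) smooth_on_has_derivative[OF assms(4,6)]
        smooth_on_has_derivative[OF smooth_on_fd[OF assms(4)] assms(6)]]] by metis
  thus ?thesis using smooth_on_fd_commute[OF assms(4,3,6), of u v]
    by (simp add: d_form1_def pullback_def)
qed

lemma form2_fd_antisym:
  assumes "form2_on U \<omega>" "open U" "x \<in> U"
  shows "fd (\<lambda>y. \<omega> y u v) x a = - fd (\<lambda>y. \<omega> y v u) x a"
proof -
  have "fd (\<lambda>y. \<omega> y u v) x = fd (\<lambda>y. - \<omega> y v u) x"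
    by (rule fd_cong[OF assms(2,3)]) (rule form2_antisym[OF assms(1)])
  thus ?thesis
    using fd_minus[OF smooth_on_differentiable[OF form2_onD(3)[OF assms(1)] assms(3)]] by simp
qed

text \<open>Homotopy formula. By closedness, the derivative in s of the form pulled back by
  \<open>h s\<close> is the integrand of d\<beta>, so integration gives \<omega> minus the pullback
  by \<open>h 0\<close>, which is assumed to vanish. Linear maps \<open>h s\<close> cover both uses,
  the weighted contraction and the retraction to a Lagrangian germ, and keep second derivatives of
  the homotopy out of the computation.\<close>

lemma poincare_form2:
  fixes \<omega> :: "'n::finite form2" and h hd :: "real \<Rightarrow> 'n space \<Rightarrow> 'n space"
  assumes \<omega>: "form2_on U \<omega>" "open U" and closed: "\<And>x u v w. x \<in> U \<Longrightarrow> d_form2 \<omega> x u v w = 0"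
    and h: "smooth_on UNIV (\<lambda>p. h (fst p) (snd p))" "\<And>s. linear (h s)"
    and hd: "smooth_on UNIV (\<lambda>p. hd (fst p) (snd p))" "\<And>s. linear (hd s)"
      "\<And>s y. ((\<lambda>s. h s y) has_vector_derivative hd s y) (at s)"
    and V: "open V" "\<And>s y. s \<in> {0..1} \<Longrightarrow> y \<in> V \<Longrightarrow> h s y \<in> U"
    and h1: "\<And>y. h 1 y = y" and h0: "\<And>y u v. y \<in> V \<Longrightarrow> \<omega> (h 0 y) (h 0 u) (h 0 v) = 0"
    and \<beta>_def: "\<beta> = (\<lambda>y u. integral {0..1} (\<lambda>s. \<omega> (h s y) (hd s y) (h s u)))"
  shows "form1_on V \<beta>" "\<And>y u v. y \<in> V \<Longrightarrow> d_form1 \<beta> y u v = \<omega> y u v"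
proof -
  \<comment> \<open>The homotopy is known to stay in U only over V and for s in the unit interval; W
    is the open set of all pairs at which the integrand makes sense.\<close>
  define W where "W = (\<lambda>p. h (fst p) (snd p)) -` U"
  define g where "g u p = \<omega> (h (fst p) (snd p)) (hd (fst p) (snd p)) (h (fst p) u)"
    for u and p :: "real \<times> 'n space"
  have W: "open W" unfolding W_def
    by (intro open_vimage \<omega>(2) smooth_on_continuous_on[OF h(1)])
  have WV: "{0..1} \<times> V \<subseteq> W" using V(2) by (auto simp: W_def)
  have hW: "smooth_on W (\<lambda>p. h (fst p) (snd p))" "smooth_on W (\<lambda>p. hd (fst p) (snd p))"
    using h(1) hd(1) smooth_on_subset by blast+
  have hu: "smooth_on W (\<lambda>p. h (fst p) u)" for u
    using smooth_on_compose[OF h(1) W, of "\<lambda>p. (fst p, u)"] W by (simp add: smooth_intros)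
  have inU: "h (fst p) (snd p) \<in> U" if "p \<in> W" for p using that by (simp add: W_def)
  have gW: "smooth_on W (g u)" for u unfolding g_def
    by (intro form2_smooth_along[OF \<omega>(1) W inU] hW hu)
  have \<beta>_g: "\<beta> = (\<lambda>y u. integral {0..1} (\<lambda>s. g u (s, y)))"
    by (simp add: \<beta>_def g_def)
  have lin_h: "((\<lambda>p. h (fst p) (snd p)) has_derivative (\<lambda>v. fst v *\<^sub>R hd s y + h s (snd v))) (at (s, y))"
    and lin_hd: "fd (\<lambda>p. hd (fst p) (snd p)) (s, y) (0, v) = hd s v"
    and lin_hu: "fd (\<lambda>p. h (fst p) u) (s, y) (0, v) = 0" for s y v u
  proof -
    have aux: "fd (\<lambda>p. k (fst p) (snd p)) (s, y) (0, v) = k s v"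
      if k: "smooth_on UNIV (\<lambda>p. k (fst p) (snd p))" "linear (k s)" for k :: "real \<Rightarrow> 'n space \<Rightarrow> 'n space" and v
    proof -
      have "((\<lambda>y. (s, y)) has_derivative (\<lambda>v. (0, v))) (at y)"
        by (intro has_derivative_Pair has_derivative_const has_derivative_ident)
      from has_derivative_compose[OF this smooth_on_has_derivative[OF k(1)]]
      have "(k s has_derivative (\<lambda>v. fd (\<lambda>p. k (fst p) (snd p)) (s, y) (0, v))) (at y)" by simp
      moreover have "(k s has_derivative k s) (at y)"
        using k(2) by (simp add: linear_imp_has_derivative)
      ultimately show ?thesis by (rule fun_cong[OF has_derivative_unique])
    qed
    show "fd (\<lambda>p. hd (fst p) (snd p)) (s, y) (0, v) = hd s v" by (rule aux[OF hd(1,2)])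
    have H: "((\<lambda>p. h (fst p) (snd p)) has_derivative fd (\<lambda>p. h (fst p) (snd p)) (s, y)) (at (s, y))" for y
      by (rule smooth_on_has_derivative[OF h(1)]) simp
    have t: "fd (\<lambda>p. h (fst p) (snd p)) (s, y) (a, 0) = a *\<^sub>R hd s y" for a y
    proof -
      have "((\<lambda>s. (s, y)) has_derivative (\<lambda>v. (v, 0))) (at s)"
        by (intro has_derivative_Pair has_derivative_const has_derivative_ident)
      from has_derivative_compose[OF this H]
      have "((\<lambda>s. h s y) has_derivative (\<lambda>a. fd (\<lambda>p. h (fst p) (snd p)) (s, y) (a, 0))) (at s)" by simp
      from fun_cong[OF has_derivative_unique[OF this hd(3)[of y s, unfolded has_vector_derivative_def]], of a]
      show ?thesis .
    qed
    have e: "fd (\<lambda>p. h (fst p) (snd p)) (s, y) = (\<lambda>v. fst v *\<^sub>R hd s y + h s (snd v))"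
    proof
      fix v :: "real \<times> 'n space"
      have "v = (fst v, 0) + (0, snd v)" by simp
      thus "fd (\<lambda>p. h (fst p) (snd p)) (s, y) v = fst v *\<^sub>R hd s y + h s (snd v)"
        using linear_add[OF bounded_linear.linear[OF smooth_on_linear_fd[OF h(1)]], of "(s,y)" "(fst v, 0)" "(0, snd v)"]
          t aux[OF h(1,2)] by simp
    qed
    show "((\<lambda>p. h (fst p) (snd p)) has_derivative (\<lambda>v. fst v *\<^sub>R hd s y + h s (snd v))) (at (s, y))"
      using H[of y] unfolding e .
    have "((\<lambda>p. (fst p, u)) has_derivative (\<lambda>v. (fst v, 0))) (at (s, y))"
      by (intro has_derivative_Pair has_derivative_const has_derivative_fst has_derivative_ident)
    from fd_eqI[OF has_derivative_compose[OF this, of "\<lambda>p. h (fst p) (snd p)" "fd (\<lambda>p. h (fst p) (snd p)) (s, u)"]] H[of u]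
    have "fd (\<lambda>p. h (fst p) u) (s, y) = (\<lambda>v. fd (\<lambda>p. h (fst p) (snd p)) (s, u) (fst v, 0))" by simp
    thus "fd (\<lambda>p. h (fst p) u) (s, y) (0, v) = 0"
      using t[of u 0] by simp
  qed
  \<comment> \<open>The last argument \<open>h s u\<close> does not depend on y, and by linearity
    \<open>h s\<close> and \<open>hd s\<close> are their own derivatives in y; only the base point
    and the velocity contribute.\<close>
  have fdg: "fd (g u) (s, y) (0, v) = fd (\<lambda>x. \<omega> x (hd s y) (h s u)) (h s y) (h s v)
      + \<omega> (h s y) (hd s v) (h s u)" if "s \<in> {0..1}" "y \<in> V" for s y u v
  proof -
    have p: "(s, y) \<in> W" using WV that by auto
    have "(g u has_derivative (\<lambda>v. fd (\<lambda>x. \<omega> x (hd s y) (h s u)) (h s y) (fst v *\<^sub>R hd s y + h s (snd v))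
       + \<omega> (h s y) (fd (\<lambda>p. hd (fst p) (snd p)) (s, y) v) (h s u)
       + \<omega> (h s y) (hd s y) (fd (\<lambda>p. h (fst p) u) (s, y) v))) (at (s, y))"
      using form2_has_derivative[OF \<omega> W p inU lin_h smooth_on_has_derivative[OF hW(2) p]
          smooth_on_has_derivative[OF hu p, of u]] by (simp add: g_def[abs_def])
    from fun_cong[OF fd_eqI[OF this], of "(0, v)"] show ?thesis
      using lin_hd lin_hu linear_0[OF form2_onD(4)[OF \<omega>(1) V(2)[OF that]]] by simp
  qed
  have cont: "continuous_on {0..1} (\<lambda>s. g u (s, y))" if "y \<in> V" for u y
    by (rule continuous_on_compose2[OF smooth_on_continuous_on[OF gW]])
      (use that WV in \<open>auto intro!: continuous_intros\<close>)
  have contd: "(\<lambda>s. fd (g u) (s, y) (0, v)) integrable_on {0..1}" if "y \<in> V" for u v y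
    by (rule integrable_continuous_interval, rule continuous_on_compose2[OF smooth_on_continuous_on[OF smooth_on_fd[OF gW]]])
      (use that WV in \<open>auto intro!: continuous_intros\<close>)
  show "form1_on V \<beta>"
    unfolding form1_on_def
  proof (intro conjI ballI allI)
    fix u show "smooth_on V (\<lambda>y. \<beta> y u)"
      unfolding \<beta>_g by (rule smooth_on_integral_param[OF gW W WV V(1)])
  next
    fix y assume y: "y \<in> V"
    have lin: "linear (\<lambda>u. g u (s, y))" if "s \<in> {0..1}" for s
      unfolding g_def using linear_compose[OF h(2)[of s] form2_onD(4)[OF \<omega>(1) V(2)[OF that y], of "hd s y"]]
      by (simp add: o_def)
    show "linear (\<beta> y)"
    proof (rule linearI)
      fix a b c
      have "integral {0..1} (\<lambda>s. g (a + b) (s, y)) = integral {0..1} (\<lambda>s. g a (s, y) + g b (s, y))"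
        by (rule integral_cong) (use linear_add[OF lin] in blast)
      also have "\<dots> = integral {0..1} (\<lambda>s. g a (s, y)) + integral {0..1} (\<lambda>s. g b (s, y))"
        by (intro integral_add integrable_continuous_interval cont y)
      finally show "\<beta> y (a + b) = \<beta> y a + \<beta> y b" by (simp add: \<beta>_g)
      have "integral {0..1} (\<lambda>s. g (c *\<^sub>R a) (s, y)) = integral {0..1} (\<lambda>s. c *\<^sub>R g a (s, y))"
        by (rule integral_cong) (use linear_scale[OF lin] in blast)
      thus "\<beta> y (c *\<^sub>R a) = c *\<^sub>R \<beta> y a" by (simp add: \<beta>_g)
    qed
  qed
  fix y u v assume y: "y \<in> V"
  have fd\<beta>: "fd (\<lambda>y. \<beta> y u) y v = integral {0..1} (\<lambda>s. fd (g u) (s, y) (0, v))" for u v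
    unfolding \<beta>_g by (rule fun_cong[OF fd_eqI]) (rule has_derivative_integral_param[OF gW W WV V(1) y])
  have "d_form1 \<beta> y u v = integral {0..1} (\<lambda>s. fd (g v) (s, y) (0, u) - fd (g u) (s, y) (0, v))"
    unfolding d_form1_def fd\<beta> by (intro integral_diff[symmetric] contd y)
  \<comment> \<open>The integrand is the s-derivative of the pulled-back form: closedness trades the
    derivative along the velocity \<open>hd s y\<close> for derivatives along \<open>h s u\<close>
    and \<open>h s v\<close>.\<close>
  moreover have "((\<lambda>s. fd (g v) (s, y) (0, u) - fd (g u) (s, y) (0, v)) has_integral
     \<omega> (h 1 y) (h 1 u) (h 1 v) - \<omega> (h 0 y) (h 0 u) (h 0 v)) {0..1}"
  proof (rule fundamental_theorem_of_calculus)
    fix s :: real assume s: "s \<in> {0..1}"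
    note U = V(2)[OF s y]
    define T where "T = (\<lambda>s. h s y) -` U"
    have "continuous_on UNIV (\<lambda>s. h s y)"
      using hd(3)[of y] by (meson continuous_at_imp_continuous_on has_vector_derivative_continuous)
    hence T: "open T" "s \<in> T" "\<And>s. s \<in> T \<Longrightarrow> h s y \<in> U"
      using U by (auto simp: T_def intro: open_vimage \<omega>(2))
    note hv = hd(3)[unfolded has_vector_derivative_def]
    have "((\<lambda>s. \<omega> (h s y) (h s u) (h s v)) has_derivative
      (\<lambda>r. fd (\<lambda>x. \<omega> x (h s u) (h s v)) (h s y) (r *\<^sub>R hd s y)
       + \<omega> (h s y) (r *\<^sub>R hd s u) (h s v) + \<omega> (h s y) (h s u) (r *\<^sub>R hd s v))) (at s)"
      by (rule form2_has_derivative[OF \<omega> T hv hv hv])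
    moreover have "fd (\<lambda>x. \<omega> x (h s u) (h s v)) (h s y) (r *\<^sub>R hd s y)
       + \<omega> (h s y) (r *\<^sub>R hd s u) (h s v) + \<omega> (h s y) (h s u) (r *\<^sub>R hd s v)
       = r *\<^sub>R (fd (g v) (s, y) (0, u) - fd (g u) (s, y) (0, v))" for r
    proof -
      have "fd (\<lambda>x. \<omega> x (h s u) (h s v)) (h s y) (r *\<^sub>R hd s y)
        = r * fd (\<lambda>x. \<omega> x (h s u) (h s v)) (h s y) (hd s y)"
        using linear_scale[OF bounded_linear.linear[OF smooth_on_linear_fd[OF form2_onD(3)[OF \<omega>(1)] U]]] by simp
      moreover have "\<omega> (h s y) (r *\<^sub>R hd s u) (h s v) = r * \<omega> (h s y) (hd s u) (h s v)"
        "\<omega> (h s y) (h s u) (r *\<^sub>R hd s v) = r * \<omega> (h s y) (h s u) (hd s v)"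
        using linear_scale[OF form2_onD(4)[OF \<omega>(1) U]] linear_scale[OF form2_onD(5)[OF \<omega>(1) U]] by auto
      moreover have "fd (\<lambda>x. \<omega> x (hd s y) (h s v)) (h s y) (h s u)
        + fd (\<lambda>x. \<omega> x (h s v) (h s u)) (h s y) (hd s y)
        + fd (\<lambda>x. \<omega> x (h s u) (hd s y)) (h s y) (h s v) = 0"
        using closed[OF U, of "h s u" "hd s y" "h s v"] by (simp add: d_form2_def)
      moreover have "fd (\<lambda>x. \<omega> x (h s u) (hd s y)) (h s y) (h s v) = - fd (\<lambda>x. \<omega> x (hd s y) (h s u)) (h s y) (h s v)"
        "fd (\<lambda>x. \<omega> x (h s v) (h s u)) (h s y) (hd s y) = - fd (\<lambda>x. \<omega> x (h s u) (h s v)) (h s y) (hd s y)"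
        by (rule form2_fd_antisym[OF \<omega> U])+
      moreover have "\<omega> (h s y) (h s u) (hd s v) = - \<omega> (h s y) (hd s v) (h s u)"
        by (rule form2_antisym[OF \<omega>(1) U])
      ultimately have "fd (\<lambda>x. \<omega> x (h s u) (h s v)) (h s y) (r *\<^sub>R hd s y)
       + \<omega> (h s y) (r *\<^sub>R hd s u) (h s v) + \<omega> (h s y) (h s u) (r *\<^sub>R hd s v)
       = r * fd (\<lambda>x. \<omega> x (h s u) (h s v)) (h s y) (hd s y)
         + r * \<omega> (h s y) (hd s u) (h s v) + r * (- \<omega> (h s y) (hd s v) (h s u))"
       and "fd (\<lambda>x. \<omega> x (h s u) (h s v)) (h s y) (hd s y)
         = fd (\<lambda>x. \<omega> x (hd s y) (h s v)) (h s y) (h s u) - fd (\<lambda>x. \<omega> x (hd s y) (h s u)) (h s y) (h s v)"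
        by simp_all
      thus ?thesis
        unfolding fdg[OF s y] real_scaleR_def
        by (simp only: distrib_left right_diff_distrib mult_minus_right)
    qed
    ultimately have "((\<lambda>s. \<omega> (h s y) (h s u) (h s v)) has_vector_derivative
      fd (g v) (s, y) (0, u) - fd (g u) (s, y) (0, v)) (at s)"
      by (simp add: has_vector_derivative_def)
    thus "((\<lambda>s. \<omega> (h s y) (h s u) (h s v)) has_vector_derivative
      fd (g v) (s, y) (0, u) - fd (g u) (s, y) (0, v)) (at s within {0..1})"
      by (rule has_vector_derivative_at_within)
  qed simp
  ultimately show "d_form1 \<beta> y u v = \<omega> y u v"
    using h0[OF y] h1 by (metis (no_types, lifting) diff_zero integral_unique)
qed

section \<open>Normal forms of algebraic restrictions\<close>

text \<open>The homotopy formula for the contraction that multiplies coordinate i by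
  \<open>s ^ wt i\<close>. The last conclusion is the point of it: \<beta> vanishes at y as soon as
  the form vanishes along the whole trajectory of y, so vanishing on a set preserved by the
  contraction is inherited by the primitive.\<close>

lemma poincare_weighted:
  fixes \<omega> :: "'n::finite form2" and wt :: "'n bit0 \<Rightarrow> nat"
  assumes \<omega>: "form2_on (ball 0 r) \<omega>" and closed: "\<And>x u v w. x \<in> ball 0 r \<Longrightarrow> d_form2 \<omega> x u v w = 0"
    and wt: "\<And>i. wt i \<ge> 1"
  obtains \<beta> where "form1_on (ball 0 r) \<beta>" "\<And>y u v. y \<in> ball 0 r \<Longrightarrow> d_form1 \<beta> y u v = \<omega> y u v"
    "\<And>y u. (\<And>s u v. s \<in> {0..1} \<Longrightarrow> \<omega> (\<chi> i. s ^ wt i * y $ i) u v = 0) \<Longrightarrow> \<beta> y u = 0"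
proof -
  define h :: "real \<Rightarrow> 'n space \<Rightarrow> 'n space" where "h s y = (\<chi> i. s ^ wt i * y $ i)" for s y
  \<comment> \<open>Natural subtraction in the exponent is harmless, the weights being at least 1;
    weight 1 gives \<open>s ^ 0\<close>.\<close>
  define hd :: "real \<Rightarrow> 'n space \<Rightarrow> 'n space" where "hd s y = (\<chi> i. real (wt i) * s ^ (wt i - 1) * y $ i)" for s y
  define \<beta> where "\<beta> y u = integral {0..1} (\<lambda>s. \<omega> (h s y) (hd s y) (h s u))" for y u
  have ball: "h s y \<in> ball 0 r" if "s \<in> {0..1}" "y \<in> ball 0 r" for s y
  proof -
    have "\<bar>s ^ wt i\<bar> * \<bar>y $ i\<bar> \<le> 1 * \<bar>y $ i\<bar>" for i
      using that(1) by (intro mult_right_mono) (auto simp: power_le_one)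
    hence "norm (h s y) \<le> norm y"
      by (intro norm_le_componentwise_cart) (simp add: h_def abs_mult)
    thus ?thesis using that(2) by simp
  qed
  \<comment> \<open>Positive weights make the contraction end at the origin, and \<open>h 0\<close>
    kills all vectors, so the form pulled back by it is zero.\<close>
  have h0: "h 0 u = 0" for u
    using wt by (simp add: h_def vec_eq_iff zero_power less_eq_Suc_le)
  have hdv: "((\<lambda>s. h s y) has_vector_derivative hd s y) (at s)" for s y
  proof -
    have "((\<lambda>s. h s y) has_derivative (\<lambda>t. \<chi> i. t * (real (wt i) * s ^ (wt i - 1)) * y $ i)) (at s)"
    proof (subst has_derivative_componentwise_within, rule ballI)
      fix b :: "'n space" assume "b \<in> Basis"
      then obtain j where b: "b = axis j 1" by (auto simp: Basis_vec_def)
      show "((\<lambda>s. h s y \<bullet> b) has_derivative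
          (\<lambda>t. (\<chi> i. t * (real (wt i) * s ^ (wt i - 1)) * y $ i) \<bullet> b)) (at s)"
        unfolding b inner_axis h_def vec_lambda_beta
        by (auto intro!: derivative_eq_intros simp: algebra_simps)
    qed
    moreover have "(\<lambda>t. \<chi> i. t * (real (wt i) * s ^ (wt i - 1)) * y $ i) = (\<lambda>t. t *\<^sub>R hd s y)"
      by (simp add: hd_def vec_eq_iff fun_eq_iff)
    ultimately show ?thesis by (simp add: has_vector_derivative_def)
  qed
  have fst_snd: "smooth_on UNIV (\<lambda>p::real \<times> 'n space. fst p)" "smooth_on UNIV (\<lambda>p::real \<times> 'n space. snd p)"
    by (intro smooth_intros open_UNIV)+
  have sm: "smooth_on UNIV (\<lambda>p. h (fst p) (snd p))" "smooth_on UNIV (\<lambda>p. hd (fst p) (snd p))"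
    unfolding h_def hd_def by (intro smooth_intros open_UNIV fst_snd)+
  have lin: "linear (h s)" "linear (hd s)" for s
    by (auto intro!: linearI simp: h_def hd_def vec_eq_iff algebra_simps)
  have zero: "\<omega> (h 0 y) (h 0 u) (h 0 v) = 0" if "y \<in> ball 0 r" for y u v
    using linear_0[OF form2_onD(4)[OF \<omega>, of 0]] ball[of 0 y] that by (simp add: h0)
  have h1: "h 1 y = y" for y by (simp add: h_def)
  have \<beta>: "\<beta> = (\<lambda>y u. integral {0..1} (\<lambda>s. \<omega> (h s y) (hd s y) (h s u)))"
    by (intro ext) (rule \<beta>_def)
  note P = poincare_form2[OF \<omega> open_ball closed sm(1) lin(1) sm(2) lin(2) hdv open_ball ball h1 zero \<beta>]
  have "form1_on (ball 0 r) \<beta> \<and> (\<forall>y u v. y \<in> ball 0 r \<longrightarrow> d_form1 \<beta> y u v = \<omega> y u v)"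
    using P by blast
  moreover have "\<beta> y u = 0" if "\<And>s u v. s \<in> {0..1} \<Longrightarrow> \<omega> (\<chi> i. s ^ wt i * y $ i) u v = 0" for y u
    using integral_cong[of "{0..1}" "\<lambda>s. \<omega> (h s y) (hd s y) (h s u)" "\<lambda>s. 0"] that
    by (simp add: \<beta>_def h_def)
  ultimately show ?thesis using that by blast
qed

lemma d_form1_add:
  assumes "form1_on U \<beta>" "form1_on U \<gamma>" "x \<in> U"
  shows "d_form1 (\<lambda>x u. \<beta> x u + \<gamma> x u) x u v = d_form1 \<beta> x u v + d_form1 \<gamma> x u v"
  using smooth_on_differentiable[OF form1_onD(2)[OF assms(1)] assms(3)]
    smooth_on_differentiable[OF form1_onD(2)[OF assms(2)] assms(3)]
  by (simp add: d_form1_def fd_add)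

lemma d_form1_diff:
  assumes "form1_on U \<beta>" "form1_on U \<gamma>" "x \<in> U"
  shows "d_form1 (\<lambda>x u. \<beta> x u - \<gamma> x u) x u v = d_form1 \<beta> x u v - d_form1 \<gamma> x u v"
  using smooth_on_differentiable[OF form1_onD(2)[OF assms(1)] assms(3)]
    smooth_on_differentiable[OF form1_onD(2)[OF assms(2)] assms(3)]
  by (simp add: d_form1_def fd_diff)

lemma form1_on_add:
  assumes "open U" "form1_on U \<beta>" "form1_on U \<gamma>"
  shows "form1_on U (\<lambda>x u. \<beta> x u + \<gamma> x u)"
  using assms by (auto simp: form1_on_def intro: linear_compose_add smooth_on_add)

lemma form1_on_diff:
  assumes "open U" "form1_on U \<beta>" "form1_on U \<gamma>"
  shows "form1_on U (\<lambda>x u. \<beta> x u - \<gamma> x u)"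
  using assms by (auto simp: form1_on_def intro: linear_compose_sub smooth_on_diff)

lemma form1_on_subset: "form1_on U \<beta> \<Longrightarrow> V \<subseteq> U \<Longrightarrow> form1_on V \<beta>"
  by (auto simp: form1_on_def intro: smooth_on_subset)

lemma form2_on_subset: "form2_on U \<beta> \<Longrightarrow> V \<subseteq> U \<Longrightarrow> form2_on V \<beta>"
  unfolding form2_on_def by (meson smooth_on_subset subsetD)

lemma d_form2_cong:
  assumes "open U" "x \<in> U" "\<And>x u v. x \<in> U \<Longrightarrow> \<alpha> x u v = \<beta> x u v"
  shows "d_form2 \<alpha> x u v w = d_form2 \<beta> x u v w"
  using fd_cong[OF assms(1,2), of "\<lambda>y. \<alpha> y _ _" "\<lambda>y. \<beta> y _ _"] assms(3) by (simp add: d_form2_def)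

text \<open>Indices are residues modulo 2n, and 2n is at least 4, so 1, 2 and 3 are their own
  representatives.\<close>

lemma bit0_numerals_distinct:
  assumes "CARD('n::finite) \<ge> 2"
  shows "(1::'n bit0) \<noteq> 2" "(1::'n bit0) \<noteq> 3" "(2::'n bit0) \<noteq> 3"
    "(2::'n bit0) \<noteq> 1" "(3::'n bit0) \<noteq> 1" "(3::'n bit0) \<noteq> 2"
proof -
  have c: "int CARD('n bit0) \<ge> 4" using assms by simp
  have r: "Rep_bit0 (of_int z :: 'n bit0) = z mod int CARD('n bit0)" for z
    by (simp add: bit0.of_int_eq bit0.Abs_inverse)
  have R: "Rep_bit0 (1::'n bit0) = 1" "Rep_bit0 (2::'n bit0) = 2" "Rep_bit0 (3::'n bit0) = 3"
    using r[of 1] r[of 2] r[of 3] c by (simp_all add: mod_pos_pos_trivial)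
  have ne: "a \<noteq> b" if "Rep_bit0 a \<noteq> Rep_bit0 b" for a b :: "'n bit0" using that by blast
  show "(1::'n bit0) \<noteq> 2" by (rule ne) (unfold R, simp)
  show "(1::'n bit0) \<noteq> 3" by (rule ne) (unfold R, simp)
  show "(2::'n bit0) \<noteq> 3" by (rule ne) (unfold R, simp)
  show "(2::'n bit0) \<noteq> 1" by (rule ne) (unfold R, simp)
  show "(3::'n bit0) \<noteq> 1" by (rule ne) (unfold R, simp)
  show "(3::'n bit0) \<noteq> 2" by (rule ne) (unfold R, simp)
qed

text \<open>The weights 3, 4, 2 are the exponents of the cusp \<open>(t^3, -t^4, t^2)\<close>; they
  make the two equations of \<open>U8\<close> quasihomogeneous of degrees 6 and 7. The other
  coordinates vanish on \<open>U8\<close>, so any positive weight could be given to them.\<close>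

definition U8_weight :: "'n::finite bit0 \<Rightarrow> nat" where
  "U8_weight i = (if i = 1 then 3 else if i = 2 then 4 else if i = 3 then 2 else 1)"

lemma U8_quasihomogeneous:
  fixes x :: "'n::finite space"
  assumes "CARD('n) \<ge> 2" "x \<in> U8"
  shows "(\<chi> i. s ^ U8_weight i * x $ i) \<in> U8"
proof -
  have 1: "(x $ 1)^2 + x $ 2 * x $ 3 = 0" "x $ 1 * x $ 2 + x $ 1 * (x $ 3)^2 = 0" "\<And>i. i \<notin> {1,2,3} \<Longrightarrow> x $ i = 0"
    using assms(2) by (auto simp: U8_def)
  have "(s^3 * x $ 1)^2 + (s^4 * x $ 2) * (s^2 * x $ 3) = s^6 * ((x $ 1)^2 + x $ 2 * x $ 3)"
    "(s^3 * x $ 1) * (s^4 * x $ 2) + (s^3 * x $ 1) * (s^2 * x $ 3)^2 = s^7 * (x $ 1 * x $ 2 + x $ 1 * (x $ 3)^2)"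
    by algebra+
  thus ?thesis using 1 bit0_numerals_distinct[OF assms(1)]
    by (auto simp: U8_def U8_weight_def)
qed

text \<open>A germ of a diffeomorphism with its inverse and domains named, and without the sets that
  it maps to each other, so that charts can be inverted, restricted and composed.\<close>

definition local_diffeo :: "('a::euclidean_space \<Rightarrow> 'a) \<Rightarrow> ('a \<Rightarrow> 'a) \<Rightarrow> 'a set \<Rightarrow> 'a set \<Rightarrow> bool" where
  "local_diffeo \<Phi> \<Psi> U V \<longleftrightarrow> open U \<and> open V \<and> 0 \<in> U \<and> \<Phi> 0 = 0 \<and> homeomorphism U V \<Phi> \<Psi> \<and>
     smooth_on U \<Phi> \<and> smooth_on V \<Psi>"

lemma local_diffeoD:
  assumes "local_diffeo \<Phi> \<Psi> U V"
  shows "open U" "open V" "0 \<in> U" "0 \<in> V" "\<Phi> 0 = 0" "\<Psi> 0 = 0" "smooth_on U \<Phi>" "smooth_on V \<Psi>"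
    "\<And>x. x \<in> U \<Longrightarrow> \<Phi> x \<in> V" "\<And>y. y \<in> V \<Longrightarrow> \<Psi> y \<in> U"
    "\<And>x. x \<in> U \<Longrightarrow> \<Psi> (\<Phi> x) = x" "\<And>y. y \<in> V \<Longrightarrow> \<Phi> (\<Psi> y) = y"
proof -
  have *: "open U" "open V" "0 \<in> U" "\<Phi> 0 = 0" "\<And>x. x \<in> U \<Longrightarrow> \<Psi> (\<Phi> x) = x" "\<Phi> ` U = V"
    "\<And>y. y \<in> V \<Longrightarrow> \<Phi> (\<Psi> y) = y" "\<Psi> ` V = U" "smooth_on U \<Phi>" "smooth_on V \<Psi>"
    using assms unfolding local_diffeo_def homeomorphism_def by simp_all
  show "open U" "open V" "0 \<in> U" "\<Phi> 0 = 0" "\<And>x. x \<in> U \<Longrightarrow> \<Psi> (\<Phi> x) = x"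
    "\<And>y. y \<in> V \<Longrightarrow> \<Phi> (\<Psi> y) = y" "smooth_on U \<Phi>" "smooth_on V \<Psi>" by (fact *)+
  show "\<And>x. x \<in> U \<Longrightarrow> \<Phi> x \<in> V" using *(6) by blast
  show "\<And>y. y \<in> V \<Longrightarrow> \<Psi> y \<in> U" using *(8) by blast
  show "\<Psi> 0 = 0" using *(3,4) *(5)[of 0] by simp
  show "0 \<in> V" using *(3,4,6) by force
qed

lemma local_diffeo_sym: "local_diffeo \<Phi> \<Psi> U V \<Longrightarrow> local_diffeo \<Psi> \<Phi> V U"
  using homeomorphism_sym[of U V \<Phi> \<Psi>] local_diffeoD(4,6)[of \<Phi> \<Psi> U V]
  unfolding local_diffeo_def by blast

lemma local_diffeo_restrict:
  assumes "local_diffeo \<Phi> \<Psi> U V" "open U'" "0 \<in> U'"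
  shows "local_diffeo \<Phi> \<Psi> (U \<inter> U') (V \<inter> \<Psi> -` U')"
proof -
  note d = local_diffeoD[OF assms(1)]
  have "open (V \<inter> \<Psi> -` U')"
    using continuous_open_preimage[OF smooth_on_continuous_on[OF d(8)] d(2) assms(2)] .
  moreover have "\<Phi> ` (U \<inter> U') = V \<inter> \<Psi> -` U'"
  proof safe
    fix y assume "y \<in> V" "\<Psi> y \<in> U'"
    thus "y \<in> \<Phi> ` (U \<inter> U')" using d(10,12) by (metis IntI imageI)
  qed (use d in auto)
  moreover have "homeomorphism (U \<inter> U') (\<Phi> ` (U \<inter> U')) \<Phi> \<Psi>"
    by (rule homeomorphism_of_subsets) (use assms(1) in \<open>auto simp: local_diffeo_def\<close>)
  ultimately show ?thesis
    using assms d(1-8) by (auto simp: local_diffeo_def intro: smooth_on_subset)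
qed

lemma local_diffeo_fd_inverse:
  assumes "local_diffeo \<Phi> \<Psi> U V" "x \<in> U"
  shows "fd \<Psi> (\<Phi> x) (fd \<Phi> x v) = v" "fd \<Phi> x (fd \<Psi> (\<Phi> x) v) = v"
proof -
  note d = local_diffeoD[OF assms(1)]
  have *: "fd g (f x) (fd f x v) = v"
    if "open A" "x \<in> A" "smooth_on A f" "smooth_on B g" "\<And>x. x \<in> A \<Longrightarrow> f x \<in> B" "\<And>x. x \<in> A \<Longrightarrow> g (f x) = x"
    for f g :: "'a \<Rightarrow> 'a" and A B x v
  proof -
    have "fd (\<lambda>x. g (f x)) x v = v"
      using fd_cong[OF that(1,2), of "\<lambda>x. g (f x)" "\<lambda>x. x"] that(6) by (simp add: fd_eqI[OF has_derivative_ident])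
    thus ?thesis using fd_compose[OF that(4,3,2) that(5)[OF that(2)]] by metis
  qed
  show "fd \<Psi> (\<Phi> x) (fd \<Phi> x v) = v"
    by (rule *[OF d(1) assms(2) d(7,8,9,11)])
  show "fd \<Phi> x (fd \<Psi> (\<Phi> x) v) = v"
    using *[OF d(2) d(9)[OF assms(2)] d(8,7,10,12)] d(11)[OF assms(2)] by simp
qed

lemma local_diffeo_compose:
  assumes "local_diffeo \<Phi> \<Psi> U V" "local_diffeo \<Phi>' \<Psi>' U' V'"
  shows "local_diffeo (\<lambda>x. \<Phi>' (\<Phi> x)) (\<lambda>y. \<Psi> (\<Psi>' y)) (U \<inter> \<Phi> -` U') (V' \<inter> \<Psi>' -` V)"
proof -
  note d = local_diffeoD[OF assms(1)] and d' = local_diffeoD[OF assms(2)]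
  have o: "open (U \<inter> \<Phi> -` U')" "open (V' \<inter> \<Psi>' -` V)"
    using continuous_open_preimage[OF smooth_on_continuous_on] d d' by blast+
  have s: "smooth_on (U \<inter> \<Phi> -` U') (\<lambda>x. \<Phi>' (\<Phi> x))" "smooth_on (V' \<inter> \<Psi>' -` V) (\<lambda>y. \<Psi> (\<Psi>' y))"
    using smooth_on_compose[OF d'(7) o(1) smooth_on_subset[OF d(7)]]
      smooth_on_compose[OF d(8) o(2) smooth_on_subset[OF d'(8)]] by auto
  have "homeomorphism (U \<inter> \<Phi> -` U') (V' \<inter> \<Psi>' -` V) (\<lambda>x. \<Phi>' (\<Phi> x)) (\<lambda>y. \<Psi> (\<Psi>' y))"
    by (rule homeomorphismI) (use s d d' in \<open>auto intro: smooth_on_continuous_on\<close>)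
  thus ?thesis using o s d d' by (auto simp: local_diffeo_def)
qed

lemma diffeo_germ_ontoE:
  assumes "diffeo_germ_onto \<Phi> M N"
  obtains \<Psi> U V where "local_diffeo \<Phi> \<Psi> U V" "\<Phi> ` (M \<inter> U) = N \<inter> V"
proof -
  obtain U V \<Psi> where "\<Phi> 0 = 0" "open U" "open V" "0 \<in> U" "homeomorphism U V \<Phi> \<Psi>" "smooth_on U \<Phi>"
    "smooth_on V \<Psi>" and eq: "\<Phi> ` (M \<inter> U) = N \<inter> V"
    using assms unfolding diffeo_germ_onto_def by (elim conjE exE) (rule that)
  hence "local_diffeo \<Phi> \<Psi> U V" by (simp add: local_diffeo_def)
  thus ?thesis using eq by (rule that)
qed

text \<open>With a primitive of \<omega> at hand only 1-forms have to be pulled back; that a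
  pulled-back form is closed then follows from d after d being zero.\<close>

lemma symplectic_germ_exact:
  fixes \<omega> :: "'n::finite form2"
  assumes "symplectic_germ \<omega>"
  obtains r lam where "r > 0" "form1_on (ball 0 r) lam" "form2_on (ball 0 r) \<omega>"
    "\<And>x u v. x \<in> ball 0 r \<Longrightarrow> \<omega> x u v = d_form1 lam x u v"
    "\<And>x u. x \<in> ball 0 r \<Longrightarrow> (\<And>v. \<omega> x u v = 0) \<Longrightarrow> u = 0"
proof -
  obtain U where U0: "open U" "0 \<in> U" "form2_on U \<omega>"
    "\<forall>x\<in>U. (\<forall>u v w. d_form2 \<omega> x u v w = 0) \<and> (\<forall>u. (\<forall>v. \<omega> x u v = 0) \<longrightarrow> u = 0)"
    using assms unfolding symplectic_germ_def by (elim exE conjE) (rule that)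
  hence U: "open U" "0 \<in> U" "form2_on U \<omega>" "\<And>x u v w. x \<in> U \<Longrightarrow> d_form2 \<omega> x u v w = 0"
    "\<And>x u. x \<in> U \<Longrightarrow> (\<And>v. \<omega> x u v = 0) \<Longrightarrow> u = 0"
    by simp_all
  obtain r where r: "r > 0" "ball 0 r \<subseteq> U" using U(1,2) open_contains_ball by blast
  have \<omega>: "form2_on (ball 0 r) \<omega>" using U(3) r(2) form2_on_subset by blast
  obtain lam where l: "form1_on (ball 0 r) lam" "\<And>y u v. y \<in> ball 0 r \<Longrightarrow> d_form1 lam y u v = \<omega> y u v"
    by (rule poincare_weighted[OF \<omega>, of "\<lambda>_. 1"]) (use U(4) r in auto)
  show ?thesis by (rule that[OF r(1) l(1) \<omega>]) (use l(2) U(5) r(2) in \<open>auto simp: subset_iff\<close>)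
qed

lemma normal_form_exact:
  fixes \<omega> :: "'n::finite form2"
  assumes card: "CARD('n) \<ge> 2" and \<omega>: "symplectic_germ \<omega>" and \<eta>: "form1_on UNIV \<eta>"
    and nf: "has_normal_form \<omega> N (d_form1 \<eta>)"
  obtains \<Phi> \<Psi> U V \<beta> where "local_diffeo \<Phi> \<Psi> U V" "\<Phi> ` (U8 \<inter> U) = N \<inter> V" "form1_on U \<beta>"
    "\<And>x u v. x \<in> U \<Longrightarrow> pullback \<Phi> \<omega> x u v = d_form1 (\<lambda>x u. \<eta> x u + \<beta> x u) x u v"
    "\<And>x u. x \<in> U8 \<inter> U \<Longrightarrow> \<beta> x u = 0"
proof -
  obtain \<Phi> where \<Phi>: "diffeo_germ_onto \<Phi> U8 N" "same_alg_restriction U8 (pullback \<Phi> \<omega>) (d_form1 \<eta>)"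
    using nf unfolding alg_restrictions_diffeomorphic_def by (elim exE conjE) (rule that)
  obtain \<Psi> U V where d: "local_diffeo \<Phi> \<Psi> U V" "\<Phi> ` (U8 \<inter> U) = N \<inter> V"
    using diffeo_germ_ontoE[OF \<Phi>(1)] .
  note D = local_diffeoD[OF d(1)]
  obtain U1 \<alpha> \<beta>1 where U10: "open U1" "0 \<in> U1" "form2_on U1 \<alpha>" "form1_on U1 \<beta>1"
    "\<forall>x\<in>U1. \<forall>u v. pullback \<Phi> \<omega> x u v - d_form1 \<eta> x u v = \<alpha> x u v + d_form1 \<beta>1 x u v"
    "\<forall>x\<in>U8 \<inter> U1. (\<forall>u v. \<alpha> x u v = 0) \<and> (\<forall>u. \<beta>1 x u = 0)"
    using \<Phi>(2) unfolding same_alg_restriction_def by (elim exE conjE) (rule that)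
  hence U1: "open U1" "0 \<in> U1" "form2_on U1 \<alpha>" "form1_on U1 \<beta>1"
    "\<And>x u v. x \<in> U1 \<Longrightarrow> pullback \<Phi> \<omega> x u v - d_form1 \<eta> x u v = \<alpha> x u v + d_form1 \<beta>1 x u v"
    "\<And>x u v. x \<in> U8 \<inter> U1 \<Longrightarrow> \<alpha> x u v = 0" "\<And>x u. x \<in> U8 \<inter> U1 \<Longrightarrow> \<beta>1 x u = 0"
    by simp_all
  obtain r1 lam where l: "r1 > 0" "form1_on (ball 0 r1) lam" "\<And>x u v. x \<in> ball 0 r1 \<Longrightarrow> \<omega> x u v = d_form1 lam x u v"
    by (rule symplectic_germ_exact[OF \<omega>]) (rule that)
  have "open (U \<inter> \<Phi> -` ball 0 r1 \<inter> U1)"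
    by (intro open_Int continuous_open_preimage[OF smooth_on_continuous_on] D U1) auto
  moreover have "0 \<in> U \<inter> \<Phi> -` ball 0 r1 \<inter> U1" using D U1 l by auto
  ultimately obtain r where r: "r > 0" "ball 0 r \<subseteq> U \<inter> \<Phi> -` ball 0 r1 \<inter> U1"
    using open_contains_ball by blast
  let ?B = "ball (0::'n space) r"
  have B: "?B \<subseteq> U1" "?B \<subseteq> U" "\<And>x. x \<in> ?B \<Longrightarrow> \<Phi> x \<in> ball 0 r1" using r(2) by auto
  \<comment> \<open>A primitive of \<alpha>, made from the primitive of \<omega>. It need not vanish
    on \<open>U8\<close>; it only shows that \<alpha> is closed.\<close>
  define \<kappa> where "\<kappa> x u = pullback1 \<Phi> lam x u - (\<eta> x u + \<beta>1 x u)" for x u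
  have \<Phi>B: "smooth_on ?B \<Phi>" using D(7) B(2) smooth_on_subset by blast
  note f = form1_on_pullback1[OF l(2) open_ball \<Phi>B B(3)] form1_on_subset[OF \<eta>, of ?B]
    form1_on_subset[OF U1(4) B(1)]
  note f3 = form1_on_add[OF open_ball f(2)[OF subset_UNIV] f(3)]
  have \<kappa>: "form1_on ?B \<kappa>" unfolding \<kappa>_def by (rule form1_on_diff[OF open_ball f(1) f3])
  have d\<kappa>: "d_form1 \<kappa> x u v = \<alpha> x u v" if "x \<in> ?B" for x u v
  proof -
    have "d_form1 \<kappa> x u v = d_form1 (pullback1 \<Phi> lam) x u v - (d_form1 \<eta> x u v + d_form1 \<beta>1 x u v)"
      unfolding \<kappa>_def using d_form1_diff[OF f(1) f3 that] d_form1_add[OF f(2)[OF subset_UNIV] f(3) that] by simp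
    also have "d_form1 (pullback1 \<Phi> lam) x u v = pullback \<Phi> \<omega> x u v"
      using d_form1_pullback1[OF l(2) open_ball open_ball \<Phi>B B(3) that] l(3)[OF B(3)[OF that]]
      by (simp add: pullback_def)
    finally show ?thesis using U1(5)[of x u v] that B(1) by auto
  qed
  obtain \<beta>2 where b2: "form1_on ?B \<beta>2" "\<And>y u v. y \<in> ?B \<Longrightarrow> d_form1 \<beta>2 y u v = \<alpha> y u v"
    "\<And>y u. (\<And>s u v. s \<in> {0..1} \<Longrightarrow> \<alpha> (\<chi> i. s ^ U8_weight i * y $ i) u v = 0) \<Longrightarrow> \<beta>2 y u = 0"
  proof (rule poincare_weighted[of r \<alpha> U8_weight])
    show "form2_on ?B \<alpha>" using U1(3) B(1) form2_on_subset by blast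
    show "d_form2 \<alpha> x u v w = 0" if "x \<in> ?B" for x u v w
      using d_form2_d_form1[OF \<kappa> open_ball that, of u v w]
        d_form2_cong[OF open_ball that, of "d_form1 \<kappa>" \<alpha> u v w] d\<kappa> by simp
  qed (auto simp: U8_weight_def)
  have scale: "(\<chi> i. s ^ U8_weight i * y $ i) \<in> ?B" if "s \<in> {0..1}" "y \<in> ?B" for s and y :: "'n space"
  proof -
    have "\<bar>s ^ U8_weight i\<bar> * \<bar>y $ i\<bar> \<le> 1 * \<bar>y $ i\<bar>" for i
      using that(1) by (intro mult_right_mono) (auto simp: power_le_one)
    hence "norm (\<chi> i. s ^ U8_weight i * y $ i) \<le> norm y"
      by (intro norm_le_componentwise_cart) (simp add: abs_mult)
    thus ?thesis using that(2) by simp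
  qed
  define \<beta> where "\<beta> x u = \<beta>1 x u + \<beta>2 x u" for x u
  have f\<beta>: "form1_on ?B \<beta>" unfolding \<beta>_def by (rule form1_on_add[OF open_ball f(3) b2(1)])
  show ?thesis
  proof (rule that)
    show "local_diffeo \<Phi> \<Psi> (U \<inter> ?B) (V \<inter> \<Psi> -` ?B)"
      by (rule local_diffeo_restrict[OF d(1)]) (use r in auto)
    show "\<Phi> ` (U8 \<inter> (U \<inter> ?B)) = N \<inter> (V \<inter> \<Psi> -` ?B)"
    proof safe
      fix y assume "y \<in> N" "y \<in> V" "\<Psi> y \<in> ?B"
      hence "y \<in> \<Phi> ` (U8 \<inter> U)" using d(2) by blast
      thus "y \<in> \<Phi> ` (U8 \<inter> (U \<inter> ?B))" using D(11) \<open>\<Psi> y \<in> ?B\<close> by auto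
    qed (use d(2) D in auto)
    show "form1_on (U \<inter> ?B) \<beta>" using f\<beta> form1_on_subset by blast
    show "pullback \<Phi> \<omega> x u v = d_form1 (\<lambda>x u. \<eta> x u + \<beta> x u) x u v" if "x \<in> U \<inter> ?B" for x u v
    proof -
      have x: "x \<in> ?B" "x \<in> U1" using that B(1) by auto
      have "d_form1 (\<lambda>x u. \<eta> x u + \<beta> x u) x u v = d_form1 \<eta> x u v + (d_form1 \<beta>1 x u v + d_form1 \<beta>2 x u v)"
        using d_form1_add[OF f(2)[OF subset_UNIV] f\<beta> x(1)] d_form1_add[OF f(3) b2(1) x(1)]
        by (simp add: \<beta>_def[abs_def])
      thus ?thesis using U1(5)[OF x(2), of u v] b2(2)[OF x(1), of u v] by simp
    qed
    show "\<beta> x u = 0" if "x \<in> U8 \<inter> (U \<inter> ?B)" for x u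
    proof -
      \<comment> \<open>The contraction keeps the point in \<open>U8\<close> and in the ball, so
        \<alpha> vanishes along its whole trajectory.\<close>
      have "\<beta>2 x u = 0"
        by (rule b2(3)) (use U1(6) that B(1) scale U8_quasihomogeneous[OF card] in blast)
      thus ?thesis using U1(7)[of x u] that B(1) by (auto simp: \<beta>_def)
    qed
  qed
qed

section \<open>Flows of time-dependent vector fields\<close>

text \<open>Regularity in the space variable, together with joint continuity in time over the closed
  interval. Differentiability in time is left out, because what is wanted of a flow is smoothness in
  the initial point at a fixed time.\<close>

fun time_Ck_on :: "nat \<Rightarrow> 'p::real_normed_vector set \<Rightarrow> (real \<Rightarrow> 'p \<Rightarrow> 'e::real_normed_vector) \<Rightarrow> bool" where
  "time_Ck_on 0 B g \<longleftrightarrow> continuous_on ({0..1} \<times> B) (\<lambda>q. g (fst q) (snd q))"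
| "time_Ck_on (Suc k) B g \<longleftrightarrow> continuous_on ({0..1} \<times> B) (\<lambda>q. g (fst q) (snd q)) \<and>
     (\<forall>t\<in>{0..1}. \<forall>y\<in>B. g t differentiable (at y)) \<and> (\<forall>v. time_Ck_on k B (\<lambda>t y. fd (g t) y v))"

section \<open>Closure properties of time-dependent maps\<close>

lemma continuous_on_uncurry_compose:
  assumes "continuous_on (T \<times> B) (\<lambda>q. g (fst q) (snd q))" "continuous_on S \<tau>" "continuous_on S u"
    "\<And>s. s \<in> S \<Longrightarrow> \<tau> s \<in> T" "\<And>s. s \<in> S \<Longrightarrow> u s \<in> B"
  shows "continuous_on S (\<lambda>s. g (\<tau> s) (u s))"
proof -
  have "(\<lambda>s. (\<tau> s, u s)) ` S \<subseteq> T \<times> B" using assms(4,5) by blast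
  from continuous_on_compose2[OF assms(1) continuous_on_Pair[OF assms(2,3)] this] show ?thesis by simp
qed

lemma time_Ck_on_continuous: "time_Ck_on k B g \<Longrightarrow> continuous_on ({0..1} \<times> B) (\<lambda>q. g (fst q) (snd q))"
  by (cases k) auto

lemma time_Ck_on_SucD: "time_Ck_on (Suc k) B g \<Longrightarrow> time_Ck_on k B g"
proof (induction k arbitrary: g)
  case 0 thus ?case by simp
next
  case (Suc k)
  have "\<forall>v. time_Ck_on k B (\<lambda>t y. fd (g t) y v)"
    using Suc.prems Suc.IH unfolding time_Ck_on.simps(2)[of "Suc k" B g] by blast
  thus ?case using Suc.prems unfolding time_Ck_on.simps(2)[of "Suc k" B g] time_Ck_on.simps(2)[of k B g] by blast
qed

lemma time_Ck_on_SucE: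
  assumes "time_Ck_on (Suc k) B g"
  shows "t \<in> {0..1} \<Longrightarrow> y \<in> B \<Longrightarrow> (g t has_derivative fd (g t) y) (at y)"
    "time_Ck_on k B (\<lambda>t y. fd (g t) y v)"
  using assms by (auto simp: frechet_derivative_works[symmetric])

lemma time_Ck_on_cong:
  assumes "open B" "\<And>t y. t \<in> {0..1} \<Longrightarrow> y \<in> B \<Longrightarrow> f t y = g t y"
  shows "time_Ck_on k B f \<longleftrightarrow> time_Ck_on k B g"
  using assms(2)
proof (induction k arbitrary: f g)
  case 0
  have "continuous_on ({0..1} \<times> B) (\<lambda>q. f (fst q) (snd q)) \<longleftrightarrow> continuous_on ({0..1} \<times> B) (\<lambda>q. g (fst q) (snd q))"
    by (rule continuous_on_cong) (use 0 in auto)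
  thus ?case by simp
next
  case (Suc k)
  have c: "continuous_on ({0..1} \<times> B) (\<lambda>q. f (fst q) (snd q)) \<longleftrightarrow> continuous_on ({0..1} \<times> B) (\<lambda>q. g (fst q) (snd q))"
    by (rule continuous_on_cong) (use Suc.prems in auto)
  have e: "fd (f t) y = fd (g t) y" "f t differentiable (at y) \<longleftrightarrow> g t differentiable (at y)"
    if "t \<in> {0..1}" "y \<in> B" for t y
    using fd_cong[OF assms(1) that(2)] differentiable_cong_open[OF assms(1) that(2)] Suc.prems[OF that(1)] by auto
  have "time_Ck_on k B (\<lambda>t y. fd (f t) y v) \<longleftrightarrow> time_Ck_on k B (\<lambda>t y. fd (g t) y v)" for v
    by (rule Suc.IH) (simp add: e)
  thus ?case using c e(2) by simp
qed

lemma time_Ck_on_SucI: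
  assumes B: "open B" and c: "continuous_on ({0..1} \<times> B) (\<lambda>q. g (fst q) (snd q))"
    and D: "\<And>t y. t \<in> {0..1} \<Longrightarrow> y \<in> B \<Longrightarrow> (g t has_derivative D t y) (at y)"
    and k: "\<And>v. time_Ck_on k B (\<lambda>t y. D t y v)"
  shows "time_Ck_on (Suc k) B g"
proof -
  have "fd (g t) y = D t y" if "t \<in> {0..1}" "y \<in> B" for t y by (rule fd_eqI) (rule D[OF that])
  hence "time_Ck_on k B (\<lambda>t y. fd (g t) y v)" for v
    using k[of v] time_Ck_on_cong[OF B, of "\<lambda>t y. fd (g t) y v" "\<lambda>t y. D t y v"] by simp
  moreover have "\<forall>t\<in>{0..1}. \<forall>y\<in>B. g t differentiable (at y)"
    using D by (meson differentiable_def)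
  ultimately show ?thesis using c by simp
qed

lemma time_Ck_on_add:
  assumes "open B" "time_Ck_on k B f" "time_Ck_on k B g"
  shows "time_Ck_on k B (\<lambda>t y. f t y + g t y)"
  using assms(2,3)
proof (induction k arbitrary: f g)
  case 0 thus ?case by (auto intro: continuous_on_add)
next
  case (Suc k)
  note f = time_Ck_on_SucE[OF Suc.prems(1)] and g = time_Ck_on_SucE[OF Suc.prems(2)]
  show ?case
    by (rule time_Ck_on_SucI[OF assms(1) continuous_on_add[OF time_Ck_on_continuous[OF Suc.prems(1)]
            time_Ck_on_continuous[OF Suc.prems(2)]], where D="\<lambda>t x v. fd (f t) x v + fd (g t) x v"])
      (rule has_derivative_add[OF f(1) g(1)] Suc.IH[OF f(2) g(2)], assumption?, assumption?, assumption?, assumption?)+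
qed

lemma time_Ck_on_bilinear:
  assumes B: "bounded_bilinear h" and "open B" "time_Ck_on k B f" "time_Ck_on k B g"
  shows "time_Ck_on k B (\<lambda>t y. h (f t y) (g t y))"
  using assms(3,4)
proof (induction k arbitrary: f g)
  case 0 thus ?case using bounded_bilinear.continuous_on[OF B] by auto
next
  case (Suc k)
  note f = time_Ck_on_SucE[OF Suc.prems(1)] and g = time_Ck_on_SucE[OF Suc.prems(2)]
  show ?case
  proof (rule time_Ck_on_SucI[where D="\<lambda>t x v. h (f t x) (fd (g t) x v) + h (fd (f t) x v) (g t x)"])
    show "time_Ck_on k B (\<lambda>t x. h (f t x) (fd (g t) x v) + h (fd (f t) x v) (g t x))" for v
      by (intro time_Ck_on_add[OF assms(2)] Suc.IH f(2) g(2) time_Ck_on_SucD[OF Suc.prems(1)]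
          time_Ck_on_SucD[OF Suc.prems(2)])
    show "continuous_on ({0..1} \<times> B) (\<lambda>q. h (f (fst q) (snd q)) (g (fst q) (snd q)))"
      by (rule bounded_bilinear.continuous_on[OF B time_Ck_on_continuous[OF Suc.prems(1)]
            time_Ck_on_continuous[OF Suc.prems(2)]])
    show "((\<lambda>y. h (f t y) (g t y)) has_derivative (\<lambda>v. h (f t y) (fd (g t) y v) + h (fd (f t) y v) (g t y))) (at y)"
      if "t \<in> {0..1}" "y \<in> B" for t y
      by (rule bounded_bilinear.FDERIV[OF B f(1)[OF that] g(1)[OF that]])
  qed (rule assms(2))
qed

lemma time_Ck_on_const:
  assumes "open B" "Ck_on k B b"
  shows "time_Ck_on k B (\<lambda>t. b)"
  using assms(2)
proof (induction k arbitrary: b)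
  have c: "continuous_on ({0..1} \<times> B) (\<lambda>q. b (snd q))" if "continuous_on B b" for b
    by (rule continuous_on_compose2[OF that continuous_on_snd[OF continuous_on_id]]) auto
  {
    case 0 thus ?case using c by simp
  next
    case (Suc k)
    note b = Ck_on_SucE[OF Suc.prems]
    show ?case
      by (rule time_Ck_on_SucI[OF assms(1) c[OF Ck_on_imp_continuous_on[OF Suc.prems]] b(1) Suc.IH[OF b(2)]])
  }
qed

lemma time_Ck_on_bl_comp:
  assumes "open B" "bounded_linear h" "time_Ck_on k B f"
  shows "time_Ck_on k B (\<lambda>t y. h (f t y))"
  using assms(3)
proof (induction k arbitrary: f)
  case 0 thus ?case using bounded_linear.continuous_on[OF assms(2)] by auto
next
  case (Suc k)
  note f = time_Ck_on_SucE[OF Suc.prems(1)]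
  show ?case
    by (rule time_Ck_on_SucI[OF assms(1) bounded_linear.continuous_on[OF assms(2)
            time_Ck_on_continuous[OF Suc.prems]] bounded_linear.has_derivative[OF assms(2) f(1)]
          Suc.IH[OF f(2)]])
qed

lemma time_Ck_on_sum:
  assumes "open B" "\<And>i. i \<in> I \<Longrightarrow> time_Ck_on k B (f i)"
  shows "time_Ck_on k B (\<lambda>t y. \<Sum>i\<in>I. f i t y)"
  using assms(2)
  by (induction I rule: infinite_finite_induct)
    (simp_all add: time_Ck_on_const[OF assms(1) Ck_on_const] time_Ck_on_add[OF assms(1)] del: time_Ck_on.simps)

lemma time_Ck_on_Pair:
  assumes "open B" "time_Ck_on k B f" "time_Ck_on k B g"
  shows "time_Ck_on k B (\<lambda>t y. (f t y, g t y))"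
proof -
  have "bounded_linear (\<lambda>a. (a, 0))" "bounded_linear (\<lambda>b. (0, b))"
    by (auto intro!: bounded_linear_Pair bounded_linear_ident bounded_linear_zero)
  hence "time_Ck_on k B (\<lambda>t y. (f t y, 0) + (0, g t y))"
    using assms by (intro time_Ck_on_add time_Ck_on_bl_comp[where h="\<lambda>a. (a, 0)"]
        time_Ck_on_bl_comp[where h="\<lambda>b. (0, b)"])
  thus ?thesis by simp
qed

text \<open>As for \<open>Ck_on\<close>, the moving direction in the chain rule is expanded in a
  basis, so that the induction hypothesis applies to the directional derivatives of f.\<close>

lemma time_Ck_on_compose:
  fixes f :: "real \<Rightarrow> 'q::euclidean_space \<Rightarrow> 'c::real_normed_vector"
  assumes "open B" "time_Ck_on k Q f" "time_Ck_on k B g" "\<And>t y. t \<in> {0..1} \<Longrightarrow> y \<in> B \<Longrightarrow> g t y \<in> Q"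
  shows "time_Ck_on k B (\<lambda>t y. f t (g t y))"
  using assms(2,3)
proof (induction k arbitrary: f)
  case 0
  have "continuous_on ({0..1} \<times> B) (\<lambda>q. (fst q, g (fst q) (snd q)))"
    using time_Ck_on_continuous[OF 0(2)] by (intro continuous_on_Pair continuous_on_fst continuous_on_id)
  from continuous_on_compose2[OF time_Ck_on_continuous[OF 0(1)] this] assms(4)
  show ?case by (auto simp: image_subset_iff)
next
  case (Suc k)
  note f = time_Ck_on_SucE[OF Suc.prems(1)] and g = time_Ck_on_SucE[OF Suc.prems(2)]
  have c: "continuous_on ({0..1} \<times> B) (\<lambda>q. (fst q, g (fst q) (snd q)))"
    using time_Ck_on_continuous[OF Suc.prems(2)] by (intro continuous_on_Pair continuous_on_fst continuous_on_id)
  have eq: "fd (f t) (g t y) (fd (g t) y v) = (\<Sum>b\<in>Basis. (fd (g t) y v \<bullet> b) *\<^sub>R fd (f t) (g t y) b)"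
    if "t \<in> {0..1}" "y \<in> B" for t y v
    by (rule fd_basis_expand) (use f(1)[OF that(1) assms(4)[OF that]] in \<open>auto simp: differentiable_def\<close>)
  show ?case
  proof (rule time_Ck_on_SucI[OF assms(1)])
    show "continuous_on ({0..1} \<times> B) (\<lambda>q. f (fst q) (g (fst q) (snd q)))"
      using continuous_on_compose2[OF time_Ck_on_continuous[OF Suc.prems(1)] c] assms(4)
      by (auto simp: image_subset_iff)
    fix t y assume t: "t \<in> {0..1::real}" "y \<in> B"
    have "((\<lambda>y. f t (g t y)) has_derivative (\<lambda>v. fd (f t) (g t y) (fd (g t) y v))) (at y)"
      using has_derivative_compose[OF g(1)[OF t] f(1)[OF t(1) assms(4)[OF t]]] .
    thus "((\<lambda>y. f t (g t y)) has_derivative (\<lambda>v. \<Sum>b\<in>Basis. (fd (g t) y v \<bullet> b) *\<^sub>R fd (f t) (g t y) b)) (at y)"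
      by (simp add: eq[OF t])
  next
    show "time_Ck_on k B (\<lambda>t y. \<Sum>b\<in>Basis. (fd (g t) y v \<bullet> b) *\<^sub>R fd (f t) (g t y) b)" for v
      by (intro time_Ck_on_sum[OF assms(1)] time_Ck_on_bilinear[OF bounded_bilinear_scaleR assms(1)]
          time_Ck_on_bl_comp[OF assms(1) bounded_linear_inner_left] Suc.IH g(2) f(2)
          time_Ck_on_SucD[OF Suc.prems(2)])
  qed
qed

text \<open>The bridge from maps that are smooth jointly in time and space, such as the vector field
  of the Moser method, to this weaker notion.\<close>

lemma time_Ck_on_of_Ck_on:
  fixes f :: "real \<times> 'p::euclidean_space \<Rightarrow> 'c::real_normed_vector"
  assumes "open B" "{0..1} \<times> B \<subseteq> W" "Ck_on k W f"
  shows "time_Ck_on k B (\<lambda>t y. f (t, y))"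
  using assms(3)
proof (induction k arbitrary: f)
  case 0 thus ?case using assms(2) by (auto intro: continuous_on_subset)
next
  case (Suc k)
  note f = Ck_on_SucE[OF Suc.prems]
  show ?case
  proof (rule time_Ck_on_SucI[OF assms(1) _ _ Suc.IH[OF f(2)]])
    show "continuous_on ({0..1} \<times> B) (\<lambda>q. f (fst q, snd q))"
      using continuous_on_subset[OF Ck_on_imp_continuous_on[OF Suc.prems] assms(2)] by simp
    fix t y assume t: "t \<in> {0..1::real}" "y \<in> B"
    have "((\<lambda>y. (t, y)) has_derivative (\<lambda>v. (0, v))) (at y)"
      by (intro has_derivative_Pair has_derivative_const has_derivative_ident)
    moreover have "(t, y) \<in> W" using t by (intro subsetD[OF assms(2)] SigmaI)
    ultimately show "((\<lambda>y. f (t, y)) has_derivative (\<lambda>v. fd f (t, y) (0, v))) (at y)"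
      using has_derivative_compose[OF _ f(1)] by blast
  qed
qed

lemma Ck_on_of_time_Ck_on: "time_Ck_on k B g \<Longrightarrow> t \<in> {0..1} \<Longrightarrow> Ck_on k B (g t)"
proof (induction k arbitrary: g)
  case 0
  have "continuous_on B (\<lambda>y. (t, y))" by (intro continuous_on_Pair continuous_on_const continuous_on_id)
  moreover have "(\<lambda>y. (t, y)) ` B \<subseteq> {0..1} \<times> B" using 0(2) by blast
  ultimately show ?case using continuous_on_compose2[OF time_Ck_on_continuous[OF 0(1)]] by fastforce
qed auto

text \<open>With a coefficient \<kappa> below 1 and time at most 1 no exponential appears: at the
  time where the norm has its maximum m, the inequality gives m \<le> c + \<kappa> m.\<close>

lemma integral_gronwall:
  fixes u :: "real \<Rightarrow> 'e::euclidean_space"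
  assumes u: "continuous_on {0..1} u" and \<kappa>: "0 \<le> \<kappa>" "\<kappa> < 1"
    and le: "\<And>t. t \<in> {0..1} \<Longrightarrow> norm (u t) \<le> c + integral {0..t} (\<lambda>s. \<kappa> * norm (u s))"
    and t: "t \<in> {0..1}"
  shows "norm (u t) \<le> c / (1 - \<kappa>)"
proof -
  have "continuous_on {0..1} (\<lambda>t. norm (u t))" using u by (intro continuous_intros)
  from continuous_attains_sup[OF compact_Icc _ this]
  obtain m where m: "m \<in> {0..1}" "\<And>t. t \<in> {0..1} \<Longrightarrow> norm (u t) \<le> norm (u m)" by auto
  have "continuous_on {0..m} (\<lambda>s. \<kappa> * norm (u s))"
    using continuous_on_subset[OF u, of "{0..m}"] m(1) by (auto intro!: continuous_intros)
  hence "integral {0..m} (\<lambda>s. \<kappa> * norm (u s)) \<le> integral {0..m} (\<lambda>s. \<kappa> * norm (u m))"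
    using m \<kappa>(1) by (intro integral_le integrable_continuous_interval mult_left_mono) (auto intro: continuous_intros)
  also have "\<dots> = m * (\<kappa> * norm (u m))" using m(1) by simp
  also have "\<dots> \<le> 1 * (\<kappa> * norm (u m))" using m(1) \<kappa>(1) by (intro mult_right_mono) auto
  finally have "norm (u m) \<le> c + \<kappa> * norm (u m)" using le[OF m(1)] by simp
  hence "norm (u m) * (1 - \<kappa>) \<le> c" by (simp add: algebra_simps)
  hence "norm (u m) \<le> c / (1 - \<kappa>)" using \<kappa>(2) by (simp add: pos_le_divide_eq)
  thus ?thesis using m(2)[OF t] by simp
qed

text \<open>Picard iteration. A Lipschitz constant 1/2 over an interval of length 1 makes the
  integral operator a contraction on the whole interval at once; that the iteration stays in the
  closed set \<open>Z\<close> is the hypothesis \<open>inv\<close>.\<close>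

lemma integral_equation_exists:
  fixes f :: "real \<Rightarrow> 'e::euclidean_space \<Rightarrow> 'e"
  assumes f: "continuous_on ({0..1} \<times> Z) (\<lambda>q. f (fst q) (snd q))" and Z: "closed Z" "Z \<noteq> {}"
    and lip: "\<And>t x y. t \<in> {0..1} \<Longrightarrow> x \<in> Z \<Longrightarrow> y \<in> Z \<Longrightarrow> norm (f t x - f t y) \<le> norm (x - y) / 2"
    and inv: "\<And>u t. continuous_on {0..1} u \<Longrightarrow> (\<And>s. s \<in> {0..1} \<Longrightarrow> u s \<in> Z) \<Longrightarrow> t \<in> {0..1} \<Longrightarrow>
      b + integral {0..t} (\<lambda>s. f s (u s)) \<in> Z"
  obtains z where "continuous_on {0..1} z" "\<And>t. t \<in> {0..1} \<Longrightarrow> z t \<in> Z"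
    "\<And>t. t \<in> {0..1} \<Longrightarrow> z t = b + integral {0..t} (\<lambda>s. f s (z s))"
proof -
  \<comment> \<open>Times are clamped to the unit interval, so that the unknown can live in the
    complete space of bounded continuous functions on the line.\<close>
  define cl :: "real \<Rightarrow> real" where "cl t = max 0 (min 1 t)" for t
  have cl: "cl t \<in> {0..1}" "t \<in> {0..1} \<Longrightarrow> cl t = t" for t by (auto simp: cl_def)
  have cl_cont: "continuous_on UNIV cl" unfolding cl_def by (intro continuous_intros)
  define I where "I u t = b + integral {0..cl t} (\<lambda>s. f s (u s))" for u t
  have fu: "continuous_on {0..1} (\<lambda>s. f s (u s))"
    if "continuous_on {0..1} u" "\<And>s. s \<in> {0..1} \<Longrightarrow> u s \<in> Z" for u
    by (rule continuous_on_uncurry_compose[OF f continuous_on_id that(1)]) (use that(2) in simp_all)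
  have I_cont: "continuous_on UNIV (I u)"
    if "continuous_on {0..1} u" "\<And>s. s \<in> {0..1} \<Longrightarrow> u s \<in> Z" for u
  proof -
    have "continuous_on {0..1} (\<lambda>t. integral {0..t} (\<lambda>s. f s (u s)))"
      by (rule indefinite_integral_continuous_1[OF integrable_continuous_interval[OF fu[OF that]]])
    moreover have "range cl \<subseteq> {0..1}" using cl(1) by blast
    ultimately show ?thesis unfolding I_def
      by (intro continuous_on_add continuous_on_const continuous_on_compose2[OF _ cl_cont])
  qed
  have I_bc: "I u \<in> bcontfun" if "continuous_on {0..1} u" "\<And>s. s \<in> {0..1} \<Longrightarrow> u s \<in> Z" for u
  proof -
    have "bounded (I u ` {0..1})"
      by (intro compact_imp_bounded compact_continuous_image continuous_on_subset[OF I_cont[OF that]]) auto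
    moreover have "range (I u) \<subseteq> I u ` {0..1}"
    proof safe
      fix t show "I u t \<in> I u ` {0..1}"
        using cl[of t] cl(2)[of "cl t"] by (intro image_eqI[of _ _ "cl t"]) (auto simp: I_def)
    qed
    ultimately show ?thesis using I_cont[OF that] bounded_subset unfolding bcontfun_def by blast
  qed
  define S :: "(real \<Rightarrow>\<^sub>C 'e) set" where "S = {u. \<forall>t. apply_bcontfun u t \<in> Z}"
  define P :: "(real \<Rightarrow>\<^sub>C 'e) \<Rightarrow> (real \<Rightarrow>\<^sub>C 'e)" where "P u = Bcontfun (I (apply_bcontfun u))" for u
  have uc: "continuous_on A (apply_bcontfun u)" for u :: "real \<Rightarrow>\<^sub>C 'e" and A
    using apply_bcontfun[of u] unfolding bcontfun_def by (auto intro: continuous_on_subset)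
  have P: "apply_bcontfun (P u) t = I (apply_bcontfun u) t" if "u \<in> S" for u t
    unfolding P_def using I_bc[OF uc, of u] that by (simp add: Bcontfun_inverse S_def)
  have "\<exists>!u\<in>S. P u = u"
  proof (rule Banach_fix)
    show "complete S" unfolding S_def
    proof (subst complete_eq_closed)
      have "{u :: real \<Rightarrow>\<^sub>C 'e. \<forall>t. apply_bcontfun u t \<in> Z} = (\<Inter>t. (\<lambda>u. apply_bcontfun u t) -` Z)" by auto
      moreover have "closed ((\<lambda>u::real \<Rightarrow>\<^sub>C 'e. apply_bcontfun u t) -` Z)" for t
      proof (rule closed_vimage[OF Z(1)])
        show "continuous_on UNIV (\<lambda>u::real \<Rightarrow>\<^sub>C 'e. apply_bcontfun u t)"
          by (rule continuous_on_iff[THEN iffD2]) (meson dist_bounded le_less_trans)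
      qed
      ultimately show "closed {u :: real \<Rightarrow>\<^sub>C 'e. \<forall>t. apply_bcontfun u t \<in> Z}" by auto
    qed
    show "S \<noteq> {}"
    proof -
      obtain c where "c \<in> Z" using Z(2) by blast
      hence "const_bcontfun c \<in> S" by (simp add: S_def)
      thus ?thesis by blast
    qed
    show "P ` S \<subseteq> S"
    proof safe
      fix u assume u: "u \<in> S"
      show "P u \<in> S" unfolding S_def
      proof safe
        fix t show "apply_bcontfun (P u) t \<in> Z"
          unfolding P[OF u] I_def using inv[OF uc _ cl(1)] u by (auto simp: S_def)
      qed
    qed
    show "dist (P u) (P v) \<le> 1 / 2 * dist u v" if "u \<in> S" "v \<in> S" for u v
    proof (rule dist_bound)
      fix t
      have uv: "\<And>s. apply_bcontfun u s \<in> Z" "\<And>s. apply_bcontfun v s \<in> Z" using that by (auto simp: S_def)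
      have i: "(\<lambda>s. f s (apply_bcontfun w s)) integrable_on {0..cl t}" if "w \<in> S" for w
        by (rule integrable_continuous_interval, rule continuous_on_subset[OF fu[OF uc]])
          (use that cl[of t] in \<open>auto simp: S_def\<close>)
      have "norm (integral {0..cl t} (\<lambda>s. f s (apply_bcontfun u s)) - integral {0..cl t} (\<lambda>s. f s (apply_bcontfun v s)))
        = norm (integral {0..cl t} (\<lambda>s. f s (apply_bcontfun u s) - f s (apply_bcontfun v s)))"
        using i that by (simp add: integral_diff)
      also have "\<dots> \<le> integral {0..cl t} (\<lambda>s. 1 / 2 * dist u v)"
      proof (rule integral_norm_bound_integral)
        fix s assume "s \<in> {0..cl t}"
        hence "norm (f s (apply_bcontfun u s) - f s (apply_bcontfun v s)) \<le> norm (apply_bcontfun u s - apply_bcontfun v s) / 2"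
          using uv cl(1)[of t] by (intro lip) auto
        thus "norm (f s (apply_bcontfun u s) - f s (apply_bcontfun v s)) \<le> 1 / 2 * dist u v"
          using dist_bounded[of u s v] by (simp add: dist_norm)
      qed (use i that in \<open>auto intro: integrable_diff\<close>)
      also have "\<dots> = cl t * (1 / 2 * dist u v)" using cl(1)[of t] by simp
      also have "\<dots> \<le> 1 * (1 / 2 * dist u v)" using cl(1)[of t] by (intro mult_right_mono) auto
      finally show "dist (apply_bcontfun (P u) t) (apply_bcontfun (P v) t) \<le> 1 / 2 * dist u v"
        by (simp add: P that I_def dist_norm)
    qed
  qed auto
  then obtain u where u: "u \<in> S" "P u = u" by blast
  show ?thesis
  proof (rule that[of "apply_bcontfun u"])
    show "continuous_on {0..1} (apply_bcontfun u)" by (rule uc)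
    show "apply_bcontfun u t \<in> Z" for t using u(1) by (simp add: S_def)
    show "apply_bcontfun u t = b + integral {0..t} (\<lambda>s. f s (apply_bcontfun u s))" if "t \<in> {0..1}" for t
      using P[OF u(1), of t] u(2) cl(2)[OF that] by (simp add: I_def)
  qed
qed

text \<open>The difference of the solutions for two parameters satisfies a Gronwall inequality whose
  constant term is small uniformly in time. Together with the continuity in time of a single
  solution this gives joint continuity.\<close>

lemma integral_equation_jointly_continuous:
  fixes f :: "real \<Rightarrow> 'p::euclidean_space \<times> 'e::euclidean_space \<Rightarrow> 'e" and z :: "real \<Rightarrow> 'p \<Rightarrow> 'e"
  assumes f: "continuous_on ({0..1} \<times> (B \<times> Z)) (\<lambda>q. f (fst q) (snd q))" and b: "continuous_on B b"
    and lip: "\<And>t y x x'. t \<in> {0..1} \<Longrightarrow> y \<in> B \<Longrightarrow> x \<in> Z \<Longrightarrow> x' \<in> Z \<Longrightarrow>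
      norm (f t (y, x) - f t (y, x')) \<le> norm (x - x') / 2"
    and zc: "\<And>y. y \<in> B \<Longrightarrow> continuous_on {0..1} (\<lambda>t. z t y)"
    and zZ: "\<And>t y. t \<in> {0..1} \<Longrightarrow> y \<in> B \<Longrightarrow> z t y \<in> Z"
    and eq: "\<And>t y. t \<in> {0..1} \<Longrightarrow> y \<in> B \<Longrightarrow> z t y = b y + integral {0..t} (\<lambda>s. f s (y, z s y))"
  shows "continuous_on ({0..1} \<times> B) (\<lambda>q. z (fst q) (snd q))"
proof -
  have fc: "continuous_on {0..t} (\<lambda>s. f s (y, z s y'))" if "t \<in> {0..1}" "y \<in> B" "y' \<in> B" for t y y'
    by (rule continuous_on_uncurry_compose[OF f continuous_on_id])
      (use that zZ in \<open>auto intro!: continuous_on_Pair continuous_on_const continuous_on_subset[OF zc]\<close>)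
  have uniform: "\<exists>d>0. \<forall>y\<in>B. dist y y0 < d \<longrightarrow> (\<forall>t\<in>{0..1}. norm (z t y - z t y0) < e)"
    if y0: "y0 \<in> B" and e: "e > 0" for y0 e
  proof -
    have c: "continuous_on (B \<times> {0..1}) (\<lambda>(y, s). f s (y, z s y0))"
      unfolding split_def
      by (rule continuous_on_uncurry_compose[OF f, where \<tau>=snd])
        (use zZ y0 in \<open>auto intro!: continuous_on_Pair continuous_on_fst continuous_on_snd continuous_on_id
          continuous_on_compose2[OF zc[OF y0]]\<close>)
    \<comment> \<open>By compactness of the time interval, the change of the right-hand side with
      the parameter, along the fixed solution for \<open>y0\<close>, is small uniformly in
      time.\<close>
    obtain X where X: "y0 \<in> X" "open X" "\<And>y s. y \<in> X \<inter> B \<Longrightarrow> s \<in> {0..1} \<Longrightarrow>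
        dist (f s (y, z s y0)) (f s (y0, z s y0)) \<le> e / 8"
      using continuous_on_prod_compactE[OF c compact_Icc y0, of "e / 8"] e
      unfolding split_def fst_conv snd_conv by (metis divide_pos_pos zero_less_numeral)
    obtain d1 where d1: "d1 > 0" "ball y0 d1 \<subseteq> X" using X open_contains_ball by blast
    obtain d2 where d2: "d2 > 0" "\<And>y. y \<in> B \<Longrightarrow> dist y y0 < d2 \<Longrightarrow> dist (b y) (b y0) < e / 8"
      using b[unfolded continuous_on_iff, rule_format, OF y0, of "e / 8"] e by auto
    show ?thesis
    proof (intro exI[of _ "min d1 d2"] conjI ballI impI)
      show "min d1 d2 > 0" using d1 d2 by simp
      fix y t assume y: "y \<in> B" "dist y y0 < min d1 d2" and t: "t \<in> {0..1::real}"
      have yX: "y \<in> X \<inter> B" using y d1(2) by (auto simp: dist_commute)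
      \<comment> \<open>Two contributions of \<open>e / 8\<close>, from b and from the right-hand
        side, are doubled by the factor \<open>1 / (1 - 1 / 2)\<close>; the total
        \<open>e / 2\<close> is below e.\<close>
      have "norm (z t y - z t y0) \<le> (e / 4) / (1 - 1 / 2)"
      proof (rule integral_gronwall[where u="\<lambda>t. z t y - z t y0", OF _ _ _ _ t])
        show "continuous_on {0..1} (\<lambda>t. z t y - z t y0)" by (intro continuous_on_diff zc y y0)
        fix t :: real assume t: "t \<in> {0..1}"
        note i = integrable_continuous_interval[OF fc[OF t y(1) y(1)]]
          integrable_continuous_interval[OF fc[OF t y0 y0]]
        have zci: "continuous_on {0..t} (\<lambda>s. 1 / 2 * norm (z s y - z s y0))"
          using t by (intro continuous_intros continuous_on_subset[OF zc] y y0) auto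
        have "norm (integral {0..t} (\<lambda>s. f s (y, z s y)) - integral {0..t} (\<lambda>s. f s (y0, z s y0)))
            = norm (integral {0..t} (\<lambda>s. f s (y, z s y) - f s (y0, z s y0)))"
          using i by (simp add: integral_diff)
        also have "\<dots> \<le> integral {0..t} (\<lambda>s. e / 8 + 1 / 2 * norm (z s y - z s y0))"
        proof (rule integral_norm_bound_integral)
          fix s assume "s \<in> {0..t}"
          hence s: "s \<in> {0..1}" using t by auto
          have "f s (y, z s y) - f s (y0, z s y0)
            = (f s (y, z s y0) - f s (y0, z s y0)) + (f s (y, z s y) - f s (y, z s y0))" by simp
          also have "norm \<dots> \<le> norm (f s (y, z s y0) - f s (y0, z s y0)) + norm (f s (y, z s y) - f s (y, z s y0))"
            by (rule norm_triangle_ineq)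
          also have "\<dots> \<le> e / 8 + norm (z s y - z s y0) / 2"
            using X(3)[OF yX s] lip[OF s y(1) zZ[OF s y(1)] zZ[OF s y0]] by (simp add: dist_norm)
          finally show "norm (f s (y, z s y) - f s (y0, z s y0)) \<le> e / 8 + 1 / 2 * norm (z s y - z s y0)" by simp
        next
          show "(\<lambda>s. f s (y, z s y) - f s (y0, z s y0)) integrable_on {0..t}" by (rule integrable_diff[OF i])
          show "(\<lambda>s. e / 8 + 1 / 2 * norm (z s y - z s y0)) integrable_on {0..t}"
            by (rule integrable_continuous_interval[OF continuous_on_add[OF continuous_on_const zci]])
        qed
        also have "\<dots> = e / 8 * t + integral {0..t} (\<lambda>s. 1 / 2 * norm (z s y - z s y0))"
          using t by (subst integral_add[OF integrable_const_ivl integrable_continuous_interval[OF zci]]) simp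
        also have "\<dots> \<le> e / 8 * 1 + integral {0..t} (\<lambda>s. 1 / 2 * norm (z s y - z s y0))"
          using t e by (intro add_right_mono mult_left_mono) auto
        finally have 1: "norm (integral {0..t} (\<lambda>s. f s (y, z s y)) - integral {0..t} (\<lambda>s. f s (y0, z s y0)))
          \<le> e / 8 + integral {0..t} (\<lambda>s. 1 / 2 * norm (z s y - z s y0))" by simp
        have "norm (z t y - z t y0) \<le> norm (b y - b y0)
          + norm (integral {0..t} (\<lambda>s. f s (y, z s y)) - integral {0..t} (\<lambda>s. f s (y0, z s y0)))"
          unfolding eq[OF t y(1)] eq[OF t y0] by (rule norm_diff_triangle_ineq)
        also have "norm (b y - b y0) \<le> e / 8" using d2(2)[OF y(1)] y(2) by (simp add: dist_norm)
        finally show "norm (z t y - z t y0) \<le> e / 4 + integral {0..t} (\<lambda>s. 1 / 2 * norm (z s y - z s y0))"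
          using 1 by simp
      qed auto
      thus "norm (z t y - z t y0) < e" using e by simp
    qed
  qed
  show ?thesis
    unfolding continuous_on_iff
  proof (intro ballI allI impI)
    fix q :: "real \<times> 'p" and e :: real assume q: "q \<in> {0..1} \<times> B" and e: "0 < e"
    obtain t0 y0 where q0: "q = (t0, y0)" "t0 \<in> {0..1}" "y0 \<in> B" using q by auto
    obtain d1 where d1: "d1 > 0" "\<And>y t. y \<in> B \<Longrightarrow> dist y y0 < d1 \<Longrightarrow> t \<in> {0..1} \<Longrightarrow> norm (z t y - z t y0) < e / 2"
      using uniform[OF q0(3), of "e / 2"] e by auto
    obtain d2 where d2: "d2 > 0" "\<And>t. t \<in> {0..1} \<Longrightarrow> dist t t0 < d2 \<Longrightarrow> dist (z t y0) (z t0 y0) < e / 2"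
      using zc[OF q0(3), unfolded continuous_on_iff, rule_format, OF q0(2), of "e / 2"] e by auto
    show "\<exists>d>0. \<forall>x'\<in>{0..1} \<times> B. dist x' q < d \<longrightarrow> dist (z (fst x') (snd x')) (z (fst q) (snd q)) < e"
    proof (intro exI[of _ "min d1 d2"] conjI ballI impI)
      show "min d1 d2 > 0" using d1 d2 by simp
      fix p assume p: "p \<in> {0..1} \<times> B" "dist p q < min d1 d2"
      have f1: "fst p \<in> {0..1}" and f2: "snd p \<in> B" using p(1) by auto
      have "dist (snd p) y0 < d1" "dist (fst p) t0 < d2"
        using p(2) dist_snd_le[of p q] dist_fst_le[of p q] q0(1) by auto
      from d1(2)[OF f2 this(1) f1] d2(2)[OF f1 this(2)]
      show "dist (z (fst p) (snd p)) (z (fst q) (snd q)) < e"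
        using dist_triangle[of "z (fst p) (snd p)" "z t0 y0" "z (fst p) y0"]
        by (simp add: q0(1) dist_norm)
    qed
  qed
qed

text \<open>Carries a Lipschitz bound along one direction over to the derivative in that direction.
  In this way the constant 1/2 in the unknown passes to the equation of first variation.\<close>

lemma fd_norm_le_of_lipschitz:
  fixes g :: "'a::real_normed_vector \<Rightarrow> 'b::real_normed_vector"
  assumes g: "g differentiable (at x)" and "open S" "x \<in> S"
    and lip: "\<And>h. x + h *\<^sub>R w \<in> S \<Longrightarrow> norm (g (x + h *\<^sub>R w) - g x) \<le> c * norm (h *\<^sub>R w)"
  shows "norm (fd g x w) \<le> c * norm w"
proof -
  have bl: "bounded_linear (fd g x)" and
    alt: "\<And>e. e > 0 \<Longrightarrow> \<exists>d>0. \<forall>y. norm (y - x) < d \<longrightarrow> norm (g y - g x - fd g x (y - x)) \<le> e * norm (y - x)"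
    using g[unfolded frechet_derivative_works] unfolding has_derivative_at_alt by auto
  obtain r where r: "r > 0" "ball x r \<subseteq> S" using assms(2,3) open_contains_ball by blast
  have "norm (fd g x w) \<le> (c + e) * norm w" if e: "e > 0" for e
  proof (cases "w = 0")
    case True thus ?thesis using linear_0[OF bounded_linear.linear[OF bl]] by simp
  next
    case False
    obtain d where d: "d > 0" "\<And>y. norm (y - x) < d \<Longrightarrow> norm (g y - g x - fd g x (y - x)) \<le> e * norm (y - x)"
      using alt[OF e] by blast
    define h where "h = min d r / (2 * norm w)"
    have h: "h > 0" "h * norm w < d" "h * norm w < r" using False d(1) r(1) by (auto simp: h_def)
    have "x + h *\<^sub>R w \<in> S" using r(2) h by (intro subsetD[OF r(2)]) (simp add: dist_norm)
    from lip[OF this] have 1: "norm (g (x + h *\<^sub>R w) - g x) \<le> c * (h * norm w)" using h(1) by simp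
    have 2: "norm (g (x + h *\<^sub>R w) - g x - fd g x (h *\<^sub>R w)) \<le> e * (h * norm w)"
      using d(2)[of "x + h *\<^sub>R w"] h by simp
    have "h * norm (fd g x w) = norm (fd g x (h *\<^sub>R w))"
      using linear_scale[OF bounded_linear.linear[OF bl]] h(1) by simp
    also have "\<dots> = norm ((g (x + h *\<^sub>R w) - g x) - (g (x + h *\<^sub>R w) - g x - fd g x (h *\<^sub>R w)))" by simp
    also have "\<dots> \<le> c * (h * norm w) + e * (h * norm w)"
      using norm_triangle_ineq4 1 2 by (meson add_mono order_trans)
    finally have "h * norm (fd g x w) \<le> h * ((c + e) * norm w)" by (simp add: algebra_simps)
    thus ?thesis using h(1) by simp
  qed
  note * = this
  show ?thesis
  proof (rule field_le_epsilon)
    fix e :: real assume "e > 0"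
    hence "norm (fd g x w) \<le> (c + e / (norm w + 1)) * norm w" by (intro *) (simp add: add_nonneg_pos)
    also have "\<dots> = c * norm w + e * (norm w / (norm w + 1))" by (simp add: algebra_simps)
    also have "\<dots> \<le> c * norm w + e * 1" using \<open>e > 0\<close>
      by (intro add_left_mono mult_left_mono divide_le_eq_1_pos[THEN iffD2]) (auto simp: add_nonneg_pos)
    finally show "norm (fd g x w) \<le> c * norm w + e" by simp
  qed
qed


text \<open>First order expansion of \<open>f s\<close> at the moving point \<open>q0 s\<close> with
  a remainder uniform in time: the derivative is uniformly continuous on a compact tube around the
  curve.\<close>

lemma uniform_linearization:
  fixes f :: "real \<Rightarrow> 'q::euclidean_space \<Rightarrow> 'e::euclidean_space"
  assumes f: "time_Ck_on (Suc 0) Q f" and Q: "open Q" and q0: "continuous_on {0..1} q0" "\<And>s. s \<in> {0..1} \<Longrightarrow> q0 s \<in> Q"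
    and e: "e > 0"
  obtains d where "d > 0" "\<And>s q. s \<in> {0..1} \<Longrightarrow> norm (q - q0 s) < d \<Longrightarrow> q \<in> Q \<and>
    norm (f s q - f s (q0 s) - fd (f s) (q0 s) (q - q0 s)) \<le> e * norm (q - q0 s)"
proof -
  note D = time_Ck_on_SucE[OF f]
  have K: "compact (q0 ` {0..1})" using q0(1) by (intro compact_continuous_image) auto
  obtain r where r: "r > 0" "(\<Union>x\<in>q0 ` {0..1}. ball x r) \<subseteq> Q"
    using compact_subset_open_imp_ball_epsilon_subset[OF K Q] q0(2) by blast
  define C where "C = (\<Union>x\<in>q0 ` {0..1}. cball x (r / 2))"
  have C: "compact C" unfolding C_def by (rule compact_minkowski_sum_cball[OF K])
  have CQ: "C \<subseteq> Q"
  proof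
    fix q assume "q \<in> C"
    then obtain s where s: "s \<in> {0..1}" "dist (q0 s) q \<le> r / 2" by (auto simp: C_def)
    hence "q \<in> ball (q0 s) r" using r(1) by simp
    thus "q \<in> Q" using r(2) s(1) by blast
  qed
  define H where "H p = Blinfun (fd (f (fst p)) (snd p))" for p
  have bl: "bounded_linear (fd (f s) q)" if "s \<in> {0..1}" "q \<in> Q" for s q
    using D(1)[OF that] by (rule has_derivative_bounded_linear)
  have H: "blinfun_apply (H (s, q)) = fd (f s) q" if "s \<in> {0..1}" "q \<in> Q" for s q
    unfolding H_def using bounded_linear_Blinfun_apply[OF bl[OF that]] by simp
  have "continuous_on ({0..1} \<times> C) H"
  proof (rule continuous_on_blinfun_componentwise)
    fix i :: 'q
    have "continuous_on ({0..1} \<times> C) (\<lambda>p. fd (f (fst p)) (snd p) i)"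
      by (rule continuous_on_subset[OF time_Ck_on_continuous[OF D(2)[of i]]]) (use CQ in auto)
    thus "continuous_on ({0..1} \<times> C) (\<lambda>p. blinfun_apply (H p) i)"
    proof (rule continuous_on_cong[THEN iffD1, OF refl, rotated])
      fix p :: "real \<times> 'q" assume "p \<in> {0..1} \<times> C"
      thus "fd (f (fst p)) (snd p) i = blinfun_apply (H p) i"
        using H[of "fst p" "snd p"] CQ by auto
    qed
  qed
  hence "uniformly_continuous_on ({0..1} \<times> C) H"
    using C by (intro compact_uniformly_continuous compact_Times) auto
  then obtain d1 where d1: "d1 > 0" "\<And>p p'. p \<in> {0..1} \<times> C \<Longrightarrow> p' \<in> {0..1} \<times> C \<Longrightarrow> dist p' p < d1 \<Longrightarrow> dist (H p') (H p) < e"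
    unfolding uniformly_continuous_on_def using e by metis
  show ?thesis
  proof (rule that[of "min d1 (r / 2)"])
    show "min d1 (r / 2) > 0" using d1(1) r(1) by simp
    fix s q assume s: "s \<in> {0..1::real}" and q: "norm (q - q0 s) < min d1 (r / 2)"
    let ?S = "ball (q0 s) (min d1 (r / 2))"
    have SC: "x \<in> C" if "x \<in> ?S" for x
      using that s unfolding C_def by (intro UN_I[of "q0 s"]) auto
    hence SQ: "x \<in> Q" if "x \<in> ?S" for x using that CQ by blast
    have qS: "q \<in> ?S" using q by (simp add: dist_norm norm_minus_commute)
    have cS: "q0 s \<in> ?S" using d1(1) r(1) by simp
    have "norm (f s q - f s (q0 s) - fd (f s) (q0 s) (q - q0 s)) \<le> norm (q - q0 s) * e"
    proof (rule differentiable_bound_linearization[where S="?S"])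
      fix t :: real assume "t \<in> {0..1}"
      thus "q0 s + t *\<^sub>R (q - q0 s) \<in> ?S"
        using convexD_alt[OF convex_ball cS qS, of t] by (simp add: algebra_simps)
    next
      show "(f s has_derivative fd (f s) x) (at x within ?S)" if "x \<in> ?S" for x
        by (rule has_derivative_at_withinI[OF D(1)[OF s SQ[OF that]]])
    next
      fix x assume x: "x \<in> ?S"
      have "dist (H (s, x)) (H (s, q0 s)) < e"
        by (rule d1(2)) (use s SC[OF x] SC[OF cS] x in \<open>auto simp: dist_Pair_Pair dist_commute\<close>)
      hence "norm (H (s, x) - H (s, q0 s)) \<le> e" by (simp add: dist_norm)
      thus "onorm (fd (f s) x - fd (f s) (q0 s)) \<le> e"
        using H[OF s SQ[OF x]] H[OF s SQ[OF cS]]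
        by (simp add: norm_blinfun.rep_eq minus_blinfun.rep_eq fun_diff_def)
    qed (rule cS)
    thus "q \<in> Q \<and> norm (f s q - f s (q0 s) - fd (f s) (q0 s) (q - q0 s)) \<le> e * norm (q - q0 s)"
      using SQ[OF qS] by (simp add: mult.commute)
  qed
qed

text \<open>The candidate derivative \<open>w v\<close> solves the equation of first variation. The
  error of the linear approximation then satisfies a Gronwall inequality whose constant term is an
  arbitrarily small multiple of the displacement.\<close>

lemma integral_equation_has_derivative:
  fixes f :: "real \<Rightarrow> 'p::euclidean_space \<times> 'e::euclidean_space \<Rightarrow> 'e" and z :: "real \<Rightarrow> 'p \<Rightarrow> 'e"
  assumes B: "open B" "y0 \<in> B" and Z: "open Z" and f: "time_Ck_on (Suc 0) (B \<times> Z) f"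
    and b: "(b has_derivative b') (at y0)"
    and lip: "\<And>t y x x'. t \<in> {0..1} \<Longrightarrow> y \<in> B \<Longrightarrow> x \<in> Z \<Longrightarrow> x' \<in> Z \<Longrightarrow>
      norm (f t (y, x) - f t (y, x')) \<le> norm (x - x') / 2"
    and zc: "continuous_on ({0..1} \<times> B) (\<lambda>q. z (fst q) (snd q))"
    and zZ: "\<And>t y. t \<in> {0..1} \<Longrightarrow> y \<in> B \<Longrightarrow> z t y \<in> Z"
    and eq: "\<And>t y. t \<in> {0..1} \<Longrightarrow> y \<in> B \<Longrightarrow> z t y = b y + integral {0..t} (\<lambda>s. f s (y, z s y))"
    and wc: "\<And>v. continuous_on {0..1} (w v)"
    and weq: "\<And>v t. t \<in> {0..1} \<Longrightarrow> w v t = b' v + integral {0..t} (\<lambda>s. fd (f s) (y0, z s y0) (v, w v s))"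
    and t: "t \<in> {0..1}"
  shows "(z t has_derivative (\<lambda>v. w v t)) (at y0)"
proof -
  note D = time_Ck_on_SucE[OF f]
  define A where "A s = fd (f s) (y0, z s y0)" for s
  have BZ: "open (B \<times> Z)" using B Z by (rule_tac open_Times)
  have zcy: "continuous_on {0..1} (\<lambda>s. z s y)" if "y \<in> B" for y
    by (rule continuous_on_uncurry_compose[OF zc continuous_on_id continuous_on_const]) (use that in auto)
  have q0: "(y0, z s y0) \<in> B \<times> Z" if "s \<in> {0..1}" for s using B(2) zZ[OF that] by simp
  have linA: "linear (A s)" if "s \<in> {0..1}" for s
    unfolding A_def by (rule has_derivative_linear[OF D(1)[OF that q0[OF that]]])
  have A_le: "norm (A s (0, x)) \<le> norm x / 2" if "s \<in> {0..1}" for s x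
  proof -
    have "norm (A s (0, x)) \<le> 1 / 2 * norm ((0::'p), x)"
      unfolding A_def
    proof (rule fd_norm_le_of_lipschitz[OF _ BZ q0[OF that]])
      show "f s differentiable (at (y0, z s y0))" using D(1)[OF that q0[OF that]] by (auto simp: differentiable_def)
      fix h assume "(y0, z s y0) + h *\<^sub>R (0, x) \<in> B \<times> Z"
      thus "norm (f s ((y0, z s y0) + h *\<^sub>R (0, x)) - f s (y0, z s y0)) \<le> 1 / 2 * norm (h *\<^sub>R (0::'p, x))"
        using lip[OF that B(2), of "z s y0 + h *\<^sub>R x" "z s y0"] zZ[OF that B(2)] by (simp add: norm_Pair)
    qed
    thus ?thesis by (simp add: norm_Pair)
  qed
  have Ac: "continuous_on S (\<lambda>s. A s (g s))" if g: "continuous_on S g" "S \<subseteq> {0..1}" for g S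
  proof -
    have "A s (g s) = (\<Sum>b\<in>Basis. (g s \<bullet> b) *\<^sub>R fd (f s) (y0, z s y0) b)" if "s \<in> S" for s
    proof -
      have "s \<in> {0..1}" using that g(2) by blast
      from D(1)[OF this q0[OF this]] show ?thesis unfolding A_def
        by (intro fd_basis_expand differentiableI)
    qed
    moreover have "continuous_on S (\<lambda>s. \<Sum>b\<in>Basis. (g s \<bullet> b) *\<^sub>R fd (f s) (y0, z s y0) b)"
    proof (intro continuous_on_sum continuous_on_scaleR continuous_on_inner g(1) continuous_on_const)
      fix b
      show "continuous_on S (\<lambda>s. fd (f s) (y0, z s y0) b)"
        by (rule continuous_on_uncurry_compose[OF time_Ck_on_continuous[OF D(2)] continuous_on_id])
          (use g(2) q0 in \<open>auto intro!: continuous_on_Pair continuous_on_const continuous_on_subset[OF zcy[OF B(2)]]\<close>)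
    qed
    ultimately show ?thesis using continuous_on_cong[of S S "\<lambda>s. A s (g s)"] by simp
  qed
  have Ai: "(\<lambda>s. A s (v, g s)) integrable_on {0..t}" if "continuous_on {0..1} g" "t \<in> {0..1}" for v g t
    by (intro integrable_continuous_interval Ac continuous_on_Pair continuous_on_const)
      (use that in \<open>auto intro: continuous_on_subset\<close>)
  note weq' = weq[folded A_def]
  \<comment> \<open>Uniqueness for the homogeneous variational equation. Since \<open>w\<close> is
    given only through integral equations, the linearity of \<open>w v t\<close> in v has to be
    deduced from this.\<close>
  have zero: "u t = 0"
    if u: "continuous_on {0..1} u" "\<And>t. t \<in> {0..1} \<Longrightarrow> u t = integral {0..t} (\<lambda>s. A s (0, u s))" and t: "t \<in> {0..1}" for u t
  proof -
    have "norm (u t) \<le> 0 / (1 - 1 / 2)"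
    proof (rule integral_gronwall[OF u(1) _ _ _ t])
      fix t :: real assume t: "t \<in> {0..1}"
      have "norm (integral {0..t} (\<lambda>s. A s (0, u s))) \<le> integral {0..t} (\<lambda>s. 1 / 2 * norm (u s))"
      proof (rule integral_norm_bound_integral[OF Ai[OF u(1) t]])
        show "(\<lambda>s. 1 / 2 * norm (u s)) integrable_on {0..t}"
          using t by (intro integrable_continuous_interval continuous_intros continuous_on_subset[OF u(1)]) auto
        show "norm (A s (0, u s)) \<le> 1 / 2 * norm (u s)" if "s \<in> {0..t}" for s
          using A_le[of s "u s"] that t by auto
      qed
      thus "norm (u t) \<le> 0 + integral {0..t} (\<lambda>s. 1 / 2 * norm (u s))" using u(2)[OF t] by simp
    qed auto
    thus ?thesis by simp
  qed
  note linb = bounded_linear.linear[OF has_derivative_bounded_linear[OF b]]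
  have w_lin: "linear (\<lambda>v. w v t)" if t: "t \<in> {0..1}" for t
  proof (rule linearI)
    fix a c :: 'p and r :: real
    have "w (a + c) t - w a t - w c t = 0"
    proof (rule zero[where u="\<lambda>t. w (a + c) t - w a t - w c t", OF _ _ t])
      show "continuous_on {0..1} (\<lambda>t. w (a + c) t - w a t - w c t)" by (intro continuous_on_diff wc)
      fix t :: real assume t: "t \<in> {0..1}"
      have "integral {0..t} (\<lambda>s. A s (0, w (a + c) s - w a s - w c s))
        = integral {0..t} (\<lambda>s. A s (a + c, w (a + c) s) - A s (a, w a s) - A s (c, w c s))"
      proof (rule integral_cong)
        fix s assume "s \<in> {0..t}"
        hence l: "linear (A s)" using linA t by auto
        have "(0, w (a + c) s - w a s - w c s) = (a + c, w (a + c) s) - (a, w a s) - (c, w c s)" by simp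
        thus "A s (0, w (a + c) s - w a s - w c s) = A s (a + c, w (a + c) s) - A s (a, w a s) - A s (c, w c s)"
          by (simp only: linear_diff[OF l])
      qed
      also have "\<dots> = integral {0..t} (\<lambda>s. A s (a + c, w (a + c) s)) - integral {0..t} (\<lambda>s. A s (a, w a s))
          - integral {0..t} (\<lambda>s. A s (c, w c s))"
        by (simp add: integral_diff integrable_diff Ai[OF wc t])
      finally show "w (a + c) t - w a t - w c t = integral {0..t} (\<lambda>s. A s (0, w (a + c) s - w a s - w c s))"
        using weq'[OF t, of "a + c"] weq'[OF t, of a] weq'[OF t, of c] linear_add[OF linb, of a c] by simp
    qed
    thus "w (a + c) t = w a t + w c t" by (simp add: algebra_simps)
    have "w (r *\<^sub>R a) t - r *\<^sub>R w a t = 0"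
    proof (rule zero[where u="\<lambda>t. w (r *\<^sub>R a) t - r *\<^sub>R w a t", OF _ _ t])
      show "continuous_on {0..1} (\<lambda>t. w (r *\<^sub>R a) t - r *\<^sub>R w a t)"
        by (intro continuous_on_diff continuous_on_scaleR continuous_on_const wc)
      fix t :: real assume t: "t \<in> {0..1}"
      have "integral {0..t} (\<lambda>s. A s (0, w (r *\<^sub>R a) s - r *\<^sub>R w a s))
        = integral {0..t} (\<lambda>s. A s (r *\<^sub>R a, w (r *\<^sub>R a) s) - r *\<^sub>R A s (a, w a s))"
      proof (rule integral_cong)
        fix s assume "s \<in> {0..t}"
        hence l: "linear (A s)" using linA t by auto
        have "(0, w (r *\<^sub>R a) s - r *\<^sub>R w a s) = (r *\<^sub>R a, w (r *\<^sub>R a) s) - r *\<^sub>R (a, w a s)" by simp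
        thus "A s (0, w (r *\<^sub>R a) s - r *\<^sub>R w a s) = A s (r *\<^sub>R a, w (r *\<^sub>R a) s) - r *\<^sub>R A s (a, w a s)"
          by (simp only: linear_diff[OF l] linear_scale[OF l])
      qed
      also have "\<dots> = integral {0..t} (\<lambda>s. A s (r *\<^sub>R a, w (r *\<^sub>R a) s)) - r *\<^sub>R integral {0..t} (\<lambda>s. A s (a, w a s))"
        by (simp add: integral_diff integrable_cmul Ai[OF wc t])
      finally show "w (r *\<^sub>R a) t - r *\<^sub>R w a t = integral {0..t} (\<lambda>s. A s (0, w (r *\<^sub>R a) s - r *\<^sub>R w a s))"
        using weq'[OF t, of "r *\<^sub>R a"] weq'[OF t, of a] linear_scale[OF linb, of r a] by (simp add: algebra_simps)
    qed
    thus "w (r *\<^sub>R a) t = r *\<^sub>R w a t" by simp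
  qed
  have "\<exists>K. \<forall>t\<in>{0..1}. norm (w b t) \<le> K" for b
    using compact_imp_bounded[OF compact_continuous_image[OF wc compact_Icc]] unfolding bounded_iff by auto
  then obtain Kb where Kb: "\<And>b t. t \<in> {0..1} \<Longrightarrow> norm (w b t) \<le> Kb b" by metis
  define K where "K = (\<Sum>b\<in>Basis. \<bar>Kb b\<bar>)"
  have K0: "K \<ge> 0" unfolding K_def by (intro sum_nonneg) simp
  have K: "norm (w v t) \<le> K * norm v" if t: "t \<in> {0..1}" for v t
  proof -
    interpret linear "\<lambda>v. w v t" by (rule w_lin[OF t])
    have "w v t = w (\<Sum>b\<in>Basis. (v \<bullet> b) *\<^sub>R b) t" by (simp add: euclidean_representation)
    also have "\<dots> = (\<Sum>b\<in>Basis. (v \<bullet> b) *\<^sub>R w b t)" by (simp only: sum scaleR)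
    also have "norm \<dots> \<le> (\<Sum>b\<in>Basis. norm v * \<bar>Kb b\<bar>)"
    proof (rule sum_norm_le)
      fix b :: 'p assume "b \<in> Basis"
      have "\<bar>v \<bullet> b\<bar> * norm (w b t) \<le> norm v * \<bar>Kb b\<bar>"
        using Kb[OF t, of b] Basis_le_norm[OF \<open>b \<in> Basis\<close>, of v] by (intro mult_mono) auto
      thus "norm ((v \<bullet> b) *\<^sub>R w b t) \<le> norm v * \<bar>Kb b\<bar>" by simp
    qed
    finally show ?thesis by (simp add: K_def sum_distrib_left mult.commute)
  qed
  show ?thesis
    unfolding has_derivative_at_alt
  proof (intro conjI allI impI)
    show "bounded_linear (\<lambda>v. w v t)" using w_lin[OF t] by (simp add: linear_conv_bounded_linear)
    fix e :: real assume e: "e > 0"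
    \<comment> \<open>The bound 1/4 keeps the Gronwall coefficient at 1/4 + 1/2 = 3/4, so the final
      division costs a factor 4. The sum \<open>2 + K\<close> collects \<open>e1\<close> from the
      initial value and \<open>e1 * (1 + K)\<close> from the remainder of f.\<close>
    define e1 where "e1 = min (1 / 4) (e / (4 * (2 + K)))"
    have e1: "e1 > 0" "e1 \<le> 1 / 4" "4 * (e1 * (2 + K)) \<le> e"
    proof -
      show "e1 > 0" using e K0 by (simp add: e1_def)
      show "e1 \<le> 1 / 4" unfolding e1_def by (rule min.cobounded1)
      have "e1 \<le> e / (4 * (2 + K))" by (simp add: e1_def)
      thus "4 * (e1 * (2 + K)) \<le> e" using K0 by (simp add: field_simps)
    qed
    have q0c: "continuous_on {0..1} (\<lambda>s. (y0, z s y0))" by (intro continuous_on_Pair continuous_on_const zcy B)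
    obtain d1 where d1: "d1 > 0" "\<And>s q. s \<in> {0..1} \<Longrightarrow> norm (q - (y0, z s y0)) < d1 \<Longrightarrow> q \<in> B \<times> Z \<and>
        norm (f s q - f s (y0, z s y0) - fd (f s) (y0, z s y0) (q - (y0, z s y0))) \<le> e1 * norm (q - (y0, z s y0))"
      using uniform_linearization[OF f BZ q0c q0 e1(1)] by blast
    \<comment> \<open>The solution for y stays close to that for \<open>y0\<close> at all times
      simultaneously, which brings it into the range of the uniform linearization.\<close>
    have "continuous_on (B \<times> {0..1}) (\<lambda>(y, s). z s y)"
      unfolding split_def
      by (rule continuous_on_uncurry_compose[OF zc]) (auto intro: continuous_on_fst continuous_on_snd continuous_on_id)
    then obtain X where X: "y0 \<in> X" "open X" "\<And>y s. y \<in> X \<inter> B \<Longrightarrow> s \<in> {0..1} \<Longrightarrow> dist (z s y) (z s y0) \<le> d1 / 4"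
      using continuous_on_prod_compactE[OF _ compact_Icc B(2), of 0 1 "\<lambda>(y, s). z s y" "d1 / 4"] d1(1)
      unfolding split_def fst_conv snd_conv by (metis divide_pos_pos zero_less_numeral)
    obtain d2 where d2: "d2 > 0" "ball y0 d2 \<subseteq> X \<inter> B"
      using X B open_contains_ball[of "X \<inter> B"] by (metis IntI open_Int)
    obtain d3 where d3: "d3 > 0" "\<And>y. norm (y - y0) < d3 \<Longrightarrow> norm (b y - b y0 - b' (y - y0)) \<le> e1 * norm (y - y0)"
      using b e1(1) unfolding has_derivative_at_alt by blast
    show "\<exists>d>0. \<forall>y. norm (y - y0) < d \<longrightarrow> norm (z t y - z t y0 - w (y - y0) t) \<le> e * norm (y - y0)"
    proof (intro exI[of _ "min (d1 / 2) (min d2 d3)"] conjI allI impI)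
      show "min (d1 / 2) (min d2 d3) > 0" using d1 d2 d3 by simp
      fix y assume y: "norm (y - y0) < min (d1 / 2) (min d2 d3)"
      define h where "h = y - y0"
      define \<rho> where "\<rho> s = z s y - z s y0 - w h s" for s
      have "y \<in> ball y0 d2" using y by (simp add: dist_norm norm_minus_commute)
      hence yB: "y \<in> X \<inter> B" using d2 by blast
      have \<rho>c: "continuous_on {0..1} \<rho>" unfolding \<rho>_def by (intro continuous_on_diff wc zcy B) (use yB in simp)
      have "norm (\<rho> t) \<le> (e1 * (2 + K) * norm h) / (1 - 3 / 4)"
      proof (rule integral_gronwall[OF \<rho>c _ _ _ t])
        fix t :: real assume t: "t \<in> {0..1}"
        have fc: "(\<lambda>s. f s (y, z s y)) integrable_on {0..t}" if "y \<in> B" for y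
          by (intro integrable_continuous_interval continuous_on_uncurry_compose[OF time_Ck_on_continuous[OF f] continuous_on_id]
              continuous_on_Pair continuous_on_const continuous_on_subset[OF zcy]) (use that t zZ in auto)
        note i = fc[OF B(2)] fc[of y] Ai[OF wc t, of h h]
        have "\<rho> t = (b y - b y0 - b' h) + (integral {0..t} (\<lambda>s. f s (y, z s y)) - integral {0..t} (\<lambda>s. f s (y0, z s y0))
             - integral {0..t} (\<lambda>s. A s (h, w h s)))"
          using eq[OF t, of y] eq[OF t B(2)] weq'[OF t, of h] yB by (simp add: \<rho>_def)
        also have "\<dots> = (b y - b y0 - b' h) + integral {0..t} (\<lambda>s. f s (y, z s y) - f s (y0, z s y0) - A s (h, w h s))"
          using i yB by (simp add: integral_diff integrable_diff)
        finally have "norm (\<rho> t) \<le> norm (b y - b y0 - b' h)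
            + norm (integral {0..t} (\<lambda>s. f s (y, z s y) - f s (y0, z s y0) - A s (h, w h s)))"
          by (simp add: norm_triangle_ineq)
        also have "norm (b y - b y0 - b' h) \<le> e1 * norm h" using d3(2)[of y] y by (simp add: h_def)
        also have "norm (integral {0..t} (\<lambda>s. f s (y, z s y) - f s (y0, z s y0) - A s (h, w h s)))
            \<le> integral {0..t} (\<lambda>s. e1 * (1 + K) * norm h + 3 / 4 * norm (\<rho> s))"
        proof (rule integral_norm_bound_integral)
          show "(\<lambda>s. f s (y, z s y) - f s (y0, z s y0) - A s (h, w h s)) integrable_on {0..t}"
            using i yB by (intro integrable_diff) auto
          show "(\<lambda>s. e1 * (1 + K) * norm h + 3 / 4 * norm (\<rho> s)) integrable_on {0..t}"
            using t by (intro integrable_continuous_interval continuous_intros continuous_on_subset[OF \<rho>c]) auto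
          fix s assume "s \<in> {0..t}"
          hence s: "s \<in> {0..1}" using t by auto
          let ?q = "(y, z s y)" and ?p = "(y0, z s y0)"
          have qq: "?q - ?p = (h, w h s) + (0, \<rho> s)"
            by (simp add: h_def \<rho>_def)
          have "norm (?q - ?p) \<le> norm h + norm (z s y - z s y0)"
            using norm_Pair_le[of h "z s y - z s y0"] by (simp add: h_def)
          also have "\<dots> < d1 / 2 + d1 / 2"
            using X(3)[OF yB s] y d1(1) by (simp add: h_def dist_norm)
          finally have R: "norm (f s ?q - f s ?p - A s (?q - ?p)) \<le> e1 * norm (?q - ?p)"
            using d1(2)[OF s, of ?q] by (simp add: A_def)
          have "norm (?q - ?p) \<le> norm (h, w h s) + norm ((0::'p), \<rho> s)"
            unfolding qq by (rule norm_triangle_ineq)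
          also have "\<dots> \<le> norm h + K * norm h + norm (\<rho> s)"
            using norm_Pair_le[of h "w h s"] K[OF s, of h] by (simp add: norm_Pair)
          finally have n: "norm (?q - ?p) \<le> norm h + K * norm h + norm (\<rho> s)" .
          have Aq: "A s (?q - ?p) = A s (h, w h s) + A s (0, \<rho> s)"
            by (simp only: qq linear_add[OF linA[OF s]])
          have "f s ?q - f s ?p - A s (h, w h s) = (f s ?q - f s ?p - A s (?q - ?p)) + A s (0, \<rho> s)"
            unfolding Aq by simp
          hence "norm (f s ?q - f s ?p - A s (h, w h s)) \<le> norm (f s ?q - f s ?p - A s (?q - ?p)) + norm (A s (0, \<rho> s))"
            by (simp only: norm_triangle_ineq)
          also have "\<dots> \<le> e1 * norm (?q - ?p) + norm (\<rho> s) / 2" using R A_le[OF s] by (rule add_mono)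
          also have "\<dots> \<le> e1 * (norm h + K * norm h + norm (\<rho> s)) + norm (\<rho> s) / 2"
            using n e1(1) by (intro add_right_mono mult_left_mono) auto
          also have "\<dots> = e1 * (1 + K) * norm h + (e1 * norm (\<rho> s) + norm (\<rho> s) / 2)" by (simp add: algebra_simps)
          also have "\<dots> \<le> e1 * (1 + K) * norm h + (1 / 4 * norm (\<rho> s) + norm (\<rho> s) / 2)"
            using e1(2) by (intro add_left_mono add_right_mono mult_right_mono) auto
          finally show "norm (f s ?q - f s ?p - A s (h, w h s)) \<le> e1 * (1 + K) * norm h + 3 / 4 * norm (\<rho> s)"
            by simp
        qed
        also have "\<dots> = e1 * (1 + K) * norm h * t + integral {0..t} (\<lambda>s. 3 / 4 * norm (\<rho> s))"
          using t by (subst integral_add) (auto intro!: integrable_continuous_interval continuous_intros continuous_on_subset[OF \<rho>c])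
        also have "\<dots> \<le> e1 * (1 + K) * norm h * 1 + integral {0..t} (\<lambda>s. 3 / 4 * norm (\<rho> s))"
          using t e1(1) K0 by (intro add_right_mono mult_left_mono) auto
        finally show "norm (\<rho> t) \<le> e1 * (2 + K) * norm h + integral {0..t} (\<lambda>s. 3 / 4 * norm (\<rho> s))"
          by (simp add: algebra_simps)
      qed auto
      also have "\<dots> = 4 * (e1 * (2 + K)) * norm h" by simp
      also have "\<dots> \<le> e * norm h" using e1(3) by (rule mult_right_mono) simp
      finally show "norm (z t y - z t y0 - w (y - y0) t) \<le> e * norm (y - y0)" by (simp add: \<rho>_def h_def)
    qed
  qed
qed

text \<open>Bounds the coefficient of the unknown in the equation of first variation by the
  Lipschitz constant of f, so that this equation too is solvable over the whole unit
  interval.\<close>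

lemma lipschitz_fd_snd_le:
  fixes f :: "real \<Rightarrow> 'p::euclidean_space \<times> 'e::euclidean_space \<Rightarrow> 'e"
  assumes "open B" "open Z" and f: "time_Ck_on (Suc 0) (B \<times> Z) f"
    and lip: "\<And>t y x x'. t \<in> {0..1} \<Longrightarrow> y \<in> B \<Longrightarrow> x \<in> Z \<Longrightarrow> x' \<in> Z \<Longrightarrow>
      norm (f t (y, x) - f t (y, x')) \<le> norm (x - x') / 2"
    and t: "t \<in> {0..1}" and y: "y \<in> B" and z: "z \<in> Z"
  shows "norm (fd (f t) (y, z) (0, x)) \<le> norm x / 2"
proof -
  have q: "(y, z) \<in> B \<times> Z" using y z by simp
  have "norm (fd (f t) (y, z) (0, x)) \<le> 1 / 2 * norm ((0::'p), x)"
  proof (rule fd_norm_le_of_lipschitz[OF _ open_Times[OF assms(1,2)] q])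
    show "f t differentiable (at (y, z))" using time_Ck_on_SucE(1)[OF f t q] by (auto simp: differentiable_def)
    fix h assume "(y, z) + h *\<^sub>R (0, x) \<in> B \<times> Z"
    thus "norm (f t ((y, z) + h *\<^sub>R (0, x)) - f t (y, z)) \<le> 1 / 2 * norm (h *\<^sub>R (0::'p, x))"
      using lip[OF t y, of "z + h *\<^sub>R x" z] z by (simp add: norm_Pair)
  qed
  thus ?thesis by (simp add: norm_Pair)
qed

text \<open>Right-hand side of the equation of first variation along z in direction v. Parameter and
  unknown form one pair, so that it has the same type as the right-hand side f it comes
  from.\<close>

definition variation_rhs :: "(real \<Rightarrow> 'p::euclidean_space \<times> 'e::euclidean_space \<Rightarrow> 'e) \<Rightarrow> (real \<Rightarrow> 'p \<Rightarrow> 'e) \<Rightarrow> 'p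
    \<Rightarrow> real \<Rightarrow> 'p \<times> 'e \<Rightarrow> 'e" where
  "variation_rhs f z v t p = fd (f t) (fst p, z t (fst p)) (v, snd p)"

text \<open>Exactly one order is lost: z is of order k and so are the first derivatives of f. The
  direction \<open>(v, snd p)\<close> moves and is expanded in a basis.\<close>

lemma time_Ck_on_variation_rhs:
  fixes f :: "real \<Rightarrow> 'p::euclidean_space \<times> 'e::euclidean_space \<Rightarrow> 'e"
  assumes "open B" "open Z" and f: "time_Ck_on (Suc k) (B \<times> Z) f" and z: "time_Ck_on k B z"
    and zZ: "\<And>t y. t \<in> {0..1} \<Longrightarrow> y \<in> B \<Longrightarrow> z t y \<in> Z"
  shows "time_Ck_on k (B \<times> UNIV) (variation_rhs f z v)"
proof -
  have o: "open (B \<times> (UNIV :: 'e set))" using assms(1) by (intro open_Times) auto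
  note D = time_Ck_on_SucE[OF f]
  have fst: "time_Ck_on k (B \<times> UNIV) (\<lambda>t (p::'p \<times> 'e). fst p)" and snd: "time_Ck_on k (B \<times> UNIV) (\<lambda>t (p::'p \<times> 'e). snd p)"
    using time_Ck_on_const[OF o Ck_on_bounded_linear[OF o bounded_linear_fst]]
      time_Ck_on_const[OF o Ck_on_bounded_linear[OF o bounded_linear_snd]] by auto
  have g: "time_Ck_on k (B \<times> UNIV) (\<lambda>t (p::'p \<times> 'e). (fst p, z t (fst p)))"
    by (intro time_Ck_on_Pair[OF o] fst time_Ck_on_compose[OF o z fst]) auto
  have "time_Ck_on k (B \<times> UNIV)
    (\<lambda>t p. \<Sum>b\<in>Basis. ((v, snd p) \<bullet> b) *\<^sub>R fd (f t) (fst p, z t (fst p)) b)"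
    by (intro time_Ck_on_sum[OF o] time_Ck_on_bilinear[OF bounded_bilinear_scaleR o]
        time_Ck_on_bl_comp[OF o bounded_linear_inner_left] time_Ck_on_Pair[OF o]
        time_Ck_on_const[OF o Ck_on_const] snd time_Ck_on_compose[OF o D(2) g]) (use zZ in auto)
  moreover have "variation_rhs f z v t p = (\<Sum>b\<in>Basis. ((v, snd p) \<bullet> b) *\<^sub>R fd (f t) (fst p, z t (fst p)) b)"
    if "t \<in> {0..1}" "p \<in> B \<times> UNIV" for t p
  proof -
    have "(fst p, z t (fst p)) \<in> B \<times> Z" using that zZ by auto
    from D(1)[OF that(1) this] show ?thesis
      unfolding variation_rhs_def by (intro fd_basis_expand differentiableI)
  qed
  ultimately show ?thesis using time_Ck_on_cong[OF o, of "variation_rhs f z v"] by simp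
qed

text \<open>The equation of first variation is solved first. It is affine in the unknown with
  Lipschitz constant 1/2, so the whole space can be taken for \<open>Z\<close>; its solution is then
  recognized as the derivative of z.\<close>

lemma integral_equation_variation:
  fixes f :: "real \<Rightarrow> 'p::euclidean_space \<times> 'e::euclidean_space \<Rightarrow> 'e" and z :: "real \<Rightarrow> 'p \<Rightarrow> 'e"
  assumes B: "open B" and Z: "open Z" and f: "time_Ck_on (Suc 0) (B \<times> Z) f" and b: "Ck_on (Suc 0) B b"
    and lip: "\<And>t y x x'. t \<in> {0..1} \<Longrightarrow> y \<in> B \<Longrightarrow> x \<in> Z \<Longrightarrow> x' \<in> Z \<Longrightarrow>
      norm (f t (y, x) - f t (y, x')) \<le> norm (x - x') / 2"
    and zc: "\<And>y. y \<in> B \<Longrightarrow> continuous_on {0..1} (\<lambda>t. z t y)"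
    and zZ: "\<And>t y. t \<in> {0..1} \<Longrightarrow> y \<in> B \<Longrightarrow> z t y \<in> Z"
    and eq: "\<And>t y. t \<in> {0..1} \<Longrightarrow> y \<in> B \<Longrightarrow> z t y = b y + integral {0..t} (\<lambda>s. f s (y, z s y))"
    and y: "y \<in> B"
  shows "t \<in> {0..1} \<Longrightarrow> (z t has_derivative fd (z t) y) (at y)"
    "continuous_on {0..1} (\<lambda>t. fd (z t) y v)"
    "t \<in> {0..1} \<Longrightarrow> fd (z t) y v = fd b y v + integral {0..t} (\<lambda>s. variation_rhs f z v s (y, fd (z s) y v))"
proof -
  have joint: "continuous_on ({0..1} \<times> B) (\<lambda>q. z (fst q) (snd q))"
    by (rule integral_equation_jointly_continuous[OF time_Ck_on_continuous[OF f] Ck_on_imp_continuous_on[OF b] lip zc zZ eq])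
  have z0: "time_Ck_on 0 B z" using joint by simp
  have "\<exists>w. continuous_on {0..1} w \<and> (\<forall>t\<in>{0..1}. w t = fd b y v + integral {0..t} (\<lambda>s. variation_rhs f z v s (y, w s)))" for v
  proof -
    have lin: "linear (fd (f t) (y, z t y))" if "t \<in> {0..1}" for t
      by (rule has_derivative_linear[OF time_Ck_on_SucE(1)[OF f that]]) (use that zZ y in auto)
    have l: "norm (variation_rhs f z v t (y, x) - variation_rhs f z v t (y, x')) \<le> norm (x - x') / 2"
      if "t \<in> {0..1}" for t x x'
    proof -
      have "variation_rhs f z v t (y, x) - variation_rhs f z v t (y, x') = fd (f t) (y, z t y) (0, x - x')"
        unfolding variation_rhs_def fst_conv snd_conv linear_diff[OF lin[OF that], symmetric] by simp
      thus ?thesis using lipschitz_fd_snd_le[OF B Z f lip that y zZ[OF that y]] by simp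
    qed
    have c: "continuous_on ({0..1} \<times> UNIV) (\<lambda>q. variation_rhs f z v (fst q) (y, snd q))"
      by (rule continuous_on_uncurry_compose[OF time_Ck_on_continuous[OF time_Ck_on_variation_rhs[OF B Z f z0 zZ]]])
        (use y in \<open>auto intro!: continuous_on_Pair continuous_on_fst continuous_on_snd continuous_on_id continuous_on_const\<close>)
    obtain w where "continuous_on {0..1} w"
      "\<And>t. t \<in> {0..1} \<Longrightarrow> w t = fd b y v + integral {0..t} (\<lambda>s. variation_rhs f z v s (y, w s))"
      by (rule integral_equation_exists[of UNIV "\<lambda>t x. variation_rhs f z v t (y, x)" "fd b y v", OF c]) (use l in auto)
    thus ?thesis by blast
  qed
  then obtain w where w: "\<And>v. continuous_on {0..1} (w v)"
    "\<And>v t. t \<in> {0..1} \<Longrightarrow> w v t = fd b y v + integral {0..t} (\<lambda>s. variation_rhs f z v s (y, w v s))"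
    by metis
  note w2 = w(2)[unfolded variation_rhs_def fst_conv snd_conv]
  have d: "(z t has_derivative (\<lambda>v. w v t)) (at y)" if "t \<in> {0..1}" for t
    by (rule integral_equation_has_derivative[OF B y Z f Ck_on_SucE(1)[OF b y] lip joint zZ eq w(1) w2 that])
  have e: "fd (z t) y = (\<lambda>v. w v t)" if "t \<in> {0..1}" for t by (rule fd_eqI[OF d[OF that]])
  show "(z t has_derivative fd (z t) y) (at y)" if "t \<in> {0..1}" using d[OF that] e[OF that] by simp
  show "continuous_on {0..1} (\<lambda>t. fd (z t) y v)"
    by (rule continuous_on_cong[THEN iffD1, OF refl _ w(1)[of v]]) (simp add: e)
  show "fd (z t) y v = fd b y v + integral {0..t} (\<lambda>s. variation_rhs f z v s (y, fd (z s) y v))" if t: "t \<in> {0..1}"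
  proof -
    have "integral {0..t} (\<lambda>s. variation_rhs f z v s (y, fd (z s) y v)) = integral {0..t} (\<lambda>s. variation_rhs f z v s (y, w v s))"
      by (rule integral_cong) (use t e in auto)
    thus ?thesis using w(2)[OF t, of v] e[OF t] by simp
  qed
qed

text \<open>The derivative of the solution with respect to the parameter solves an equation of the same
  kind, over the same spaces, whose right-hand side has lost one derivative.\<close>

lemma integral_equation_time_Ck:
  fixes f :: "real \<Rightarrow> 'p::euclidean_space \<times> 'e::euclidean_space \<Rightarrow> 'e" and z :: "real \<Rightarrow> 'p \<Rightarrow> 'e"
  assumes B: "open B" and "open Z" "time_Ck_on k (B \<times> Z) f" "Ck_on k B b"
    and "\<And>t y x x'. t \<in> {0..1} \<Longrightarrow> y \<in> B \<Longrightarrow> x \<in> Z \<Longrightarrow> x' \<in> Z \<Longrightarrow>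
      norm (f t (y, x) - f t (y, x')) \<le> norm (x - x') / 2"
    and "\<And>y. y \<in> B \<Longrightarrow> continuous_on {0..1} (\<lambda>t. z t y)"
    and "\<And>t y. t \<in> {0..1} \<Longrightarrow> y \<in> B \<Longrightarrow> z t y \<in> Z"
    and "\<And>t y. t \<in> {0..1} \<Longrightarrow> y \<in> B \<Longrightarrow> z t y = b y + integral {0..t} (\<lambda>s. f s (y, z s y))"
  shows "time_Ck_on k B z"
  using assms(2-)
proof (induction k arbitrary: Z f b z)
  case 0
  show ?case
    using integral_equation_jointly_continuous[OF time_Ck_on_continuous[OF 0(2)] Ck_on_imp_continuous_on[OF 0(3)] 0(4-7)]
    by simp
next
  case (Suc k)
  note Z = Suc.prems(1) and f = Suc.prems(2) and b = Suc.prems(3) and lip = Suc.prems(4)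
    and zc = Suc.prems(5) and zZ = Suc.prems(6) and eq = Suc.prems(7)
  have f1: "time_Ck_on (Suc 0) (B \<times> Z) f" and b1: "Ck_on (Suc 0) B b"
  proof -
    have "time_Ck_on (Suc j) (B \<times> Z) f \<Longrightarrow> time_Ck_on (Suc 0) (B \<times> Z) f" for j
      by (induction j) (blast dest: time_Ck_on_SucD)+
    thus "time_Ck_on (Suc 0) (B \<times> Z) f" using f by blast
    show "Ck_on (Suc 0) B b" by (rule Ck_on_le[OF b]) simp
  qed
  note V = integral_equation_variation[OF B Z f1 b1 lip zc zZ eq]
  have zk: "time_Ck_on k B z"
    by (rule Suc.IH[OF Z time_Ck_on_SucD[OF f] Ck_on_SucD[OF b] lip zc zZ eq])
  have joint: "continuous_on ({0..1} \<times> B) (\<lambda>q. z (fst q) (snd q))" by (rule time_Ck_on_continuous[OF zk])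
  show ?case
  proof (rule time_Ck_on_SucI[OF B joint V(1)])
    fix v
    show "time_Ck_on k B (\<lambda>t y. fd (z t) y v)"
    proof (rule Suc.IH[OF open_UNIV time_Ck_on_variation_rhs[OF B Z f zk zZ] Ck_on_SucE(2)[OF b]])
      fix t y x x' assume t: "t \<in> {0..1::real}" and y: "y \<in> B"
      have lin: "linear (fd (f t) (y, z t y))"
        by (rule has_derivative_linear[OF time_Ck_on_SucE(1)[OF f1 t]]) (use t zZ y in auto)
      have "variation_rhs f z v t (y, x) - variation_rhs f z v t (y, x') = fd (f t) (y, z t y) (0, x - x')"
        unfolding variation_rhs_def fst_conv snd_conv linear_diff[OF lin, symmetric] by simp
      thus "norm (variation_rhs f z v t (y, x) - variation_rhs f z v t (y, x')) \<le> norm (x - x') / 2"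
        using lipschitz_fd_snd_le[OF B Z f1 lip t y zZ[OF t y]] by simp
    qed (use V in auto)
  qed
qed

text \<open>The field vanishes at 0 together with its space derivative, so near 0 its Lipschitz
  constant is 1/2 and the flow exists up to time 1. The equation of first variation and the rest
  points of the field are recorded for the Moser argument.\<close>

lemma local_flow:
  fixes X :: "real \<times> 'a::euclidean_space \<Rightarrow> 'a"
  assumes X: "smooth_on W X" "open W" "{0..1} \<times> ball 0 r \<subseteq> W" "r > 0"
    and X0: "\<And>t. t \<in> {0..1} \<Longrightarrow> X (t, 0) = 0"
    and DX0: "\<And>t v. t \<in> {0..1} \<Longrightarrow> fd X (t, 0) (0, v) = 0"
  obtains \<delta> \<phi> where "\<delta> > 0" "\<And>k. time_Ck_on k (ball 0 \<delta>) \<phi>"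
    "\<And>t y. t \<in> {0..1} \<Longrightarrow> y \<in> ball 0 \<delta> \<Longrightarrow> \<phi> t y \<in> ball 0 r"
    "\<And>y. y \<in> ball 0 \<delta> \<Longrightarrow> \<phi> 0 y = y" "\<And>y v. y \<in> ball 0 \<delta> \<Longrightarrow> fd (\<phi> 0) y v = v"
    "\<And>t y. t \<in> {0..1} \<Longrightarrow> y \<in> ball 0 \<delta> \<Longrightarrow>
      ((\<lambda>t. \<phi> t y) has_vector_derivative X (t, \<phi> t y)) (at t within {0..1})"
    "\<And>t y v. t \<in> {0..1} \<Longrightarrow> y \<in> ball 0 \<delta> \<Longrightarrow>
      ((\<lambda>t. fd (\<phi> t) y v) has_vector_derivative fd X (t, \<phi> t y) (0, fd (\<phi> t) y v)) (at t within {0..1})"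
    "\<And>t y. t \<in> {0..1} \<Longrightarrow> y \<in> ball 0 \<delta> \<Longrightarrow> (\<And>s. s \<in> {0..1} \<Longrightarrow> X (s, y) = 0) \<Longrightarrow> \<phi> t y = y"
proof -
  \<comment> \<open>The space derivative as an operator. It is zero at the origin, and by
    compactness of the time interval its norm is at most 1/2 near the origin uniformly in
    time.\<close>
  define H where "H y t = Blinfun (\<lambda>v. fd X (t, y) (0, v))" for y t
  have W: "(t, y) \<in> W" if "t \<in> {0..1}" "y \<in> ball 0 r" for t y using that by (intro subsetD[OF X(3)] SigmaI)
  have bl: "bounded_linear (\<lambda>v. fd X (t, y) (0, v))" if "t \<in> {0..1}" "y \<in> ball 0 r" for t y
    by (rule bounded_linear_compose[OF smooth_on_linear_fd[OF X(1) W[OF that]]])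
      (intro bounded_linear_Pair bounded_linear_ident bounded_linear_zero)
  have H: "blinfun_apply (H y t) = (\<lambda>v. fd X (t, y) (0, v))" if "t \<in> {0..1}" "y \<in> ball 0 r" for t y
    unfolding H_def by (rule bounded_linear_Blinfun_apply[OF bl[OF that]])
  have "continuous_on (ball 0 r \<times> {0..1}) (\<lambda>(y, t). H y t)"
    unfolding split_def
  proof (rule continuous_on_blinfun_componentwise)
    fix i :: 'a
    have "(\<lambda>p. (snd p, fst p)) ` (ball 0 r \<times> {0..1}) \<subseteq> W" using W by auto
    hence "continuous_on (ball 0 r \<times> {0..1}) (\<lambda>p. fd X (snd p, fst p) (0, i))"
      by (intro continuous_on_compose2[OF smooth_on_continuous_on[OF smooth_on_fd[OF X(1)]]]
         continuous_on_Pair continuous_on_fst continuous_on_snd continuous_on_id)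
    thus "continuous_on (ball 0 r \<times> {0..1}) (\<lambda>p. blinfun_apply (H (fst p) (snd p)) i)"
      by (rule continuous_on_cong[THEN iffD1, OF refl, rotated]) (auto simp: H)
  qed
  hence Hc: "continuous_on (ball 0 r \<times> {0..1}) (\<lambda>p. H (fst p) (snd p))" by (simp only: split_def)
  have r0: "0 \<in> ball (0::'a) r" using X(4) by simp
  obtain N where N: "0 \<in> N" "open N" "\<forall>y\<in>N \<inter> ball 0 r. \<forall>t\<in>{0..1}. dist (H y t) (H 0 t) \<le> 1 / 2"
    by (rule continuous_on_prod_compactE[OF Hc compact_Icc r0, of "1 / 2"]) (auto intro: that)
  have "0 \<in> N \<inter> ball 0 r" "open (N \<inter> ball 0 r)" using N X(4) by auto
  then obtain \<rho> where \<rho>: "\<rho> > 0" "ball 0 \<rho> \<subseteq> N \<inter> ball 0 r" using open_contains_ball by blast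
  have H0: "H 0 t = 0" if "t \<in> {0..1}" for t
    by (rule blinfun_eqI) (use H[OF that] DX0[OF that] X(4) in simp)
  have onorm: "onorm (\<lambda>v. fd X (t, y) (0, v)) \<le> 1 / 2" if "t \<in> {0..1}" "y \<in> ball 0 \<rho>" for t y
  proof -
    have y: "y \<in> N \<inter> ball 0 r" using that \<rho> by blast
    have "norm (H y t) \<le> 1 / 2" using N(3)[rule_format, OF y that(1)] H0[OF that(1)] by (simp add: dist_norm)
    thus ?thesis using H[OF that(1), of y] y by (simp add: norm_blinfun.rep_eq)
  qed
  have lip: "norm (X (t, x) - X (t, x')) \<le> norm (x - x') / 2" if t: "t \<in> {0..1}" and x: "x \<in> ball 0 \<rho>" "x' \<in> ball 0 \<rho>" for t x x'
  proof -
    have "norm (X (t, x) - X (t, x')) \<le> 1 / 2 * norm (x - x')"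
    proof (rule differentiable_bound[OF convex_ball _ _ x])
      fix y :: 'a assume y: "y \<in> ball 0 \<rho>"
      have "((\<lambda>y. (t, y)) has_derivative (\<lambda>v. (0, v))) (at y within ball 0 \<rho>)"
        by (intro has_derivative_Pair has_derivative_const has_derivative_ident)
      from has_derivative_compose[OF this smooth_on_has_derivative[OF X(1) W]]
      show "((\<lambda>y. X (t, y)) has_derivative (\<lambda>v. fd X (t, y) (0, v))) (at y within ball 0 \<rho>)"
        using t y \<rho> by blast
    qed (use onorm[OF t] in auto)
    thus ?thesis by simp
  qed
  have Xb: "norm (X (t, x)) \<le> norm x / 2" if "t \<in> {0..1}" "x \<in> ball 0 \<rho>" for t x
    using lip[OF that, of 0] X0[OF that(1)] \<rho>(1) by simp
  have Xc: "continuous_on ({0..1} \<times> ball 0 \<rho>) (\<lambda>q. X (fst q, snd q))"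
  proof -
    have "{0..1} \<times> ball 0 \<rho> \<subseteq> W" using X(3) \<rho>(2) by blast
    from continuous_on_subset[OF smooth_on_continuous_on[OF X(1)] this] show ?thesis by simp
  qed
  have Xi: "continuous_on {0..t} (\<lambda>s. X (s, u s))"
    if "t \<in> {0..1}" "continuous_on {0..1} u" "\<And>s. s \<in> {0..1} \<Longrightarrow> u s \<in> ball 0 \<rho>" for t u
    by (rule continuous_on_uncurry_compose[OF Xc continuous_on_id continuous_on_subset[OF that(2)]])
      (use that in auto)
  \<comment> \<open>Starting within \<rho>/4 and moving with speed at most \<rho>/4 for time at most
    1, a solution stays within \<rho>/2, where this speed bound holds.\<close>
  define \<delta> where "\<delta> = \<rho> / 4"
  have \<delta>: "\<delta> > 0" "ball 0 \<delta> \<subseteq> (ball 0 \<rho> :: 'a set)" using \<rho>(1) by (auto simp: \<delta>_def)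
  have sub: "x \<in> ball 0 \<rho>" if "x \<in> cball (0::'a) (\<rho> / 2)" for x using that \<rho>(1) by simp
  have "\<exists>z. continuous_on {0..1} z \<and> (\<forall>t\<in>{0..1}. z t \<in> cball 0 (\<rho> / 2) \<and> z t = y + integral {0..t} (\<lambda>s. X (s, z s)))"
    if y: "y \<in> ball 0 \<delta>" for y
  proof -
    obtain z where "continuous_on {0..1} z" "\<And>t. t \<in> {0..1} \<Longrightarrow> z t \<in> cball 0 (\<rho> / 2)"
      "\<And>t. t \<in> {0..1} \<Longrightarrow> z t = y + integral {0..t} (\<lambda>s. X (s, z s))"
    proof (rule integral_equation_exists[of "cball 0 (\<rho> / 2)" "\<lambda>t x. X (t, x)" y])
      show "continuous_on ({0..1} \<times> cball 0 (\<rho> / 2)) (\<lambda>q. X (fst q, snd q))"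
        by (rule continuous_on_subset[OF Xc]) (use sub in auto)
      show "norm (X (t, x) - X (t, x')) \<le> norm (x - x') / 2"
        if "t \<in> {0..1}" "x \<in> cball 0 (\<rho> / 2)" "x' \<in> cball 0 (\<rho> / 2)" for t x x'
        using lip that sub by blast
      fix u :: "real \<Rightarrow> 'a" and t :: real
      assume u: "continuous_on {0..1} u" "\<And>s. s \<in> {0..1} \<Longrightarrow> u s \<in> cball 0 (\<rho> / 2)" and t: "t \<in> {0..1}"
      have "norm (integral {0..t} (\<lambda>s. X (s, u s))) \<le> integral {0..t} (\<lambda>s. \<rho> / 4)"
      proof (rule integral_norm_bound_integral)
        show "(\<lambda>s. X (s, u s)) integrable_on {0..t}"
          by (intro integrable_continuous_interval Xi t u(1) sub u(2))
        fix s assume "s \<in> {0..t}"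
        hence s: "s \<in> {0..1}" using t by auto
        show "norm (X (s, u s)) \<le> \<rho> / 4" using Xb[OF s sub[OF u(2)[OF s]]] u(2)[OF s] by simp
      qed auto
      also have "\<dots> = \<rho> / 4 * t" using t by simp
      also have "\<dots> \<le> \<rho> / 4 * 1" using t \<rho>(1) by (intro mult_left_mono) auto
      finally have "norm (y + integral {0..t} (\<lambda>s. X (s, u s))) \<le> \<rho> / 4 + \<rho> / 4 * 1"
        using y by (intro norm_triangle_mono) (auto simp: \<delta>_def)
      thus "y + integral {0..t} (\<lambda>s. X (s, u s)) \<in> cball 0 (\<rho> / 2)" by simp
    qed (use \<rho>(1) in auto)
    thus ?thesis by blast
  qed
  then obtain \<phi> where \<phi>0: "\<And>y. y \<in> ball 0 \<delta> \<Longrightarrow> continuous_on {0..1} (\<lambda>t. \<phi> t y)"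
    "\<And>t y. t \<in> {0..1} \<Longrightarrow> y \<in> ball 0 \<delta> \<Longrightarrow> \<phi> t y \<in> cball 0 (\<rho> / 2)"
    "\<And>t y. t \<in> {0..1} \<Longrightarrow> y \<in> ball 0 \<delta> \<Longrightarrow> \<phi> t y = y + integral {0..t} (\<lambda>s. X (s, \<phi> s y))"
  proof -
    assume a: "\<And>y. y \<in> ball 0 \<delta> \<Longrightarrow> \<exists>z. continuous_on {0..1} z \<and> (\<forall>t\<in>{0..1}. z t \<in> cball 0 (\<rho> / 2) \<and> z t = y + integral {0..t} (\<lambda>s. X (s, z s)))"
    define F where "F y = (SOME z. continuous_on {0..1} z \<and> (\<forall>t\<in>{0..1}. z t \<in> cball 0 (\<rho> / 2) \<and> z t = y + integral {0..t} (\<lambda>s. X (s, z s))))" for y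
    have F: "continuous_on {0..1} (F y) \<and> (\<forall>t\<in>{0..1}. F y t \<in> cball 0 (\<rho> / 2) \<and> F y t = y + integral {0..t} (\<lambda>s. X (s, F y s)))"
      if "y \<in> ball 0 \<delta>" for y unfolding F_def by (rule someI_ex[OF a[OF that]])
    show ?thesis by (rule that[of "\<lambda>t y. F y t"]) (use F in blast)+
  qed
  note \<phi>\<rho> = sub[OF \<phi>0(2)]
  \<comment> \<open>The initial point is the parameter. It enters through the initial value, and the
    right-hand side gets a dummy first component to fit the parametrized integral equation.\<close>
  let ?f = "\<lambda>t (p::'a \<times> 'a). X (t, snd p)"
  have o: "open (ball 0 \<delta> \<times> ball (0::'a) \<rho>)" by (intro open_Times) auto
  have XB: "time_Ck_on k (ball 0 \<rho>) (\<lambda>t x. X (t, x))" for k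
    by (rule time_Ck_on_of_Ck_on[OF open_ball _ smooth_onD[OF X(1)]]) (use X(3) \<rho>(2) in auto)
  have f: "time_Ck_on k (ball 0 \<delta> \<times> ball 0 \<rho>) ?f" for k
    by (rule time_Ck_on_compose[OF o XB])
      (auto intro: time_Ck_on_const[OF o] Ck_on_bounded_linear[OF o] bounded_linear_snd)
  have b: "Ck_on k (ball 0 \<delta>) (\<lambda>y::'a. y)" for k by (rule Ck_on_bounded_linear) auto
  have fsnd: "fd (?f t) (y, x) (v, w) = fd X (t, x) (0, w)" if "t \<in> {0..1}" "x \<in> ball 0 \<rho>" for t x y v w
  proof -
    have "((\<lambda>p. (t, snd p)) has_derivative (\<lambda>p. (0, snd p))) (at (y, x))"
      by (intro has_derivative_Pair has_derivative_const has_derivative_snd has_derivative_ident)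
    moreover have "(X has_derivative fd X (t, x)) (at (t, snd (y, x)))"
      using smooth_on_has_derivative[OF X(1) W[OF that(1)], of x] that(2) \<rho>(2) by auto
    ultimately have "(?f t has_derivative (\<lambda>p. fd X (t, x) (0, snd p))) (at (y, x))"
      by (rule has_derivative_compose)
    from fun_cong[OF fd_eqI[OF this], of "(v, w)"] show ?thesis by simp
  qed
  have lip': "norm (?f t (y, x) - ?f t (y, x')) \<le> norm (x - x') / 2"
    if "t \<in> {0..1}" "y \<in> ball 0 \<delta>" "x \<in> ball 0 \<rho>" "x' \<in> ball 0 \<rho>" for t y x x' using lip[OF that(1,3,4)] by simp
  have eq': "\<phi> t y = y + integral {0..t} (\<lambda>s. ?f s (y, \<phi> s y))" if "t \<in> {0..1}" "y \<in> ball 0 \<delta>" for t y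
    using \<phi>0(3)[OF that] by simp
  have V2: "continuous_on {0..1} (\<lambda>t. fd (\<phi> t) y v)" if "y \<in> ball 0 \<delta>" for y v
    by (rule integral_equation_variation(2)[OF open_ball open_ball f b lip' \<phi>0(1) \<phi>\<rho> eq' that])
  have V3: "fd (\<phi> t) y v = fd (\<lambda>y. y) y v + integral {0..t} (\<lambda>s. variation_rhs ?f \<phi> v s (y, fd (\<phi> s) y v))"
    if "t \<in> {0..1}" "y \<in> ball 0 \<delta>" for t y v
    by (rule integral_equation_variation(3)[OF open_ball open_ball f b lip' \<phi>0(1) \<phi>\<rho> eq' that(2,1)])
  have fd_id: "fd (\<lambda>y::'a. y) y v = v" for y v by (simp add: fd_eqI[OF has_derivative_ident])
  show ?thesis
  proof (rule that[OF \<delta>(1), of \<phi>])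
    show "time_Ck_on k (ball 0 \<delta>) \<phi>" for k
      by (rule integral_equation_time_Ck[OF open_ball open_ball f b lip' \<phi>0(1) \<phi>\<rho> eq'])
    show "\<phi> t y \<in> ball 0 r" if "t \<in> {0..1}" "y \<in> ball 0 \<delta>" for t y
      using \<phi>\<rho>[OF that] \<rho>(2) by blast
    show "\<phi> 0 y = y" if "y \<in> ball 0 \<delta>" for y using \<phi>0(3)[OF _ that, of 0] by simp
    show "fd (\<phi> 0) y v = v" if "y \<in> ball 0 \<delta>" for y v using V3[OF _ that, of 0 v] by (simp add: fd_id)
    show "((\<lambda>t. \<phi> t y) has_vector_derivative X (t, \<phi> t y)) (at t within {0..1})"
      if t: "t \<in> {0..1}" and y: "y \<in> ball 0 \<delta>" for t y
    proof -
      have "((\<lambda>t. y + integral {0..t} (\<lambda>s. X (s, \<phi> s y))) has_vector_derivative (0 + X (t, \<phi> t y))) (at t within {0..1})"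
        by (intro has_vector_derivative_add has_vector_derivative_const integral_has_vector_derivative
            Xi \<phi>0(1) \<phi>\<rho> y t) auto
      thus ?thesis unfolding add_0
        by (rule has_vector_derivative_transform[OF t, rotated]) (rule \<phi>0(3)[OF _ y])
    qed
    show "((\<lambda>t. fd (\<phi> t) y v) has_vector_derivative fd X (t, \<phi> t y) (0, fd (\<phi> t) y v)) (at t within {0..1})"
      if t: "t \<in> {0..1}" and y: "y \<in> ball 0 \<delta>" for t y v
    proof -
      have vr: "variation_rhs ?f \<phi> v s (y, x) = fd X (s, \<phi> s y) (0, x)" if "s \<in> {0..1}" for s x
        using fsnd[OF that \<phi>\<rho>[OF that y]] by (simp add: variation_rhs_def)
      have c: "continuous_on {0..1} (\<lambda>s. variation_rhs ?f \<phi> v s (y, fd (\<phi> s) y v))"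
      proof (rule continuous_on_uncurry_compose[OF time_Ck_on_continuous[OF time_Ck_on_variation_rhs[OF open_ball open_ball f _ \<phi>\<rho>]] continuous_on_id])
        show "time_Ck_on 0 (ball 0 \<delta>) \<phi>"
          by (rule integral_equation_time_Ck[OF open_ball open_ball f b lip' \<phi>0(1) \<phi>\<rho> eq'])
      qed (use V2 y in \<open>auto intro!: continuous_on_Pair continuous_on_const\<close>)
      have "((\<lambda>t. v + integral {0..t} (\<lambda>s. variation_rhs ?f \<phi> v s (y, fd (\<phi> s) y v)))
        has_vector_derivative (0 + variation_rhs ?f \<phi> v t (y, fd (\<phi> t) y v))) (at t within {0..1})"
        by (intro has_vector_derivative_add has_vector_derivative_const integral_has_vector_derivative c t)
      thus ?thesis unfolding vr[OF t] add_0
        by (rule has_vector_derivative_transform[OF t, rotated]) (simp add: V3[OF _ y] fd_id)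
    qed
    show "\<phi> t y = y" if t: "t \<in> {0..1}" and y: "y \<in> ball 0 \<delta>" and zero: "\<And>s. s \<in> {0..1} \<Longrightarrow> X (s, y) = 0" for t y
    proof -
      have y\<rho>: "y \<in> ball 0 \<rho>" using y \<delta>(2) by blast
      have "norm (\<phi> t y - y) \<le> 0 / (1 - 1 / 2)"
      proof (rule integral_gronwall[where u="\<lambda>t. \<phi> t y - y", OF _ _ _ _ t])
        show c: "continuous_on {0..1} (\<lambda>t. \<phi> t y - y)" by (intro continuous_on_diff continuous_on_const \<phi>0(1) y)
        fix t :: real assume t: "t \<in> {0..1}"
        have "norm (integral {0..t} (\<lambda>s. X (s, \<phi> s y))) \<le> integral {0..t} (\<lambda>s. 1 / 2 * norm (\<phi> s y - y))"
        proof (rule integral_norm_bound_integral)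
          show "(\<lambda>s. X (s, \<phi> s y)) integrable_on {0..t}"
            by (intro integrable_continuous_interval Xi t \<phi>0(1) \<phi>\<rho> y)
          show "(\<lambda>s. 1 / 2 * norm (\<phi> s y - y)) integrable_on {0..t}"
            using t by (intro integrable_continuous_interval continuous_on_mult continuous_on_const
                continuous_on_norm continuous_on_subset[OF c]) auto
          fix s assume "s \<in> {0..t}"
          hence s: "s \<in> {0..1}" using t by auto
          show "norm (X (s, \<phi> s y)) \<le> 1 / 2 * norm (\<phi> s y - y)"
            using lip[OF s \<phi>\<rho>[OF s y] y\<rho>] zero[OF s] by simp
        qed
        thus "norm (\<phi> t y - y) \<le> 0 + integral {0..t} (\<lambda>s. 1 / 2 * norm (\<phi> s y - y))"
          using \<phi>0(3)[OF t y] by simp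
      qed auto
      thus ?thesis by simp
    qed
  qed
qed

section \<open>Moser isotopies\<close>

lemma form2_on_lincomb:
  assumes "open U" "form2_on U \<alpha>" "form2_on U \<beta>"
  shows "form2_on U (\<lambda>x u v. \<alpha> x u v + c * \<beta> x u v)"
proof -
  have "linear (\<lambda>v. \<alpha> x u v + c * \<beta> x u v)" "linear (\<lambda>u. \<alpha> x u v + c * \<beta> x u v)" if "x \<in> U" for x u v
    using linear_compose_add[OF form2_onD(4)[OF assms(2) that] linear_compose_scale_right[OF form2_onD(4)[OF assms(3) that], of c]]
      linear_compose_add[OF form2_onD(5)[OF assms(2) that] linear_compose_scale_right[OF form2_onD(5)[OF assms(3) that], of c]]
    by simp_all
  moreover have "smooth_on U (\<lambda>x. \<alpha> x u v + c * \<beta> x u v)" for u v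
    by (intro smooth_intros assms(1) form2_onD(3)[OF assms(2)] form2_onD(3)[OF assms(3)])
  ultimately show ?thesis
    using form2_onD(2)[OF assms(2)] form2_onD(2)[OF assms(3)] by (simp add: form2_on_def bilinear_def)
qed

lemma fd_lincomb:
  fixes f g :: "_ \<Rightarrow> real"
  assumes "f differentiable (at x)" "g differentiable (at x)"
  shows "fd (\<lambda>y. f y + c * g y) x v = fd f x v + c * fd g x v"
  using fd_eqI[OF has_derivative_add[OF assms(1)[unfolded frechet_derivative_works]
        has_derivative_mult_right[OF assms(2)[unfolded frechet_derivative_works], of c]]] by simp

lemma d_form2_lincomb:
  assumes "form2_on U \<alpha>" "form2_on U \<beta>" "x \<in> U"
  shows "d_form2 (\<lambda>x u v. \<alpha> x u v + c * \<beta> x u v) x u v w = d_form2 \<alpha> x u v w + c * d_form2 \<beta> x u v w"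
  using smooth_on_differentiable[OF form2_onD(3)[OF assms(1)] assms(3)]
    smooth_on_differentiable[OF form2_onD(3)[OF assms(2)] assms(3)]
  by (simp add: d_form2_def fd_lincomb algebra_simps)

lemma form2_continuous_along:
  fixes g w z :: "'a::topological_space \<Rightarrow> 'n::finite space"
  assumes \<omega>: "form2_on U \<omega>" and g: "continuous_on S g" "\<And>x. x \<in> S \<Longrightarrow> g x \<in> U"
    and w: "continuous_on S w" and z: "continuous_on S z"
  shows "continuous_on S (\<lambda>x. \<omega> (g x) (w x) (z x))"
proof -
  have gU: "g ` S \<subseteq> U" using g(2) by blast
  have "continuous_on S (\<lambda>x. \<Sum>i\<in>UNIV. w x $ i * (\<Sum>j\<in>UNIV. z x $ j * \<omega> (g x) (axis i 1) (axis j 1)))"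
    by (intro continuous_on_sum continuous_on_mult continuous_on_component w z
        continuous_on_compose2[OF smooth_on_continuous_on[OF form2_onD(3)[OF \<omega>]] g(1) gU])
  moreover have "(\<Sum>i\<in>UNIV. w x $ i * (\<Sum>j\<in>UNIV. z x $ j * \<omega> (g x) (axis i 1) (axis j 1))) = \<omega> (g x) (w x) (z x)"
    if "x \<in> S" for x
    using form2_expand[OF \<omega> g(2)[OF that], of "w x" "z x"]
      vec_linear_expand[OF form2_onD(4)[OF \<omega> g(2)[OF that]], of "axis _ 1" "z x"] by simp
  ultimately show ?thesis using continuous_on_cong[OF refl, of S] by (simp cong: continuous_on_cong)
qed

lemma linear_eq_on_axis:
  fixes f g :: "real ^ 'n::finite \<Rightarrow> real"
  assumes "linear f" "linear g" "\<And>i. f (axis i 1) = g (axis i 1)"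
  shows "f x = g x"
  using vec_linear_expand[OF assms(1), of x] vec_linear_expand[OF assms(2), of x] assms(3) by simp

text \<open>Moser's method along the segment \<open>Om t\<close> from \<omega>1 to \<omega>: the
  field X whose contraction with \<open>Om t\<close> is - \<mu> has a flow under which the pullback
  of \<open>Om t\<close> stays equal to \<omega>1. As \<mu> vanishes at 0 with its first
  derivatives, so does X, and the flow reaches time 1. Where \<mu> vanishes, X does too, and points
  stay fixed.\<close>

lemma moser_isotopy:
  fixes \<omega> \<omega>1 :: "'n::finite form2" and \<mu> :: "'n form1"
  assumes r: "r > 0" and \<omega>: "form2_on (ball 0 r) \<omega>" and \<omega>1: "form2_on (ball 0 r) \<omega>1" and \<mu>: "form1_on (ball 0 r) \<mu>"
    and closed: "\<And>x u v w. x \<in> ball 0 r \<Longrightarrow> d_form2 \<omega> x u v w = 0"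
      "\<And>x u v w. x \<in> ball 0 r \<Longrightarrow> d_form2 \<omega>1 x u v w = 0"
    and d\<mu>: "\<And>x u v. x \<in> ball 0 r \<Longrightarrow> d_form1 \<mu> x u v = \<omega> x u v - \<omega>1 x u v"
    and eq0: "\<And>u v. \<omega> 0 u v = \<omega>1 0 u v" and nondeg: "\<And>u. (\<And>v. \<omega> 0 u v = 0) \<Longrightarrow> u = 0"
    and \<mu>0: "\<And>u. \<mu> 0 u = 0" "\<And>u v. fd (\<lambda>y. \<mu> y u) 0 v = 0"
  obtains \<delta> \<phi> where "\<delta> > 0" "smooth_on (ball 0 \<delta>) \<phi>" "\<And>y. y \<in> ball 0 \<delta> \<Longrightarrow> \<phi> y \<in> ball 0 r"
    "\<And>y u v. y \<in> ball 0 \<delta> \<Longrightarrow> pullback \<phi> \<omega> y u v = \<omega>1 y u v"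
    "\<And>y. y \<in> ball 0 \<delta> \<Longrightarrow> (\<And>u. \<mu> y u = 0) \<Longrightarrow> \<phi> y = y"
proof -
  define E where "E = (\<lambda>x u v. \<omega> x u v + (- 1) * \<omega>1 x u v)"
  define Om where "Om t = (\<lambda>x u v. \<omega>1 x u v + t * E x u v)" for t
  let ?B = "ball (0::'n space) r"
  have E: "form2_on ?B E" unfolding E_def by (rule form2_on_lincomb[OF open_ball \<omega> \<omega>1])
  have Om: "form2_on ?B (Om t)" for t unfolding Om_def by (rule form2_on_lincomb[OF open_ball \<omega>1 E])
  have dOm: "d_form2 (Om t) x u v w = 0" if "x \<in> ?B" for t x u v w
    unfolding Om_def d_form2_lincomb[OF \<omega>1 E that] unfolding E_def d_form2_lincomb[OF \<omega> \<omega>1 that]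
    using closed[OF that] by simp
  have Om0: "Om t 0 u v = \<omega> 0 u v" for t u v by (simp add: Om_def E_def eq0)
  \<comment> \<open>The system that determines X: column j carries the j-th coordinate of X, row i
    the test vector \<open>axis i 1\<close>.\<close>
  define A where "A p i j = Om (fst p) (snd p) (axis j 1) (axis i 1)" for p and i j :: "'n bit0"
  define b where "b p i = - \<mu> (snd p) (axis i 1)" for p :: "real \<times> 'n space" and i :: "'n bit0"
  define W0 where "W0 = (UNIV :: real set) \<times> ?B"
  have W0: "open W0" unfolding W0_def by (intro open_Times) auto
  have sW0: "snd p \<in> ?B" if "p \<in> W0" for p using that by (auto simp: W0_def)
  have fs: "smooth_on W0 fst" "smooth_on W0 snd"
    by (intro smooth_on_bounded_linear W0 bounded_linear_fst bounded_linear_snd)+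
  have As: "smooth_on W0 (\<lambda>p. A p i j)" for i j
    unfolding A_def Om_def
    by (intro smooth_intros W0 fs smooth_on_compose[OF form2_onD(3)[OF \<omega>1] W0 fs(2) sW0]
        smooth_on_compose[OF form2_onD(3)[OF E] W0 fs(2) sW0])
  have bs: "smooth_on W0 (\<lambda>p. b p i)" for i
    unfolding b_def by (intro smooth_intros W0 smooth_on_compose[OF form1_onD(2)[OF \<mu>] W0 fs(2) sW0])
  have dets: "smooth_on W0 (\<lambda>p. det (\<chi> i j. A p i j))" by (intro smooth_on_det W0 As)
  \<comment> \<open>The open set of times and points at which the form of the segment is
    nondegenerate.\<close>
  define W where "W = W0 \<inter> (\<lambda>p. det (\<chi> i j. A p i j)) -` (- {0})"
  have W: "open W" unfolding W_def
    by (rule continuous_open_preimage[OF smooth_on_continuous_on[OF dets] W0]) auto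
  have WW0: "W \<subseteq> W0" by (auto simp: W_def)
  have det: "det (\<chi> i j. A p i j) \<noteq> 0" if "p \<in> W" for p using that by (auto simp: W_def)
  have lin0: "linear (\<lambda>u. (\<chi> i. \<omega> 0 u (axis i 1)) :: 'n space)"
    using linear_add[OF form2_onD(5)[OF \<omega>, of 0]] linear_scale[OF form2_onD(5)[OF \<omega>, of 0]] r
    by (auto intro!: linearI simp: vec_eq_iff)
  have inj0: "w = 0" if "(\<chi> i. \<omega> 0 w (axis i 1)) = (0 :: 'n space)" for w
  proof (rule nondeg)
    fix v
    have "\<omega> 0 w v = (\<Sum>j\<in>UNIV. (v $ j) *\<^sub>R \<omega> 0 w (axis j 1))"
      by (rule vec_linear_expand[OF form2_onD(4)[OF \<omega>]]) (use r in simp)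
    thus "\<omega> 0 w v = 0" using that by (simp add: vec_eq_iff)
  qed
  \<comment> \<open>At the origin all forms of the segment coincide with \<omega>, so they are
    nondegenerate there for every t.\<close>
  have W_0: "(t, 0) \<in> W" for t
    using det_nonzero_if_inj[OF lin0 inj0] r by (simp add: W_def W0_def A_def Om0)
  define X where "X p = (\<chi> k. det (\<chi> i j. if j = k then b p i else A p i j) / det (\<chi> i j. A p i j))" for p
  have X: "(\<Sum>j\<in>UNIV. A p i j * X p $ j) = b p i" if "p \<in> W" for p i
  proof -
    have "(\<chi> i j. A p i j) *v X p = (\<chi> i. b p i)"
      unfolding cramer[OF det[OF that]] X_def by (simp cong: if_cong)
    thus ?thesis by (simp add: matrix_vector_mult_def vec_eq_iff)
  qed
  have Xs: "smooth_on W X"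
    by (rule smooth_on_solve[OF W smooth_on_subset[OF As WW0] smooth_on_subset[OF bs WW0] det X])
  have Xeq: "Om t y (X (t, y)) w = - \<mu> y w" if "(t, y) \<in> W" for t y w
  proof (rule linear_eq_on_axis[where f="Om t y (X (t, y))" and g="\<lambda>w. - \<mu> y w"])
    have y: "y \<in> ?B" using that WW0 sW0 by fastforce
    show "linear (Om t y (X (t, y)))" by (rule form2_onD(4)[OF Om y])
    show "linear (\<lambda>w. - \<mu> y w)" by (rule linear_compose_neg[OF form1_onD(1)[OF \<mu> y]])
    fix i
    have "Om t y (X (t, y)) (axis i 1) = (\<Sum>j\<in>UNIV. X (t, y) $ j * Om t y (axis j 1) (axis i 1))"
      by (rule form2_expand[OF Om y])
    also have "\<dots> = b (t, y) i" using X[OF that, of i] by (simp add: A_def mult.commute)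
    finally show "Om t y (X (t, y)) (axis i 1) = - \<mu> y (axis i 1)" by (simp add: b_def)
  qed
  have X_unique: "x = 0" if "\<And>i. (\<Sum>j\<in>UNIV. A p i j * x $ j) = 0" "p \<in> W" for p and x :: "'n space"
  proof -
    have "(\<chi> i j. A p i j) *v x = 0" using that(1) by (simp add: matrix_vector_mult_def vec_eq_iff)
    moreover have "(\<chi> i j. A p i j) *v 0 = 0" by simp
    ultimately show ?thesis unfolding cramer[OF det[OF that(2)]] by metis
  qed
  have X_zero: "X (t, y) = 0" if "(t, y) \<in> W" "\<And>u. \<mu> y u = 0" for t y
    by (rule X_unique[OF _ that(1)]) (use X[OF that(1)] that(2) in \<open>simp add: b_def\<close>)
  have fdX: "((\<lambda>y. X (t, y)) has_derivative (\<lambda>v. fd X (t, y) (0, v))) (at y)" if "(t, y) \<in> W" for t y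
  proof -
    have "((\<lambda>y. (t, y)) has_derivative (\<lambda>v. (0, v))) (at y)"
      by (intro has_derivative_Pair has_derivative_const has_derivative_ident)
    from has_derivative_compose[OF this smooth_on_has_derivative[OF Xs that]] show ?thesis .
  qed
  \<comment> \<open>Differentiating the equation that defines X gives its derivative contracted with
    the form. Both the vanishing of the derivative at 0 and the final cancellation use it in this
    contracted shape.\<close>
  have diff_eq: "fd (\<lambda>y. Om t y (X (t, x)) w) x a + Om t x (fd X (t, x) (0, a)) w = - fd (\<lambda>y. \<mu> y w) x a"
    if "(t, x) \<in> W" for t x w a
  proof -
    define S where "S = (\<lambda>y. (t, y)) -` W"
    have "continuous_on UNIV (\<lambda>y::'n space. (t, y))" by (intro continuous_on_Pair continuous_on_const continuous_on_id)
    hence S: "open S" "x \<in> S" "S \<subseteq> ?B" "\<And>y. y \<in> S \<Longrightarrow> y \<in> ?B"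
      using open_vimage[OF W] that WW0 sW0 by (fastforce simp: S_def)+
    have "((\<lambda>y. Om t y (X (t, y)) w) has_derivative
      (\<lambda>a. fd (\<lambda>y. Om t y (X (t, x)) w) x a + Om t x (fd X (t, x) (0, a)) w + Om t x (X (t, x)) 0)) (at x)"
      by (rule form2_has_derivative[OF Om open_ball S(1,2,4) has_derivative_ident fdX[OF that] has_derivative_const])
    from fun_cong[OF fd_eqI[OF this], of a]
    have "fd (\<lambda>y. Om t y (X (t, y)) w) x a = fd (\<lambda>y. Om t y (X (t, x)) w) x a + Om t x (fd X (t, x) (0, a)) w"
      using linear_0[OF form2_onD(4)[OF Om S(4)[OF S(2)]]] by simp
    moreover have "fd (\<lambda>y. Om t y (X (t, y)) w) x = fd (\<lambda>y. - \<mu> y w) x"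
      by (rule fd_cong[OF S(1,2)]) (simp add: Xeq S_def)
    ultimately show ?thesis
      using fd_minus[OF smooth_on_differentiable[OF form1_onD(2)[OF \<mu>] S(4)[OF S(2)]]] by simp
  qed
  have DX0: "fd X (t, 0) (0, v) = 0" for t v
  proof (rule X_unique[OF _ W_0])
    fix i
    have "Om t 0 (fd X (t, 0) (0, v)) (axis i 1) = 0"
      using diff_eq[OF W_0, of t "axis i 1" v] \<mu>0 X_zero[OF W_0 \<mu>0(1), of t]
        linear_0[OF form2_fd_linear[OF Om open_ball, of 0]] r by simp
    thus "(\<Sum>j\<in>UNIV. A (t, 0) i j * fd X (t, 0) (0, v) $ j) = 0"
      using form2_expand[OF Om, of 0 t "fd X (t, 0) (0, v)" "axis i 1"] r by (simp add: A_def mult.commute)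
  qed
  \<comment> \<open>One neighbourhood of the origin for all times, by compactness of the unit
    interval.\<close>
  obtain r1 where r1: "r1 > 0" "{0..1} \<times> ball 0 r1 \<subseteq> W"
  proof -
    have "compact ({0..1::real} \<times> {0::'n space})" by (intro compact_Times) auto
    then obtain \<epsilon> where \<epsilon>: "\<epsilon> > 0" "(\<Union>p\<in>{0..1} \<times> {0}. ball p \<epsilon>) \<subseteq> W"
      using compact_subset_open_imp_ball_epsilon_subset[OF _ W] W_0 by blast
    have "(t, y) \<in> W" if "t \<in> {0..1}" "y \<in> ball 0 \<epsilon>" for t y
    proof -
      have "(t, y) \<in> ball (t, 0) \<epsilon>" using that by (simp add: dist_Pair_Pair)
      thus ?thesis using \<epsilon>(2) that(1) by blast
    qed
    hence "{0..1} \<times> ball 0 \<epsilon> \<subseteq> W" by (intro subsetI) (elim SigmaE, simp only:)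
    thus ?thesis using that[of \<epsilon>] \<epsilon>(1) by simp
  qed
  obtain \<delta> \<phi> where \<delta>: "\<delta> > 0" and flow: "\<And>k. time_Ck_on k (ball 0 \<delta>) \<phi>"
    "\<And>t y. t \<in> {0..1} \<Longrightarrow> y \<in> ball 0 \<delta> \<Longrightarrow> \<phi> t y \<in> ball 0 r1"
    "\<And>y. y \<in> ball 0 \<delta> \<Longrightarrow> \<phi> 0 y = y" "\<And>y v. y \<in> ball 0 \<delta> \<Longrightarrow> fd (\<phi> 0) y v = v"
    "\<And>t y. t \<in> {0..1} \<Longrightarrow> y \<in> ball 0 \<delta> \<Longrightarrow>
      ((\<lambda>t. \<phi> t y) has_vector_derivative X (t, \<phi> t y)) (at t within {0..1})"
    "\<And>t y v. t \<in> {0..1} \<Longrightarrow> y \<in> ball 0 \<delta> \<Longrightarrow>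
      ((\<lambda>t. fd (\<phi> t) y v) has_vector_derivative fd X (t, \<phi> t y) (0, fd (\<phi> t) y v)) (at t within {0..1})"
    "\<And>t y. t \<in> {0..1} \<Longrightarrow> y \<in> ball 0 \<delta> \<Longrightarrow> (\<And>s. s \<in> {0..1} \<Longrightarrow> X (s, y) = 0) \<Longrightarrow> \<phi> t y = y"
    using local_flow[OF Xs W r1(2,1) X_zero[OF W_0 \<mu>0(1)] DX0] by blast
  have inW: "(t, \<phi> t y) \<in> W" if "t \<in> {0..1}" "y \<in> ball 0 \<delta>" for t y
    by (rule subsetD[OF r1(2) SigmaI[OF that(1) flow(2)[OF that]]])
  have inB: "\<phi> t y \<in> ?B" if "t \<in> {0..1}" "y \<in> ball 0 \<delta>" for t y
    using inW[OF that] WW0 sW0 by fastforce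
  show ?thesis
  proof (rule that[of \<delta> "\<phi> 1"])
    show "\<delta> > 0" by fact
    show "smooth_on (ball 0 \<delta>) (\<phi> 1)" unfolding smooth_on_def
      using Ck_on_of_time_Ck_on[OF flow(1), of 1] by auto
    show "\<phi> 1 y \<in> ?B" if "y \<in> ball 0 \<delta>" for y by (rule inB[OF _ that]) simp
    show "\<phi> 1 y = y" if y: "y \<in> ball 0 \<delta>" and z: "\<And>u. \<mu> y u = 0" for y
    proof (rule flow(7)[OF _ y])
      have "\<mu> y u = 0" for u by (rule z)
      moreover have "(s, y) \<in> W" if "s \<in> {0..1}" for s
      proof -
        have "(0, y) \<in> W0" using inW[of 0 y] flow(3)[OF y] y WW0 by auto
        show ?thesis
        proof (cases "norm y < r1")
          case True thus ?thesis using r1(2) that by (intro subsetD[OF r1(2)]) auto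
        next
          case False
          thus ?thesis using flow(2)[of 0 y] flow(3)[OF y] y by simp
        qed
      qed
      ultimately show "X (s, y) = 0" if "s \<in> {0..1}" for s using X_zero that by blast
    qed simp
    fix y u v :: "'n space" assume y: "y \<in> ball 0 \<delta>"
    define a where "a t = fd (\<phi> t) y u" for t
    define c where "c t = fd (\<phi> t) y v" for t
    \<comment> \<open>The form \<open>Om t\<close> pulled back by the time-t flow, evaluated on u
      and v. At time 1 it is the pullback of \<omega>, at time 0 it is \<omega>1, so it remains to
      see that it is constant.\<close>
    define g where "g t = \<omega>1 (\<phi> t y) (a t) (c t) + t * E (\<phi> t y) (a t) (c t)" for t
    have \<phi>c: "continuous_on {0..1} (\<lambda>t. \<phi> t y)" and ac: "continuous_on {0..1} a" and cc: "continuous_on {0..1} c"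
      unfolding a_def c_def continuous_on_eq_continuous_within
      using flow(5,6)[OF _ y] has_vector_derivative_continuous by blast+
    have "g 1 = g 0"
    proof (rule DERIV_isconst2[of 0 1])
      show "continuous_on {0..1} g" unfolding g_def
        by (intro continuous_on_add continuous_on_mult continuous_on_id
            form2_continuous_along[OF \<omega>1 \<phi>c inB[OF _ y] ac cc] form2_continuous_along[OF E \<phi>c inB[OF _ y] ac cc])
      fix t :: real assume t: "0 < t" "t < 1"
      hence t01: "t \<in> {0..1}" by simp
      have at: "at t within {0..1} = at t" using t by (simp add: at_within_Icc_at)
      define x where "x = \<phi> t y"
      define Y where "Y = X (t, x)"
      define D where "D w = fd X (t, x) (0, w)" for w
      have xW: "(t, x) \<in> W" and xB: "x \<in> ?B" unfolding x_def by (rule inW[OF t01 y], rule inB[OF t01 y])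
      note hv = flow(5)[OF t01 y, unfolded at has_vector_derivative_def, folded x_def, folded Y_def]
        flow(6)[OF t01 y, of u, unfolded at has_vector_derivative_def, folded x_def a_def, folded D_def]
        flow(6)[OF t01 y, of v, unfolded at has_vector_derivative_def, folded x_def c_def, folded D_def]
      have ts: "open {0<..<1::real}" "t \<in> {0<..<1}" "\<And>s. s \<in> {0<..<1} \<Longrightarrow> \<phi> s y \<in> ?B"
        using t inB[OF _ y] by auto
      have P: "((\<lambda>s. \<eta> (\<phi> s y) (a s) (c s)) has_real_derivative
          fd (\<lambda>y. \<eta> y (a t) (c t)) x Y + \<eta> x (D (a t)) (c t) + \<eta> x (a t) (D (c t))) (at t)"
        if \<eta>: "form2_on ?B \<eta>" for \<eta>
      proof -
        have "((\<lambda>s. \<eta> (\<phi> s y) (a s) (c s)) has_derivative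
          (\<lambda>h. fd (\<lambda>y. \<eta> y (a t) (c t)) (\<phi> t y) (h *\<^sub>R Y) + \<eta> (\<phi> t y) (h *\<^sub>R D (a t)) (c t)
            + \<eta> (\<phi> t y) (a t) (h *\<^sub>R D (c t)))) (at t)"
          by (rule form2_has_derivative[OF \<eta> open_ball ts hv[folded a_def c_def]])
        moreover have "fd (\<lambda>y. \<eta> y (a t) (c t)) (\<phi> t y) (h *\<^sub>R Y) + \<eta> (\<phi> t y) (h *\<^sub>R D (a t)) (c t)
            + \<eta> (\<phi> t y) (a t) (h *\<^sub>R D (c t)) = (fd (\<lambda>y. \<eta> y (a t) (c t)) x Y + \<eta> x (D (a t)) (c t) + \<eta> x (a t) (D (c t))) * h" for h
          unfolding x_def[symmetric]
          using linear_scale[OF bounded_linear.linear[OF smooth_on_linear_fd[OF form2_onD(3)[OF \<eta>] xB]]]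
            linear_scale[OF form2_onD(4)[OF \<eta> xB]] linear_scale[OF form2_onD(5)[OF \<eta> xB]]
          by (simp add: algebra_simps)
        ultimately show ?thesis unfolding has_field_derivative_def by simp
      qed
      have "(g has_real_derivative
        (fd (\<lambda>y. \<omega>1 y (a t) (c t)) x Y + \<omega>1 x (D (a t)) (c t) + \<omega>1 x (a t) (D (c t)))
        + (1 * E (\<phi> t y) (a t) (c t) + (fd (\<lambda>y. E y (a t) (c t)) x Y + E x (D (a t)) (c t) + E x (a t) (D (c t))) * t)) (at t)"
        unfolding g_def by (intro DERIV_add DERIV_mult P \<omega>1 E DERIV_ident)
      \<comment> \<open>Cartan's formula written out: the derivatives of \<mu> supplied by the
        implicit derivative of X cancel E, which is d\<mu>, and the remaining derivatives of
        \<open>Om t\<close> cancel by closedness.\<close>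
      moreover have "(fd (\<lambda>y. \<omega>1 y (a t) (c t)) x Y + \<omega>1 x (D (a t)) (c t) + \<omega>1 x (a t) (D (c t)))
        + (1 * E (\<phi> t y) (a t) (c t) + (fd (\<lambda>y. E y (a t) (c t)) x Y + E x (D (a t)) (c t) + E x (a t) (D (c t))) * t) = 0"
      proof -
        note dd = smooth_on_differentiable[OF form2_onD(3)[OF \<omega>1] xB] smooth_on_differentiable[OF form2_onD(3)[OF E] xB]
        have 1: "fd (\<lambda>y. Om t y (a t) (c t)) x Y = fd (\<lambda>y. \<omega>1 y (a t) (c t)) x Y + t * fd (\<lambda>y. E y (a t) (c t)) x Y"
          unfolding Om_def by (rule fd_lincomb[OF dd])
        have 2: "E x (a t) (c t) = fd (\<lambda>y. \<mu> y (c t)) x (a t) - fd (\<lambda>y. \<mu> y (a t)) x (c t)"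
          using d\<mu>[OF xB, of "a t" "c t"] by (simp add: E_def d_form1_def)
        have 3: "Om t x (D (a t)) (c t) = - fd (\<lambda>y. \<mu> y (c t)) x (a t) - fd (\<lambda>y. Om t y Y (c t)) x (a t)"
          using diff_eq[OF xW, of "c t" "a t"] by (simp add: D_def Y_def)
        have 4: "Om t x (a t) (D (c t)) = fd (\<lambda>y. \<mu> y (a t)) x (c t) + fd (\<lambda>y. Om t y Y (a t)) x (c t)"
          using diff_eq[OF xW, of "a t" "c t"] form2_antisym[OF Om xB, of t "a t" "D (c t)"] by (simp add: D_def Y_def)
        have 5: "fd (\<lambda>y. Om t y (a t) (c t)) x Y + fd (\<lambda>y. Om t y (c t) Y) x (a t) + fd (\<lambda>y. Om t y Y (a t)) x (c t) = 0"
          using dOm[OF xB, of t Y "a t" "c t"] by (simp add: d_form2_def)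
        have 6: "fd (\<lambda>y. Om t y (c t) Y) x (a t) = - fd (\<lambda>y. Om t y Y (c t)) x (a t)"
          by (rule form2_fd_antisym[OF Om open_ball xB])
        have 7: "Om t x (D (a t)) (c t) = \<omega>1 x (D (a t)) (c t) + t * E x (D (a t)) (c t)"
          "Om t x (a t) (D (c t)) = \<omega>1 x (a t) (D (c t)) + t * E x (a t) (D (c t))" by (simp_all add: Om_def)
        have "(fd (\<lambda>y. \<omega>1 y (a t) (c t)) x Y + t * fd (\<lambda>y. E y (a t) (c t)) x Y)
          + (\<omega>1 x (D (a t)) (c t) + t * E x (D (a t)) (c t)) + (\<omega>1 x (a t) (D (c t)) + t * E x (a t) (D (c t)))
          + E x (a t) (c t) = 0"
          unfolding 1[symmetric] 7[symmetric] using 2 3 4 5 6 by linarith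
        thus ?thesis by (simp add: x_def[symmetric] algebra_simps)
      qed
      ultimately show "(g has_real_derivative 0) (at t)" by simp
    qed auto
    thus "pullback (\<phi> 1) \<omega> y u v = \<omega>1 y u v"
      by (simp add: g_def a_def c_def pullback_def E_def flow(3,4)[OF y])
  qed
qed

section \<open>Lagrangian germs\<close>

text \<open>Among the isotropic subspaces containing M one of largest dimension is chosen. A vector
  that B pairs to zero with it could be adjoined, B being alternating, so it lies in the subspace
  already.\<close>

lemma maximal_isotropic:
  fixes B :: "'a::euclidean_space \<Rightarrow> 'a \<Rightarrow> real"
  assumes B: "bilinear B" "\<And>u. B u u = 0" and M: "subspace M" "\<And>u v. u \<in> M \<Longrightarrow> v \<in> M \<Longrightarrow> B u v = 0"
  obtains L where "subspace L" "M \<subseteq> L" "L = {u. \<forall>v\<in>L. B u v = 0}"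
proof -
  define P where "P L \<longleftrightarrow> subspace L \<and> M \<subseteq> L \<and> (\<forall>u\<in>L. \<forall>v\<in>L. B u v = 0)" for L
  have "\<exists>k. (\<exists>L. P L \<and> dim L = k) \<and> (\<forall>j. (\<exists>L. P L \<and> dim L = j) \<longrightarrow> j \<le> k)"
  proof (rule ex_has_greatest_nat[where b="Suc DIM('a)"])
    show "\<exists>L. P L \<and> dim L = dim M" using M by (auto simp: P_def)
  qed (auto intro: dim_subset_UNIV le_SucI simp: less_Suc_eq_le)
  then obtain L where L: "P L" "\<And>L'. P L' \<Longrightarrow> dim L' \<le> dim L" by blast
  have L': "subspace L" "M \<subseteq> L" "\<And>u v. u \<in> L \<Longrightarrow> v \<in> L \<Longrightarrow> B u v = 0" using L(1) by (auto simp: P_def)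
  have anti: "B u v = - B v u" for u v
    using B(2)[of "u + v"] B(2)[of u] B(2)[of v] by (simp add: bilinear_ladd[OF B(1)] bilinear_radd[OF B(1)])
  have "u \<in> L" if u: "\<And>v. v \<in> L \<Longrightarrow> B u v = 0" for u
  proof (rule ccontr)
    assume nu: "u \<notin> L"
    have "P (span (insert u L))" unfolding P_def
    proof (intro conjI ballI)
      show "M \<subseteq> span (insert u L)" using L'(2) span_superset by blast
      fix x y assume "x \<in> span (insert u L)" "y \<in> span (insert u L)"
      then obtain k l where k: "x - k *\<^sub>R u \<in> L" "y - l *\<^sub>R u \<in> L"
        unfolding span_insert using span_eq_iff[THEN iffD2, OF L'(1)] by auto
      have "B x y = B ((x - k *\<^sub>R u) + k *\<^sub>R u) ((y - l *\<^sub>R u) + l *\<^sub>R u)" by simp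
      also have "\<dots> = B (x - k *\<^sub>R u) (y - l *\<^sub>R u) + l * B (x - k *\<^sub>R u) u + (k * B u (y - l *\<^sub>R u) + k * (l * B u u))"
        by (simp only: bilinear_ladd[OF B(1)] bilinear_radd[OF B(1)] bilinear_lmul[OF B(1)] bilinear_rmul[OF B(1)]
            real_scaleR_def distrib_left ac_simps)
      also have "\<dots> = 0" using L'(3)[OF k] u[OF k(1)] u[OF k(2)] anti[of "x - k *\<^sub>R u" u] B(2) by simp
      finally show "B x y = 0" .
    qed simp
    hence "dim (insert u L) \<le> dim L" using L(2) by fastforce
    moreover have "dim (insert u L) = Suc (dim L)"
      unfolding dim_insert span_eq_iff[THEN iffD2, OF L'(1)] using nu by simp
    ultimately show False by simp
  qed
  hence "L = {u. \<forall>v\<in>L. B u v = 0}" using L'(3) by blast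
  thus ?thesis using that L' by blast
qed

text \<open>In terms of the Euclidean product, L is the orthogonal complement of its own image under
  an injective linear map J; hence twice the dimension of L is 2n.\<close>

lemma dim_lagrangian_subspace:
  fixes B :: "'n::finite space \<Rightarrow> 'n space \<Rightarrow> real"
  assumes B: "bilinear B" "\<And>u. B u u = 0" "\<And>u. (\<And>v. B u v = 0) \<Longrightarrow> u = 0"
    and L: "subspace L" "L = {u. \<forall>v\<in>L. B u v = 0}"
  shows "dim L = CARD('n)"
proof -
  define J where "J v = (\<chi> i. B (axis i 1) v)" for v
  have lin1: "linear (\<lambda>u. B u v)" and lin2: "linear (B u)" for u v using B(1) by (auto simp: bilinear_def)
  have J: "B u v = J v \<bullet> u" for u v
    using vec_linear_expand[OF lin1, of u v] by (simp add: J_def inner_vec_def mult.commute)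
  have linJ: "linear J"
    by (rule linearI) (simp_all add: J_def vec_eq_iff linear_add[OF lin2] linear_scale[OF lin2])
  have anti: "B u v = - B v u" for u v
    using B(2)[of "u + v"] B(2)[of u] B(2)[of v] by (simp add: bilinear_ladd[OF B(1)] bilinear_radd[OF B(1)])
  have inj: "inj J"
  proof (subst linear_injective_0[OF linJ], safe)
    fix v assume "J v = 0"
    hence "B v u = 0" for u using J[of u v] anti[of v u] by simp
    thus "v = 0" by (rule B(3))
  qed
  have "dim {y \<in> UNIV. \<forall>x\<in>J ` L. orthogonal x y} + dim (J ` L) = dim (UNIV :: 'n space set)"
    by (rule dim_subspace_orthogonal_to_vectors) (auto intro: linear_subspace_image[OF linJ L(1)])
  moreover have "{y \<in> UNIV. \<forall>x\<in>J ` L. orthogonal x y} = L"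
  proof -
    have "{y \<in> UNIV. \<forall>x\<in>J ` L. orthogonal x y} = {u. \<forall>v\<in>L. B u v = 0}"
      by (auto simp: orthogonal_def J)
    thus ?thesis using L(2) by simp
  qed
  moreover have "dim (J ` L) = dim L"
    by (rule dim_image_eq[OF linJ]) (use inj in \<open>blast intro: inj_on_subset\<close>)
  ultimately show ?thesis by simp
qed

text \<open>Linear Darboux coordinates adapted to M: p vanishes on a Lagrangian subspace containing
  M, and nondegeneracy makes q injective on M, which yields the left inverse \<tau> with values in
  M.\<close>

lemma lagrangian_splitting:
  fixes B :: "'n::finite space \<Rightarrow> 'n space \<Rightarrow> real"
  assumes B: "bilinear B" "\<And>u. B u u = 0" "\<And>u. (\<And>v. B u v = 0) \<Longrightarrow> u = 0"
    and M: "subspace M" "\<And>u v. u \<in> M \<Longrightarrow> v \<in> M \<Longrightarrow> B u v = 0"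
  obtains p q :: "'n space \<Rightarrow> real ^ 'n" and \<tau> :: "real ^ 'n \<Rightarrow> 'n space"
  where "linear p" "linear q" "linear \<tau>" "\<And>u v. B u v = p u \<bullet> q v - p v \<bullet> q u"
    "\<And>m. m \<in> M \<Longrightarrow> p m = 0" "\<And>m. m \<in> M \<Longrightarrow> \<tau> (q m) = m" "\<And>x. \<tau> x \<in> M"
proof -
  obtain L where L: "subspace L" "M \<subseteq> L" "L = {u. \<forall>v\<in>L. B u v = 0}"
    using maximal_isotropic[OF B(1,2) M] .
  have anti: "B u v = - B v u" for u v
    using B(2)[of "u + v"] B(2)[of u] B(2)[of v] by (simp add: bilinear_ladd[OF B(1)] bilinear_radd[OF B(1)])
  have lin1: "linear (\<lambda>u. B u v)" and lin2: "linear (B u)" for u v using B(1) by (auto simp: bilinear_def)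
  have "dim (UNIV :: (real ^ 'n) set) = dim L"
    using dim_lagrangian_subspace[OF B L(1,3)] by simp
  then obtain T :: "real ^ 'n \<Rightarrow> 'n space" where T: "linear T" "T ` UNIV = L" "inj_on T UNIV"
    using subspace_isomorphism[OF subspace_UNIV L(1)] by blast
  obtain l where l: "linear l" "l \<circ> T = id" using linear_injective_left_inverse[OF T(1,3)] by blast
  have lT: "l (T a) = a" for a using l(2) by (simp add: fun_eq_iff)
  have Tl: "T (l x) = x" if "x \<in> L" for x using that T(2) lT by force
  define p where "p u = (\<chi> i. B u (T (axis i 1)))" for u
  have p: "linear p"
    by (rule linearI) (simp_all add: p_def vec_eq_iff linear_add[OF lin1] linear_scale[OF lin1])
  have BT: "B u (T a) = p u \<bullet> a" for u a
    using vec_linear_expand[OF linear_compose[OF T(1) lin2], of u a]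
    by (simp add: p_def inner_vec_def o_def mult.commute)
  have p0: "p u = 0 \<longleftrightarrow> u \<in> L" for u
  proof
    assume "p u = 0"
    hence "B u v = 0" if "v \<in> L" for v using BT[of u "l v"] Tl[OF that] by simp
    thus "u \<in> L" using L(3) by blast
  next
    assume "u \<in> L"
    hence "B u (T a) = 0" for a using L(3) T(2) by blast
    thus "p u = 0" by (simp add: p_def vec_eq_iff)
  qed
  have "surj p"
  proof (rule ccontr)
    assume "\<not> surj p"
    hence "span (range p) \<noteq> UNIV"
      unfolding span_eq_iff[THEN iffD2, OF linear_subspace_image[OF p subspace_UNIV]] .
    then obtain a where a: "a \<noteq> 0" "span (range p) \<subseteq> {x. a \<bullet> x = 0}"
      using span_not_univ_subset_hyperplane by blast
    have "p u \<in> {x. a \<bullet> x = 0}" for u by (rule subsetD[OF a(2) span_base]) simp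
    hence "B u (T a) = 0" for u using BT[of u a] by (simp add: inner_commute)
    hence "B (T a) u = 0" for u using anti[of "T a" u] by simp
    hence "T a = 0" by (rule B(3))
    hence "a = 0" using lT[of a] linear_0[OF l(1)] by simp
    thus False using a(1) by simp
  qed
  then obtain s where s: "linear s" "p \<circ> s = id" using linear_surjective_right_inverse[OF p] by blast
  have ps: "p (s a) = a" for a using s(2) by (simp add: fun_eq_iff)
  \<comment> \<open>The image of the section s of p need not be isotropic, and K measures the
    failure. Since the failure is antisymmetric, adding half of it to q restores the Darboux
    formula.\<close>
  define K where "K b = (\<chi> i. B (s (axis i 1)) (s b))" for b
  have K: "linear K"
    by (rule linearI) (simp_all add: K_def vec_eq_iff linear_add[OF s(1)] linear_scale[OF s(1)]
        linear_add[OF lin2] linear_scale[OF lin2])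
  have BK: "B (s a) (s b) = a \<bullet> K b" for a b
    using vec_linear_expand[OF linear_compose[OF s(1) lin1], of "s b" a]
    by (simp add: K_def inner_vec_def o_def)
  define c where "c v = v - s (p v)" for v
  have cL: "c v \<in> L" for v
    using p0[of "c v"] by (simp add: c_def linear_diff[OF p] ps)
  have linc: "linear c" unfolding c_def
    using linear_compose_sub[OF linear_ident linear_compose[OF p s(1)]] by (simp add: o_def)
  define q where "q v = l (c v) + (1 / 2) *\<^sub>R K (p v)" for v
  have q: "linear q" unfolding q_def
    using linear_compose_add[OF linear_compose[OF linc l(1)] linear_compose_scale_right[OF linear_compose[OF p K], of "1/2"]]
    by (simp add: o_def)
  have Bpq: "B u v = p u \<bullet> q v - p v \<bullet> q u" for u v
  proof -
    have 1: "B (s (p u)) (c v) = p u \<bullet> l (c v)" for u v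
      using BT[of "s (p u)" "l (c v)"] Tl[OF cL] by (simp add: ps)
    have 2: "B (c u) (c v) = 0" using L(3) cL by blast
    have "B u v = B (s (p u) + c u) (s (p v) + c v)" by (simp add: c_def)
    also have "\<dots> = B (s (p u)) (s (p v)) + B (s (p u)) (c v) + B (c u) (s (p v)) + B (c u) (c v)"
      by (simp only: bilinear_ladd[OF B(1)] bilinear_radd[OF B(1)])
    also have "\<dots> = p u \<bullet> K (p v) + p u \<bullet> l (c v) - p v \<bullet> l (c u)"
      using 1[of u v] 1[of v u] 2 anti[of "c u" "s (p v)"] BK by simp
    finally have "B u v = p u \<bullet> K (p v) + p u \<bullet> l (c v) - p v \<bullet> l (c u)" .
    moreover have "p u \<bullet> K (p v) = - (p v \<bullet> K (p u))"
      using anti[of "s (p u)" "s (p v)"] by (simp add: BK)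
    ultimately show ?thesis by (simp add: q_def inner_add_right)
  qed
  have pM: "p m = 0" if "m \<in> M" for m using p0 that L(2) by blast
  have "inj_on q M"
  proof (rule inj_onI)
    fix x y assume xy: "x \<in> M" "y \<in> M" "q x = q y"
    have m: "x - y \<in> M" using xy M(1) by (simp add: subspace_diff)
    have "q (x - y) = 0" using xy(3) by (simp add: linear_diff[OF q])
    hence "B (x - y) v = 0" for v using Bpq pM[OF m] by simp
    hence "x - y = 0" by (rule B(3))
    thus "x = y" by simp
  qed
  then obtain \<tau> where \<tau>: "\<tau> ` UNIV \<subseteq> M" "linear \<tau>" "\<forall>v\<in>M. \<tau> (q v) = v"
    using linear_exists_left_inverse_on[OF q M(1)] by blast
  show ?thesis
    by (rule that[OF p q \<tau>(2) Bpq pM]) (use \<tau> in auto)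
qed

section \<open>Behaviour of Lagrangian germs under charts\<close>

lemma lagrangian_germ_transport:
  fixes \<omega> \<omega>' :: "'n::finite form2"
  assumes d: "local_diffeo \<Phi> \<Psi> U V" and H: "lagrangian_germ \<omega>' H"
    and eq: "\<And>y u v. y \<in> U \<Longrightarrow> pullback \<Phi> \<omega> y u v = \<omega>' y u v"
  shows "lagrangian_germ \<omega> (\<lambda>x. H (\<Psi> x))"
proof -
  note D = local_diffeoD[OF d]
  obtain U1 where U1: "open U1" "0 \<in> U1" "smooth_on U1 H"
    and L: "\<forall>x\<in>U1. H x = 0 \<longrightarrow> (\<forall>u v. fd H x u = 0 \<longrightarrow> fd H x v = 0 \<longrightarrow> \<omega>' x u v = 0)"
    using H unfolding lagrangian_germ_def by (elim exE conjE) (rule that)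
  have H0: "H 0 = 0" "surj (fd H 0)" using H unfolding lagrangian_germ_def by simp_all
  define V1 where "V1 = V \<inter> \<Psi> -` U1"
  have V1: "open V1" "0 \<in> V1" unfolding V1_def
    using continuous_open_preimage[OF smooth_on_continuous_on[OF D(8)] D(2) U1(1)] D(4,6) U1(2) by auto
  have \<Psi>: "smooth_on V1 \<Psi>" by (rule smooth_on_subset[OF D(8)]) (auto simp: V1_def)
  have in1: "\<Psi> x \<in> U1" if "x \<in> V1" for x using that by (simp add: V1_def)
  have fdH: "fd (\<lambda>x. H (\<Psi> x)) x v = fd H (\<Psi> x) (fd \<Psi> x v)" if "x \<in> V1" for x v
    by (rule fd_compose[OF U1(3) \<Psi> that in1[OF that]])
  note inv = local_diffeo_fd_inverse[OF local_diffeo_sym[OF d]]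
  show ?thesis
    unfolding lagrangian_germ_def
  proof (intro conjI exI[of _ V1] ballI impI allI)
    show "H (\<Psi> 0) = 0" using H0 D(6) by simp
    show "surj (fd (\<lambda>x. H (\<Psi> x)) 0)"
    proof (rule surjI)
      fix w
      have "fd H 0 (inv (fd H 0) w) = w" using H0(2) by (simp add: surj_f_inv_f)
      thus "fd (\<lambda>x. H (\<Psi> x)) 0 (fd \<Phi> 0 (inv (fd H 0) w)) = w"
        using fdH[OF V1(2)] inv(2)[OF D(4)] D(6) by simp
    qed
    show "smooth_on V1 (\<lambda>x. H (\<Psi> x))" by (rule smooth_on_compose[OF U1(3) V1(1) \<Psi> in1])
    fix x u v assume x: "x \<in> V1" and z: "H (\<Psi> x) = 0" "fd (\<lambda>x. H (\<Psi> x)) x u = 0" "fd (\<lambda>x. H (\<Psi> x)) x v = 0"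
    have xV: "x \<in> V" using x by (simp add: V1_def)
    have "\<omega>' (\<Psi> x) (fd \<Psi> x u) (fd \<Psi> x v) = 0"
      using L[rule_format, OF in1[OF x] z(1)] z(2,3) fdH[OF x] by simp
    hence "\<omega> (\<Phi> (\<Psi> x)) (fd \<Phi> (\<Psi> x) (fd \<Psi> x u)) (fd \<Phi> (\<Psi> x) (fd \<Psi> x v)) = 0"
      using eq[OF D(10)[OF xV]] by (simp add: pullback_def)
    thus "\<omega> x u v = 0" using inv(1)[OF xV] D(12)[OF xV] by simp
  qed (fact V1)+
qed

lemma lagrangian_germ_pullback:
  fixes \<omega> :: "'n::finite form2"
  assumes d: "local_diffeo \<Phi> \<Psi> U V" and H: "lagrangian_germ \<omega> H"
  shows "lagrangian_germ (pullback \<Phi> \<omega>) (\<lambda>x. H (\<Phi> x))"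
proof (rule lagrangian_germ_transport[OF local_diffeo_sym[OF d] H])
  fix y u v assume y: "y \<in> V"
  show "pullback \<Psi> (pullback \<Phi> \<omega>) y u v = \<omega> y u v"
    using local_diffeo_fd_inverse(1)[OF local_diffeo_sym[OF d] y] local_diffeoD(12)[OF d y]
    by (simp add: pullback_def)
qed

lemma lagrangian_germ_cong:
  assumes "lagrangian_germ \<omega> H" "open U" "0 \<in> U" "\<And>x u v. x \<in> U \<Longrightarrow> \<omega> x u v = \<omega>' x u v"
  shows "lagrangian_germ \<omega>' H"
proof -
  have "local_diffeo (\<lambda>x. x) (\<lambda>x. x) U U"
    using assms(2,3) by (simp add: local_diffeo_def homeomorphism_def smooth_on_ident)
  from lagrangian_germ_transport[OF this assms(1)] show ?thesis
    using assms(4) by (simp add: pullback_def fd_eqI[OF has_derivative_ident])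
qed

lemma fd_linear: "linear f \<Longrightarrow> fd f x = f" for f :: "'a::euclidean_space \<Rightarrow> 'b::real_normed_vector"
  by (rule fd_eqI) (rule linear_imp_has_derivative)

lemma smooth_on_linear: "linear f \<Longrightarrow> open S \<Longrightarrow> smooth_on S f" for f :: "'a::euclidean_space \<Rightarrow> 'b::real_normed_vector"
  by (simp add: smooth_on_bounded_linear linear_conv_bounded_linear)

text \<open>The Moser deformation of \<open>d\<beta>\<close> to a form which is constant up to a pullback from \<open>M\<close>; its
  generating 1-form \<open>\<mu>\<close> is normalized by an exact form so as to vanish on \<open>M\<close> and to second order at 0.\<close>

lemma moser_primitive:
  fixes \<nu> :: "'n::finite form1" and \<pi> :: "'n space \<Rightarrow> 'n space"
  assumes \<nu>: "form1_on (ball 0 r) \<nu>" and r: "r > 0" and \<pi>: "linear \<pi>" "\<And>x. \<pi> (\<pi> x) = \<pi> x"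
    and \<pi>r: "\<And>x. x \<in> ball 0 r' \<Longrightarrow> \<pi> x \<in> ball 0 r" and r': "0 < r'" "r' \<le> r"
    and \<nu>M: "\<And>x u. x \<in> ball 0 r \<Longrightarrow> \<pi> x = x \<Longrightarrow> \<nu> x (\<pi> u) = 0"
    and d0: "\<And>u v. d_form1 \<nu> 0 u v = 0"
  obtains \<mu> where "form1_on (ball 0 r') \<mu>" "\<And>x u v. x \<in> ball 0 r' \<Longrightarrow> d_form1 \<mu> x u v = d_form1 \<nu> x u v"
    "\<And>x u. x \<in> ball 0 r' \<Longrightarrow> \<pi> x = x \<Longrightarrow> \<mu> x u = 0" "\<And>u v. fd (\<lambda>y. \<mu> y u) 0 v = 0"
proof -
  let ?B = "ball (0::'n space) r'"
  define c where "c x = x - \<pi> x" for x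
  have c: "linear c" unfolding c_def by (rule linear_compose_sub[OF linear_ident \<pi>(1)])
  have c0: "c x = 0 \<longleftrightarrow> \<pi> x = x" for x by (auto simp: c_def)
  have \<pi>0: "\<pi> 0 = 0" by (rule linear_0[OF \<pi>(1)])
  have c00: "c 0 = 0" by (rule linear_0[OF c])
  \<comment> \<open>The first derivative of \<nu> at 0 as a bilinear form; it is symmetric because
    d\<nu> vanishes at 0.\<close>
  define \<kappa> where "\<kappa> u v = fd (\<lambda>y. \<nu> y v) 0 u" for u v
  have B0: "0 \<in> ball (0::'n space) r" using r by simp
  have \<kappa>1: "linear (\<lambda>u. \<kappa> u v)" for v unfolding \<kappa>_def
    using bounded_linear.linear[OF smooth_on_linear_fd[OF form1_onD(2)[OF \<nu>] B0]] .
  have \<kappa>2: "linear (\<kappa> u)" for u unfolding \<kappa>_def by (rule form1_fd_linear[OF \<nu> open_ball B0])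
  have \<kappa>b: "bilinear \<kappa>" using \<kappa>1 \<kappa>2 by (simp add: bilinear_def)
  have \<kappa>_sym: "\<kappa> u v = \<kappa> v u" for u v using d0[of u v] by (simp add: d_form1_def \<kappa>_def)
  \<comment> \<open>Along M the form \<nu> is zero on vectors tangent to M, so this block of its
    derivative vanishes.\<close>
  have \<kappa>MM: "\<kappa> (\<pi> u) (\<pi> v) = 0" for u v
  proof -
    have "((\<lambda>t. \<nu> (t *\<^sub>R \<pi> u) (\<pi> v)) has_derivative (\<lambda>t. fd (\<lambda>y. \<nu> y (\<pi> v)) (0 *\<^sub>R \<pi> u) (t *\<^sub>R \<pi> u))) (at 0)"
      by (rule has_derivative_compose[OF _ smooth_on_has_derivative[OF form1_onD(2)[OF \<nu>]]])
        (use r in \<open>auto intro!: derivative_eq_intros\<close>)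
    hence 1: "fd (\<lambda>t. \<nu> (t *\<^sub>R \<pi> u) (\<pi> v)) 0 1 = \<kappa> (\<pi> u) (\<pi> v)"
      by (simp add: fd_eqI \<kappa>_def)
    define S where "S = (\<lambda>t. t *\<^sub>R \<pi> u) -` ball 0 r"
    have S: "open S" "0 \<in> S" unfolding S_def using r
      by (auto intro!: open_vimage continuous_on_scaleR continuous_on_id continuous_on_const)
    have "fd (\<lambda>t. \<nu> (t *\<^sub>R \<pi> u) (\<pi> v)) 0 = fd (\<lambda>t. 0) 0"
      by (rule fd_cong[OF S]) (use \<nu>M in \<open>simp add: S_def linear_scale[OF \<pi>(1)] \<pi>(2)\<close>)
    thus ?thesis using 1 by (simp add: fd_eqI[OF has_derivative_const])
  qed
  \<comment> \<open>On M the first term has differential \<nu>, as \<nu> is zero on vectors tangent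
    to M. The quadratic term supplies the part of \<kappa> in two directions complementary to M,
    which the first term misses.\<close>
  define F where "F x = \<nu> (\<pi> x) (c x) + (1 / 2) * \<kappa> (c x) (c x)" for x
  have s\<pi>: "smooth_on ?B \<pi>" and sc: "smooth_on ?B c" by (intro smooth_on_linear \<pi> c open_ball)+
  have \<kappa>form: "form1_on UNIV (\<lambda>x. \<kappa> x)"
    using \<kappa>1 \<kappa>2 by (simp add: form1_on_def smooth_on_linear)
  have sF: "smooth_on ?B F" unfolding F_def
    by (intro smooth_intros open_ball form1_smooth_along[OF \<nu> open_ball \<pi>r s\<pi> sc]
        form1_smooth_along[OF \<kappa>form open_ball UNIV_I sc sc])
  have fdF: "fd F x u = fd (\<lambda>y. \<nu> y (c x)) (\<pi> x) (\<pi> u) + \<nu> (\<pi> x) (c u) + \<kappa> (c u) (c x)" if x: "x \<in> ?B" for x u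
  proof -
    have 1: "((\<lambda>x. \<nu> (\<pi> x) (c x)) has_derivative (\<lambda>u. fd (\<lambda>y. \<nu> y (c x)) (\<pi> x) (\<pi> u) + \<nu> (\<pi> x) (c u))) (at x)"
      by (rule form1_has_derivative[OF \<nu> open_ball open_ball x \<pi>r linear_imp_has_derivative[OF \<pi>(1)]
            linear_imp_has_derivative[OF c]])
    have 2: "((\<lambda>x. \<kappa> (c x) (c x)) has_derivative (\<lambda>u. fd (\<lambda>y. \<kappa> y (c x)) (c x) (c u) + \<kappa> (c x) (c u))) (at x)"
      by (rule form1_has_derivative[OF \<kappa>form open_UNIV open_ball x UNIV_I linear_imp_has_derivative[OF c]
            linear_imp_has_derivative[OF c]])
    have 3: "fd (\<lambda>y. \<kappa> y (c x)) (c x) (c u) = \<kappa> (c u) (c x)" by (simp add: fd_linear[OF \<kappa>1])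
    have "(F has_derivative (\<lambda>u. (fd (\<lambda>y. \<nu> y (c x)) (\<pi> x) (\<pi> u) + \<nu> (\<pi> x) (c u))
        + (1 / 2) * (fd (\<lambda>y. \<kappa> y (c x)) (c x) (c u) + \<kappa> (c x) (c u)))) (at x)"
      unfolding F_def[abs_def] by (intro has_derivative_add 1 has_derivative_mult_right 2)
    from fun_cong[OF fd_eqI[OF this], of u] show ?thesis by (simp add: 3 \<kappa>_sym[of "c x"])
  qed
  define \<mu> where "\<mu> x u = \<nu> x u - fd F x u" for x u
  have \<nu>B: "form1_on ?B \<nu>" by (rule form1_on_subset[OF \<nu>]) (use r' in auto)
  have FB: "form1_on ?B (\<lambda>x. fd F x)"
    unfolding form1_on_def using bounded_linear.linear[OF smooth_on_linear_fd[OF sF]] smooth_on_fd[OF sF] by blast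
  have x0: "0 \<in> ?B" using r' by simp
  show ?thesis
  proof (rule that[of \<mu>])
    show "form1_on ?B \<mu>" unfolding \<mu>_def by (rule form1_on_diff[OF open_ball \<nu>B FB])
    show "d_form1 \<mu> x u v = d_form1 \<nu> x u v" if "x \<in> ?B" for x u v
      unfolding \<mu>_def d_form1_diff[OF \<nu>B FB that]
      using smooth_on_fd_commute[OF sF open_ball that, of u v] by (simp add: d_form1_def)
    show "\<mu> x u = 0" if x: "x \<in> ?B" "\<pi> x = x" for x u
    proof -
      have xr: "x \<in> ball 0 r" using x r' by simp
      have "fd (\<lambda>y. \<nu> y 0) x (\<pi> u) = 0"
        using linear_0[OF form1_fd_linear[OF \<nu> open_ball xr]] .
      moreover have "\<nu> x u = \<nu> x (\<pi> u) + \<nu> x (c u)"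
        using linear_add[OF form1_onD(1)[OF \<nu> xr], of "\<pi> u" "c u"] by (simp add: c_def)
      moreover have "c x = 0" using x(2) c0 by simp
      ultimately show ?thesis
        using \<nu>M[OF xr x(2), of u] x(2) linear_0[OF \<kappa>2] by (simp add: \<mu>_def fdF[OF x(1)])
    qed
    fix u v
    define N where "N x w = fd (\<lambda>y. \<nu> y w) x (\<pi> u)" for x w
    have N: "form1_on (ball 0 r) N"
      unfolding form1_on_def N_def using form1_fd_linear[OF \<nu> open_ball] smooth_on_fd[OF form1_onD(2)[OF \<nu>]] by auto
    have N1: "((\<lambda>x. N (\<pi> x) (c x)) has_derivative (\<lambda>v. fd (\<lambda>y. N y (c 0)) (\<pi> 0) (\<pi> v) + N (\<pi> 0) (c v))) (at 0)"
      by (rule form1_has_derivative[OF N open_ball open_ball x0 \<pi>r linear_imp_has_derivative[OF \<pi>(1)]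
            linear_imp_has_derivative[OF c]])
    have N2: "((\<lambda>x. \<nu> (\<pi> x) (c u)) has_derivative (\<lambda>v. fd (\<lambda>y. \<nu> y (c u)) (\<pi> 0) (\<pi> v))) (at 0)"
      by (rule has_derivative_compose[OF linear_imp_has_derivative[OF \<pi>(1)] smooth_on_has_derivative[OF form1_onD(2)[OF \<nu>]]])
        (use r \<pi>0 in simp)
    have N3: "((\<lambda>x. \<kappa> (c u) (c x)) has_derivative (\<lambda>v. \<kappa> (c u) (c v))) (at 0)"
      using linear_imp_has_derivative[OF linear_compose[OF c \<kappa>2]] by (simp add: o_def)
    have "((\<lambda>x. N (\<pi> x) (c x) + \<nu> (\<pi> x) (c u) + \<kappa> (c u) (c x)) has_derivative
      (\<lambda>v. (fd (\<lambda>y. N y (c 0)) (\<pi> 0) (\<pi> v) + N (\<pi> 0) (c v)) + fd (\<lambda>y. \<nu> y (c u)) (\<pi> 0) (\<pi> v) + \<kappa> (c u) (c v))) (at 0)"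
      by (intro has_derivative_add N1 N2 N3)
    from fun_cong[OF fd_eqI[OF this], of v]
    have "fd (\<lambda>x. N (\<pi> x) (c x) + \<nu> (\<pi> x) (c u) + \<kappa> (c u) (c x)) 0 v = \<kappa> (\<pi> u) (c v) + \<kappa> (\<pi> v) (c u) + \<kappa> (c u) (c v)"
      unfolding c00 \<pi>0 using linear_0[OF form1_fd_linear[OF N open_ball B0]] by (simp add: N_def \<kappa>_def)
    moreover have "fd (\<lambda>x. fd F x u) 0 = fd (\<lambda>x. N (\<pi> x) (c x) + \<nu> (\<pi> x) (c u) + \<kappa> (c u) (c x)) 0"
      by (rule fd_cong[OF open_ball x0]) (simp add: fdF N_def)
    moreover have "fd (\<lambda>y. \<mu> y u) 0 v = fd (\<lambda>y. \<nu> y u) 0 v - fd (\<lambda>x. fd F x u) 0 v"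
      unfolding \<mu>_def by (rule fd_diff[OF smooth_on_differentiable[OF form1_onD(2)[OF \<nu>B] x0]
            smooth_on_differentiable[OF smooth_on_fd[OF sF] x0]])
    moreover have "fd (\<lambda>y. \<nu> y u) 0 v = \<kappa> (\<pi> v + c v) (\<pi> u + c u)" by (simp add: \<kappa>_def c_def)
    moreover have "\<dots> = \<kappa> (\<pi> v) (c u) + \<kappa> (c v) (\<pi> u) + \<kappa> (c v) (c u)"
      using \<kappa>MM by (simp add: bilinear_ladd[OF \<kappa>b] bilinear_radd[OF \<kappa>b])
    ultimately show "fd (\<lambda>y. \<mu> y u) 0 v = 0"
      using \<kappa>_sym[of "c v" "\<pi> u"] \<kappa>_sym[of "c v" "c u"] by simp
  qed
qed

text \<open>An isotopy fixing M pointwise turns d\<beta> into \<omega>1, the constant form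
  d\<beta>(0) plus the pullback of d\<beta> by the projection \<pi> to M. For \<omega>1 a Lagrangian
  germ can be written down, \<open>p y + G y = 0\<close> with \<open>G\<close> made of components of
  \<beta> at the projected point. On M both p and the isotopy disappear, so the equations become
  components of \<beta>.\<close>

lemma lagrangian_of_primitive:
  fixes \<beta> :: "'n::finite form1"
  assumes U: "open U" "0 \<in> U" and \<beta>: "form1_on U \<beta>" and nondeg: "\<And>u. (\<And>v. d_form1 \<beta> 0 u v = 0) \<Longrightarrow> u = 0"
    and M: "subspace M" "\<And>u v. u \<in> M \<Longrightarrow> v \<in> M \<Longrightarrow> d_form1 \<beta> 0 u v = 0"
    and \<beta>0: "\<And>u. \<beta> 0 u = 0"
  obtains H \<delta> \<tau> where "lagrangian_germ (d_form1 \<beta>) H" "\<delta> > 0"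
    "\<And>y i. y \<in> M \<Longrightarrow> y \<in> ball 0 \<delta> \<Longrightarrow> y \<in> U \<and> H y $ i = \<beta> y (\<tau> i)"
proof -
  obtain r where r: "r > 0" "ball 0 r \<subseteq> U" using U open_contains_ball by blast
  let ?R = "ball (0::'n space) r"
  have R0: "0 \<in> ?R" using r by simp
  have \<beta>R: "form1_on ?R \<beta>" by (rule form1_on_subset[OF \<beta> r(2)])
  define \<omega> where "\<omega> = d_form1 \<beta>"
  have \<omega>: "form2_on ?R \<omega>" unfolding \<omega>_def by (rule form2_on_d_form1[OF \<beta>R open_ball])
  note b0 = form2_onD(1)[OF \<omega> R0]
  note nd = nondeg[folded \<omega>_def] and iso = M(2)[folded \<omega>_def]
  obtain p q :: "'n space \<Rightarrow> real ^ 'n" and \<tau> :: "real ^ 'n \<Rightarrow> 'n space" where pq: "linear p" "linear q" "linear \<tau>" "\<And>u v. \<omega> 0 u v = p u \<bullet> q v - p v \<bullet> q u"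
    "\<And>m. m \<in> M \<Longrightarrow> p m = 0" "\<And>m. m \<in> M \<Longrightarrow> \<tau> (q m) = m" "\<And>x. \<tau> x \<in> M"
    by (rule lagrangian_splitting[OF b0 form2_onD(2)[OF \<omega> R0] nd M(1) iso]) blast+
  define \<pi> where "\<pi> x = \<tau> (q x)" for x
  have \<pi>: "linear \<pi>" unfolding \<pi>_def using linear_compose[OF pq(2,3)] by (simp add: o_def)
  have \<pi>M: "\<pi> x \<in> M" for x by (simp add: \<pi>_def pq(7))
  have \<pi>fix: "\<pi> x = x \<longleftrightarrow> x \<in> M" for x using \<pi>M[of x] pq(6)[of x] by (auto simp: \<pi>_def)
  have \<pi>\<pi>: "\<pi> (\<pi> x) = \<pi> x" for x using \<pi>fix \<pi>M by simp
  have \<pi>0: "\<pi> 0 = 0" by (rule linear_0[OF \<pi>])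
  obtain r' where r': "0 < r'" "r' \<le> r" "\<And>x. x \<in> ball 0 r' \<Longrightarrow> \<pi> x \<in> ?R"
  proof -
    have "open (\<pi> -` ?R)" by (intro open_vimage linear_continuous_on \<pi>[unfolded linear_conv_bounded_linear]) auto
    moreover have "0 \<in> \<pi> -` ?R" using \<pi>0 R0 by simp
    ultimately obtain e where "e > 0" "ball 0 e \<subseteq> \<pi> -` ?R" using open_contains_ball by blast
    thus ?thesis using that[of "min e r"] r(1) by (auto simp: subset_iff)
  qed
  let ?B = "ball (0::'n space) r'"
  have B0: "0 \<in> ?B" using r' by simp
  have BR: "?B \<subseteq> ?R" using r' by auto
  have lin0: "linear (\<omega> 0 x)" "linear (\<lambda>x. \<omega> 0 x u)" for x u using form2_onD(4,5)[OF \<omega> R0] by auto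
  \<comment> \<open>Half the contraction of a constant form with x is a primitive of that
    form.\<close>
  define \<xi>0 where "\<xi>0 x u = (1 / 2) * \<omega> 0 x u" for x u
  have lh: "linear (\<xi>0 x)" "linear (\<lambda>x. \<xi>0 x u)" for x u
    unfolding \<xi>0_def using linear_compose_scale_right[OF lin0(1), of "1/2"] linear_compose_scale_right[OF lin0(2), of "1/2"] by simp_all
  have \<xi>0: "form1_on ?B \<xi>0" unfolding form1_on_def using lh smooth_on_linear by blast
  have s\<pi>: "smooth_on ?B \<pi>" by (rule smooth_on_linear[OF \<pi> open_ball])
  note \<xi>1 = form1_on_pullback1[OF \<beta>R open_ball s\<pi> r'(3)]
  define \<xi> where "\<xi> x u = \<xi>0 x u + pullback1 \<pi> \<beta> x u" for x u
  have \<xi>: "form1_on ?B \<xi>" unfolding \<xi>_def by (rule form1_on_add[OF open_ball \<xi>0 \<xi>1])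
  define \<omega>1 where "\<omega>1 = d_form1 \<xi>"
  have \<omega>1_eq: "\<omega>1 x u v = \<omega> 0 u v + \<omega> (\<pi> x) (\<pi> u) (\<pi> v)" if "x \<in> ?B" for x u v
  proof -
    have "d_form1 \<xi>0 x u v = \<omega> 0 u v"
      using form2_antisym[OF \<omega> R0, of v u] by (simp add: d_form1_def fd_linear[OF lh(2)]) (simp add: \<xi>0_def)
    moreover have "d_form1 (pullback1 \<pi> \<beta>) x u v = \<omega> (\<pi> x) (\<pi> u) (\<pi> v)"
      using d_form1_pullback1[OF \<beta>R open_ball open_ball s\<pi> r'(3) that] by (simp add: pullback_def fd_linear[OF \<pi>] \<omega>_def)
    moreover have "\<omega>1 x u v = d_form1 \<xi>0 x u v + d_form1 (pullback1 \<pi> \<beta>) x u v"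
      using d_form1_add[OF \<xi>0 \<xi>1 that, of u v] by (simp only: \<omega>1_def \<xi>_def[abs_def])
    ultimately show ?thesis by simp
  qed
  have \<beta>B: "form1_on ?B \<beta>" by (rule form1_on_subset[OF \<beta>R BR])
  define \<nu> where "\<nu> x u = \<beta> x u - \<xi> x u" for x u
  obtain s where s: "0 < s" "s \<le> r'" "\<And>x. x \<in> ball 0 s \<Longrightarrow> \<pi> x \<in> ?B"
  proof -
    have "open (\<pi> -` ?B)" by (intro open_vimage linear_continuous_on \<pi>[unfolded linear_conv_bounded_linear]) auto
    moreover have "0 \<in> \<pi> -` ?B" using \<pi>0 B0 by simp
    ultimately obtain e where "e > 0" "ball 0 e \<subseteq> \<pi> -` ?B" using open_contains_ball by blast
    thus ?thesis using that[of "min e r'"] r'(1) by (auto simp: subset_iff)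
  qed
  let ?S = "ball (0::'n space) s"
  have SB: "?S \<subseteq> ?B" using s by auto
  have S0: "0 \<in> ?S" using s by simp
  have \<nu>: "form1_on ?B \<nu>" unfolding \<nu>_def by (rule form1_on_diff[OF open_ball \<beta>B \<xi>])
  have d\<nu>: "d_form1 \<nu> x u v = \<omega> x u v - \<omega>1 x u v" if "x \<in> ?B" for x u v
    unfolding \<nu>_def d_form1_diff[OF \<beta>B \<xi> that] \<omega>_def \<omega>1_def ..
  \<comment> \<open>M is isotropic at 0, so the summand of \<omega>1 that is pulled back from M
    vanishes there.\<close>
  have eq0: "\<omega> 0 u v = \<omega>1 0 u v" for u v
    using \<omega>1_eq[OF B0, of u v] iso[OF \<pi>M \<pi>M] \<pi>0 by simp
  obtain \<mu> where \<mu>: "form1_on ?S \<mu>" "\<And>x u v. x \<in> ?S \<Longrightarrow> d_form1 \<mu> x u v = d_form1 \<nu> x u v"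
    "\<And>x u. x \<in> ?S \<Longrightarrow> \<pi> x = x \<Longrightarrow> \<mu> x u = 0" "\<And>u v. fd (\<lambda>y. \<mu> y u) 0 v = 0"
  proof (rule moser_primitive[OF \<nu> r'(1) \<pi> \<pi>\<pi> s(3,1,2)])
    show "\<nu> x (\<pi> u) = 0" if "x \<in> ?B" "\<pi> x = x" for x u
    proof -
      have "\<xi>0 x (\<pi> u) = 0" using iso[of x "\<pi> u"] that(2) \<pi>fix \<pi>M by (simp add: \<xi>0_def)
      thus ?thesis using that by (simp add: \<nu>_def \<xi>_def pullback1_def fd_linear[OF \<pi>] \<pi>\<pi>)
    qed
    show "d_form1 \<nu> 0 u v = 0" for u v using d\<nu>[OF B0] eq0 by simp
  qed (assumption | rule that)+
  have \<omega>1S: "form2_on ?S \<omega>1" unfolding \<omega>1_def by (rule form2_on_d_form1[OF form1_on_subset[OF \<xi> SB] open_ball])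
  have \<omega>S: "form2_on ?S \<omega>" by (rule form2_on_subset[OF \<omega>]) (use SB BR in blast)
  obtain \<delta> \<phi> where \<phi>: "\<delta> > 0" "smooth_on (ball 0 \<delta>) \<phi>" "\<And>y. y \<in> ball 0 \<delta> \<Longrightarrow> \<phi> y \<in> ?S"
    "\<And>y u v. y \<in> ball 0 \<delta> \<Longrightarrow> pullback \<phi> \<omega> y u v = \<omega>1 y u v"
    "\<And>y. y \<in> ball 0 \<delta> \<Longrightarrow> (\<And>u. \<mu> y u = 0) \<Longrightarrow> \<phi> y = y"
  proof (rule moser_isotopy[OF s(1) \<omega>S \<omega>1S \<mu>(1)])
    fix x u v w assume x: "x \<in> ?S"
    hence xB: "x \<in> ?B" and xR: "x \<in> ?R" using SB BR by blast+
    show "d_form2 \<omega> x u v w = 0" unfolding \<omega>_def by (rule d_form2_d_form1[OF \<beta>R open_ball xR])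
    show "d_form2 \<omega>1 x u v w = 0" unfolding \<omega>1_def by (rule d_form2_d_form1[OF \<xi> open_ball xB])
    show "d_form1 \<mu> x u v = \<omega> x u v - \<omega>1 x u v" unfolding \<mu>(2)[OF x] by (rule d\<nu>[OF xB])
  next
    show "\<omega> 0 u v = \<omega>1 0 u v" for u v by (rule eq0)
    show "u = 0" if "\<And>v. \<omega> 0 u v = 0" for u using nd that .
    show "\<mu> 0 u = 0" for u by (rule \<mu>(3)[OF S0 \<pi>0])
    show "fd (\<lambda>y. \<mu> y u) 0 v = 0" for u v by (rule \<mu>(4))
  next
    fix \<delta> and \<phi> :: "'n space \<Rightarrow> 'n space"
    assume a: "\<delta> > 0" "smooth_on (ball 0 \<delta>) \<phi>" "\<And>y. y \<in> ball 0 \<delta> \<Longrightarrow> \<phi> y \<in> ?S"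
      "\<And>y u v. y \<in> ball 0 \<delta> \<Longrightarrow> pullback \<phi> \<omega> y u v = \<omega>1 y u v"
      "\<And>y. y \<in> ball 0 \<delta> \<Longrightarrow> (\<And>u. \<mu> y u = 0) \<Longrightarrow> \<phi> y = y"
    show thesis by (rule that[OF a])
  qed
  have D0: "0 \<in> ball (0::'n space) \<delta>" using \<phi>(1) by simp
  have \<phi>M: "\<phi> y = y" if "y \<in> M" "y \<in> ball 0 \<delta>" "y \<in> ?S" for y
    by (rule \<phi>(5)[OF that(2) \<mu>(3)[OF that(3)]]) (use \<pi>fix that in simp)
  have M0: "0 \<in> M" by (rule subspace_0[OF M(1)])
  have \<phi>0: "\<phi> 0 = 0" by (rule \<phi>M[OF M0 D0 S0])
  have inj: "w = 0" if "fd \<phi> 0 w = 0" for w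
  proof (rule nd)
    fix v
    have "\<omega>1 0 w v = \<omega> (\<phi> 0) (fd \<phi> 0 w) (fd \<phi> 0 v)" using \<phi>(4)[OF D0] by (simp add: pullback_def)
    thus "\<omega> 0 w v = 0" using that \<phi>0 eq0 linear_0[OF lin0(2)] by simp
  qed
  obtain U' V g where g: "open U'" "U' \<subseteq> ball 0 \<delta>" "0 \<in> U'" "open V" "\<phi> 0 \<in> V" "homeomorphism U' V \<phi> g" "smooth_on V g"
    using smooth_inverse_function[OF open_ball D0 \<phi>(2) inj] .
  have ld: "local_diffeo \<phi> g U' V"
    unfolding local_diffeo_def using g \<phi>0 smooth_on_subset[OF \<phi>(2) g(2)] by simp
  define G where "G y = (\<chi> i. \<beta> (\<pi> y) (\<tau> (axis i 1)))" for y
  define H1 where "H1 y = p y + G y" for y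
  have sG: "smooth_on ?B G" unfolding G_def
    by (intro smooth_intros open_ball smooth_on_compose[OF form1_onD(2)[OF \<beta>R] open_ball s\<pi> r'(3)])
  have fdG: "fd G x u \<bullet> a = fd (\<lambda>y. \<beta> y (\<tau> a)) (\<pi> x) (\<pi> u)" if x: "x \<in> ?B" for x u a
  proof -
    have "fd G x u \<bullet> a = (\<Sum>i\<in>UNIV. a $ i * (fd G x u $ i))" by (simp add: inner_vec_def mult.commute)
    also have "\<dots> = (\<Sum>i\<in>UNIV. a $ i * fd (\<lambda>y. \<beta> y (\<tau> (axis i 1))) (\<pi> x) (\<pi> u))"
    proof (rule sum.cong[OF refl])
      fix i
      have "((\<lambda>x. G x $ i) has_derivative (\<lambda>u. fd G x u $ i)) (at x)"
        by (rule bounded_linear.has_derivative[OF bounded_linear_vec_nth smooth_on_has_derivative[OF sG x]])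
      moreover have "((\<lambda>x. \<beta> (\<pi> x) (\<tau> (axis i 1))) has_derivative (\<lambda>u. fd (\<lambda>y. \<beta> y (\<tau> (axis i 1))) (\<pi> x) (\<pi> u))) (at x)"
        by (rule has_derivative_compose[OF linear_imp_has_derivative[OF \<pi>] smooth_on_has_derivative[OF form1_onD(2)[OF \<beta>R] r'(3)[OF x]]])
      ultimately have "(\<lambda>u. fd G x u $ i) = (\<lambda>u. fd (\<lambda>y. \<beta> y (\<tau> (axis i 1))) (\<pi> x) (\<pi> u))"
        unfolding G_def vec_lambda_beta by (rule has_derivative_unique)
      thus "a $ i * (fd G x u $ i) = a $ i * fd (\<lambda>y. \<beta> y (\<tau> (axis i 1))) (\<pi> x) (\<pi> u)" by (simp add: fun_eq_iff)
    qed
    also have "\<dots> = fd (\<lambda>y. \<beta> y (\<tau> a)) (\<pi> x) (\<pi> u)"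
      using vec_linear_expand[OF linear_compose[OF pq(3) form1_fd_linear[OF \<beta>R open_ball r'(3)[OF x], of "\<pi> u"]], of a]
      by (simp add: o_def)
    finally show ?thesis .
  qed
  have H1s: "smooth_on ?B H1" unfolding H1_def by (intro smooth_intros open_ball sG smooth_on_linear pq(1))
  have fdH1: "fd H1 x u = p u + fd G x u" if "x \<in> ?B" for x u
    unfolding H1_def using fd_add[OF linear_imp_differentiable[OF pq(1)] smooth_on_differentiable[OF sG that]]
    by (simp add: fd_linear[OF pq(1)])
  \<comment> \<open>Allows choosing, for each value of p, a vector with \<open>q u = 0\<close>. Its
    projection \<open>\<pi> u\<close> is zero, so \<open>G\<close> contributes nothing to the
    differential at 0 in this direction.\<close>
  have surj_pq: "surj (\<lambda>u. (p u, q u))"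
  proof -
    have l: "linear (\<lambda>u. (p u, q u))"
      by (rule linearI) (simp_all add: linear_add[OF pq(1)] linear_add[OF pq(2)] linear_scale[OF pq(1)] linear_scale[OF pq(2)])
    have i: "inj (\<lambda>u. (p u, q u))"
    proof (subst linear_injective_0[OF l], intro allI impI)
      fix u assume "(p u, q u) = 0"
      hence "p u = 0" "q u = 0" by (simp_all add: prod_eq_iff)
      hence "\<omega> 0 u v = 0" for v by (simp add: pq(4))
      thus "u = 0" by (rule nd)
    qed
    have "dim (range (\<lambda>u. (p u, q u))) = dim (UNIV :: 'n space set)"
      by (rule dim_image_eq[OF l]) (use i in simp)
    hence "dim (range (\<lambda>u. (p u, q u))) = DIM((real ^ 'n) \<times> (real ^ 'n))" by simp
    hence "span (range (\<lambda>u. (p u, q u))) = UNIV" by (simp only: dim_eq_full)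
    thus ?thesis unfolding span_eq_iff[THEN iffD2, OF linear_subspace_image[OF l subspace_UNIV]] .
  qed
  have lag1: "lagrangian_germ \<omega>1 H1"
    unfolding lagrangian_germ_def
  proof (intro conjI exI[of _ ?B] ballI impI allI)
    show "H1 0 = 0" by (simp add: H1_def G_def \<pi>0 \<beta>0 linear_0[OF pq(1)] vec_eq_iff)
    show "surj (fd H1 0)"
    proof (rule surjI)
      fix w
      obtain u where "(w, 0) = (p u, q u)" using surjD[OF surj_pq, of "(w, 0)"] by (elim exE)
      hence u: "p u = w" "q u = 0" by simp_all
      show "fd H1 0 (SOME u. p u = w \<and> q u = 0) = w"
      proof (rule someI2[of "\<lambda>u. p u = w \<and> q u = 0" u])
        fix u assume u: "p u = w \<and> q u = 0"
        hence "\<pi> u = 0" by (simp add: \<pi>_def linear_0[OF pq(3)])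
        hence "fd G 0 u \<bullet> a = 0" for a
          unfolding fdG[OF B0] \<pi>0
          using linear_0[OF bounded_linear.linear[OF smooth_on_linear_fd[OF form1_onD(2)[OF \<beta>R] R0]]] by simp
        from this[of "fd G 0 u"] have "fd G 0 u = 0" by simp
        thus "fd H1 0 u = w" using u by (simp add: fdH1[OF B0])
      qed (use u in simp)
    qed
    show "smooth_on ?B H1" by (rule H1s)
    \<comment> \<open>Tangent vectors satisfy \<open>p u = - fd G x u\<close>. Inserted into the
      Darboux formula, with \<open>\<tau> (q v) = \<pi> v\<close>, this makes the constant summand
      the negative of the pulled-back one.\<close>
    fix x u v assume x: "x \<in> ?B" and z: "fd H1 x u = 0" "fd H1 x v = 0"
    have pu: "p u = - fd G x u" "p v = - fd G x v"
      using z fdH1[OF x] by (simp_all add: eq_neg_iff_add_eq_0)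
    have "\<omega> 0 u v = - (fd G x u \<bullet> q v) + fd G x v \<bullet> q u" unfolding pq(4) pu by simp
    also have "\<dots> = - \<omega> (\<pi> x) (\<pi> u) (\<pi> v)"
      unfolding fdG[OF x] \<pi>_def[symmetric] by (simp add: \<omega>_def d_form1_def)
    finally show "\<omega>1 x u v = 0" using \<omega>1_eq[OF x] by simp
  qed (use r' in auto)
  have lag: "lagrangian_germ \<omega> (\<lambda>x. H1 (g x))"
    by (rule lagrangian_germ_transport[OF ld lag1]) (use \<phi>(4) g(2) in blast)
  have "open (U' \<inter> ?S)" "0 \<in> U' \<inter> ?S" using g(1,3) S0 by auto
  then obtain e where e: "e > 0" "ball 0 e \<subseteq> U' \<inter> ?S" using open_contains_ball by blast
  show ?thesis
  proof (rule that[OF lag[unfolded \<omega>_def] e(1), of "\<lambda>i. \<tau> (axis i 1)"])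
    fix y i assume y: "y \<in> M" "y \<in> ball 0 e"
    have yU: "y \<in> U'" "y \<in> ?S" using y e(2) by blast+
    have "\<phi> y = y" by (rule \<phi>M) (use y yU g(2) in auto)
    hence "g y = y" using local_diffeoD(11)[OF ld yU(1)] by simp
    moreover have "y \<in> U" using yU(2) SB BR r(2) by blast
    ultimately show "y \<in> U \<and> H1 (g y) $ i = \<beta> y (\<tau> (axis i 1))"
      using pq(5)[OF y(1)] \<pi>fix[THEN iffD2, OF y(1)] by (simp add: H1_def G_def)
  qed
qed

section \<open>Primitives vanishing on a Lagrangian germ\<close>

lemma form2_bound_on_compact:
  fixes \<omega> :: "'n::finite form2"
  assumes \<omega>: "form2_on U \<omega>" and C: "compact C" "C \<subseteq> U"
  obtains K where "K \<ge> 0" "\<And>z a b. z \<in> C \<Longrightarrow> \<bar>\<omega> z a b\<bar> \<le> K * norm a * norm b"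
proof -
  have "\<exists>k. \<forall>z\<in>C. \<bar>\<omega> z (axis i 1) (axis j 1)\<bar> \<le> k" for i j
  proof -
    have "continuous_on C (\<lambda>z. \<omega> z (axis i 1) (axis j 1))"
      by (rule continuous_on_subset[OF smooth_on_continuous_on[OF form2_onD(3)[OF \<omega>]] C(2)])
    from compact_imp_bounded[OF compact_continuous_image[OF this C(1)]] show ?thesis
      unfolding bounded_iff by auto
  qed
  then obtain k where k: "\<And>i j z. z \<in> C \<Longrightarrow> \<bar>\<omega> z (axis i 1) (axis j 1)\<bar> \<le> k i j" by metis
  define K where "K = (\<Sum>i\<in>UNIV. \<Sum>j\<in>UNIV. \<bar>k i j\<bar>)"
  show ?thesis
  proof (rule that[of K])
    show "K \<ge> 0" unfolding K_def by (intro sum_nonneg) simp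
    fix z a b assume z: "z \<in> C"
    hence zU: "z \<in> U" using C(2) by blast
    have "\<omega> z a b = (\<Sum>i\<in>UNIV. \<Sum>j\<in>UNIV. a $ i * (b $ j * \<omega> z (axis i 1) (axis j 1)))"
      using form2_expand[OF \<omega> zU, of a b] vec_linear_expand[OF form2_onD(4)[OF \<omega> zU], of "axis _ 1" b]
      by (simp add: sum_distrib_left)
    also have "\<bar>\<dots>\<bar> \<le> (\<Sum>i\<in>UNIV. \<Sum>j\<in>UNIV. norm a * (norm b * \<bar>k i j\<bar>))"
    proof (intro order_trans[OF sum_abs] sum_mono)
      fix i j
      show "\<bar>a $ i * (b $ j * \<omega> z (axis i 1) (axis j 1))\<bar> \<le> norm a * (norm b * \<bar>k i j\<bar>)"
        unfolding abs_mult using component_le_norm_cart[of a i] component_le_norm_cart[of b j] k[OF z, of i j]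
        by (intro mult_mono) auto
    qed
    also have "\<dots> = K * norm a * norm b"
      by (simp add: K_def sum_distrib_left sum_distrib_right mult_ac)
    finally show "\<bar>\<omega> z a b\<bar> \<le> K * norm a * norm b" .
  qed
qed

lemma smooth_fd_bound_on_compact:
  fixes G :: "'a::euclidean_space \<Rightarrow> 'b::euclidean_space"
  assumes G: "smooth_on U G" and C: "compact C" "C \<subseteq> U"
  obtains K where "K \<ge> 0" "\<And>z a. z \<in> C \<Longrightarrow> norm (fd G z a) \<le> K * norm a"
proof -
  have "\<exists>k. \<forall>z\<in>C. norm (fd G z b) \<le> k" for b
    using compact_imp_bounded[OF compact_continuous_image[OF continuous_on_subset[OF
          smooth_on_continuous_on[OF smooth_on_fd[OF G]] C(2)] C(1)]]
    unfolding bounded_iff by auto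
  then obtain k where k: "\<And>b z. z \<in> C \<Longrightarrow> norm (fd G z b) \<le> k b" by metis
  define K where "K = (\<Sum>b\<in>Basis. \<bar>k b\<bar>)"
  show ?thesis
  proof (rule that[of K])
    show "K \<ge> 0" unfolding K_def by (intro sum_nonneg) simp
    fix z a assume z: "z \<in> C"
    hence zU: "z \<in> U" using C(2) by blast
    have "norm (fd G z a) = norm (\<Sum>b\<in>Basis. (a \<bullet> b) *\<^sub>R fd G z b)"
      using fd_basis_expand[OF smooth_on_differentiable[OF G zU], of a] by simp
    also have "\<dots> \<le> (\<Sum>b\<in>Basis. norm a * \<bar>k b\<bar>)"
    proof (rule sum_norm_le)
      fix b :: 'a assume b: "b \<in> Basis"
      show "norm ((a \<bullet> b) *\<^sub>R fd G z b) \<le> norm a * \<bar>k b\<bar>"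
        unfolding norm_scaleR using Basis_le_norm[OF b, of a] k[OF z, of b] by (intro mult_mono) auto
    qed
    also have "\<dots> = K * norm a" by (simp add: K_def sum_distrib_left mult.commute)
    finally show "norm (fd G z a) \<le> K * norm a" .
  qed
qed

text \<open>G changes the identity only in the range of s, a complement of the kernel of A, where it
  inserts the equation H itself. Its derivative at 0 is the identity, and \<open>H = 0\<close> turns
  into the linear subspace \<open>A = 0\<close>.\<close>

lemma smooth_straighten:
  fixes H :: "'n::finite space \<Rightarrow> real ^ 'n"
  assumes H: "smooth_on U H" "open U" "0 \<in> U" "H 0 = 0" and surj: "surj (fd H 0)"
  obtains A s G K U' V where "linear A" "linear s" "\<And>w. A (s w) = w" "local_diffeo G K U' V" "U' \<subseteq> U"
    "\<And>x. A (G x) = H x"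
proof -
  define A where "A = fd H 0"
  have A: "linear A" unfolding A_def using bounded_linear.linear[OF smooth_on_linear_fd[OF H(1,3)]] .
  obtain s where s: "linear s" "A \<circ> s = id"
    using linear_surjective_right_inverse[OF A] surj by (auto simp: A_def)
  have As: "A (s w) = w" for w using s(2) by (simp add: fun_eq_iff)
  define G where "G y = y - s (A y) + s (H y)" for y
  have lin: "linear (\<lambda>y. y - s (A y))"
    using linear_compose_sub[OF linear_ident linear_compose[OF A s(1)]] by (simp add: o_def)
  have sG: "smooth_on U G" unfolding G_def
    by (intro smooth_on_add smooth_on_linear[OF lin] smooth_on_linear_comp[OF s(1)] H)
  have "(G has_derivative (\<lambda>v. (v - s (A v)) + s (A v))) (at 0)"
    unfolding G_def[abs_def] A_def[symmetric]
    by (intro has_derivative_add linear_imp_has_derivative[OF lin]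
        bounded_linear.has_derivative[OF s(1)[unfolded linear_conv_bounded_linear]]
        smooth_on_has_derivative[OF H(1,3), folded A_def])
  from fun_cong[OF fd_eqI[OF this]] have fdG: "fd G 0 v = v" for v by simp
  have G0: "G 0 = 0" by (simp add: G_def H(4) linear_0[OF s(1)] linear_0[OF A])
  obtain U' V K where g: "open U'" "U' \<subseteq> U" "0 \<in> U'" "open V" "G 0 \<in> V" "homeomorphism U' V G K" "smooth_on V K"
    by (rule smooth_inverse_function[OF H(2,3) sG]) (auto simp: fdG intro: that)
  have "local_diffeo G K U' V"
    unfolding local_diffeo_def using g G0 smooth_on_subset[OF sG g(2)] by simp
  moreover have "A (G x) = H x" for x by (simp add: G_def linear_add[OF A] linear_diff[OF A] As)
  ultimately show ?thesis using that[OF A s(1) As _ g(2)] by blast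
qed

text \<open>Relative Poincare lemma: the primitive is the homotopy integral over the retraction to \<open>H = 0\<close>.\<close>

lemma primitive_of_lagrangian:
  fixes \<beta> :: "'n::finite form1"
  assumes U: "open U" "0 \<in> U" and \<beta>: "form1_on U \<beta>" and H: "lagrangian_germ (d_form1 \<beta>) H"
  obtains V \<gamma> C where "open V" "0 \<in> V" "V \<subseteq> U" "form1_on V \<gamma>"
    "\<And>x u v. x \<in> V \<Longrightarrow> d_form1 \<gamma> x u v = d_form1 \<beta> x u v"
    "\<And>x u. x \<in> V \<Longrightarrow> \<bar>\<gamma> x u\<bar> \<le> C * norm u * norm (H x)"
proof -
  obtain U1 where U1: "open U1" "0 \<in> U1" "smooth_on U1 H"
    and L: "\<forall>x\<in>U1. H x = 0 \<longrightarrow> (\<forall>u v. fd H x u = 0 \<longrightarrow> fd H x v = 0 \<longrightarrow> d_form1 \<beta> x u v = 0)"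
    using H unfolding lagrangian_germ_def by (elim exE conjE) (rule that)
  have H0: "H 0 = 0" "surj (fd H 0)" using H unfolding lagrangian_germ_def by simp_all
  have o: "open (U \<inter> U1)" and z: "0 \<in> U \<inter> U1" using U U1 by auto
  obtain A s G K U' V where A: "linear A" and s: "linear s" and As: "\<And>w. A (s w) = w"
    and ld: "local_diffeo G K U' V" and U': "U' \<subseteq> U \<inter> U1" and AG: "\<And>x. A (G x) = H x"
    using smooth_straighten[OF smooth_on_subset[OF U1(3)] o z H0] by (metis inf_le2)
  note D = local_diffeoD[OF ld]
  have KU: "K y \<in> U" if "y \<in> V" for y using D(10)[OF that] U' by blast
  define \<beta>' where "\<beta>' = pullback1 K \<beta>"
  have \<beta>': "form1_on V \<beta>'" unfolding \<beta>'_def by (rule form1_on_pullback1[OF \<beta> D(2,8) KU])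
  define \<omega> where "\<omega> = d_form1 \<beta>'"
  have \<omega>: "form2_on V \<omega>" unfolding \<omega>_def by (rule form2_on_d_form1[OF \<beta>' D(2)])
  have \<omega>_eq: "\<omega> y u v = d_form1 \<beta> (K y) (fd K y u) (fd K y v)" if "y \<in> V" for y u v
    using d_form1_pullback1[OF \<beta> U(1) D(2,8) KU that] by (simp add: \<omega>_def \<beta>'_def pullback_def)
  define Q where "Q y = s (A y)" for y
  have Q: "linear Q" unfolding Q_def using linear_compose[OF A s] by (simp add: o_def)
  have AQ: "A (y - Q y) = 0" for y by (simp add: Q_def linear_diff[OF A] As)
  obtain k1 where k1: "k1 > 0" "\<And>y. norm (Q y) \<le> k1 * norm y"
    using linear_bounded_pos[OF Q] by blast
  obtain k2 where k2: "k2 > 0" "\<And>y. norm (s y) \<le> k2 * norm y"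
    using linear_bounded_pos[OF s] by blast
  \<comment> \<open>Straight homotopy to the identity from the projection onto the kernel of A. Its
    velocity \<open>Q y = s (A y)\<close> is a linear image of the equation, which is why the
    primitive comes out bounded by H.\<close>
  define h where "h \<sigma> y = (y - Q y) + \<sigma> *\<^sub>R Q y" for \<sigma> y
  have hn: "norm (h \<sigma> y) \<le> (1 + k1) * norm y" if "\<sigma> \<in> {0..1}" for \<sigma> y
  proof -
    have "h \<sigma> y = y - (1 - \<sigma>) *\<^sub>R Q y" by (simp add: h_def algebra_simps)
    hence "norm (h \<sigma> y) \<le> norm y + norm ((1 - \<sigma>) *\<^sub>R Q y)" by (simp only: norm_triangle_ineq4)
    also have "norm ((1 - \<sigma>) *\<^sub>R Q y) \<le> 1 * norm (Q y)"
      unfolding norm_scaleR using that by (intro mult_right_mono) auto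
    finally show ?thesis using k1(2)[of y] by (simp add: algebra_simps)
  qed
  \<comment> \<open>The closed ball is the compact set on which the form is bounded; \<rho> is
    chosen so that the homotopy keeps a smaller ball inside it.\<close>
  obtain \<rho>0 where \<rho>0: "\<rho>0 > 0" "cball 0 \<rho>0 \<subseteq> V" using D(2,4) open_contains_cball by blast
  define \<rho> where "\<rho> = \<rho>0 / (1 + k1)"
  have \<rho>: "\<rho> > 0" using \<rho>0(1) k1(1) by (simp add: \<rho>_def)
  have hC: "h \<sigma> y \<in> cball 0 \<rho>0" if "\<sigma> \<in> {0..1}" "y \<in> ball 0 \<rho>" for \<sigma> y
  proof -
    have "norm (h \<sigma> y) \<le> (1 + k1) * norm y" by (rule hn[OF that(1)])
    also have "\<dots> \<le> (1 + k1) * \<rho>" using that(2) k1(1) by (intro mult_left_mono) auto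
    finally show ?thesis using k1(1) by (simp add: \<rho>_def)
  qed
  have hV: "h \<sigma> y \<in> V" if "\<sigma> \<in> {0..1}" "y \<in> ball 0 \<rho>" for \<sigma> y using hC[OF that] \<rho>0(2) by blast
  define \<gamma>' where "\<gamma>' y u = integral {0..1} (\<lambda>\<sigma>. \<omega> (h \<sigma> y) (Q y) (h \<sigma> u))" for y u
  have \<gamma>'_def2: "\<gamma>' = (\<lambda>y u. integral {0..1} (\<lambda>\<sigma>. \<omega> (h \<sigma> y) (Q y) (h \<sigma> u)))" by (intro ext) (rule \<gamma>'_def)
  have fs: "smooth_on UNIV (\<lambda>p::real \<times> 'n space. fst p)" "smooth_on UNIV (\<lambda>p::real \<times> 'n space. snd p)"
    by (intro smooth_intros open_UNIV)+
  have sh: "smooth_on UNIV (\<lambda>p. h (fst p) (snd p))" "smooth_on UNIV (\<lambda>p::real \<times> 'n space. Q (snd p))"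
    unfolding h_def by (intro smooth_intros open_UNIV fs smooth_on_linear_comp[OF Q])+
  have lh: "linear (h \<sigma>)" for \<sigma>
    by (rule linearI) (simp_all add: h_def linear_add[OF Q] linear_scale[OF Q] algebra_simps)
  have hd: "((\<lambda>\<sigma>. h \<sigma> y) has_vector_derivative Q y) (at \<sigma>)" for \<sigma> y
    unfolding h_def has_vector_derivative_def by (auto intro!: derivative_eq_intros)
  have h1: "h 1 y = y" for y by (simp add: h_def)
  \<comment> \<open>The image of \<open>h 0\<close> lies in the straightened Lagrangian germ, and
    vectors in its image are tangent to it.\<close>
  have h0: "\<omega> (h 0 y) (h 0 u) (h 0 v) = 0" if y: "y \<in> ball 0 \<rho>" for y u v
  proof -
    have yV: "h 0 y \<in> V" by (rule hV[OF _ y]) simp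
    define x where "x = K (h 0 y)"
    have x: "x \<in> U'" "G x = h 0 y" using D(10,12)[OF yV] by (simp_all add: x_def)
    have x1: "x \<in> U1" using x(1) U' by blast
    have Hx: "H x = 0" using AG[of x] AQ[of y] by (simp add: x(2) h_def)
    have fdH: "fd H x (fd K (h 0 y) (h 0 w)) = 0" for w
    proof -
      have "(H has_derivative (\<lambda>v. A (fd G x v))) (at x)"
        using bounded_linear.has_derivative[OF A[unfolded linear_conv_bounded_linear] smooth_on_has_derivative[OF D(7) x(1)]]
        by (simp add: AG)
      from fun_cong[OF fd_eqI[OF this], of "fd K (h 0 y) (h 0 w)"]
      show ?thesis using local_diffeo_fd_inverse(2)[OF ld x(1), of "h 0 w"] AQ[of w] by (simp add: x(2) h_def)
    qed
    show ?thesis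
      unfolding \<omega>_eq[OF yV] using L[rule_format, OF x1 Hx fdH fdH] by (simp add: x_def)
  qed
  have closed: "d_form2 \<omega> x u v w = 0" if "x \<in> V" for x u v w
    unfolding \<omega>_def by (rule d_form2_d_form1[OF \<beta>' D(2) that])
  note P = poincare_form2[OF \<omega> D(2) closed sh(1) lh sh(2) Q hd open_ball hV h1 h0 \<gamma>'_def2]
  have P1: "form1_on (ball 0 \<rho>) \<gamma>'" and P2: "\<And>y u v. y \<in> ball 0 \<rho> \<Longrightarrow> d_form1 \<gamma>' y u v = \<omega> y u v"
    using P by blast+
  obtain k3 where k3: "k3 \<ge> 0" "\<And>z a b. z \<in> cball 0 \<rho>0 \<Longrightarrow> \<bar>\<omega> z a b\<bar> \<le> k3 * norm a * norm b"
    using form2_bound_on_compact[OF \<omega> compact_cball \<rho>0(2)] by blast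
  define k where "k = k3 * k2 * (1 + k1)"
  have \<gamma>'_le: "\<bar>\<gamma>' y u\<bar> \<le> k * norm u * norm (A y)" if y: "y \<in> ball 0 \<rho>" for y u
  proof -
    have i: "\<bar>\<omega> (h \<sigma> y) (Q y) (h \<sigma> u)\<bar> \<le> k * norm u * norm (A y)" if \<sigma>: "\<sigma> \<in> {0..1}" for \<sigma>
    proof -
      have "\<bar>\<omega> (h \<sigma> y) (Q y) (h \<sigma> u)\<bar> \<le> k3 * norm (Q y) * norm (h \<sigma> u)" by (rule k3(2)[OF hC[OF \<sigma> y]])
      also have "\<dots> \<le> k3 * (k2 * norm (A y)) * ((1 + k1) * norm u)"
        using k2 k1(1) k3(1) hn[OF \<sigma>] by (intro mult_mono mult_left_mono) (auto simp: Q_def)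
      finally show ?thesis by (simp add: k_def mult_ac)
    qed
    have "continuous_on {0..1} (\<lambda>\<sigma>. h \<sigma> w)" for w
      unfolding h_def by (intro continuous_on_add continuous_on_scaleR continuous_on_id continuous_on_const)
    hence "continuous_on {0..1} (\<lambda>\<sigma>. \<omega> (h \<sigma> y) (Q y) (h \<sigma> u))"
      by (intro form2_continuous_along[OF \<omega>] hV[OF _ y] continuous_on_const)
    from integral_norm_bound_integral[OF integrable_continuous_interval[OF this] integrable_const_ivl, of "k * norm u * norm (A y)"]
    show ?thesis using i by (simp add: \<gamma>'_def)
  qed
  define S where "S = U' \<inter> G -` ball 0 \<rho>"
  have "open S" unfolding S_def
    by (rule continuous_open_preimage[OF smooth_on_continuous_on[OF D(7)] D(1)]) auto
  moreover have "0 \<in> S" using D(3,5) \<rho> by (simp add: S_def)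
  ultimately obtain e where e: "e > 0" "cball 0 e \<subseteq> S" using open_contains_cball by blast
  have eS: "x \<in> S" if "x \<in> ball 0 e" for x using that by (intro subsetD[OF e(2)]) simp
  have GB: "G x \<in> ball 0 \<rho>" "x \<in> U'" if "x \<in> ball 0 e" for x using eS[OF that] by (simp_all add: S_def)
  have sGe: "smooth_on (ball 0 e) G" by (rule smooth_on_subset[OF D(7)]) (use GB in blast)
  obtain k4 where k4: "k4 \<ge> 0" "\<And>z a. z \<in> cball 0 e \<Longrightarrow> norm (fd G z a) \<le> k4 * norm a"
    by (rule smooth_fd_bound_on_compact[OF D(7) compact_cball, of 0 e]) (use e(2) S_def that in auto)
  show ?thesis
  proof (rule that[of "ball 0 e" "pullback1 G \<gamma>'" "k * k4"])
    show "open (ball (0::'n space) e)" "0 \<in> ball (0::'n space) e" using e(1) by auto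
    show "ball 0 e \<subseteq> U" using GB(2) U' by blast
    show "form1_on (ball 0 e) (pullback1 G \<gamma>')" by (rule form1_on_pullback1[OF P1 open_ball sGe GB(1)])
    fix x u v :: "'n space" assume x: "x \<in> ball 0 e"
    have "d_form1 (pullback1 G \<gamma>') x u v = \<omega> (G x) (fd G x u) (fd G x v)"
      using d_form1_pullback1[OF P1 open_ball open_ball sGe GB(1) x] P2[OF GB(1)[OF x]]
      by (simp add: pullback_def)
    also have "\<dots> = d_form1 \<beta> x u v"
      using \<omega>_eq[OF D(9)[OF GB(2)[OF x]]] D(11)[OF GB(2)[OF x]] local_diffeo_fd_inverse(1)[OF ld GB(2)[OF x]] by simp
    finally show "d_form1 (pullback1 G \<gamma>') x u v = d_form1 \<beta> x u v" .
  next
    fix x u :: "'n space" assume x: "x \<in> ball 0 e"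
    have k0: "k \<ge> 0" using k1 k2 k3 by (simp add: k_def)
    have "\<bar>pullback1 G \<gamma>' x u\<bar> \<le> k * norm (fd G x u) * norm (H x)"
      using \<gamma>'_le[OF GB(1)[OF x], of "fd G x u"] by (simp add: pullback1_def AG)
    also have "\<dots> \<le> k * (k4 * norm u) * norm (H x)"
      using k4(2)[of x u] x k0 by (intro mult_right_mono mult_left_mono) auto
    finally show "\<bar>pullback1 G \<gamma>' x u\<bar> \<le> k * k4 * norm u * norm (H x)" by (simp add: mult_ac)
  qed
qed

section \<open>Orders of vanishing\<close>

definition smooth_at0 :: "(real \<Rightarrow> 'b::real_normed_vector) \<Rightarrow> bool" where
  "smooth_at0 g \<longleftrightarrow> (\<exists>T. open T \<and> 0 \<in> T \<and> smooth_on T g)"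

text \<open>An inequality instead of derivatives, so that it applies to vector-valued functions and
  to parameter changes whose smoothness is not established.\<close>

definition order_ge :: "nat \<Rightarrow> (real \<Rightarrow> 'b::real_normed_vector) \<Rightarrow> bool" where
  "order_ge k g \<longleftrightarrow> (\<exists>C. \<forall>\<^sub>F t in nhds 0. norm (g t) \<le> C * \<bar>t\<bar> ^ k)"

definition tcoeff :: "nat \<Rightarrow> (real \<Rightarrow> real) \<Rightarrow> real" where
  "tcoeff m g = (deriv ^^ m) g 0 / fact m"

section \<open>Taylor coefficients of functions of one variable\<close>

lemma smooth_on_DERIV:
  fixes g :: "real \<Rightarrow> real"
  assumes "smooth_on T g" "t \<in> T"
  shows "(g has_real_derivative deriv g t) (at t)" "deriv g t = fd g t 1"
proof -
  have "(g has_derivative fd g t) (at t)" by (rule smooth_on_has_derivative[OF assms])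
  moreover have "fd g t = (\<lambda>v. fd g t 1 * v)"
  proof
    fix v show "fd g t v = fd g t 1 * v"
      using linear_scale[OF bounded_linear.linear[OF smooth_on_linear_fd[OF assms]], of v 1] by simp
  qed
  ultimately have *: "(g has_real_derivative fd g t 1) (at t)" by (simp add: has_field_derivative_def)
  thus "deriv g t = fd g t 1" by (rule DERIV_imp_deriv)
  thus "(g has_real_derivative deriv g t) (at t)" using * by simp
qed

lemma smooth_on_deriv:
  fixes g :: "real \<Rightarrow> real"
  assumes "smooth_on T g" "open T"
  shows "smooth_on T (deriv g)"
  using smooth_on_fd[OF assms(1), of 1] smooth_on_cong[OF assms(2), of "deriv g" "\<lambda>t. fd g t 1"]
    smooth_on_DERIV(2)[OF assms(1)] by simp

lemma smooth_on_deriv_iter: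
  fixes g :: "real \<Rightarrow> real"
  assumes "smooth_on T g" "open T"
  shows "smooth_on T ((deriv ^^ m) g)"
  by (induction m) (simp_all add: assms smooth_on_deriv)

lemma deriv_cong_open:
  fixes f g :: "real \<Rightarrow> real"
  assumes "open T" "t \<in> T" "\<And>s. s \<in> T \<Longrightarrow> f s = g s"
  shows "deriv f t = deriv g t"
proof (rule deriv_cong_ev)
  show "\<forall>\<^sub>F s in nhds t. f s = g s" using assms eventually_nhds by blast
qed simp

lemma deriv_iter_cong_open:
  fixes f g :: "real \<Rightarrow> real"
  assumes "open T" "t \<in> T" "\<And>s. s \<in> T \<Longrightarrow> f s = g s"
  shows "(deriv ^^ m) f t = (deriv ^^ m) g t"
  using assms(2)
proof (induction m arbitrary: t)
  case 0 thus ?case using assms(3) by simp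
next
  case (Suc m) thus ?case using deriv_cong_open[OF assms(1) Suc.prems Suc.IH] by simp
qed

lemma tcoeff_cong:
  assumes "\<forall>\<^sub>F t in nhds 0. f t = g t"
  shows "tcoeff m f = tcoeff m g"
proof -
  obtain T where "open T" "0 \<in> T" "\<And>t. t \<in> T \<Longrightarrow> f t = g t" using assms unfolding eventually_nhds by blast
  from deriv_iter_cong_open[OF this] show ?thesis by (simp add: tcoeff_def)
qed

lemma smooth_at0_Int:
  assumes "smooth_at0 f" "smooth_at0 g"
  obtains T where "open T" "0 \<in> T" "smooth_on T f" "smooth_on T g"
proof -
  obtain S T where "open S" "0 \<in> S" "smooth_on S f" "open T" "0 \<in> T" "smooth_on T g"
    using assms unfolding smooth_at0_def by (elim exE conjE) (rule that)
  thus ?thesis using that[of "S \<inter> T"] smooth_on_subset[of S f "S \<inter> T"] smooth_on_subset[of T g "S \<inter> T"] by auto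
qed

lemma tcoeff_add:
  assumes "smooth_at0 f" "smooth_at0 g"
  shows "tcoeff m (\<lambda>t. f t + g t) = tcoeff m f + tcoeff m g"
proof -
  obtain T where T: "open T" "0 \<in> T" "smooth_on T f" "smooth_on T g" using smooth_at0_Int[OF assms] .
  have "(deriv ^^ m) (\<lambda>t. f t + g t) t = (deriv ^^ m) f t + (deriv ^^ m) g t" if "t \<in> T" for t
    using that
  proof (induction m arbitrary: t)
    case (Suc m)
    have "deriv ((deriv ^^ m) (\<lambda>t. f t + g t)) t = deriv (\<lambda>t. (deriv ^^ m) f t + (deriv ^^ m) g t) t"
      by (rule deriv_cong_open[OF T(1) Suc.prems Suc.IH])
    also have "\<dots> = (deriv ^^ Suc m) f t + (deriv ^^ Suc m) g t"
      using DERIV_add[OF smooth_on_DERIV(1)[OF smooth_on_deriv_iter[OF T(3,1)] Suc.prems, of m]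
          smooth_on_DERIV(1)[OF smooth_on_deriv_iter[OF T(4,1)] Suc.prems, of m]] by (simp add: DERIV_imp_deriv)
    finally show ?case by simp
  qed simp
  from this[OF T(2)] show ?thesis by (simp add: tcoeff_def add_divide_distrib)
qed

lemma tcoeff_cmult:
  assumes "smooth_at0 f"
  shows "tcoeff m (\<lambda>t. c * f t) = c * tcoeff m f"
proof -
  obtain T where T: "open T" "0 \<in> T" "smooth_on T f" using assms unfolding smooth_at0_def by blast
  have "(deriv ^^ m) (\<lambda>t. c * f t) t = c * (deriv ^^ m) f t" if "t \<in> T" for t
    using that
  proof (induction m arbitrary: t)
    case (Suc m)
    have "deriv ((deriv ^^ m) (\<lambda>t. c * f t)) t = deriv (\<lambda>t. c * (deriv ^^ m) f t) t"
      by (rule deriv_cong_open[OF T(1) Suc.prems Suc.IH])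
    also have "\<dots> = c * (deriv ^^ Suc m) f t"
      using DERIV_cmult[OF smooth_on_DERIV(1)[OF smooth_on_deriv_iter[OF T(3,1)] Suc.prems, of m], of c]
      by (simp add: DERIV_imp_deriv)
    finally show ?case by simp
  qed simp
  from this[OF T(2)] show ?thesis by (simp add: tcoeff_def)
qed

lemma tcoeff_deriv: "tcoeff m (deriv g) = real (Suc m) * tcoeff (Suc m) g"
proof -
  have "(deriv ^^ m) (deriv g) = (deriv ^^ Suc m) g" by (simp only: funpow_Suc_right o_def)
  thus ?thesis by (simp add: tcoeff_def)
qed

lemma tcoeff_mult_ident:
  assumes "smooth_at0 f"
  shows "tcoeff 0 (\<lambda>t. t * f t) = 0" "tcoeff (Suc m) (\<lambda>t. t * f t) = tcoeff m f"
proof -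
  obtain T where T: "open T" "0 \<in> T" "smooth_on T f" using assms unfolding smooth_at0_def by blast
  have "(deriv ^^ Suc m) (\<lambda>t. t * f t) t = t * (deriv ^^ Suc m) f t + real (Suc m) * (deriv ^^ m) f t" if "t \<in> T" for t m
    using that
  proof (induction m arbitrary: t)
    case 0
    have "((\<lambda>t. t * f t) has_real_derivative 1 * f t + deriv f t * t) (at t)"
      by (intro DERIV_mult DERIV_ident smooth_on_DERIV(1)[OF T(3) 0])
    thus ?case by (simp add: DERIV_imp_deriv mult.commute)
  next
    case (Suc m)
    note d = smooth_on_DERIV(1)[OF smooth_on_deriv_iter[OF T(3,1)] Suc.prems]
    have "deriv ((deriv ^^ Suc m) (\<lambda>t. t * f t)) t = deriv (\<lambda>t. t * (deriv ^^ Suc m) f t + real (Suc m) * (deriv ^^ m) f t) t"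
      by (rule deriv_cong_open[OF T(1) Suc.prems Suc.IH])
    also have "\<dots> = (1 * (deriv ^^ Suc m) f t + deriv ((deriv ^^ Suc m) f) t * t) + real (Suc m) * deriv ((deriv ^^ m) f) t"
      by (rule DERIV_imp_deriv) (intro DERIV_add DERIV_mult DERIV_ident DERIV_cmult d)
    finally show ?case by (simp add: algebra_simps)
  qed
  from this[OF T(2), of m] show "tcoeff (Suc m) (\<lambda>t. t * f t) = tcoeff m f" by (simp add: tcoeff_def)
  show "tcoeff 0 (\<lambda>t. t * f t) = 0" by (simp add: tcoeff_def)
qed

lemma smooth_at0_mult_power:
  fixes f :: "real \<Rightarrow> real"
  assumes "smooth_at0 f"
  shows "smooth_at0 (\<lambda>t. t ^ j * f t)"
proof -
  obtain T where T: "open T" "0 \<in> T" "smooth_on T f" using assms unfolding smooth_at0_def by blast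
  have "smooth_on T (\<lambda>t. t ^ j * f t)" by (intro smooth_intros T)
  thus ?thesis using T unfolding smooth_at0_def by blast
qed

lemma tcoeff_mult_power:
  assumes "smooth_at0 f"
  shows "tcoeff m (\<lambda>t. t ^ j * f t) = (if m < j then 0 else tcoeff (m - j) f)"
proof (induction j arbitrary: m)
  case (Suc j)
  have "(\<lambda>t. t ^ Suc j * f t) = (\<lambda>t. t * (t ^ j * f t))" by (simp add: fun_eq_iff mult.assoc)
  thus ?case using tcoeff_mult_ident[OF smooth_at0_mult_power[OF assms, of j]] Suc.IH
    by (cases m) auto
qed simp

lemma tcoeff_const: "tcoeff m (\<lambda>t. c) = (if m = 0 then c else 0)"
proof (cases m)
  case (Suc k)
  have "(deriv ^^ Suc k) (\<lambda>t. c::real) = (\<lambda>t. 0)" by (induction k) simp_all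
  thus ?thesis by (simp add: tcoeff_def Suc)
qed (simp add: tcoeff_def)

lemma smooth_at0_const: "smooth_at0 (\<lambda>t. c)"
  unfolding smooth_at0_def by (intro exI[of _ UNIV]) (simp add: smooth_on_const)

lemma tcoeff_power: "tcoeff m (\<lambda>t. t ^ j) = (if m = j then 1 else 0)"
  using tcoeff_mult_power[OF smooth_at0_const[of 1], of m j] by (auto simp: tcoeff_const)

text \<open>Maclaurin's formula with vanishing lower terms. The radius is fixed before k, so that it
  serves all orders.\<close>

lemma taylor_bound:
  fixes g :: "real \<Rightarrow> real"
  assumes "open T" "0 \<in> T" "smooth_on T g"
  obtains d where "d > 0" "cball 0 d \<subseteq> T" "\<And>x k. \<bar>x\<bar> \<le> d \<Longrightarrow> (\<And>j. j < k \<Longrightarrow> (deriv ^^ j) g 0 = 0) \<Longrightarrow>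
     \<exists>t. \<bar>t\<bar> \<le> \<bar>x\<bar> \<and> g x = (deriv ^^ k) g t / fact k * x ^ k"
proof -
  obtain d where d: "d > 0" "cball 0 d \<subseteq> T" using assms(1,2) open_contains_cball by blast
  have "\<exists>t. \<bar>t\<bar> \<le> \<bar>x\<bar> \<and> g x = (deriv ^^ k) g t / fact k * x ^ k"
    if x: "\<bar>x\<bar> \<le> d" and z: "\<And>j. j < k \<Longrightarrow> (deriv ^^ j) g 0 = 0" for x k
  proof -
    have "\<exists>t. \<bar>t\<bar> \<le> \<bar>x\<bar> \<and> g x = (\<Sum>m<k. (deriv ^^ m) g 0 / fact m * x ^ m) + (deriv ^^ k) g t / fact k * x ^ k"
    proof (rule Maclaurin_bi_le)
      show "\<forall>m t. m < k \<and> \<bar>t\<bar> \<le> \<bar>x\<bar> \<longrightarrow> ((deriv ^^ m) g has_real_derivative (deriv ^^ Suc m) g t) (at t)"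
      proof (intro allI impI)
        fix m t assume "m < k \<and> \<bar>t\<bar> \<le> \<bar>x\<bar>"
        hence "t \<in> T" using x d(2) by (intro subsetD[OF d(2)]) simp
        from smooth_on_DERIV(1)[OF smooth_on_deriv_iter[OF assms(3,1)] this, of m]
        show "((deriv ^^ m) g has_real_derivative (deriv ^^ Suc m) g t) (at t)" by simp
      qed
    qed simp
    thus ?thesis using z by simp
  qed
  thus ?thesis using that d by blast
qed

text \<open>One direction is Taylor's formula. Conversely, at a first nonvanishing derivative of
  order j < k the function is bounded below by a multiple of \<open>\<bar>x\<bar> ^ j\<close> near
  0, against the assumed upper bound.\<close>

lemma order_ge_iff_deriv:
  fixes g :: "real \<Rightarrow> real"
  assumes "smooth_at0 g"
  shows "order_ge k g \<longleftrightarrow> (\<forall>j<k. (deriv ^^ j) g 0 = 0)"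
proof -
  obtain T where T: "open T" "0 \<in> T" "smooth_on T g" using assms unfolding smooth_at0_def by blast
  obtain d where d: "d > 0" "cball 0 d \<subseteq> T" "\<And>x k. \<bar>x\<bar> \<le> d \<Longrightarrow> (\<And>j. j < k \<Longrightarrow> (deriv ^^ j) g 0 = 0) \<Longrightarrow>
     \<exists>t. \<bar>t\<bar> \<le> \<bar>x\<bar> \<and> g x = (deriv ^^ k) g t / fact k * x ^ k"
    by (rule taylor_bound[OF T]) blast
  have cont: "continuous_on T ((deriv ^^ j) g)" for j
    by (rule smooth_on_continuous_on[OF smooth_on_deriv_iter[OF T(3,1)]])
  show ?thesis
  proof
    assume z: "\<forall>j<k. (deriv ^^ j) g 0 = 0"
    have "compact ((deriv ^^ k) g ` cball 0 d)"
      by (rule compact_continuous_image[OF continuous_on_subset[OF cont d(2)]]) simp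
    from compact_imp_bounded[OF this]
    obtain K where "\<forall>y\<in>(deriv ^^ k) g ` cball 0 d. norm y \<le> K" unfolding bounded_iff by (elim exE)
    hence K: "\<bar>(deriv ^^ k) g t\<bar> \<le> K" if "t \<in> cball 0 d" for t using that by auto
    have "norm (g x) \<le> K / fact k * \<bar>x\<bar> ^ k" if xd: "\<bar>x\<bar> < d" for x
    proof -
      obtain t where t: "\<bar>t\<bar> \<le> \<bar>x\<bar>" "g x = (deriv ^^ k) g t / fact k * x ^ k"
        using d(3)[of x k] xd z by auto
      have "\<bar>(deriv ^^ k) g t\<bar> \<le> K" using K[of t] t(1) xd by simp
      hence "\<bar>(deriv ^^ k) g t\<bar> / fact k * \<bar>x\<bar> ^ k \<le> K / fact k * \<bar>x\<bar> ^ k"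
        by (intro mult_right_mono divide_right_mono) auto
      thus ?thesis by (simp add: t(2) abs_mult power_abs)
    qed
    hence "\<forall>\<^sub>F x in nhds 0. norm (g x) \<le> K / fact k * \<bar>x\<bar> ^ k"
      unfolding eventually_nhds_metric using d(1) by (auto simp: dist_real_def)
    thus "order_ge k g" unfolding order_ge_def by blast
  next
    assume "order_ge k g"
    then obtain C e where e: "e > 0" "\<And>x. \<bar>x\<bar> < e \<Longrightarrow> \<bar>g x\<bar> \<le> C * \<bar>x\<bar> ^ k"
      unfolding order_ge_def eventually_nhds_metric dist_real_def by auto
    show "\<forall>j<k. (deriv ^^ j) g 0 = 0"
    proof (intro allI impI)
      fix j assume "j < k"
      thus "(deriv ^^ j) g 0 = 0"
      proof (induction j rule: less_induct)
        case (less j)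
        show ?case
        proof (rule ccontr)
          define a where "a = \<bar>(deriv ^^ j) g 0\<bar>"
          assume "(deriv ^^ j) g 0 \<noteq> 0"
          hence a: "a > 0" by (simp add: a_def)
          have "isCont ((deriv ^^ j) g) 0" using cont T(1,2) continuous_on_eq_continuous_at by blast
          hence "\<exists>s>0. \<forall>t. dist t 0 < s \<longrightarrow> dist ((deriv ^^ j) g t) ((deriv ^^ j) g 0) < a / 2"
            using a unfolding continuous_at_eps_delta by (meson half_gt_zero)
          then obtain s where s: "s > 0" "\<And>t. \<bar>t\<bar> < s \<Longrightarrow> \<bar>(deriv ^^ j) g t - (deriv ^^ j) g 0\<bar> < a / 2"
            by (auto simp: dist_real_def)
          define C' where "C' = (\<bar>C\<bar> + 1) * fact j"
          have C': "C' > 0" by (simp add: C'_def add_nonneg_pos)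
          \<comment> \<open>Small enough for all estimates at once; the last term brings the upper
            bound \<open>C' * x\<close> down to \<open>a / 2\<close>, the strict lower
            bound.\<close>
          define x where "x = min (min (d / 2) (e / 2)) (min (min (s / 2) 1) (a / (2 * C')))"
          have x: "x > 0" "x \<le> d" "x < e" "x < s" "x \<le> 1" "x \<le> a / (2 * C')"
            using d(1) e(1) s(1) a C' by (auto simp: x_def)
          obtain t where t: "\<bar>t\<bar> \<le> \<bar>x\<bar>" "g x = (deriv ^^ j) g t / fact j * x ^ j"
            using d(3)[of x j] x(1,2) less by auto
          have "\<bar>(deriv ^^ j) g t - (deriv ^^ j) g 0\<bar> < a / 2" using s(2) t(1) x by simp
          hence lower: "\<bar>(deriv ^^ j) g t\<bar> > a / 2" unfolding a_def by linarith
          have "\<bar>(deriv ^^ j) g t\<bar> / fact j * x ^ j \<le> C * x ^ k"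
            using e(2)[of x] x(1,3) t(2) by (simp add: abs_mult)
          also have "\<dots> \<le> (\<bar>C\<bar> + 1) * x ^ k" using x(1) by (intro mult_right_mono) auto
          also have "\<dots> \<le> (\<bar>C\<bar> + 1) * x ^ Suc j"
            using x(1,5) less.prems by (intro mult_left_mono power_decreasing) auto
          finally have "\<bar>(deriv ^^ j) g t\<bar> / fact j * x ^ j \<le> ((\<bar>C\<bar> + 1) * x) * x ^ j" by (simp add: mult.assoc)
          hence "\<bar>(deriv ^^ j) g t\<bar> / fact j \<le> (\<bar>C\<bar> + 1) * x"
            by (rule mult_right_le_imp_le) (use x(1) in simp)
          hence "\<bar>(deriv ^^ j) g t\<bar> \<le> C' * x" by (simp add: C'_def field_simps)
          also have "\<dots> \<le> a / 2" using x(6) C' by (simp add: field_simps)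
          finally show False using lower by simp
        qed
      qed
    qed
  qed
qed

lemma order_ge_iff_tcoeff:
  fixes g :: "real \<Rightarrow> real"
  shows "smooth_at0 g \<Longrightarrow> order_ge k g \<longleftrightarrow> (\<forall>j<k. tcoeff j g = 0)"
  by (simp add: order_ge_iff_deriv tcoeff_def)

lemma vanishing_order_ge_iff:
  "smooth_at0 g \<Longrightarrow> enat k \<le> vanishing_order g \<longleftrightarrow> order_ge k g"
  unfolding vanishing_order_def le_INF_iff order_ge_iff_deriv by (auto simp: not_less[symmetric])

section \<open>Rules for orders of vanishing\<close>

lemma order_ge_mono:
  assumes "order_ge k f" "\<forall>\<^sub>F t in nhds 0. norm (g t) \<le> K * norm (f t)"
  shows "order_ge k g"
proof -
  obtain C where "\<forall>\<^sub>F t in nhds 0. norm (f t) \<le> C * \<bar>t\<bar> ^ k" using assms(1) unfolding order_ge_def by blast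
  with assms(2) have "\<forall>\<^sub>F t in nhds 0. norm (g t) \<le> \<bar>K\<bar> * C * \<bar>t\<bar> ^ k"
  proof eventually_elim
    case (elim t)
    have "norm (g t) \<le> \<bar>K\<bar> * norm (f t)" using elim(1) by (smt (verit) abs_ge_self mult_right_mono norm_ge_zero)
    also have "\<dots> \<le> \<bar>K\<bar> * (C * \<bar>t\<bar> ^ k)" using elim(2) by (intro mult_left_mono) auto
    finally show ?case by simp
  qed
  thus ?thesis unfolding order_ge_def by blast
qed

lemma order_ge_add: "order_ge k f \<Longrightarrow> order_ge k g \<Longrightarrow> order_ge k (\<lambda>t. f t + g t)"
  unfolding order_ge_def
proof (elim exE)
  fix C D assume "\<forall>\<^sub>F t in nhds 0. norm (f t) \<le> C * \<bar>t\<bar> ^ k" "\<forall>\<^sub>F t in nhds 0. norm (g t) \<le> D * \<bar>t\<bar> ^ k"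
  hence "\<forall>\<^sub>F t in nhds 0. norm (f t + g t) \<le> (C + D) * \<bar>t\<bar> ^ k"
  proof eventually_elim
    case (elim t) thus ?case using norm_triangle_ineq[of "f t" "g t"] by (simp add: distrib_right)
  qed
  thus "\<exists>C. \<forall>\<^sub>F t in nhds 0. norm (f t + g t) \<le> C * \<bar>t\<bar> ^ k" by blast
qed

lemma order_ge_zero: "\<forall>\<^sub>F t in nhds 0. g t = 0 \<Longrightarrow> order_ge k g"
  unfolding order_ge_def by (intro exI[of _ 0]) (auto elim: eventually_mono)

lemma order_ge_cmult: "order_ge k f \<Longrightarrow> order_ge k (\<lambda>t. c * f t)" for f :: "real \<Rightarrow> real"
  by (rule order_ge_mono[of k f _ "\<bar>c\<bar>"]) (simp_all add: abs_mult)

lemma order_ge_sum: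
  "(\<And>i. i \<in> I \<Longrightarrow> order_ge k (f i)) \<Longrightarrow> order_ge k (\<lambda>t. \<Sum>i\<in>I. f i t)"
  by (induction I rule: infinite_finite_induct) (simp_all add: order_ge_zero order_ge_add)

lemma order_ge_vec_iff:
  fixes g :: "real \<Rightarrow> real ^ 'n::finite"
  shows "order_ge k g \<longleftrightarrow> (\<forall>i. order_ge k (\<lambda>t. g t $ i))"
proof
  assume *: "order_ge k g"
  show "\<forall>i. order_ge k (\<lambda>t. g t $ i)"
  proof
    fix i show "order_ge k (\<lambda>t. g t $ i)"
      by (rule order_ge_mono[OF *, of _ 1], rule always_eventually) (simp add: component_le_norm_cart)
  qed
next
  assume *: "\<forall>i. order_ge k (\<lambda>t. g t $ i)"
  have "order_ge k (\<lambda>t. \<bar>g t $ i\<bar>)" for i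
    by (rule order_ge_mono[OF *[rule_format, of i], of _ 1]) simp
  hence "order_ge k (\<lambda>t. \<Sum>i\<in>UNIV. \<bar>g t $ i\<bar>)" by (intro order_ge_sum)
  thus "order_ge k g"
  proof (rule order_ge_mono[where K=1], intro always_eventually allI)
    fix t
    have "norm (g t) \<le> (\<Sum>i\<in>UNIV. \<bar>g t $ i\<bar>)" by (rule norm_le_l1_cart)
    thus "norm (g t) \<le> 1 * norm (\<Sum>i\<in>UNIV. \<bar>g t $ i\<bar>)" by simp
  qed
qed

text \<open>The minimum over the equations becomes the order of one vector-valued function, since
  the norm and the components bound each other.\<close>

lemma tangency_order_ge_iff:
  fixes H :: "'n::finite space \<Rightarrow> real ^ 'n"
  assumes "smooth_at0 (\<lambda>t. H (f t))"
  shows "enat k \<le> tangency_order f H \<longleftrightarrow> order_ge k (\<lambda>t. H (f t))"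
proof -
  obtain T where T: "open T" "0 \<in> T" "smooth_on T (\<lambda>t. H (f t))" using assms unfolding smooth_at0_def by blast
  have s: "smooth_at0 (\<lambda>t. H (f t) $ j)" for j
    unfolding smooth_at0_def using T smooth_on_vec_nth[OF T(1,3)] by blast
  have "enat k \<le> tangency_order f H \<longleftrightarrow> (\<forall>j. enat k \<le> vanishing_order (\<lambda>t. H (f t) $ j))"
    unfolding tangency_order_def by (subst Min_ge_iff) auto
  thus ?thesis using vanishing_order_ge_iff[OF s] order_ge_vec_iff[of k "\<lambda>t. H (f t)"] by simp
qed

text \<open>Lets tangency orders, the infinite one included, be compared through the inequalities
  that \<open>order_ge\<close> expresses.\<close>

lemma enat_eqI:
  fixes a b :: enat
  assumes "\<And>k. enat k \<le> a \<longleftrightarrow> enat k \<le> b"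
  shows "a = b"
proof -
  have "x \<le> y" if *: "\<And>k. enat k \<le> x \<Longrightarrow> enat k \<le> y" for x y :: enat
  proof (cases y)
    case (enat n)
    show ?thesis
    proof (rule ccontr)
      assume "\<not> x \<le> y"
      hence "enat (Suc n) \<le> x" using enat by (simp add: not_le Suc_ile_eq)
      from *[OF this] show False using enat by simp
    qed
  qed simp
  from this[of a b] this[of b a] show ?thesis using assms by (intro antisym) simp_all
qed

section \<open>Jets along the branches\<close>

definition std1 :: "real \<Rightarrow> 'n::finite space" where "std1 t = axis 2 t"
definition std2 :: "real \<Rightarrow> 'n::finite space" where "std2 t = axis 3 t"
definition std3 :: "real \<Rightarrow> 'n::finite space" where
  "std3 t = axis 1 (t ^ 3) + axis 2 (- (t ^ 4)) + axis 3 (t ^ 2)"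

lemma axis_eq_scaleR: "axis i t = t *\<^sub>R axis i (1::real)"
  by (simp add: vec_eq_iff axis_def)

lemma std_0: "std1 0 = 0" "std2 0 = 0" "std3 0 = 0"
  by (simp_all add: std1_def std2_def std3_def vec_eq_iff axis_def)

lemma std_eq:
  "std1 = (\<lambda>t. t *\<^sub>R axis 2 1)" "std2 = (\<lambda>t. t *\<^sub>R axis 3 1)"
  "std3 = (\<lambda>t. (t ^ 3) *\<^sub>R axis 1 1 + (- (t ^ 4)) *\<^sub>R axis 2 1 + (t ^ 2) *\<^sub>R axis 3 1)"
  by (simp_all add: fun_eq_iff std1_def std2_def std3_def vec_eq_iff axis_def)

lemma smooth_std: "smooth_on UNIV std1" "smooth_on UNIV std2" "smooth_on UNIV std3"
  unfolding std_eq by (intro smooth_intros open_UNIV)+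

lemma smooth_at0_add:
  assumes "smooth_at0 f" "smooth_at0 g"
  shows "smooth_at0 (\<lambda>t. f t + g t)"
proof -
  obtain T where "open T" "0 \<in> T" "smooth_on T f" "smooth_on T g" using smooth_at0_Int[OF assms] .
  thus ?thesis unfolding smooth_at0_def using smooth_on_add by blast
qed

lemma smooth_at0_cmult:
  fixes f :: "real \<Rightarrow> real"
  assumes "smooth_at0 f"
  shows "smooth_at0 (\<lambda>t. c * f t)"
proof -
  obtain T where "open T" "0 \<in> T" "smooth_on T f" using assms unfolding smooth_at0_def by blast
  thus ?thesis unfolding smooth_at0_def using smooth_on_mult[OF _ smooth_on_const] by blast
qed

lemma std_components:
  assumes "CARD('n::finite) \<ge> 2"
  shows "(std1 t :: 'n space) $ 1 = 0" "(std1 t :: 'n space) $ 2 = t" "(std1 t :: 'n space) $ 3 = 0"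
    "(std2 t :: 'n space) $ 1 = 0" "(std2 t :: 'n space) $ 2 = 0" "(std2 t :: 'n space) $ 3 = t"
    "(std3 t :: 'n space) $ 1 = t ^ 3" "(std3 t :: 'n space) $ 2 = - (t ^ 4)" "(std3 t :: 'n space) $ 3 = t ^ 2"
    "i \<notin> {1,2,3} \<Longrightarrow> (std1 t :: 'n space) $ i = 0" "i \<notin> {1,2,3} \<Longrightarrow> (std2 t :: 'n space) $ i = 0"
    "i \<notin> {1,2,3} \<Longrightarrow> (std3 t :: 'n space) $ i = 0"
  using bit0_numerals_distinct[OF assms] by (auto simp: std1_def std2_def std3_def axis_def)

lemma std_in_U8:
  assumes "CARD('n::finite) \<ge> 2"
  shows "(std1 t :: 'n space) \<in> U8" "(std2 t :: 'n space) \<in> U8" "(std3 t :: 'n space) \<in> U8"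
  unfolding U8_def using std_components[OF assms] by (auto simp: power2_eq_square eval_nat_numeral)

section \<open>Mixed partial derivatives\<close>

abbreviation pd :: "'n::finite bit0 \<Rightarrow> ('n space \<Rightarrow> real) \<Rightarrow> 'n space \<Rightarrow> real" where
  "pd i F \<equiv> \<lambda>x. fd F x (axis i 1)"

lemma smooth_on_pd_iter: "smooth_on U F \<Longrightarrow> smooth_on U ((pd i ^^ m) F)"
  by (induction m) (simp_all add: smooth_on_fd)

lemma pd_pd_iter:
  assumes F: "smooth_on U F" "open U" and x: "x \<in> U"
  shows "pd j ((pd i ^^ m) F) x = (pd i ^^ m) (pd j F) x"
  using x
proof (induction m arbitrary: x)
  case (Suc m)
  have "pd j ((pd i ^^ Suc m) F) x = pd i (pd j ((pd i ^^ m) F)) x"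
    using smooth_on_fd_commute[OF smooth_on_pd_iter[OF F(1)] F(2) Suc.prems] by simp
  also have "\<dots> = pd i ((pd i ^^ m) (pd j F)) x"
    by (rule fun_cong[OF fd_cong[OF F(2) Suc.prems Suc.IH]])
  finally show ?case by simp
qed simp

lemma pd_iter_cong:
  assumes "open U" "\<And>x. x \<in> U \<Longrightarrow> F x = G x" "x \<in> U"
  shows "(pd i ^^ m) F x = (pd i ^^ m) G x"
  using assms(3)
proof (induction m arbitrary: x)
  case (Suc m)
  show ?case using fun_cong[OF fd_cong[OF assms(1) Suc.prems Suc.IH]] by simp
qed (simp add: assms(2))

text \<open>The order of the derivations is fixed by convention; symmetry of second derivatives lets
  a further one be absorbed into its place.\<close>

definition partial :: "nat \<Rightarrow> nat \<Rightarrow> nat \<Rightarrow> ('n::finite space \<Rightarrow> real) \<Rightarrow> 'n space \<Rightarrow> real" where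
  "partial p q r F = (pd 1 ^^ p) ((pd 2 ^^ q) ((pd 3 ^^ r) F))"

lemma smooth_on_partial: "smooth_on U F \<Longrightarrow> smooth_on U (partial p q r F)"
  by (simp add: partial_def smooth_on_pd_iter)

lemma pd_partial:
  assumes F: "smooth_on U F" "open U" and x: "x \<in> U"
  shows "pd 1 (partial p q r F) x = partial (Suc p) q r F x" "pd 2 (partial p q r F) x = partial p (Suc q) r F x"
    "pd 3 (partial p q r F) x = partial p q (Suc r) F x"
proof -
  note s3 = smooth_on_pd_iter[OF F(1), of r 3]
  note s2 = smooth_on_pd_iter[OF s3, of q 2]
  show "pd 1 (partial p q r F) x = partial (Suc p) q r F x" by (simp add: partial_def)
  show "pd 2 (partial p q r F) x = partial p (Suc q) r F x"
    using pd_pd_iter[OF s2 F(2) x] by (simp add: partial_def)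
  have "pd 3 (partial p q r F) x = (pd 1 ^^ p) (pd 3 ((pd 2 ^^ q) ((pd 3 ^^ r) F))) x"
    using pd_pd_iter[OF s2 F(2) x] by (simp add: partial_def)
  also have "\<dots> = (pd 1 ^^ p) ((pd 2 ^^ q) (pd 3 ((pd 3 ^^ r) F))) x"
    by (rule pd_iter_cong[OF F(2) pd_pd_iter[OF s3 F(2)] x])
  finally show "pd 3 (partial p q r F) x = partial p q (Suc r) F x" by (simp add: partial_def)
qed

lemma smooth_at0_along:
  fixes F :: "'a::euclidean_space \<Rightarrow> 'b::real_normed_vector"
  assumes "smooth_on U F" "open U" "0 \<in> U" "smooth_on UNIV c" "c 0 = 0"
  shows "smooth_at0 (\<lambda>t. F (c t))" "\<forall>\<^sub>F t in nhds 0. c t \<in> U"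
proof -
  have o: "open (c -` U)" by (rule open_vimage[OF assms(2) smooth_on_continuous_on[OF assms(4)]])
  have "smooth_on (c -` U) (\<lambda>t. F (c t))"
    by (rule smooth_on_compose[OF assms(1) o smooth_on_subset[OF assms(4)]]) auto
  thus "smooth_at0 (\<lambda>t. F (c t))" unfolding smooth_at0_def using o assms(3,5) by (intro exI[of _ "c -` U"]) simp
  show "\<forall>\<^sub>F t in nhds 0. c t \<in> U"
    unfolding eventually_nhds using o assms(3,5) by (intro exI[of _ "c -` U"]) simp
qed

lemma tcoeff_axis_Suc:
  fixes F :: "'n::finite space \<Rightarrow> real"
  assumes F: "smooth_on U F" "open U" "0 \<in> U"
  shows "real (Suc m) * tcoeff (Suc m) (\<lambda>t. F (axis i t)) = tcoeff m (\<lambda>t. pd i F (axis i t))"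
proof -
  have ax: "(\<lambda>t. axis i t :: 'n space) = (\<lambda>t. t *\<^sub>R axis i 1)" by (rule ext) (rule axis_eq_scaleR)
  have s: "smooth_on UNIV (\<lambda>t. axis i t :: 'n space)"
    by (subst ax) (intro smooth_intros open_UNIV)
  have ev: "\<forall>\<^sub>F t in nhds 0. (axis i t :: 'n space) \<in> U"
    by (rule smooth_at0_along(2)[OF F s]) (simp add: vec_eq_iff axis_def)
  have "\<forall>\<^sub>F t in nhds 0. deriv (\<lambda>t. F (axis i t)) t = pd i F (axis i t)"
    using ev
  proof eventually_elim
    case (elim t)
    have "((\<lambda>t. axis i t :: 'n space) has_derivative (\<lambda>h. h *\<^sub>R axis i 1)) (at t)"
      by (subst ax) (auto intro!: derivative_eq_intros)
    from has_derivative_compose[OF this smooth_on_has_derivative[OF F(1) elim]]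
    have "((\<lambda>t. F (axis i t)) has_real_derivative pd i F (axis i t)) (at t)"
      using linear_scale[OF bounded_linear.linear[OF smooth_on_linear_fd[OF F(1) elim]]]
      by (simp add: has_field_derivative_def mult_commute_abs)
    thus ?case by (rule DERIV_imp_deriv)
  qed
  from tcoeff_cong[OF this, of m] show ?thesis by (simp only: tcoeff_deriv)
qed

lemma tcoeff_axis:
  fixes F :: "'n::finite space \<Rightarrow> real"
  assumes F: "smooth_on U F" "open U" "0 \<in> U"
  shows "fact m * tcoeff m (\<lambda>t. F (axis i t)) = (pd i ^^ m) F 0"
  using F(1)
proof (induction m arbitrary: F)
  case 0
  have "axis i 0 = (0 :: 'n space)" by (simp add: vec_eq_iff axis_def)
  from arg_cong[OF this, of F] show ?case by (simp add: tcoeff_def)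
next
  case (Suc m)
  have "fact (Suc m) * tcoeff (Suc m) (\<lambda>t. F (axis i t)) = fact m * tcoeff m (\<lambda>t. pd i F (axis i t))"
    using tcoeff_axis_Suc[OF Suc.prems F(2,3), of m i] by (simp add: mult_ac)
  also have "\<dots> = (pd i ^^ m) (pd i F) 0" by (rule Suc.IH[OF smooth_on_fd[OF Suc.prems]])
  finally show ?case by (simp only: funpow_Suc_right o_def)
qed

text \<open>Chain rule along the cusp, whose velocity is \<open>(3 t^2, -4 t^3, 2 t)\<close>; each
  power of t shifts the index of a Taylor coefficient.\<close>

lemma tcoeff_std3_Suc:
  fixes F :: "'n::finite space \<Rightarrow> real"
  assumes F: "smooth_on U F" "open U" "0 \<in> U"
  shows "real (Suc m) * tcoeff (Suc m) (\<lambda>t. F (std3 t)) =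
    3 * (if m < 2 then 0 else tcoeff (m - 2) (\<lambda>t. pd 1 F (std3 t)))
    - 4 * (if m < 3 then 0 else tcoeff (m - 3) (\<lambda>t. pd 2 F (std3 t)))
    + 2 * (if m < 1 then 0 else tcoeff (m - 1) (\<lambda>t. pd 3 F (std3 t)))"
proof -
  note ev = smooth_at0_along(2)[OF F smooth_std(3) std_0(3)]
  note s = smooth_at0_along(1)[OF smooth_on_fd[OF F(1)] F(2,3) smooth_std(3) std_0(3)]
  have dv: "\<forall>\<^sub>F t in nhds 0. deriv (\<lambda>t. F (std3 t)) t =
     3 * (t ^ 2 * pd 1 F (std3 t)) + (- 4) * (t ^ 3 * pd 2 F (std3 t)) + 2 * (t ^ 1 * pd 3 F (std3 t))"
    using ev
  proof eventually_elim
    case (elim t)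
    note l = bounded_linear.linear[OF smooth_on_linear_fd[OF F(1) elim]]
    have e: "fd F (std3 t) ((h * (3 * t ^ 2)) *\<^sub>R axis 1 1 + (h * - (4 * t ^ 3)) *\<^sub>R axis 2 1 + (h * (2 * t)) *\<^sub>R axis 3 1)
       = (3 * (t ^ 2 * pd 1 F (std3 t)) + (- 4) * (t ^ 3 * pd 2 F (std3 t)) + 2 * (t ^ 1 * pd 3 F (std3 t))) * h" for h
      by (simp only: linear_add[OF l] linear_scale[OF l] real_scaleR_def) (simp add: algebra_simps)
    have "(std3 has_derivative (\<lambda>h. (h * (3 * t ^ 2)) *\<^sub>R axis 1 1 + (h * - (4 * t ^ 3)) *\<^sub>R axis 2 1 + (h * (2 * t)) *\<^sub>R axis 3 1)) (at t)"
      unfolding std_eq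
      by (auto intro!: derivative_eq_intros simp: eval_nat_numeral algebra_simps)
    from has_derivative_compose[OF this smooth_on_has_derivative[OF F(1) elim]]
    have "((\<lambda>t. F (std3 t)) has_real_derivative
       3 * (t ^ 2 * pd 1 F (std3 t)) + (- 4) * (t ^ 3 * pd 2 F (std3 t)) + 2 * (t ^ 1 * pd 3 F (std3 t))) (at t)"
      unfolding e has_field_derivative_def mult_commute_abs .
    thus ?case by (rule DERIV_imp_deriv)
  qed
  have sm: "smooth_at0 (\<lambda>t. c * (t ^ j * pd i F (std3 t)))" for c j i
    by (rule smooth_at0_cmult[OF smooth_at0_mult_power[OF s]])
  from tcoeff_cong[OF dv, of m]
  have "real (Suc m) * tcoeff (Suc m) (\<lambda>t. F (std3 t)) = tcoeff m (\<lambda>t.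
     3 * (t ^ 2 * pd 1 F (std3 t)) + (- 4) * (t ^ 3 * pd 2 F (std3 t)) + 2 * (t ^ 1 * pd 3 F (std3 t)))"
    by (simp only: tcoeff_deriv)
  also have "\<dots> = 3 * tcoeff m (\<lambda>t. t ^ 2 * pd 1 F (std3 t)) + (- 4) * tcoeff m (\<lambda>t. t ^ 3 * pd 2 F (std3 t))
      + 2 * tcoeff m (\<lambda>t. t ^ 1 * pd 3 F (std3 t))"
    using tcoeff_add[OF smooth_at0_add[OF sm[of 3 2 1] sm[of "- 4" 3 2]] sm[of 2 1 3], of m]
      tcoeff_add[OF sm[of 3 2 1] sm[of "- 4" 3 2], of m]
    by (simp only: tcoeff_cmult[OF smooth_at0_mult_power[OF s]])
  finally show ?thesis
    by (simp only: tcoeff_mult_power[OF s])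
qed

text \<open>Set up for recursion: the chain rule expresses such a coefficient by coefficients of
  lower index of partial derivatives of one order more, down to index 0, the partial derivatives at
  the origin.\<close>

definition jet :: "nat \<Rightarrow> nat \<Rightarrow> nat \<Rightarrow> nat \<Rightarrow> ('n::finite space \<Rightarrow> real) \<Rightarrow> real" where
  "jet m p q r F = tcoeff m (\<lambda>t. partial p q r F (std3 t))"

lemma jet_Suc:
  fixes F :: "'n::finite space \<Rightarrow> real"
  assumes F: "smooth_on U F" "open U" "0 \<in> U"
  shows "real (Suc m) * jet (Suc m) p q r F = 3 * (if m < 2 then 0 else jet (m - 2) (Suc p) q r F)
    - 4 * (if m < 3 then 0 else jet (m - 3) p (Suc q) r F) + 2 * (if m < 1 then 0 else jet (m - 1) p q (Suc r) F)"
proof -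
  note ev = smooth_at0_along(2)[OF F smooth_std(3) std_0(3)]
  have "tcoeff j (\<lambda>t. pd 1 (partial p q r F) (std3 t)) = jet j (Suc p) q r F"
    "tcoeff j (\<lambda>t. pd 2 (partial p q r F) (std3 t)) = jet j p (Suc q) r F"
    "tcoeff j (\<lambda>t. pd 3 (partial p q r F) (std3 t)) = jet j p q (Suc r) F" for j
    unfolding jet_def
    by (rule tcoeff_cong, rule eventually_mono[OF ev], erule pd_partial[OF F(1,2)])+
  thus ?thesis
    using tcoeff_std3_Suc[OF smooth_on_partial[OF F(1)] F(2,3), of m p q r] by (simp add: jet_def)
qed

text \<open>The chain rule unrolled: index m involves only additional derivations of total weight m
  for the weights 3, 4, 2. For 8 and 9 one step of the recursion is left standing, as only few
  instances are used.\<close>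

lemma jet_values:
  fixes F :: "'n::finite space \<Rightarrow> real"
  assumes F: "smooth_on U F" "open U" "0 \<in> U" and f: "\<And>p q r. f p q r = jet 0 p q r F"
  shows "jet (Suc 0) p q r F = 0" "jet 2 p q r F = f p q (Suc r)" "jet 3 p q r F = f (Suc p) q r"
    "jet 4 p q r F = f p q (Suc (Suc r)) / 2 - f p (Suc q) r"
    "jet 5 p q r F = f (Suc p) q (Suc r)"
    "jet 6 p q r F = f (Suc (Suc p)) q r / 2 - f p (Suc q) (Suc r) + f p q (Suc (Suc (Suc r))) / 6"
    "jet 7 p q r F = f (Suc p) q (Suc (Suc r)) / 2 - f (Suc p) (Suc q) r"
    "8 * jet 8 p q r F = 3 * jet 5 (Suc p) q r F - 4 * jet 4 p (Suc q) r F + 2 * jet 6 p q (Suc r) F"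
    "9 * jet 9 p q r F = 3 * jet 6 (Suc p) q r F - 4 * jet 5 p (Suc q) r F + 2 * jet 7 p q (Suc r) F"
proof -
  note S = jet_Suc[OF F]
  have 1: "jet (Suc 0) p q r F = 0" for p q r using S[of 0 p q r] by simp
  have 2: "jet 2 p q r F = f p q (Suc r)" for p q r using S[of 1 p q r] by (simp add: f numeral_2_eq_2)
  have 3: "jet 3 p q r F = f (Suc p) q r" for p q r using S[of 2 p q r] 1 by (simp add: f numeral_3_eq_3)
  have 4: "jet 4 p q r F = f p q (Suc (Suc r)) / 2 - f p (Suc q) r" for p q r
    using S[of 3 p q r] 1[of "Suc p" q r] 2[of p q "Suc r"] by (simp add: f)
  have 5: "jet 5 p q r F = f (Suc p) q (Suc r)" for p q r
    using S[of 4 p q r] 1[of p "Suc q" r] 2[of "Suc p" q r] 3[of p q "Suc r"] by simp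
  have 6: "jet 6 p q r F = f (Suc (Suc p)) q r / 2 - f p (Suc q) (Suc r) + f p q (Suc (Suc (Suc r))) / 6" for p q r
    using S[of 5 p q r] 2[of p "Suc q" r] 3[of "Suc p" q r] 4[of p q "Suc r"] by simp
  have 7: "jet 7 p q r F = f (Suc p) q (Suc (Suc r)) / 2 - f (Suc p) (Suc q) r" for p q r
    using S[of 6 p q r] 3[of p "Suc q" r] 4[of "Suc p" q r] 5[of p q "Suc r"] by simp
  show "jet (Suc 0) p q r F = 0" "jet 2 p q r F = f p q (Suc r)" "jet 3 p q r F = f (Suc p) q r"
    "jet 4 p q r F = f p q (Suc (Suc r)) / 2 - f p (Suc q) r" "jet 5 p q r F = f (Suc p) q (Suc r)"
    "jet 6 p q r F = f (Suc (Suc p)) q r / 2 - f p (Suc q) (Suc r) + f p q (Suc (Suc (Suc r))) / 6"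
    "jet 7 p q r F = f (Suc p) q (Suc (Suc r)) / 2 - f (Suc p) (Suc q) r"
    by (rule 1 2 3 4 5 6 7)+
  show "8 * jet 8 p q r F = 3 * jet 5 (Suc p) q r F - 4 * jet 4 p (Suc q) r F + 2 * jet 6 p q (Suc r) F"
    using S[of 7 p q r] by simp
  show "9 * jet 9 p q r F = 3 * jet 6 (Suc p) q r F - 4 * jet 5 p (Suc q) r F + 2 * jet 7 p q (Suc r) F"
    using S[of 8 p q r] by simp
qed

lemma partial_on_axis_zero:
  fixes F :: "'n::finite space \<Rightarrow> real"
  assumes F: "smooth_on U F" "open U" "0 \<in> U"
    and i: "i \<in> {1, 2, 3}" and o: "order_ge k (\<lambda>t. pd i F (axis j t))" and m: "m < k"
  shows "(pd j ^^ m) (pd i F) 0 = 0"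
proof -
  have ax: "(\<lambda>t. axis j t :: 'n space) = (\<lambda>t. t *\<^sub>R axis j 1)" by (rule ext) (rule axis_eq_scaleR)
  have s: "smooth_on UNIV (\<lambda>t. axis j t :: 'n space)" by (subst ax) (intro smooth_intros open_UNIV)
  have "smooth_at0 (\<lambda>t. pd i F (axis j t))"
    by (rule smooth_at0_along(1)[OF smooth_on_fd[OF F(1)] F(2,3) s]) (simp add: vec_eq_iff axis_def)
  hence "tcoeff m (\<lambda>t. pd i F (axis j t)) = 0" using o m order_ge_iff_tcoeff by blast
  thus ?thesis using tcoeff_axis[OF smooth_on_fd[OF F(1), of "axis i 1"] F(2,3), of m j] by simp
qed

text \<open>Along a coordinate axis each first derivative of F is seen with all its derivatives in
  the direction of the axis. The order conditions therefore kill the partial derivatives that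
  contain at most one derivation across the axis.\<close>

lemma partial_zero_of_std12:
  fixes F :: "'n::finite space \<Rightarrow> real"
  assumes F: "smooth_on U F" "open U" "0 \<in> U" and m: "m < k"
    and o: "\<And>i. i \<in> {1, 2, 3} \<Longrightarrow> order_ge k (\<lambda>t. pd i F (std1 t))"
      "\<And>i. i \<in> {1, 2, 3} \<Longrightarrow> order_ge k (\<lambda>t. pd i F (std2 t))"
  shows "partial 1 m 0 F 0 = 0" "partial 0 (Suc m) 0 F 0 = 0" "partial 0 m 1 F 0 = 0"
    "partial 1 0 m F 0 = 0" "partial 0 1 m F 0 = 0" "partial 0 0 (Suc m) F 0 = 0"
proof -
  note z1 = partial_on_axis_zero[OF F _ o(1)[unfolded std1_def] m]
    and z2 = partial_on_axis_zero[OF F _ o(2)[unfolded std2_def] m]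
  show "partial 1 m 0 F 0 = 0" using z1[of 1] pd_pd_iter[OF F, where j=1 and i=2 and m=m] by (simp add: partial_def)
  show "partial 0 (Suc m) 0 F 0 = 0" using z1[of 2] pd_pd_iter[OF F, where j=2 and i=2 and m=m] by (simp add: partial_def)
  show "partial 0 m 1 F 0 = 0" using z1[of 3] by (simp add: partial_def)
  show "partial 1 0 m F 0 = 0" using z2[of 1] pd_pd_iter[OF F, where j=1 and i=3 and m=m] by (simp add: partial_def)
  show "partial 0 1 m F 0 = 0" using z2[of 2] pd_pd_iter[OF F, where j=2 and i=3 and m=m] by (simp add: partial_def)
  show "partial 0 0 (Suc m) F 0 = 0" using z2[of 3] pd_pd_iter[OF F, where j=3 and i=3 and m=m] by (simp add: partial_def)
qed

text \<open>The monomial \<open>c * t ^ l\<close> stands for the trace of a primitive on the cusp;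
  the derivative by \<open>x3\<close> has to cancel it, the other two derivatives have nothing to
  cancel.\<close>

lemma jet_of_order:
  fixes F :: "'n::finite space \<Rightarrow> real"
  assumes F: "smooth_on U F" "open U" "0 \<in> U"
    and o: "order_ge k (\<lambda>t. pd 1 F (std3 t))" "order_ge k (\<lambda>t. pd 2 F (std3 t))"
      "order_ge k (\<lambda>t. pd 3 F (std3 t) + c * t ^ l)" and m: "m < k"
  shows "jet m 1 0 0 F = 0" "jet m 0 1 0 F = 0" "jet m 0 0 1 F = - (if m = l then c else 0)"
proof -
  note s = smooth_at0_along(1)[OF smooth_on_fd[OF F(1)] F(2,3) smooth_std(3) std_0(3)]
  have p: "partial 1 0 0 F = pd 1 F" "partial 0 1 0 F = pd 2 F" "partial 0 0 1 F = pd 3 F"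
    by (simp_all add: partial_def)
  show "jet m 1 0 0 F = 0" "jet m 0 1 0 F = 0"
    unfolding jet_def p using o(1,2) m order_ge_iff_tcoeff[OF s] by blast+
  have sl: "smooth_at0 (\<lambda>t. c * t ^ l)"
    unfolding smooth_at0_def by (intro exI[of _ UNIV] conjI smooth_intros open_UNIV UNIV_I)
  have sl1: "smooth_at0 (\<lambda>t::real. t ^ l)"
    unfolding smooth_at0_def by (intro exI[of _ UNIV] conjI smooth_intros open_UNIV UNIV_I)
  have "tcoeff m (\<lambda>t. pd 3 F (std3 t) + c * t ^ l) = 0"
    using o(3) m order_ge_iff_tcoeff[OF smooth_at0_add[OF s sl]] by blast
  thus "jet m 0 0 1 F = - (if m = l then c else 0)"
    unfolding jet_def p tcoeff_add[OF s sl] tcoeff_cmult[OF sl1] tcoeff_power by auto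
qed

text \<open>The monomials of F in question are \<open>x1 x2\<close> and \<open>x1 x3^2\<close>, of
  weight 7. The derivative by \<open>x2\<close> kills the first at t^3, the derivative by
  \<open>x1\<close> then kills the second at t^4, and at t^5 the derivative by \<open>x3\<close> has
  nothing left to cancel c.\<close>

lemma std3_order_bound:
  fixes F :: "'n::finite space \<Rightarrow> real"
  assumes F: "smooth_on U F" "open U" "0 \<in> U"
    and o: "order_ge 6 (\<lambda>t. pd 1 F (std3 t))" "order_ge 6 (\<lambda>t. pd 2 F (std3 t))"
      "order_ge 6 (\<lambda>t. pd 3 F (std3 t) + c * t ^ 5)"
  shows "c = 0"
proof -
  define f where "f p q r = jet 0 p q r F" for p q r
  note v = jet_values[OF F f_def]
  note j = jet_of_order[OF F o]
  show ?thesis using j(1)[of 4] j(2)[of 3] j(3)[of 5] v(3)[of 0 1 0] v(4)[of 1 0 0] v(5)[of 0 0 1] by simp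
qed

text \<open>Only monomials of quasihomogeneous weight \<open>l + 2\<close> of \<open>F\<close> matter; the conditions on the two
  smooth branches kill enough of their coefficients for those on the cuspidal branch to be contradictory.\<close>

lemma branches_order_bound:
  fixes F :: "'n::finite space \<Rightarrow> real"
  assumes F: "smooth_on U F" "open U" "0 \<in> U" and l: "l \<in> {5, 6, 7, 8, 9}"
    and o: "order_ge (Suc l) (\<lambda>t. pd 1 F (std3 t))" "order_ge (Suc l) (\<lambda>t. pd 2 F (std3 t))"
      "order_ge (Suc l) (\<lambda>t. pd 3 F (std3 t) + c * t ^ l)"
    and o12: "\<And>i. i \<in> {1, 2, 3} \<Longrightarrow> order_ge (Suc l) (\<lambda>t. pd i F (std1 t))"
      "\<And>i. i \<in> {1, 2, 3} \<Longrightarrow> order_ge (Suc l) (\<lambda>t. pd i F (std2 t))"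
  shows "c = 0"
proof -
  define f where "f p q r = jet 0 p q r F" for p q r
  note v = jet_values[OF F f_def]
  note j = jet_of_order[OF F o]
  have ff: "f p q r = partial p q r F 0" for p q r by (simp add: f_def jet_def tcoeff_def std_0)
  note z = partial_zero_of_std12[OF F _ o12, folded ff]
  consider "l = 5" | "l = 6" | "l = 7" | "l = 8" | "l = 9" using l by auto
  thus ?thesis
  proof cases
    case 1
    thus ?thesis using j(1)[of 4] j(2)[of 3] j(3)[of 5] v(3)[of 0 1 0] v(4)[of 1 0 0] v(5)[of 0 0 1] by simp
  next
    case 2
    \<comment> \<open>Weight 8. The axes kill \<open>x2^2\<close> and \<open>x3^4\<close> in F; the
      derivative by \<open>x1\<close> kills \<open>x1^2 x3\<close>, and the one by \<open>x2\<close>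
      then kills \<open>x2 x3^2\<close>.\<close>
    thus ?thesis using j(1)[of 5] j(2)[of 4] j(3)[of 6] v(5)[of 1 0 0] v(4)[of 0 1 0] v(6)[of 0 0 1] z(2)[of 1] z(6)[of 3]
      by (simp add: eval_nat_numeral)
  next
    case 3
    \<comment> \<open>Weight 9. The derivative by \<open>x2\<close> kills \<open>x1 x2 x3\<close>
      and the third axis kills \<open>x1 x3^3\<close>; these two make up the coefficient of
      t^7.\<close>
    thus ?thesis using j(1)[of 6] j(2)[of 5] j(3)[of 7] v(6)[of 1 0 0] v(5)[of 0 1 0] v(7)[of 0 0 1] z(4)[of 3]
      by (simp add: eval_nat_numeral)
  next
    case 4
    \<comment> \<open>Weight 10. The axes kill \<open>x2^2 x3\<close>, \<open>x2 x3^3\<close> and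
      \<open>x3^5\<close>; then the derivative by \<open>x2\<close> kills \<open>x1^2 x2\<close>,
      and the one by \<open>x1\<close> kills \<open>x1^2 x3^2\<close>.\<close>
    thus ?thesis using j(1)[of 7] j(2)[of 6] j(3)[of 8] v(7)[of 1 0 0] v(6)[of 0 1 0] v(8)[of 0 0 1]
        v(5)[of 1 0 1] v(4)[of 0 1 1] v(6)[of 0 0 2] z(2)[of 1] z(5)[of 3] z(6)[of 4] z(3)[of 2]
      by (simp add: eval_nat_numeral)
  next
    case 5
    \<comment> \<open>Weight 11. The axes kill \<open>x1 x2^2\<close> and \<open>x1 x3^4\<close>;
      then the derivative by \<open>x2\<close> kills \<open>x1 x2 x3^2\<close>, and the one by
      \<open>x1\<close> kills \<open>x1^3 x3\<close>.\<close>
    thus ?thesis using j(1)[of 8] j(2)[of 7] j(3)[of 9] v(7)[of 0 1 0] v(9)[of 0 0 1] v(8)[of 1 0 0]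
        v(5)[of 2 0 0] v(4)[of 1 1 0] v(6)[of 1 0 1] v(6)[of 1 0 1] v(5)[of 0 1 1] v(7)[of 0 0 2] z(1)[of 2] z(4)[of 4]
      by (simp add: eval_nat_numeral)
  qed
qed

section \<open>Tangency orders from primitives\<close>

text \<open>\<open>F y\<close> integrates \<kappa> along the segment from 0 to y. By closedness the
  integrand of its derivative is the s-derivative of
  \<open>s * \<kappa> (s *\<^sub>R y) u\<close>.\<close>

lemma closed_form1_exact:
  fixes \<kappa> :: "'n::finite form1"
  assumes \<kappa>: "form1_on (ball 0 r) \<kappa>" and closed: "\<And>x u v. x \<in> ball 0 r \<Longrightarrow> d_form1 \<kappa> x u v = 0"
  obtains F where "smooth_on (ball 0 r) F" "\<And>x u. x \<in> ball 0 r \<Longrightarrow> fd F x u = \<kappa> x u"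
proof -
  let ?B = "ball (0::'n space) r"
  define W where "W = (\<lambda>p::real \<times> 'n space. fst p *\<^sub>R snd p) -` ?B"
  define g where "g p = \<kappa> (fst p *\<^sub>R snd p) (snd p)" for p :: "real \<times> 'n space"
  have fs: "smooth_on UNIV (\<lambda>p::real \<times> 'n space. fst p)" "smooth_on UNIV (\<lambda>p::real \<times> 'n space. snd p)"
    by (intro smooth_intros open_UNIV)+
  have sm: "smooth_on UNIV (\<lambda>p::real \<times> 'n space. fst p *\<^sub>R snd p)" by (intro smooth_intros open_UNIV)
  have W: "open W" unfolding W_def by (rule open_vimage[OF open_ball smooth_on_continuous_on[OF sm]])
  have inB: "fst p *\<^sub>R snd p \<in> ?B" if "p \<in> W" for p using that by (simp add: W_def)
  have ball: "s *\<^sub>R y \<in> ?B" if "s \<in> {0..1}" "y \<in> ?B" for s y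
  proof -
    have "\<bar>s\<bar> * norm y \<le> 1 * norm y" using that(1) by (intro mult_right_mono) auto
    thus ?thesis using that(2) by simp
  qed
  have WB: "{0..1} \<times> ?B \<subseteq> W"
  proof
    fix p :: "real \<times> 'n space" assume "p \<in> {0..1} \<times> ?B"
    hence "fst p *\<^sub>R snd p \<in> ?B" by (intro ball) auto
    thus "p \<in> W" by (simp only: W_def vimage_eq)
  qed
  have gW: "smooth_on W g" unfolding g_def
    by (rule form1_smooth_along[OF \<kappa> W inB smooth_on_subset[OF sm] smooth_on_subset[OF fs(2)]]) auto
  define F where "F y = integral {0..1} (\<lambda>s. g (s, y))" for y
  have fdg: "fd g (s, y) (0, v) = s * fd (\<lambda>x. \<kappa> x y) (s *\<^sub>R y) v + \<kappa> (s *\<^sub>R y) v"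
    if s: "s \<in> {0..1}" and y: "y \<in> ?B" for s y v
  proof -
    have p: "(s, y) \<in> W" using WB s y by blast
    have sy: "s *\<^sub>R y \<in> ?B" by (rule ball[OF s y])
    have "((\<lambda>p. fst p *\<^sub>R snd p) has_derivative (\<lambda>q. s *\<^sub>R snd q + fst q *\<^sub>R y)) (at (s, y))"
      by (auto intro!: derivative_eq_intros)
    from form1_has_derivative[OF \<kappa> open_ball W p inB this has_derivative_snd[OF has_derivative_ident]]
    have "(g has_derivative (\<lambda>q. fd (\<lambda>x. \<kappa> x y) (s *\<^sub>R y) (s *\<^sub>R snd q + fst q *\<^sub>R y) + \<kappa> (s *\<^sub>R y) (snd q))) (at (s, y))"
      by (simp add: g_def[abs_def])
    from fun_cong[OF fd_eqI[OF this], of "(0, v)"] show ?thesis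
      using linear_scale[OF bounded_linear.linear[OF smooth_on_linear_fd[OF form1_onD(2)[OF \<kappa>] sy]]] by simp
  qed
  show ?thesis
  proof (rule that[of F])
    show "smooth_on ?B F" unfolding F_def by (rule smooth_on_integral_param[OF gW W WB open_ball])
    fix y u assume y: "y \<in> ?B"
    have "fd F y u = integral {0..1} (\<lambda>s. fd g (s, y) (0, u))"
      unfolding F_def by (rule fun_cong[OF fd_eqI[OF has_derivative_integral_param[OF gW W WB open_ball y]]])
    moreover have "((\<lambda>s. fd g (s, y) (0, u)) has_integral 1 * \<kappa> (1 *\<^sub>R y) u - 0 * \<kappa> (0 *\<^sub>R y) u) {0..1}"
    proof (rule fundamental_theorem_of_calculus)
      fix s :: real assume s: "s \<in> {0..1}"
      have sy: "s *\<^sub>R y \<in> ?B" by (rule ball[OF s y])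
      have "((\<lambda>s. s *\<^sub>R y) has_derivative (\<lambda>h. h *\<^sub>R y)) (at s)" by (auto intro!: derivative_eq_intros)
      from has_derivative_compose[OF this smooth_on_has_derivative[OF form1_onD(2)[OF \<kappa>] sy]]
      have "((\<lambda>s. \<kappa> (s *\<^sub>R y) u) has_real_derivative fd (\<lambda>x. \<kappa> x u) (s *\<^sub>R y) y) (at s)"
        using linear_scale[OF bounded_linear.linear[OF smooth_on_linear_fd[OF form1_onD(2)[OF \<kappa>] sy]]]
        by (simp add: has_field_derivative_def mult_commute_abs)
      from DERIV_mult[OF DERIV_ident this]
      have "((\<lambda>s. s * \<kappa> (s *\<^sub>R y) u) has_real_derivative 1 * \<kappa> (s *\<^sub>R y) u + fd (\<lambda>x. \<kappa> x u) (s *\<^sub>R y) y * s) (at s)" .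
      moreover have "fd (\<lambda>x. \<kappa> x u) (s *\<^sub>R y) y = fd (\<lambda>x. \<kappa> x y) (s *\<^sub>R y) u"
        using closed[OF sy, of y u] by (simp add: d_form1_def)
      ultimately have "((\<lambda>s. s * \<kappa> (s *\<^sub>R y) u) has_real_derivative fd g (s, y) (0, u)) (at s)"
        unfolding fdg[OF s y] by (simp add: algebra_simps)
      thus "((\<lambda>s. s * \<kappa> (s *\<^sub>R y) u) has_vector_derivative fd g (s, y) (0, u)) (at s within {0..1})"
        by (simp add: has_real_derivative_iff_has_vector_derivative has_vector_derivative_at_within)
    qed simp
    ultimately show "fd F y u = \<kappa> y u" by (simp add: integral_unique)
  qed
qed

section \<open>Lagrangian germs built in a chart\<close>

lemma pullback_nondegenerate:
  fixes \<omega> :: "'n::finite form2"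
  assumes \<omega>: "symplectic_germ \<omega>" and d: "local_diffeo \<Phi> \<Psi> U V" and z: "\<And>v. pullback \<Phi> \<omega> 0 u v = 0"
  shows "u = 0"
proof -
  note D = local_diffeoD[OF d]
  note inv = local_diffeo_fd_inverse[OF d D(3)]
  obtain r lam where r: "r > 0" "form2_on (ball 0 r) \<omega>" "\<And>x u. x \<in> ball 0 r \<Longrightarrow> (\<And>v. \<omega> x u v = 0) \<Longrightarrow> u = 0"
    by (rule symplectic_germ_exact[OF \<omega>]) blast
  have "fd \<Phi> 0 u = 0"
  proof (rule r(3))
    show "0 \<in> ball (0::'n space) r" using r(1) by simp
    fix v
    have "\<omega> 0 (fd \<Phi> 0 u) (fd \<Phi> 0 (fd \<Psi> (\<Phi> 0) v)) = 0" using z by (simp add: pullback_def D(5))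
    thus "\<omega> 0 (fd \<Phi> 0 u) v = 0" by (simp only: inv(2))
  qed
  hence "fd \<Psi> (\<Phi> 0) (fd \<Phi> 0 u) = 0"
    using linear_0[OF bounded_linear.linear[OF smooth_on_linear_fd[OF D(8,4)]]] D(5) by simp
  thus ?thesis by (simp only: inv(1))
qed

lemma lagrangian_of_chart_primitive:
  fixes \<omega> :: "'n::finite form2"
  assumes \<omega>: "symplectic_germ \<omega>" and d: "local_diffeo \<Phi> \<Psi> U V" and \<beta>: "form1_on U \<beta>"
    and eq: "\<And>x u v. x \<in> U \<Longrightarrow> pullback \<Phi> \<omega> x u v = d_form1 \<beta> x u v" and \<beta>0: "\<And>u. \<beta> 0 u = 0"
    and M: "subspace M" "\<And>u v. u \<in> M \<Longrightarrow> v \<in> M \<Longrightarrow> d_form1 \<beta> 0 u v = 0"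
  obtains H \<delta> \<tau> where "lagrangian_germ \<omega> H" "\<delta> > 0"
    "\<And>y i. y \<in> M \<Longrightarrow> y \<in> ball 0 \<delta> \<Longrightarrow> y \<in> U \<and> H (\<Phi> y) $ i = \<beta> y (\<tau> i)"
proof -
  note D = local_diffeoD[OF d]
  have nd: "u = 0" if "\<And>v. d_form1 \<beta> 0 u v = 0" for u
    by (rule pullback_nondegenerate[OF \<omega> d]) (simp add: eq[OF D(3)] that)
  obtain H \<delta> \<tau> where H: "lagrangian_germ (d_form1 \<beta>) H" "\<delta> > 0"
    "\<And>y i. y \<in> M \<Longrightarrow> y \<in> ball 0 \<delta> \<Longrightarrow> y \<in> U \<and> H y $ i = \<beta> y (\<tau> i)"
    by (rule lagrangian_of_primitive[OF D(1,3) \<beta> nd M \<beta>0]) blast+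
  show ?thesis
  proof (rule that[OF lagrangian_germ_transport[OF d H(1) eq] H(2)])
    fix y i assume "y \<in> M" "y \<in> ball 0 \<delta>"
    from H(3)[OF this, of i] show "y \<in> U \<and> H (\<Psi> (\<Phi> y)) $ i = \<beta> y (\<tau> i)" using D(11) by simp
  qed
qed

text \<open>Straightens the surface \<open>x\<^sub>2 = - x\<^sub>3\<^sup>2\<close>, which contains the cuspidal branch.\<close>

definition shear :: "'n::finite space \<Rightarrow> 'n space" where
  "shear x = x - ((x $ 3) ^ 2) *\<^sub>R axis 2 1"

definition unshear :: "'n::finite space \<Rightarrow> 'n space" where
  "unshear x = x + ((x $ 3) ^ 2) *\<^sub>R axis 2 1"

lemma local_diffeo_shear:
  assumes "CARD('n::finite) \<ge> 2"
  shows "local_diffeo (shear :: 'n space \<Rightarrow> 'n space) unshear UNIV UNIV"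
proof -
  note b = bit0_numerals_distinct[OF assms]
  have s: "smooth_on UNIV (shear :: 'n space \<Rightarrow> 'n space)" "smooth_on UNIV (unshear :: 'n space \<Rightarrow> 'n space)"
    unfolding shear_def[abs_def] unshear_def[abs_def] by (intro smooth_intros open_UNIV)+
  have "homeomorphism UNIV UNIV (shear :: 'n space \<Rightarrow> 'n space) unshear"
  proof (rule homeomorphismI)
    show "unshear (shear x) = x" "shear (unshear x) = x" for x :: "'n space"
      using b by (simp_all add: shear_def unshear_def axis_def)
  qed (use s in \<open>simp_all add: smooth_on_continuous_on\<close>)
  thus ?thesis using s by (simp add: local_diffeo_def shear_def)
qed

lemma fd_shear: "fd shear x u = u - (2 * x $ 3 * u $ 3) *\<^sub>R axis 2 1"
proof -
  have "(shear has_derivative (\<lambda>u. u - (2 * x $ 3 * u $ 3) *\<^sub>R axis 2 1)) (at x)"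
    unfolding shear_def[abs_def]
    by (auto intro!: derivative_eq_intros bounded_linear.has_derivative[OF bounded_linear_vec_nth])
  from fun_cong[OF fd_eqI[OF this]] show ?thesis .
qed

text \<open>After the shear the cusp lies in the plane of the first and third coordinates, so
  isotropy of this one plane at 0 suffices. This is how \<open>L3\<close> can be infinite although
  the form does not vanish on W.\<close>

lemma lagrangian_along_std3:
  fixes \<omega> :: "'n::finite form2"
  assumes card: "CARD('n) \<ge> 2" and \<omega>: "symplectic_germ \<omega>" and d: "local_diffeo \<Phi> \<Psi> U V" and \<beta>: "form1_on U \<beta>"
    and eq: "\<And>x u v. x \<in> U \<Longrightarrow> pullback \<Phi> \<omega> x u v = d_form1 \<beta> x u v" and \<beta>0: "\<And>u. \<beta> 0 u = 0"
    and iso: "d_form1 \<beta> 0 (axis 1 1) (axis 3 1) = 0"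
  obtains H where "lagrangian_germ \<omega> H"
    "\<And>k. (\<And>u. order_ge k (\<lambda>t. \<beta> (std3 t) u)) \<Longrightarrow> order_ge k (\<lambda>t. H (\<Phi> (std3 t)))"
proof -
  note D = local_diffeoD[OF d]
  note b = bit0_numerals_distinct[OF card]
  note ds = local_diffeo_shear[OF card]
  note dc = local_diffeo_compose[OF ds d]
  define U1 where "U1 = (UNIV :: 'n space set) \<inter> shear -` U"
  have s1: "smooth_on U1 (shear :: 'n space \<Rightarrow> 'n space)" using local_diffeoD(7)[OF ds] smooth_on_subset by blast
  have U1: "open U1" using local_diffeoD(1)[OF dc] by (simp add: U1_def)
  have inU: "shear x \<in> U" if "x \<in> U1" for x using that by (simp add: U1_def)
  define \<beta>' where "\<beta>' = pullback1 shear \<beta>"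
  have \<beta>': "form1_on U1 \<beta>'" unfolding \<beta>'_def by (rule form1_on_pullback1[OF \<beta> U1 s1 inU])
  have d\<beta>': "d_form1 \<beta>' x u v = d_form1 \<beta> (shear x) (fd shear x u) (fd shear x v)" if "x \<in> U1" for x u v
    using d_form1_pullback1[OF \<beta> D(1) U1 s1 inU that] by (simp add: \<beta>'_def pullback_def)
  define M :: "'n space set" where "M = {x. \<forall>i. i \<notin> {1, 3} \<longrightarrow> x $ i = 0}"
  have M: "subspace M" by (auto simp: subspace_def M_def)
  have Mexp: "x = x $ 1 *\<^sub>R axis 1 1 + x $ 3 *\<^sub>R axis 3 1" if "x \<in> M" for x
    using that b by (auto simp: M_def vec_eq_iff axis_def)
  have shear0: "shear (0 :: 'n space) = 0" "fd shear 0 u = u" for u :: "'n space" by (simp_all add: shear_def fd_shear)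
  have zU1: "0 \<in> U1" using D(3) shear0 by (simp add: U1_def)
  obtain H \<delta> \<tau> where H: "lagrangian_germ \<omega> H" "\<delta> > 0"
    "\<And>y i. y \<in> M \<Longrightarrow> y \<in> ball 0 \<delta> \<Longrightarrow> y \<in> U1 \<and> H (\<Phi> (shear y)) $ i = \<beta>' y (\<tau> i)"
  proof (rule lagrangian_of_chart_primitive[OF \<omega> dc[folded U1_def] \<beta>' _ _ M])
    fix x u v assume x: "x \<in> U1"
    have "fd (\<lambda>x. \<Phi> (shear x)) x w = fd \<Phi> (shear x) (fd shear x w)" for w
      by (rule fd_compose[OF D(7) s1 x inU[OF x]])
    thus "pullback (\<lambda>x. \<Phi> (shear x)) \<omega> x u v = d_form1 \<beta>' x u v"
      using eq[OF inU[OF x]] by (simp add: d\<beta>'[OF x] pullback_def)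
  next
    show "\<beta>' 0 u = 0" for u by (simp add: \<beta>'_def pullback1_def shear0 \<beta>0)
  next
    fix u v assume uv: "u \<in> M" "v \<in> M"
    note f2 = form2_on_d_form1[OF \<beta> D(1)]
    note bl = form2_onD(1)[OF f2 D(3)] and alt = form2_onD(2)[OF f2 D(3)]
    have "d_form1 \<beta> 0 (axis 3 1) (axis 1 1) = 0" using iso form2_antisym[OF f2 D(3), of "axis 3 1"] by simp
    hence "d_form1 \<beta> 0 (u $ 1 *\<^sub>R axis 1 1 + u $ 3 *\<^sub>R axis 3 1) (v $ 1 *\<^sub>R axis 1 1 + v $ 3 *\<^sub>R axis 3 1) = 0"
      using iso alt by (simp add: bilinear_ladd[OF bl] bilinear_radd[OF bl] bilinear_lmul[OF bl] bilinear_rmul[OF bl])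
    thus "d_form1 \<beta>' 0 u v = 0" using Mexp[OF uv(1)] Mexp[OF uv(2)] by (simp add: d\<beta>'[OF zU1] shear0)
  next
    fix H \<delta> \<tau> assume a: "lagrangian_germ \<omega> H" "\<delta> > 0"
      "\<And>y i. y \<in> M \<Longrightarrow> y \<in> ball 0 \<delta> \<Longrightarrow> y \<in> U1 \<and> H (\<Phi> (shear y)) $ i = \<beta>' y (\<tau> i)"
    show thesis by (rule that[OF a])
  qed
  \<comment> \<open>The preimage of the cusp under \<open>shear\<close>, which restores the second
    coordinate \<open>- (t ^ 4)\<close> from the square of the third.\<close>
  define c :: "real \<Rightarrow> 'n space" where "c t = (t ^ 3) *\<^sub>R axis 1 1 + (t ^ 2) *\<^sub>R axis 3 1" for t
  have cM: "c t \<in> M" for t by (auto simp: c_def M_def axis_def)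
  have c3: "c t $ 3 = t ^ 2" for t using b by (simp add: c_def axis_def)
  have sc: "shear (c t) = std3 t" for t
    unfolding shear_def c3 unfolding c_def std_eq by simp
  have sm: "smooth_on UNIV c" unfolding c_def by (intro smooth_intros open_UNIV)
  have ev: "\<forall>\<^sub>F t in nhds 0. c t \<in> ball 0 \<delta>"
  proof -
    have "open (c -` ball 0 \<delta>)" by (rule open_vimage[OF open_ball smooth_on_continuous_on[OF sm]])
    moreover have "0 \<in> c -` ball 0 \<delta>" using H(2) by (simp add: c_def)
    ultimately show ?thesis unfolding eventually_nhds by (intro exI[of _ "c -` ball 0 \<delta>"]) simp
  qed
  show ?thesis
  proof (rule that[OF H(1)])
    fix k assume o: "\<And>u. order_ge k (\<lambda>t. \<beta> (std3 t) u)"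
    show "order_ge k (\<lambda>t. H (\<Phi> (std3 t)))"
      unfolding order_ge_vec_iff
    proof
      fix i
      have "order_ge k (\<lambda>t. \<beta> (std3 t) (\<tau> i))" by (rule o)
      \<comment> \<open>The differential of the shear along the cusp adds this multiple of the
        second component; its factor is bounded near 0 and does not lower the order.\<close>
      moreover have "order_ge k (\<lambda>t. (- 2 * t ^ 2 * \<tau> i $ 3) * \<beta> (std3 t) (axis 2 1))"
      proof (rule order_ge_mono[OF o[of "axis 2 1"], of _ "\<bar>2 * \<tau> i $ 3\<bar>"])
        have "\<forall>\<^sub>F t in nhds 0. \<bar>t::real\<bar> < 1"
          unfolding eventually_nhds_metric by (intro exI[of _ 1]) (simp add: dist_real_def)
        thus "\<forall>\<^sub>F t in nhds 0. norm ((- 2 * t ^ 2 * \<tau> i $ 3) * \<beta> (std3 t) (axis 2 1)) \<le> \<bar>2 * \<tau> i $ 3\<bar> * norm (\<beta> (std3 t) (axis 2 1))"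
        proof eventually_elim
          case (elim t)
          have "t ^ 2 \<le> 1" using elim by (simp add: abs_square_le_1)
          hence "t ^ 2 * \<bar>2 * \<tau> i $ 3\<bar> \<le> 1 * \<bar>2 * \<tau> i $ 3\<bar>" by (intro mult_right_mono) auto
          hence "\<bar>- 2 * t ^ 2 * \<tau> i $ 3\<bar> \<le> \<bar>2 * \<tau> i $ 3\<bar>" by (simp add: abs_mult mult_ac)
          thus ?case unfolding real_norm_def abs_mult[of _ "\<beta> _ _"] by (intro mult_right_mono) auto
        qed
      qed
      ultimately have "order_ge k (\<lambda>t. \<beta> (std3 t) (\<tau> i) + (- 2 * t ^ 2 * \<tau> i $ 3) * \<beta> (std3 t) (axis 2 1))"
        by (rule order_ge_add)
      thus "order_ge k (\<lambda>t. H (\<Phi> (std3 t)) $ i)"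
      proof (rule order_ge_mono[where K=1], intro eventually_mono[OF ev])
        fix t assume t: "c t \<in> ball 0 \<delta>"
        note h = H(3)[OF cM t, of i]
        have "linear (\<beta> (std3 t))" using form1_onD(1)[OF \<beta> inU[OF conjunct1[OF h]]] by (simp add: sc)
        from linear_diff[OF this] linear_scale[OF this]
        have "\<beta>' (c t) (\<tau> i) = \<beta> (std3 t) (\<tau> i) + (- 2 * t ^ 2 * \<tau> i $ 3) * \<beta> (std3 t) (axis 2 1)"
          by (simp add: \<beta>'_def pullback1_def fd_shear sc c3)
        thus "norm (H (\<Phi> (std3 t)) $ i) \<le> 1 * norm (\<beta> (std3 t) (\<tau> i) + (- 2 * t ^ 2 * \<tau> i $ 3) * \<beta> (std3 t) (axis 2 1))"
          using h by (simp add: sc)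
      qed
    qed
  qed
qed

definition W_std :: "'n::finite space set" where
  "W_std = {x. \<forall>i. i \<notin> {1, 2, 3} \<longrightarrow> x $ i = 0}"

text \<open>With M the whole of \<open>W_std\<close>, which contains \<open>U8\<close>, a single
  Lagrangian germ serves all branches, at the price of isotropy of W at 0. The last conclusion is
  meant for a primitive that vanishes on all of \<open>U8\<close>.\<close>

lemma lagrangian_along_W:
  fixes \<omega> :: "'n::finite form2"
  assumes card: "CARD('n) \<ge> 2" and \<omega>: "symplectic_germ \<omega>" and d: "local_diffeo \<Phi> \<Psi> U V" and \<beta>: "form1_on U \<beta>"
    and eq: "\<And>x u v. x \<in> U \<Longrightarrow> pullback \<Phi> \<omega> x u v = d_form1 \<beta> x u v" and \<beta>0: "\<And>u. \<beta> 0 u = 0"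
    and iso: "\<And>u v. u \<in> W_std \<Longrightarrow> v \<in> W_std \<Longrightarrow> d_form1 \<beta> 0 u v = 0"
  obtains H \<delta> where "lagrangian_germ \<omega> H"
    "\<And>k. (\<And>u. order_ge k (\<lambda>t. \<beta> (std1 t) u)) \<Longrightarrow> order_ge k (\<lambda>t. H (\<Phi> (std1 t)))"
    "\<And>k. (\<And>u. order_ge k (\<lambda>t. \<beta> (std2 t) u)) \<Longrightarrow> order_ge k (\<lambda>t. H (\<Phi> (std2 t)))"
    "\<And>k. (\<And>u. order_ge k (\<lambda>t. \<beta> (std3 t) u)) \<Longrightarrow> order_ge k (\<lambda>t. H (\<Phi> (std3 t)))"
    "\<delta> > 0" "\<And>x. x \<in> W_std \<Longrightarrow> x \<in> ball 0 \<delta> \<Longrightarrow> (\<And>u. \<beta> x u = 0) \<Longrightarrow> H (\<Phi> x) = 0"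
proof -
  have W: "subspace (W_std :: 'n space set)" by (auto simp: subspace_def W_std_def)
  obtain H \<delta> \<tau> where H: "lagrangian_germ \<omega> H" "\<delta> > 0"
    "\<And>y i. y \<in> W_std \<Longrightarrow> y \<in> ball 0 \<delta> \<Longrightarrow> y \<in> U \<and> H (\<Phi> y) $ i = \<beta> y (\<tau> i)"
    by (rule lagrangian_of_chart_primitive[OF \<omega> d \<beta> eq \<beta>0 W iso]) blast+
  have o: "order_ge k (\<lambda>t. H (\<Phi> (c t)))"
    if c: "smooth_on UNIV c" "c 0 = 0" "\<And>t. c t \<in> W_std" and k: "\<And>u. order_ge k (\<lambda>t. \<beta> (c t) u)" for c k
    unfolding order_ge_vec_iff
  proof
    fix i
    have ev: "\<forall>\<^sub>F t in nhds 0. c t \<in> ball 0 \<delta>"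
    proof -
      have "open (c -` ball 0 \<delta>)" by (rule open_vimage[OF open_ball smooth_on_continuous_on[OF c(1)]])
      moreover have "0 \<in> c -` ball 0 \<delta>" using H(2) c(2) by simp
      ultimately show ?thesis unfolding eventually_nhds by (intro exI[of _ "c -` ball 0 \<delta>"]) simp
    qed
    show "order_ge k (\<lambda>t. H (\<Phi> (c t)) $ i)"
      by (rule order_ge_mono[OF k[of "\<tau> i"], of _ 1], rule eventually_mono[OF ev]) (use H(3)[OF c(3)] in simp)
  qed
  have sW: "std1 t \<in> (W_std :: 'n space set)" "std2 t \<in> (W_std :: 'n space set)" "std3 t \<in> (W_std :: 'n space set)" for t
    using std_components(10-12)[OF card] by (auto simp: W_std_def)
  show ?thesis
    by (rule that[OF H(1) o[OF smooth_std(1) std_0(1) sW(1)] o[OF smooth_std(2) std_0(2) sW(2)]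
          o[OF smooth_std(3) std_0(3) sW(3)] H(2)]) (use H(3) in \<open>auto simp: vec_eq_iff\<close>)
qed

text \<open>The curves in \<open>U8\<close> are quantified after F: one potential works for all
  branches. This coupling is what the bound for \<open>Lt\<close> exploits beyond the one for
  \<open>L3\<close>.\<close>

lemma potential_of_lagrangian:
  fixes \<omega> :: "'n::finite form2"
  assumes d: "local_diffeo \<Phi> \<Psi> U V" and \<eta>: "form1_on UNIV \<eta>" and \<beta>: "form1_on U \<beta>"
    and eq: "\<And>x u v. x \<in> U \<Longrightarrow> pullback \<Phi> \<omega> x u v = d_form1 (\<lambda>x u. \<eta> x u + \<beta> x u) x u v"
    and \<beta>0: "\<And>x u. x \<in> U8 \<inter> U \<Longrightarrow> \<beta> x u = 0" and H: "lagrangian_germ \<omega> H"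
  obtains r F where "r > 0" "smooth_on (ball 0 r) F"
    "\<And>c k u. smooth_on UNIV c \<Longrightarrow> c 0 = 0 \<Longrightarrow> (\<And>t. c t \<in> U8) \<Longrightarrow> order_ge k (\<lambda>t. H (\<Phi> (c t))) \<Longrightarrow>
      order_ge k (\<lambda>t. fd F (c t) u + \<eta> (c t) u)"
proof -
  note D = local_diffeoD[OF d]
  define \<sigma> where "\<sigma> x u = \<eta> x u + \<beta> x u" for x u
  have \<sigma>: "form1_on U \<sigma>" unfolding \<sigma>_def
    by (rule form1_on_add[OF D(1) form1_on_subset[OF \<eta> subset_UNIV] \<beta>])
  have L: "lagrangian_germ (d_form1 \<sigma>) (\<lambda>x. H (\<Phi> x))"
    by (rule lagrangian_germ_cong[OF lagrangian_germ_pullback[OF d H] D(1,3)]) (use eq in \<open>simp add: \<sigma>_def[abs_def]\<close>)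
  obtain V0 \<gamma> C where V0: "open V0" "0 \<in> V0" "V0 \<subseteq> U" "form1_on V0 \<gamma>"
    "\<And>x u v. x \<in> V0 \<Longrightarrow> d_form1 \<gamma> x u v = d_form1 \<sigma> x u v"
    "\<And>x u. x \<in> V0 \<Longrightarrow> \<bar>\<gamma> x u\<bar> \<le> C * norm u * norm (H (\<Phi> x))"
    by (rule primitive_of_lagrangian[OF D(1,3) \<sigma> L]) blast
  obtain r where r: "r > 0" "ball 0 r \<subseteq> V0" using V0(1,2) open_contains_ball by blast
  note \<gamma>r = form1_on_subset[OF V0(4) r(2)] and \<sigma>r = form1_on_subset[OF \<sigma> subset_trans[OF r(2) V0(3)]]
  define \<kappa> where "\<kappa> x u = \<gamma> x u - \<sigma> x u" for x u
  have \<kappa>: "form1_on (ball 0 r) \<kappa>" unfolding \<kappa>_def by (rule form1_on_diff[OF open_ball \<gamma>r \<sigma>r])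
  have closed: "d_form1 \<kappa> x u v = 0" if "x \<in> ball 0 r" for x u v
    using d_form1_diff[OF \<gamma>r \<sigma>r that, of u v] V0(5)[of x u v] r(2) that by (auto simp: \<kappa>_def[abs_def])
  obtain F where F: "smooth_on (ball 0 r) F" "\<And>x u. x \<in> ball 0 r \<Longrightarrow> fd F x u = \<kappa> x u"
    using closed_form1_exact[OF \<kappa> closed] by blast
  show ?thesis
  proof (rule that[OF r(1) F(1)])
    fix c :: "real \<Rightarrow> 'n space" and k u
    assume c: "smooth_on UNIV c" "c 0 = 0" "\<And>t. c t \<in> U8" and o: "order_ge k (\<lambda>t. H (\<Phi> (c t)))"
    have ev: "\<forall>\<^sub>F t in nhds 0. c t \<in> ball 0 r"
      by (rule smooth_at0_along(2)[OF F(1) open_ball _ c(1,2)]) (use r in simp)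
    show "order_ge k (\<lambda>t. fd F (c t) u + \<eta> (c t) u)"
    proof (rule order_ge_mono[OF o, of _ "C * norm u"], rule eventually_mono[OF ev])
      fix t assume t: "c t \<in> ball 0 r"
      have tV: "c t \<in> V0" using t r(2) by blast
      hence tU: "c t \<in> U8 \<inter> U" using V0(3) c(3) by blast
      have "fd F (c t) u + \<eta> (c t) u = \<gamma> (c t) u"
        using F(2)[OF t, of u] \<beta>0[OF tU, of u] by (simp add: \<kappa>_def \<sigma>_def)
      thus "norm (fd F (c t) u + \<eta> (c t) u) \<le> C * norm u * norm (H (\<Phi> (c t)))"
        using V0(6)[OF tV, of u] by simp
    qed
  qed
qed

text \<open>The axes give the derivatives in directions 2 and 3; direction 1 is found as the
  coefficient of t^3 along the cusp. Applied to the components of \<beta>, this makes d\<beta>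
  vanish on W at 0.\<close>

lemma fd_zero_on_W_of_zero_on_U8:
  fixes f :: "'n::finite space \<Rightarrow> real"
  assumes card: "CARD('n) \<ge> 2" and f: "smooth_on U f" "open U" "0 \<in> U" and z: "\<And>x. x \<in> U8 \<inter> U \<Longrightarrow> f x = 0"
    and u: "u \<in> W_std"
  shows "fd f 0 u = 0"
proof -
  have tz: "tcoeff m (\<lambda>t. f (c t)) = 0" if c: "smooth_on UNIV c" "c 0 = 0" "\<And>t. c t \<in> U8" for c m
  proof -
    have "tcoeff m (\<lambda>t. f (c t)) = tcoeff m (\<lambda>t. 0)"
      by (rule tcoeff_cong, rule eventually_mono[OF smooth_at0_along(2)[OF f c(1,2)]]) (use z c(3) in blast)
    thus ?thesis by (simp add: tcoeff_const)
  qed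
  have 1: "fd f 0 (axis 1 1) = 0"
    using jet_values(3)[OF f refl, of 0 0 0] tz[OF smooth_std(3) std_0(3) std_in_U8(3)[OF card], of 3]
    by (simp add: jet_def partial_def tcoeff_def std_0)
  have 2: "fd f 0 (axis 2 1) = 0"
    using tcoeff_axis[OF f, of 1 2] tz[OF smooth_std(1) std_0(1) std_in_U8(1)[OF card], of 1] by (simp add: std1_def)
  have 3: "fd f 0 (axis 3 1) = 0"
    using tcoeff_axis[OF f, of 1 3] tz[OF smooth_std(2) std_0(2) std_in_U8(2)[OF card], of 1] by (simp add: std2_def)
  have "fd f 0 u = (\<Sum>i\<in>UNIV. u $ i *\<^sub>R fd f 0 (axis i 1))"
    by (rule vec_linear_expand[OF bounded_linear.linear[OF smooth_on_linear_fd[OF f(1,3)]]])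
  also have "\<dots> = 0"
  proof (rule sum.neutral, rule ballI)
    fix i show "u $ i *\<^sub>R fd f 0 (axis i 1) = 0"
      using u 1 2 3 by (cases "i \<in> {1, 2, 3}") (auto simp: W_std_def)
  qed
  finally show ?thesis .
qed

section \<open>Symmetries of the curve\<close>

lemma order_ge_Suc_tendsto_0:
  fixes h :: "real \<Rightarrow> real"
  assumes "order_ge (Suc k) h"
  shows "((\<lambda>t. h t / t ^ k) \<longlongrightarrow> 0) (at 0)"
proof -
  obtain C where "\<forall>\<^sub>F t in nhds 0. norm (h t) \<le> C * \<bar>t\<bar> ^ Suc k" using assms unfolding order_ge_def by blast
  hence "\<forall>\<^sub>F t in at 0. norm (h t) \<le> C * \<bar>t\<bar> ^ Suc k" by (simp add: eventually_nhds_conv_at)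
  hence *: "\<forall>\<^sub>F t in at 0. norm (h t / t ^ k) \<le> C * \<bar>t\<bar>"
    using eventually_neq_at_within[of "0::real" 0 UNIV]
  proof eventually_elim
    case (elim t)
    hence "\<bar>h t\<bar> / \<bar>t\<bar> ^ k \<le> C * \<bar>t\<bar> ^ Suc k / \<bar>t\<bar> ^ k" by (intro divide_right_mono) auto
    thus ?case using elim by (simp add: power_abs)
  qed
  have "((\<lambda>t. C * \<bar>t\<bar>) \<longlongrightarrow> C * \<bar>0::real\<bar>) (at 0)" by (intro tendsto_intros)
  hence "((\<lambda>t. C * \<bar>t\<bar>) \<longlongrightarrow> 0) (at (0::real))" by simp
  with * show ?thesis by (rule Lim_null_comparison)
qed

text \<open>Through this limit the equations of \<open>U8\<close> turn into equations for the
  leading coefficients of a curve lying in it.\<close>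

lemma leading_coefficient_tendsto:
  fixes f :: "real \<Rightarrow> real"
  assumes "smooth_at0 f" "order_ge k f"
  shows "((\<lambda>t. f t / t ^ k) \<longlongrightarrow> tcoeff k f) (at 0)"
proof -
  define a where "a = tcoeff k f"
  have s: "smooth_at0 (\<lambda>t. - a * (t ^ k * 1))"
    by (intro smooth_at0_cmult smooth_at0_mult_power smooth_at0_const)
  have "order_ge (Suc k) (\<lambda>t. f t + (- a) * (t ^ k * 1))"
    unfolding order_ge_iff_tcoeff[OF smooth_at0_add[OF assms(1) s]]
  proof (intro allI impI)
    fix j assume "j < Suc k"
    thus "tcoeff j (\<lambda>t. f t + (- a) * (t ^ k * 1)) = 0"
      using assms(2) unfolding order_ge_iff_tcoeff[OF assms(1)]
      unfolding tcoeff_add[OF assms(1) s] tcoeff_cmult[OF smooth_at0_mult_power[OF smooth_at0_const]]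
      by (auto simp: tcoeff_power a_def less_Suc_eq)
  qed
  from tendsto_add[OF order_ge_Suc_tendsto_0[OF this] tendsto_const[of a]]
  have "((\<lambda>t. (f t + (- a) * (t ^ k * 1)) / t ^ k + a) \<longlongrightarrow> a) (at 0)" by simp
  moreover have "\<forall>\<^sub>F t in at 0. (f t + (- a) * (t ^ k * 1)) / t ^ k + a = f t / t ^ k"
    using eventually_neq_at_within[of "0::real" 0 UNIV] by eventually_elim (simp add: field_simps)
  ultimately show ?thesis unfolding a_def[symmetric] by (rule Lim_transform_eventually)
qed

lemma tcoeff_along_std:
  fixes f :: "'n::finite space \<Rightarrow> real"
  assumes f: "smooth_on U f" "open U" "0 \<in> U"
  shows "tcoeff 1 (\<lambda>t. f (std1 t)) = fd f 0 (axis 2 1)" "tcoeff 1 (\<lambda>t. f (std2 t)) = fd f 0 (axis 3 1)"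
    "tcoeff 1 (\<lambda>t. f (std3 t)) = 0" "tcoeff 2 (\<lambda>t. f (std3 t)) = fd f 0 (axis 3 1)"
    "tcoeff 3 (\<lambda>t. f (std3 t)) = fd f 0 (axis 1 1)"
  using tcoeff_axis[OF f, of 1] jet_values(1-3)[OF f refl, of 0 0 0]
  by (simp_all add: jet_def partial_def tcoeff_def std_0 std1_def std2_def)

lemma order_ge_along_std:
  fixes f :: "'n::finite space \<Rightarrow> real"
  assumes f: "smooth_on U f" "open U" "0 \<in> U" "f 0 = 0"
  shows "order_ge 1 (\<lambda>t. f (std1 t))" "order_ge 1 (\<lambda>t. f (std2 t))" "order_ge 2 (\<lambda>t. f (std3 t))"
    "fd f 0 (axis 3 1) = 0 \<Longrightarrow> order_ge 3 (\<lambda>t. f (std3 t))"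
    "fd f 0 (axis 3 1) = 0 \<Longrightarrow> order_ge 2 (\<lambda>t. f (std2 t))"
proof -
  note s = smooth_at0_along(1)[OF f(1-3)]
  note o = order_ge_iff_tcoeff[OF s[OF smooth_std(1) std_0(1)]] order_ge_iff_tcoeff[OF s[OF smooth_std(2) std_0(2)]]
    order_ge_iff_tcoeff[OF s[OF smooth_std(3) std_0(3)]]
  have 0: "tcoeff 0 (\<lambda>t. f (std1 t)) = 0" "tcoeff 0 (\<lambda>t. f (std2 t)) = 0" "tcoeff 0 (\<lambda>t. f (std3 t)) = 0"
    using f(4) by (simp_all add: tcoeff_def std_0)
  note t = tcoeff_along_std[OF f(1-3)]
  show "order_ge 1 (\<lambda>t. f (std1 t))" "order_ge 1 (\<lambda>t. f (std2 t))" "order_ge 2 (\<lambda>t. f (std3 t))"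
    "fd f 0 (axis 3 1) = 0 \<Longrightarrow> order_ge 3 (\<lambda>t. f (std3 t))"
    "fd f 0 (axis 3 1) = 0 \<Longrightarrow> order_ge 2 (\<lambda>t. f (std2 t))"
    using 0 t by (simp_all add: o less_Suc_eq eval_nat_numeral)
qed

lemma U8_D:
  assumes "x \<in> U8"
  shows "(x $ 1)\<^sup>2 = - (x $ 2 * x $ 3)" "x $ 1 = 0 \<or> x $ 2 = - (x $ 3)\<^sup>2"
    "i \<notin> {1, 2, 3} \<Longrightarrow> x $ i = 0"
proof -
  have *: "(x $ 1)\<^sup>2 + x $ 2 * x $ 3 = 0" "x $ 1 * (x $ 2 + (x $ 3)\<^sup>2) = 0" "\<forall>i. i \<notin> {1, 2, 3} \<longrightarrow> x $ i = 0"
    using assms by (simp_all add: U8_def distrib_left)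
  show "(x $ 1)\<^sup>2 = - (x $ 2 * x $ 3)" using *(1) by simp
  show "x $ 1 = 0 \<or> x $ 2 = - (x $ 3)\<^sup>2" using *(2) by (simp add: eq_neg_iff_add_eq_0)
  show "i \<notin> {1, 2, 3} \<Longrightarrow> x $ i = 0" using *(3) by blast
qed

text \<open>Tells on which branch a point lies and recovers its parameter. On the cusp
  \<open>x1^2 = x3^3\<close>, so \<open>x1 / x3\<close> is the parameter.\<close>

lemma eq_std_of_U8:
  fixes x :: "'n::finite space"
  assumes card: "CARD('n) \<ge> 2" and x: "x \<in> U8"
  shows "x $ 2 + (x $ 3)\<^sup>2 \<noteq> 0 \<Longrightarrow> x $ 2 \<noteq> 0 \<Longrightarrow> x = std1 (x $ 2)"
    "x $ 1 = 0 \<Longrightarrow> x $ 3 \<noteq> 0 \<Longrightarrow> x = std2 (x $ 3)"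
    "x $ 1 \<noteq> 0 \<Longrightarrow> x = std3 (x $ 1 / x $ 3) \<and> (x $ 1 / x $ 3)\<^sup>2 = x $ 3"
proof -
  note D = U8_D[OF x] and sc = std_components[OF card]
  have eqI: "x = y" if "x $ 1 = y $ 1" "x $ 2 = y $ 2" "x $ 3 = y $ 3" "\<And>i. i \<notin> {1, 2, 3} \<Longrightarrow> y $ i = 0" for y
    unfolding vec_eq_iff
  proof
    fix i show "x $ i = y $ i" using that D(3) by (cases "i \<in> {1, 2, 3}") auto
  qed
  show "x = std1 (x $ 2)" if "x $ 2 + (x $ 3)\<^sup>2 \<noteq> 0" "x $ 2 \<noteq> 0"
    by (rule eqI) (use that D(1,2) sc in auto)
  show "x = std2 (x $ 3)" if "x $ 1 = 0" "x $ 3 \<noteq> 0"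
    by (rule eqI) (use that D(1) sc in auto)
  show "x = std3 (x $ 1 / x $ 3) \<and> (x $ 1 / x $ 3)\<^sup>2 = x $ 3" if 1: "x $ 1 \<noteq> 0"
  proof -
    have 2: "x $ 2 = - (x $ 3)\<^sup>2" using D(2) 1 by simp
    have sq: "(x $ 1)\<^sup>2 = (x $ 3) ^ 3" using D(1) by (simp add: 2 power2_eq_square power3_eq_cube)
    have 3: "x $ 3 \<noteq> 0" using sq 1 by auto
    have s: "(x $ 1 / x $ 3)\<^sup>2 = x $ 3" using 3 unfolding power_divide sq by (simp add: eval_nat_numeral)
    have "x = std3 (x $ 1 / x $ 3)"
    proof (rule eqI)
      have "(x $ 1 / x $ 3) ^ 3 = (x $ 1 / x $ 3)\<^sup>2 * (x $ 1 / x $ 3)" by (simp add: eval_nat_numeral)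
      thus "x $ 1 = (std3 (x $ 1 / x $ 3) :: 'n space) $ 1" unfolding sc s using 3 by simp
      have "(x $ 1 / x $ 3) ^ 4 = ((x $ 1 / x $ 3)\<^sup>2)\<^sup>2" by (simp flip: power_mult)
      thus "x $ 2 = (std3 (x $ 1 / x $ 3) :: 'n space) $ 2" unfolding sc s by (simp add: 2)
      show "x $ 3 = (std3 (x $ 1 / x $ 3) :: 'n space) $ 3" unfolding sc s ..
    qed (rule sc(12))
    thus ?thesis using s by simp
  qed
qed

text \<open>Divided by \<open>t^2\<close>, the equations of \<open>U8\<close> have the limits
  \<open>v1^2 + v2 v3 = 0\<close> and \<open>v1 v2 = 0\<close>, so a nonzero velocity points along
  direction 2 or along direction 3.\<close>

lemma U8_regular_curve_velocity:
  fixes g :: "real \<Rightarrow> 'n::finite space"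
  assumes s: "\<And>i. smooth_at0 (\<lambda>t. g t $ i)" "\<And>i. order_ge 1 (\<lambda>t. g t $ i)"
    and U8: "\<forall>\<^sub>F t in nhds 0. g t \<in> U8" and v: "\<And>i. v i = tcoeff 1 (\<lambda>t. g t $ i)"
  shows "v 1 = 0" "v 2 * v 3 = 0" "\<And>i. i \<notin> {1, 2, 3} \<Longrightarrow> v i = 0"
proof -
  have l: "((\<lambda>t. g t $ i / t) \<longlongrightarrow> v i) (at 0)" for i
    using leading_coefficient_tendsto[OF s] by (simp add: v)
  have U8': "\<forall>\<^sub>F t in at 0. g t \<in> U8" using U8 by (simp add: eventually_nhds_conv_at)
  have z: "z = 0" if "(f \<longlongrightarrow> z) (at 0)" "\<And>t. t \<noteq> 0 \<Longrightarrow> g t \<in> U8 \<Longrightarrow> f t = 0" for f :: "real \<Rightarrow> real" and z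
  proof -
    have "\<forall>\<^sub>F t in at 0. f t = 0"
      using U8' eventually_neq_at_within[of "0::real" 0 UNIV] by eventually_elim (rule that(2))
    from Lim_transform_eventually[OF that(1) this] show ?thesis by (rule LIM_unique[OF _ tendsto_const])
  qed
  have a: "(v 1)\<^sup>2 + v 2 * v 3 = 0"
  proof (rule z)
    show "((\<lambda>t. (g t $ 1 / t)\<^sup>2 + (g t $ 2 / t) * (g t $ 3 / t)) \<longlongrightarrow> (v 1)\<^sup>2 + v 2 * v 3) (at 0)"
      by (intro tendsto_intros l)
    fix t :: real assume "t \<noteq> 0" "g t \<in> U8"
    thus "(g t $ 1 / t)\<^sup>2 + (g t $ 2 / t) * (g t $ 3 / t) = 0"
      using U8_D(1)[of "g t"] by (simp add: power_divide) (simp add: power2_eq_square)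
  qed
  \<comment> \<open>The term \<open>x3^2 / t\<close> is \<open>(x3 / t)^2\<close> times t, so it
    tends to 0; the limit carries this factor 0 explicitly.\<close>
  have b: "v 1 * (v 2 + v 3 * (v 3 * 0)) = 0"
  proof (rule z)
    show "((\<lambda>t. (g t $ 1 / t) * (g t $ 2 / t + (g t $ 3 / t) * ((g t $ 3 / t) * t))) \<longlongrightarrow> v 1 * (v 2 + v 3 * (v 3 * 0))) (at 0)"
      by (intro tendsto_intros l)
    fix t :: real assume "t \<noteq> 0" "g t \<in> U8"
    thus "(g t $ 1 / t) * (g t $ 2 / t + (g t $ 3 / t) * ((g t $ 3 / t) * t)) = 0"
      using U8_D(2)[of "g t"] by (auto simp: field_simps power2_eq_square)
  qed
  show "v 1 = 0" "v 2 * v 3 = 0" using a b by auto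
  show "v i = 0" if "i \<notin> {1, 2, 3}" for i
    by (rule z[OF l[of i]]) (use U8_D(3)[OF _ that] in simp)
qed

text \<open>All is decided by limits of coordinates divided by powers of t and by the injectivity of
  the differential. The velocities of the images of the axes are known up to an exchange of
  directions 2 and 3; the cusp, tangent to the third axis only, rules the exchange out.\<close>

lemma U8_symmetry:
  fixes T :: "'n::finite space \<Rightarrow> 'n space"
  assumes card: "CARD('n) \<ge> 2" and d: "local_diffeo T S U V" and U8: "\<And>x. x \<in> U8 \<inter> U \<Longrightarrow> T x \<in> U8"
  obtains a b p q \<tau>1 \<tau>2 \<tau>3 where "fd T 0 (axis 2 1) = a *\<^sub>R axis 2 1" "fd T 0 (axis 3 1) = b *\<^sub>R axis 3 1"
    "fd T 0 (axis 1 1) = p *\<^sub>R axis 1 1 + q *\<^sub>R axis 3 1"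
    "order_ge 1 \<tau>1" "\<forall>\<^sub>F t in nhds 0. T (std1 t) = std1 (\<tau>1 t)"
    "order_ge 1 \<tau>2" "\<forall>\<^sub>F t in nhds 0. T (std2 t) = std2 (\<tau>2 t)"
    "order_ge 1 \<tau>3" "\<forall>\<^sub>F t in nhds 0. T (std3 t) = std3 (\<tau>3 t)"
proof -
  note D = local_diffeoD[OF d] and b3 = bit0_numerals_distinct[OF card]
  note A = bounded_linear.linear[OF smooth_on_linear_fd[OF D(7,3)]]
  have inj: "u = 0" if "fd T 0 u = 0" for u
    using local_diffeo_fd_inverse(1)[OF d D(3), of u] that
      linear_0[OF bounded_linear.linear[OF smooth_on_linear_fd[OF D(8,4)]]] D(5) by simp
  have sc: "smooth_on U (\<lambda>x. T x $ i)" for i by (rule smooth_on_vec_nth[OF D(1,7)])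
  have fdT: "fd (\<lambda>x. T x $ i) 0 u = fd T 0 u $ i" for i u
    by (rule fun_cong[OF fd_eqI[OF bounded_linear.has_derivative[OF bounded_linear_vec_nth smooth_on_has_derivative[OF D(7,3)]]]])
  note sa = smooth_at0_along(1)[OF sc D(1,3)]
  note s = sa[OF smooth_std(1) std_0(1)] sa[OF smooth_std(2) std_0(2)] sa[OF smooth_std(3) std_0(3)]
  have T0: "T 0 $ i = 0" for i by (simp add: D(5))
  note o = order_ge_along_std[OF sc D(1,3) T0, unfolded fdT]
  note t = tcoeff_along_std[OF sc D(1,3), unfolded fdT]
  have ev: "\<forall>\<^sub>F t in nhds 0. T (c t) \<in> U8" if "smooth_on UNIV c" "c 0 = 0" "\<And>t. c t \<in> U8" for c :: "real \<Rightarrow> 'n space"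
    by (rule eventually_mono[OF smooth_at0_along(2)[OF D(7,1,3) that(1,2)]]) (use U8 that(3) in blast)
  note e = ev[OF smooth_std(1) std_0(1) std_in_U8(1)[OF card]] ev[OF smooth_std(2) std_0(2) std_in_U8(2)[OF card]]
    ev[OF smooth_std(3) std_0(3) std_in_U8(3)[OF card]]
  have e': "\<forall>\<^sub>F t in at 0. T (std1 t) \<in> U8" "\<forall>\<^sub>F t in at 0. T (std2 t) \<in> U8" "\<forall>\<^sub>F t in at 0. T (std3 t) \<in> U8"
    using e by (simp_all add: eventually_nhds_conv_at)
  define v1 v2 v3 where "v1 = fd T 0 (axis 1 1)" and "v2 = fd T 0 (axis 2 1)" and "v3 = fd T 0 (axis 3 1)"
  note vdef = v1_def v2_def v3_def
  note vel2 = U8_regular_curve_velocity[OF s(1) o(1) e(1) t(1)[symmetric], folded v2_def]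
  note vel3 = U8_regular_curve_velocity[OF s(2) o(2) e(2) t(2)[symmetric], folded v3_def]
  have q1: "((\<lambda>t. T (std1 t) $ i / t) \<longlongrightarrow> v2 $ i) (at 0)" for i
    using leading_coefficient_tendsto[OF s(1) o(1), of i] by (simp add: t[unfolded One_nat_def] v2_def)
  have q2: "((\<lambda>t. T (std2 t) $ i / t) \<longlongrightarrow> v3 $ i) (at 0)" for i
    using leading_coefficient_tendsto[OF s(2) o(2), of i] by (simp add: t[unfolded One_nat_def] v3_def)
  \<comment> \<open>Along the cusp the image of direction 3 shows at order \<open>t^2\<close>; in
    the components where it is zero, the image of direction 1 shows at order
    \<open>t^3\<close>.\<close>
  have q3: "((\<lambda>t. T (std3 t) $ i / t\<^sup>2) \<longlongrightarrow> v3 $ i) (at 0)" for i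
    using leading_coefficient_tendsto[OF s(3) o(3), of i] by (simp add: t v3_def)
  have q4: "((\<lambda>t. T (std3 t) $ i / t ^ 3) \<longlongrightarrow> v1 $ i) (at 0)" if "v3 $ i = 0" for i
    using leading_coefficient_tendsto[OF s(3) o(4), of i] that by (simp add: t v3_def v1_def)
  have ne0: "\<forall>\<^sub>F t in at 0. (t::real) \<noteq> 0" by (rule eventually_neq_at_within)
  have v1W: "v1 $ i = 0" if i: "i \<notin> {1, 2, 3}" for i
  proof -
    have "\<forall>\<^sub>F t in at 0. T (std3 t) $ i / t ^ 3 = 0"
      using e'(3) by eventually_elim (use U8_D(3)[OF _ i] in simp)
    from Lim_transform_eventually[OF q4[OF vel3(3)[OF i]] this] show ?thesis by (rule LIM_unique[OF _ tendsto_const])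
  qed
  \<comment> \<open>If \<open>v3\<close> pointed along direction 2, then \<open>x2 + x3^2\<close>
    would be nonzero on the image of the cusp, which would thus lie on the second axis. Its t^3
    coefficient \<open>v1\<close> would be parallel to \<open>v3\<close>, against
    injectivity.\<close>
  have v32: "v3 $ 2 = 0"
  proof (rule ccontr)
    assume n: "v3 $ 2 \<noteq> 0"
    hence v33: "v3 $ 3 = 0" using vel3(2) by simp
    have "((\<lambda>t. T (std3 t) $ 2 / t\<^sup>2 + (T (std3 t) $ 3 / t\<^sup>2) * (T (std3 t) $ 3 / t\<^sup>2 * t\<^sup>2)) \<longlongrightarrow> v3 $ 2 + v3 $ 3 * (v3 $ 3 * 0\<^sup>2)) (at 0)"
      by (intro tendsto_intros q3)
    hence "\<forall>\<^sub>F t in at 0. T (std3 t) $ 2 / t\<^sup>2 + (T (std3 t) $ 3 / t\<^sup>2) * (T (std3 t) $ 3 / t\<^sup>2 * t\<^sup>2) \<noteq> 0"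
      by (rule tendsto_imp_eventually_ne) (simp add: n)
    moreover have "\<forall>\<^sub>F t in at 0. T (std3 t) $ 2 / t\<^sup>2 \<noteq> 0" by (rule tendsto_imp_eventually_ne[OF q3 n])
    ultimately have st: "\<forall>\<^sub>F t in at 0. T (std3 t) = std1 (T (std3 t) $ 2)"
      using e'(3) ne0
    proof eventually_elim
      case (elim t)
      have "(T (std3 t) $ 2 + (T (std3 t) $ 3)\<^sup>2) / t\<^sup>2 \<noteq> 0"
        using elim(1,4) by (simp add: add_divide_distrib power2_eq_square)
      thus ?case using eq_std_of_U8(1)[OF card elim(3)] elim(2) by auto
    qed
    have "v1 $ i = 0" if i: "i \<noteq> 2" for i
    proof -
      have z: "v3 $ i = 0" using vel3(1,3) v33 i by (cases "i \<in> {1, 2, 3}") auto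
      have "\<forall>\<^sub>F t in at 0. T (std3 t) $ i / t ^ 3 = 0" using st
      proof eventually_elim
        case (elim t)
        have "std1 (T (std3 t) $ 2) $ i = 0" using i by (simp add: std1_def axis_def)
        thus ?case using elim by simp
      qed
      from Lim_transform_eventually[OF q4[OF z] this] show ?thesis by (rule LIM_unique[OF _ tendsto_const])
    qed
    moreover have "v3 $ i = 0" if "i \<noteq> 2" for i
      using vel3(1) vel3(3)[of i] v33 that by (cases "i \<in> {1, 2, 3}") auto
    ultimately have "v1 = v1 $ 2 *\<^sub>R axis 2 1" "v3 = v3 $ 2 *\<^sub>R axis 2 1"
      by (auto simp: vec_eq_iff axis_def)
    hence "v3 $ 2 *\<^sub>R v1 - v1 $ 2 *\<^sub>R v3 = 0"
      by (metis (no_types, lifting) mult.commute right_minus_eq scaleR_scaleR)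
    hence "fd T 0 (v3 $ 2 *\<^sub>R axis 1 1 - v1 $ 2 *\<^sub>R axis 3 1) = 0"
      by (simp add: linear_diff[OF A] linear_scale[OF A] vdef)
    from inj[OF this] have "(v3 $ 2 *\<^sub>R axis 1 1 - v1 $ 2 *\<^sub>R axis 3 (1::real) :: 'n space) $ 1 = 0" by (simp only: zero_index)
    thus False using n b3 by (simp add: axis_def)
  qed
  have v3: "v3 = v3 $ 3 *\<^sub>R axis 3 1"
    unfolding vec_eq_iff
  proof
    fix i show "v3 $ i = (v3 $ 3 *\<^sub>R axis 3 1) $ i"
      using vel3(1) vel3(3)[of i] v32 by (cases "i \<in> {1, 2, 3}") (auto simp: axis_def)
  qed
  have v33: "v3 $ 3 \<noteq> 0"
  proof
    assume "v3 $ 3 = 0"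
    hence "axis 3 1 = (0 :: 'n space)" using v3 inj[of "axis 3 1"] by (simp add: v3_def)
    thus False by (simp add: axis_eq_0_iff)
  qed
  \<comment> \<open>Otherwise both axis directions would be sent to direction 3.\<close>
  have v22: "v2 $ 2 \<noteq> 0"
  proof
    assume z: "v2 $ 2 = 0"
    have "v2 = v2 $ 3 *\<^sub>R axis 3 1" unfolding vec_eq_iff
    proof
      fix i show "v2 $ i = (v2 $ 3 *\<^sub>R axis 3 1) $ i"
        using vel2(1) vel2(3)[of i] z by (cases "i \<in> {1, 2, 3}") (auto simp: axis_def)
    qed
    hence "v3 $ 3 *\<^sub>R v2 - v2 $ 3 *\<^sub>R v3 = 0" using v3
      by (metis (no_types, lifting) mult.commute right_minus_eq scaleR_scaleR)
    hence "fd T 0 (v3 $ 3 *\<^sub>R axis 2 1 - v2 $ 3 *\<^sub>R axis 3 1) = 0"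
      by (simp add: linear_diff[OF A] linear_scale[OF A] vdef)
    from inj[OF this] have "(v3 $ 3 *\<^sub>R axis 2 1 - v2 $ 3 *\<^sub>R axis 3 (1::real) :: 'n space) $ 2 = 0" by (simp only: zero_index)
    thus False using v33 b3 by (simp add: axis_def)
  qed
  have v23: "v2 $ 3 = 0" using vel2(2) v22 by simp
  have v2: "v2 = v2 $ 2 *\<^sub>R axis 2 1"
    unfolding vec_eq_iff
  proof
    fix i show "v2 $ i = (v2 $ 2 *\<^sub>R axis 2 1) $ i"
      using vel2(1) vel2(3)[of i] v23 by (cases "i \<in> {1, 2, 3}") (auto simp: axis_def)
  qed
  have v1': "v1 = v1 $ 1 *\<^sub>R axis 1 1 + v1 $ 2 *\<^sub>R axis 2 1 + v1 $ 3 *\<^sub>R axis 3 1"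
    unfolding vec_eq_iff
  proof
    fix i show "v1 $ i = (v1 $ 1 *\<^sub>R axis 1 1 + v1 $ 2 *\<^sub>R axis 2 1 + v1 $ 3 *\<^sub>R axis 3 1) $ i"
      using v1W[of i] b3 by (cases "i \<in> {1, 2, 3}") (auto simp: axis_def)
  qed
  \<comment> \<open>Otherwise \<open>v1\<close> would be a combination of \<open>v2\<close> and
    \<open>v3\<close>, against injectivity.\<close>
  have v11: "v1 $ 1 \<noteq> 0"
  proof
    assume "v1 $ 1 = 0"
    hence "v1 = v1 $ 2 *\<^sub>R axis 2 1 + v1 $ 3 *\<^sub>R axis 3 1" using v1' by simp
    also have "\<dots> = (v1 $ 2 / v2 $ 2) *\<^sub>R (v2 $ 2 *\<^sub>R axis 2 1) + (v1 $ 3 / v3 $ 3) *\<^sub>R (v3 $ 3 *\<^sub>R axis 3 1)"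
      using v22 v33 by simp
    also have "\<dots> = (v1 $ 2 / v2 $ 2) *\<^sub>R v2 + (v1 $ 3 / v3 $ 3) *\<^sub>R v3"
      unfolding v2[symmetric] v3[symmetric] ..
    finally have "v1 - ((v1 $ 2 / v2 $ 2) *\<^sub>R v2 + (v1 $ 3 / v3 $ 3) *\<^sub>R v3) = 0"
      by (rule eq_iff_diff_eq_0[THEN iffD1])
    hence "v1 - (v1 $ 2 / v2 $ 2) *\<^sub>R v2 - (v1 $ 3 / v3 $ 3) *\<^sub>R v3 = 0" by (simp only: diff_diff_eq)
    hence "fd T 0 (axis 1 1 - (v1 $ 2 / v2 $ 2) *\<^sub>R axis 2 1 - (v1 $ 3 / v3 $ 3) *\<^sub>R axis 3 1) = 0"
      by (simp only: linear_diff[OF A] linear_scale[OF A] vdef)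
    from inj[OF this] have "(axis 1 1 - (v1 $ 2 / v2 $ 2) *\<^sub>R axis 2 1 - (v1 $ 3 / v3 $ 3) *\<^sub>R axis 3 (1::real) :: 'n space) $ 1 = 0" by (simp only: zero_index)
    thus False using b3 by (simp add: axis_def)
  qed
  have B1: "\<forall>\<^sub>F t in at 0. T (std1 t) = std1 (T (std1 t) $ 2)"
  proof -
    have "((\<lambda>t. T (std1 t) $ 2 / t + (T (std1 t) $ 3 / t) * (T (std1 t) $ 3 / t * t)) \<longlongrightarrow> v2 $ 2 + v2 $ 3 * (v2 $ 3 * 0)) (at 0)"
      by (intro tendsto_intros q1)
    hence "\<forall>\<^sub>F t in at 0. T (std1 t) $ 2 / t + (T (std1 t) $ 3 / t) * (T (std1 t) $ 3 / t * t) \<noteq> 0"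
      by (rule tendsto_imp_eventually_ne) (simp add: v22)
    moreover have "\<forall>\<^sub>F t in at 0. T (std1 t) $ 2 / t \<noteq> 0" by (rule tendsto_imp_eventually_ne[OF q1 v22])
    ultimately show ?thesis using e'(1) ne0
    proof eventually_elim
      case (elim t)
      have "(T (std1 t) $ 2 + (T (std1 t) $ 3)\<^sup>2) / t \<noteq> 0"
        using elim(1,4) by (simp add: add_divide_distrib power2_eq_square)
      thus ?case using eq_std_of_U8(1)[OF card elim(3)] elim(2) by auto
    qed
  qed
  \<comment> \<open>The third axis and the cusp share their tangent line, so orders must decide:
    \<open>x1\<close> is of order 2, hence \<open>x1^2 / t^3\<close> tends to 0 while
    \<open>x3^3 / t^3\<close> does not, which excludes the cusp relation
    \<open>x1^2 = x3^3\<close>.\<close>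
  have B2: "\<forall>\<^sub>F t in at 0. T (std2 t) = std2 (T (std2 t) $ 3)"
  proof -
    have "order_ge 2 (\<lambda>t. T (std2 t) $ 1)" by (rule o(5)) (use vel3(1) in \<open>simp add: v3_def\<close>)
    note l = leading_coefficient_tendsto[OF s(2) this]
    have "((\<lambda>t. (T (std2 t) $ 1 / t) * (T (std2 t) $ 1 / t\<^sup>2) - (T (std2 t) $ 3 / t) ^ 3) \<longlongrightarrow>
        v3 $ 1 * tcoeff 2 (\<lambda>t. T (std2 t) $ 1) - (v3 $ 3) ^ 3) (at 0)"
      by (intro tendsto_intros q2 l)
    hence "\<forall>\<^sub>F t in at 0. (T (std2 t) $ 1 / t) * (T (std2 t) $ 1 / t\<^sup>2) - (T (std2 t) $ 3 / t) ^ 3 \<noteq> 0"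
      by (rule tendsto_imp_eventually_ne) (simp add: v33 vel3(1))
    moreover have "\<forall>\<^sub>F t in at 0. T (std2 t) $ 3 / t \<noteq> 0" by (rule tendsto_imp_eventually_ne[OF q2 v33])
    ultimately show ?thesis using e'(2)
    proof eventually_elim
      case (elim t)
      have "(T (std2 t) $ 1)\<^sup>2 \<noteq> (T (std2 t) $ 3) ^ 3"
        using elim(1) by (auto simp: power_divide eval_nat_numeral)
      hence "T (std2 t) $ 1 = 0"
        using U8_D(1,2)[OF elim(3)] by (auto simp: eval_nat_numeral)
      thus ?case using eq_std_of_U8(2)[OF card elim(3)] elim(2) by auto
    qed
  qed
  \<comment> \<open>\<open>x1 / t^3\<close> has a nonzero limit, so \<open>x1\<close> is nonzero,
    which happens only on the cusp.\<close>
  have B3: "\<forall>\<^sub>F t in at 0. T (std3 t) = std3 (T (std3 t) $ 1 / T (std3 t) $ 3) \<and>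
      (T (std3 t) $ 1 / T (std3 t) $ 3)\<^sup>2 = T (std3 t) $ 3 \<and> T (std3 t) $ 2 = - (T (std3 t) $ 3)\<^sup>2"
  proof -
    have "\<forall>\<^sub>F t in at 0. T (std3 t) $ 1 / t ^ 3 \<noteq> 0" by (rule tendsto_imp_eventually_ne[OF q4[OF vel3(1)] v11])
    thus ?thesis using e'(3)
    proof eventually_elim
      case (elim t)
      thus ?case using eq_std_of_U8(3)[OF card elim(2)] U8_D(2)[OF elim(2)] by auto
    qed
  qed
  \<comment> \<open>On the cusp \<open>x2 = - x3^2\<close> is of order 4 and has no t^3
    term.\<close>
  have v12: "v1 $ 2 = 0"
  proof -
    have l: "((\<lambda>t. - ((T (std3 t) $ 3 / t\<^sup>2)\<^sup>2 * t)) \<longlongrightarrow> - ((v3 $ 3)\<^sup>2 * 0)) (at 0)" by (intro tendsto_intros q3)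
    have "\<forall>\<^sub>F t in at 0. T (std3 t) $ 2 / t ^ 3 = - ((T (std3 t) $ 3 / t\<^sup>2)\<^sup>2 * t)"
      using B3 ne0 by eventually_elim (simp add: field_simps eval_nat_numeral)
    from LIM_unique[OF Lim_transform_eventually[OF q4[OF v32] this] l] show ?thesis by simp
  qed
  have v1: "v1 = v1 $ 1 *\<^sub>R axis 1 1 + v1 $ 3 *\<^sub>R axis 3 1" using v1' v12 by simp
  have nh: "\<forall>\<^sub>F t in nhds 0. P t" if "\<forall>\<^sub>F t in at 0. P t" "P 0" for P :: "real \<Rightarrow> bool"
    using that by (simp add: eventually_nhds_conv_at)
  show ?thesis
  proof (rule that[of "v2 $ 2" "v3 $ 3" "v1 $ 1" "v1 $ 3" "\<lambda>t. T (std1 t) $ 2" "\<lambda>t. T (std2 t) $ 3"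
        "\<lambda>t. T (std3 t) $ 1 / T (std3 t) $ 3", folded vdef, OF v2 v3 v1 o(1) _ o(2)])
    show "\<forall>\<^sub>F t in nhds 0. T (std1 t) = std1 (T (std1 t) $ 2)" by (rule nh[OF B1]) (simp add: std_0 D(5))
    show "\<forall>\<^sub>F t in nhds 0. T (std2 t) = std2 (T (std2 t) $ 3)" by (rule nh[OF B2]) (simp add: std_0 D(5))
    have B3': "\<forall>\<^sub>F t in nhds 0. T (std3 t) = std3 (T (std3 t) $ 1 / T (std3 t) $ 3) \<and>
      (T (std3 t) $ 1 / T (std3 t) $ 3)\<^sup>2 = T (std3 t) $ 3 \<and> T (std3 t) $ 2 = - (T (std3 t) $ 3)\<^sup>2"
      by (rule nh[OF B3]) (simp add: std_0 D(5))
    show "\<forall>\<^sub>F t in nhds 0. T (std3 t) = std3 (T (std3 t) $ 1 / T (std3 t) $ 3)"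
      by (rule eventually_mono[OF B3']) (elim conjE)
    \<comment> \<open>The new parameter is a quotient, but its square is the third coordinate, of
      order 2; taking roots gives order 1.\<close>
    obtain C where "\<forall>\<^sub>F t in nhds 0. norm (T (std3 t) $ 3) \<le> C * \<bar>t\<bar>\<^sup>2" using o(3)[of 3] unfolding order_ge_def by blast
    with B3' have "\<forall>\<^sub>F t in nhds 0. norm (T (std3 t) $ 1 / T (std3 t) $ 3) \<le> sqrt \<bar>C\<bar> * \<bar>t\<bar> ^ 1"
    proof eventually_elim
      case (elim t)
      have "C * \<bar>t\<bar>\<^sup>2 \<le> \<bar>C\<bar> * \<bar>t\<bar>\<^sup>2" by (intro mult_right_mono) auto
      hence "\<bar>T (std3 t) $ 1 / T (std3 t) $ 3\<bar>\<^sup>2 \<le> (sqrt \<bar>C\<bar> * \<bar>t\<bar>)\<^sup>2"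
        using conjunct1[OF conjunct2[OF elim(1)]] elim(2) unfolding power2_abs by (simp add: power_mult_distrib)
      hence "\<bar>T (std3 t) $ 1 / T (std3 t) $ 3\<bar> \<le> sqrt \<bar>C\<bar> * \<bar>t\<bar>" by (rule power2_le_imp_le) simp
      thus ?case by (simp only: real_norm_def power_one_right)
    qed
    thus "order_ge 1 (\<lambda>t. T (std3 t) $ 1 / T (std3 t) $ 3)" unfolding order_ge_def by blast
  qed
qed

text \<open>Substitution into the defining inequality: \<tau> enters through a linear bound, which
  is just what is known of the parameter change on the cusp.\<close>

lemma order_ge_reparametrize:
  fixes G :: "'a::real_normed_vector \<Rightarrow> 'b::real_normed_vector" and \<tau> :: "real \<Rightarrow> real"
  assumes g: "order_ge k (\<lambda>t. G (c t))" and \<tau>: "order_ge 1 \<tau>" and e: "\<forall>\<^sub>F t in nhds 0. h t = G (c (\<tau> t))"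
  shows "order_ge k h"
proof -
  obtain C where C: "\<forall>\<^sub>F t in nhds 0. norm (\<tau> t) \<le> C * \<bar>t\<bar> ^ 1" using \<tau> unfolding order_ge_def by blast
  obtain D where D: "\<forall>\<^sub>F t in nhds 0. norm (G (c t)) \<le> D * \<bar>t\<bar> ^ k" using g unfolding order_ge_def by blast
  have "((\<lambda>t. C * \<bar>t\<bar> ^ 1) \<longlongrightarrow> C * \<bar>0::real\<bar> ^ 1) (nhds 0)" by (intro tendsto_intros filterlim_ident)
  hence "((\<lambda>t. C * \<bar>t\<bar> ^ 1) \<longlongrightarrow> 0) (nhds (0::real))" by simp
  from Lim_null_comparison[OF C this] have "filterlim \<tau> (nhds 0) (nhds 0)" .
  from eventually_compose_filterlim[OF D this]
  have "\<forall>\<^sub>F t in nhds 0. norm (h t) \<le> (\<bar>D\<bar> * \<bar>C\<bar> ^ k) * \<bar>t\<bar> ^ k"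
    using C e
  proof eventually_elim
    case (elim t)
    have "C * \<bar>t\<bar> \<le> \<bar>C\<bar> * \<bar>t\<bar>" by (intro mult_right_mono) auto
    hence "\<bar>\<tau> t\<bar> \<le> \<bar>C\<bar> * \<bar>t\<bar>" using elim(2) by simp
    hence "\<bar>\<tau> t\<bar> ^ k \<le> \<bar>C\<bar> ^ k * \<bar>t\<bar> ^ k" using power_mono[of "\<bar>\<tau> t\<bar>" "\<bar>C\<bar> * \<bar>t\<bar>" k] by (simp add: power_mult_distrib)
    hence "\<bar>D\<bar> * \<bar>\<tau> t\<bar> ^ k \<le> \<bar>D\<bar> * (\<bar>C\<bar> ^ k * \<bar>t\<bar> ^ k)" by (intro mult_left_mono) auto
    moreover have "D * \<bar>\<tau> t\<bar> ^ k \<le> \<bar>D\<bar> * \<bar>\<tau> t\<bar> ^ k" by (intro mult_right_mono) auto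
    ultimately show ?case using elim(1,3) by (simp add: mult.assoc)
  qed
  thus ?thesis unfolding order_ge_def by blast
qed

section \<open>Independence of the chart\<close>

lemma linear_image_span_subset:
  assumes "linear A" "\<And>x. x \<in> X \<Longrightarrow> A x \<in> span Y"
  shows "A ` span X \<subseteq> span Y"
  unfolding linear_span_image[OF assms(1), symmetric] using assms(2) by (intro span_minimal) auto

lemma branch_eq_std: "branch1 \<Phi> t = \<Phi> (std1 t)" "branch2 \<Phi> t = \<Phi> (std2 t)" "branch3 \<Phi> t = \<Phi> (std3 t)"
  by (simp_all add: branch1_def branch2_def branch3_def std1_def std2_def std3_def)

text \<open>The transition map between the charts preserves \<open>U8\<close>, so its differential
  respects the model subspaces and it reparametrizes every branch. Inclusions and implications in
  one direction are enough, as the charts may be exchanged.\<close>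

lemma chart_change:
  fixes \<Phi> \<Phi>' :: "'n::finite space \<Rightarrow> 'n space" and N :: "'n space set" and H :: "'n space \<Rightarrow> real ^ 'n"
  assumes card: "CARD('n) \<ge> 2" and d: "local_diffeo \<Phi> \<Psi> U V" "\<Phi> ` (U8 \<inter> U) = N \<inter> V"
    and d': "local_diffeo \<Phi>' \<Psi>' U' V'" "\<Phi>' ` (U8 \<inter> U') = N \<inter> V'"
  shows "line1 \<Phi> \<subseteq> line1 \<Phi>'" "line2 \<Phi> \<subseteq> line2 \<Phi>'" "V_space \<Phi> \<subseteq> V_space \<Phi>'" "W_space \<Phi> \<subseteq> W_space \<Phi>'"
    "order_ge k (\<lambda>t. H (\<Phi>' (std1 t))) \<Longrightarrow> order_ge k (\<lambda>t. H (\<Phi> (std1 t)))"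
    "order_ge k (\<lambda>t. H (\<Phi>' (std2 t))) \<Longrightarrow> order_ge k (\<lambda>t. H (\<Phi> (std2 t)))"
    "order_ge k (\<lambda>t. H (\<Phi>' (std3 t))) \<Longrightarrow> order_ge k (\<lambda>t. H (\<Phi> (std3 t)))"
proof -
  note D' = local_diffeoD[OF d'(1)]
  define T where "T x = \<Psi>' (\<Phi> x)" for x
  define R where "R = U \<inter> \<Phi> -` V'"
  note dT = local_diffeo_compose[OF d(1) local_diffeo_sym[OF d'(1)], folded T_def R_def]
  note DT = local_diffeoD[OF dT]
  have \<Phi>T: "\<Phi> x = \<Phi>' (T x)" "T x \<in> U'" if "x \<in> R" for x
    using that D'(10,12) by (simp_all add: R_def T_def)
  \<comment> \<open>The first chart sends the point into N, where it is also the image of a point of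
    \<open>U8\<close> under the second chart; injectivity of the latter identifies that point with
    \<open>T x\<close>.\<close>
  have TU8: "T x \<in> U8" if x: "x \<in> U8 \<inter> R" for x
  proof -
    have "\<Phi> x \<in> N \<inter> V" using x d(2) by (auto simp: R_def)
    hence "\<Phi> x \<in> \<Phi>' ` (U8 \<inter> U')" using x d'(2) by (simp add: R_def)
    then obtain y where "y \<in> U8" "y \<in> U'" "\<Phi> x = \<Phi>' y" by auto
    thus ?thesis using D'(11) by (simp add: T_def)
  qed
  obtain a b p q \<tau>1 \<tau>2 \<tau>3 where sym: "fd T 0 (axis 2 1) = a *\<^sub>R axis 2 1" "fd T 0 (axis 3 1) = b *\<^sub>R axis 3 1"
    "fd T 0 (axis 1 1) = p *\<^sub>R axis 1 1 + q *\<^sub>R axis 3 1"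
    "order_ge 1 \<tau>1" "\<forall>\<^sub>F t in nhds 0. T (std1 t) = std1 (\<tau>1 t)"
    "order_ge 1 \<tau>2" "\<forall>\<^sub>F t in nhds 0. T (std2 t) = std2 (\<tau>2 t)"
    "order_ge 1 \<tau>3" "\<forall>\<^sub>F t in nhds 0. T (std3 t) = std3 (\<tau>3 t)"
    using TU8 by (rule U8_symmetry[OF card dT])
  have fd\<Phi>: "fd \<Phi> 0 u = fd \<Phi>' 0 (fd T 0 u)" for u
    using fd_cong[OF DT(1,3), of \<Phi> "\<lambda>x. \<Phi>' (T x)"] \<Phi>T(1)
      fd_compose[OF D'(7) DT(7,3) \<Phi>T(2)[OF DT(3)], of u] by (simp add: DT(5))
  have im: "fd \<Phi> 0 ` span X \<subseteq> fd \<Phi>' 0 ` span X" if "\<And>x. x \<in> X \<Longrightarrow> fd T 0 x \<in> span X" for X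
    using linear_image_span_subset[OF bounded_linear.linear[OF smooth_on_linear_fd[OF DT(7,3)]] that]
    by (auto simp: fd\<Phi>)
  have sp: "x *\<^sub>R v \<in> span X" if "v \<in> X" for x v and X :: "'n space set" using that by (intro span_scale span_base)
  show "line1 \<Phi> \<subseteq> line1 \<Phi>'" "line2 \<Phi> \<subseteq> line2 \<Phi>'" "V_space \<Phi> \<subseteq> V_space \<Phi>'" "W_space \<Phi> \<subseteq> W_space \<Phi>'"
    unfolding line1_def line2_def V_space_def W_space_def
    by (rule im, force simp: sym(1-3) intro!: span_add sp)+
  have ev: "\<forall>\<^sub>F t in nhds 0. H (\<Phi> (c t)) = H (\<Phi>' (c' (\<tau> t)))"
    if "smooth_on UNIV c" "c 0 = 0" "\<forall>\<^sub>F t in nhds 0. T (c t) = c' (\<tau> t)" for c c' and \<tau> :: "real \<Rightarrow> real"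
    using smooth_at0_along(2)[OF DT(7,1,3) that(1,2)] that(3)
    by eventually_elim (simp only: \<Phi>T(1))
  show "order_ge k (\<lambda>t. H (\<Phi> (std1 t)))" if o: "order_ge k (\<lambda>t. H (\<Phi>' (std1 t)))"
    by (rule order_ge_reparametrize[where G=H, OF o sym(4) ev[where c=std1 and c'=std1 and \<tau>=\<tau>1, OF smooth_std(1) std_0(1) sym(5)]])
  show "order_ge k (\<lambda>t. H (\<Phi> (std2 t)))" if o: "order_ge k (\<lambda>t. H (\<Phi>' (std2 t)))"
    by (rule order_ge_reparametrize[where G=H, OF o sym(6) ev[where c=std2 and c'=std2 and \<tau>=\<tau>2, OF smooth_std(2) std_0(2) sym(7)]])
  show "order_ge k (\<lambda>t. H (\<Phi> (std3 t)))" if o: "order_ge k (\<lambda>t. H (\<Phi>' (std3 t)))"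
    by (rule order_ge_reparametrize[where G=H, OF o sym(8) ev[where c=std3 and c'=std3 and \<tau>=\<tau>3, OF smooth_std(3) std_0(3) sym(9)]])
qed

lemma smooth_at0_lagrangian_along:
  fixes \<Phi> :: "'n::finite space \<Rightarrow> 'n space"
  assumes H: "lagrangian_germ \<omega> H" and d: "local_diffeo \<Phi> \<Psi> U V" and c: "smooth_on UNIV c" "c 0 = 0"
  shows "smooth_at0 (\<lambda>t. H (\<Phi> (c t)))"
proof -
  note D = local_diffeoD[OF d]
  obtain O' where O: "open O'" "0 \<in> O'" "smooth_on O' H"
    using H unfolding lagrangian_germ_def by (elim conjE exE) (rule that)
  have o: "open (U \<inter> \<Phi> -` O')"
    by (rule continuous_open_preimage[OF smooth_on_continuous_on[OF D(7)] D(1) O(1)])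
  have "smooth_on (U \<inter> \<Phi> -` O') (\<lambda>x. H (\<Phi> x))"
    by (rule smooth_on_compose[OF O(3) o smooth_on_subset[OF D(7)]]) auto
  thus ?thesis by (rule smooth_at0_along(1)[OF _ o _ c]) (use D(3,5) O(2) in simp)
qed

lemma tangency_order_branches:
  assumes H: "lagrangian_germ \<omega> H" and d: "local_diffeo \<Phi> \<Psi> U V"
  shows "enat k \<le> tangency_order (branch1 \<Phi>) H \<longleftrightarrow> order_ge k (\<lambda>t. H (\<Phi> (std1 t)))"
    "enat k \<le> tangency_order (branch2 \<Phi>) H \<longleftrightarrow> order_ge k (\<lambda>t. H (\<Phi> (std2 t)))"
    "enat k \<le> tangency_order (branch3 \<Phi>) H \<longleftrightarrow> order_ge k (\<lambda>t. H (\<Phi> (std3 t)))"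
  using tangency_order_ge_iff[of H "branch1 \<Phi>" k] tangency_order_ge_iff[of H "branch2 \<Phi>" k]
    tangency_order_ge_iff[of H "branch3 \<Phi>" k] smooth_at0_lagrangian_along[OF H d smooth_std(1) std_0(1)]
    smooth_at0_lagrangian_along[OF H d smooth_std(2) std_0(2)] smooth_at0_lagrangian_along[OF H d smooth_std(3) std_0(3)]
  by (simp_all add: branch_eq_std)

text \<open>The tangency orders agree for each Lagrangian germ separately, hence so do their
  maxima.\<close>

lemma chart_independence:
  fixes \<Phi> \<Phi>' :: "'n::finite space \<Rightarrow> 'n space" and N :: "'n space set" and \<omega> :: "'n form2"
  assumes card: "CARD('n) \<ge> 2" and d: "local_diffeo \<Phi> \<Psi> U V" "\<Phi> ` (U8 \<inter> U) = N \<inter> V"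
    and d': "local_diffeo \<Phi>' \<Psi>' U' V'" "\<Phi>' ` (U8 \<inter> U') = N \<inter> V'"
  shows "line2 \<Phi> = line2 \<Phi>'" "V_space \<Phi> = V_space \<Phi>'" "W_space \<Phi> = W_space \<Phi>'"
    "lines_sum \<Phi> = lines_sum \<Phi>'" "Lt \<omega> \<Phi> = Lt \<omega> \<Phi>'" "L12 \<omega> \<Phi> = L12 \<omega> \<Phi>'" "L3 \<omega> \<Phi> = L3 \<omega> \<Phi>'"
proof -
  note c = chart_change[OF card d d'] and c' = chart_change[OF card d' d]
  show 1: "line2 \<Phi> = line2 \<Phi>'" "V_space \<Phi> = V_space \<Phi>'" "W_space \<Phi> = W_space \<Phi>'"
    by (rule subset_antisym[OF c(2) c'(2)] subset_antisym[OF c(3) c'(3)] subset_antisym[OF c(4) c'(4)])+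
  show "lines_sum \<Phi> = lines_sum \<Phi>'"
    unfolding lines_sum_def 1 subset_antisym[OF c(1) c'(1)] ..
  have t: "tangency_order (branch1 \<Phi>) H = tangency_order (branch1 \<Phi>') H"
    "tangency_order (branch2 \<Phi>) H = tangency_order (branch2 \<Phi>') H"
    "tangency_order (branch3 \<Phi>) H = tangency_order (branch3 \<Phi>') H" if H: "lagrangian_germ \<omega> H" for H
    by (rule enat_eqI,
        use c(5-7) c'(5-7) in \<open>auto simp: tangency_order_branches[OF H d(1)] tangency_order_branches[OF H d'(1)]\<close>)+
  show "Lt \<omega> \<Phi> = Lt \<omega> \<Phi>'" "L12 \<omega> \<Phi> = L12 \<omega> \<Phi>'" "L3 \<omega> \<Phi> = L3 \<omega> \<Phi>'"
    unfolding Lt_def L12_def L3_def using t by (simp_all cong: conj_cong)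
qed

section \<open>Invariants read off a normal form\<close>

lemma enat_infinityI: "(\<And>k. enat k \<le> x) \<Longrightarrow> x = \<infinity>"
  by (rule enat_eqI) simp

lemma order_ge_monomial: "m \<le> j \<Longrightarrow> order_ge m (\<lambda>t. c * t ^ j)"
proof (rule order_ge_cmult)
  assume "m \<le> j"
  have "smooth_at0 (\<lambda>t. t ^ j :: real)" using smooth_at0_mult_power[OF smooth_at0_const[of 1], of j] by simp
  thus "order_ge m (\<lambda>t. t ^ j :: real)" using \<open>m \<le> j\<close> by (simp add: order_ge_iff_tcoeff tcoeff_power)
qed

lemma span_axis_zero: "u \<in> span ((\<lambda>i. axis i 1) ` I) \<Longrightarrow> i \<notin> I \<Longrightarrow> u $ i = 0" for u :: "'n::finite space"
proof -
  have "subspace {x :: 'n space. x $ i = 0}" by (auto simp: subspace_def)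
  moreover assume "i \<notin> I"
  hence "(\<lambda>i. axis i (1::real)) ` I \<subseteq> {x :: 'n space. x $ i = 0}" by (auto simp: axis_def)
  ultimately have "span ((\<lambda>i. axis i 1) ` I) \<subseteq> {x :: 'n space. x $ i = 0}" by (intro span_minimal)
  moreover assume "u \<in> span ((\<lambda>i. axis i 1) ` I)"
  ultimately show ?thesis by auto
qed

text \<open>The given chart and the chart that comes with the normal form are unrelated a priori;
  here all invariants are moved to the latter. The correction \<beta> does not contribute to the
  form on W at 0, which is therefore that of the normal form.\<close>

lemma normal_form_chart:
  fixes \<omega> :: "'n::finite form2"
  assumes card: "CARD('n) \<ge> 2" and \<omega>: "symplectic_germ \<omega>" and \<Phi>: "diffeo_germ_onto \<Phi> U8 N"
    and \<eta>: "form1_on UNIV \<eta>" and nf: "has_normal_form \<omega> N (d_form1 \<eta>)"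
  obtains \<Phi>' \<Psi>' U V \<beta> where "local_diffeo \<Phi>' \<Psi>' U V" "\<Phi>' ` (U8 \<inter> U) = N \<inter> V" "form1_on U \<beta>"
    "\<And>x u v. x \<in> U \<Longrightarrow> pullback \<Phi>' \<omega> x u v = d_form1 (\<lambda>x u. \<eta> x u + \<beta> x u) x u v"
    "\<And>x u. x \<in> U8 \<inter> U \<Longrightarrow> \<beta> x u = 0"
    "\<And>u v. u \<in> W_std \<Longrightarrow> v \<in> W_std \<Longrightarrow> d_form1 (\<lambda>x u. \<eta> x u + \<beta> x u) 0 u v = d_form1 \<eta> 0 u v"
    "line2 \<Phi> = line2 \<Phi>'" "V_space \<Phi> = V_space \<Phi>'" "W_space \<Phi> = W_space \<Phi>'" "lines_sum \<Phi> = lines_sum \<Phi>'"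
    "Lt \<omega> \<Phi> = Lt \<omega> \<Phi>'" "L12 \<omega> \<Phi> = L12 \<omega> \<Phi>'" "L3 \<omega> \<Phi> = L3 \<omega> \<Phi>'"
proof -
  obtain \<Psi> U0 V0 where d: "local_diffeo \<Phi> \<Psi> U0 V0" "\<Phi> ` (U8 \<inter> U0) = N \<inter> V0"
    using diffeo_germ_ontoE[OF \<Phi>] .
  obtain \<Phi>' \<Psi>' U V \<beta> where n: "local_diffeo \<Phi>' \<Psi>' U V" "\<Phi>' ` (U8 \<inter> U) = N \<inter> V" "form1_on U \<beta>"
    "\<And>x u v. x \<in> U \<Longrightarrow> pullback \<Phi>' \<omega> x u v = d_form1 (\<lambda>x u. \<eta> x u + \<beta> x u) x u v"
    "\<And>x u. x \<in> U8 \<inter> U \<Longrightarrow> \<beta> x u = 0"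
    by (rule normal_form_exact[OF card \<omega> \<eta> nf]) blast
  note D = local_diffeoD[OF n(1)]
  have z: "fd (\<lambda>y. \<beta> y w) 0 u = 0" if "u \<in> W_std" for u w
    by (rule fd_zero_on_W_of_zero_on_U8[OF card form1_onD(2)[OF n(3)] D(1,3) n(5) that])
  have dz: "d_form1 (\<lambda>x u. \<eta> x u + \<beta> x u) 0 u v = d_form1 \<eta> 0 u v" if "u \<in> W_std" "v \<in> W_std" for u v
    using d_form1_add[OF form1_on_subset[OF \<eta> subset_UNIV] n(3) D(3), of u v] z that
    by (simp add: d_form1_def[of \<beta>])
  show ?thesis by (rule that[OF n dz chart_independence[OF card d n(1,2)]])
qed

lemma zero_on_chart:
  fixes \<omega> :: "'n::finite form2"
  assumes d: "local_diffeo \<Phi> \<Psi> U V" and eq: "\<And>u v. u \<in> S \<Longrightarrow> v \<in> S \<Longrightarrow> pullback \<Phi> \<omega> 0 u v = \<theta> u v"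
  shows "zero_on \<omega> (fd \<Phi> 0 ` S) \<longleftrightarrow> (\<forall>u\<in>S. \<forall>v\<in>S. \<theta> u v = 0)"
    "ker_on \<omega> (fd \<Phi> 0 ` S) = fd \<Phi> 0 ` {u \<in> S. \<forall>v\<in>S. \<theta> u v = 0}"
proof -
  have e: "\<omega> 0 (fd \<Phi> 0 u) (fd \<Phi> 0 v) = \<theta> u v" if "u \<in> S" "v \<in> S" for u v
    using eq[OF that] local_diffeoD(5)[OF d] by (simp add: pullback_def)
  show "zero_on \<omega> (fd \<Phi> 0 ` S) \<longleftrightarrow> (\<forall>u\<in>S. \<forall>v\<in>S. \<theta> u v = 0)" by (simp add: zero_on_def e)
  show "ker_on \<omega> (fd \<Phi> 0 ` S) = fd \<Phi> 0 ` {u \<in> S. \<forall>v\<in>S. \<theta> u v = 0}" by (auto simp: ker_on_def e)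
qed

lemma lines_sum_eq:
  fixes \<Phi> :: "'n::finite space \<Rightarrow> 'n space"
  assumes "linear (fd \<Phi> 0)"
  shows "lines_sum \<Phi> = fd \<Phi> 0 ` span {axis 2 1, axis 3 1}"
proof -
  have "span {axis 2 1, axis 3 (1::real)} = {x + y | x y :: 'n space. x \<in> span {axis 2 1} \<and> y \<in> span {axis 3 1}}"
    using span_Un[of "{axis 2 1 :: 'n space}" "{axis 3 1}"] by (simp add: insert_commute)
  moreover have "lines_sum \<Phi> = {fd \<Phi> 0 x + fd \<Phi> 0 y | x y. x \<in> span {axis 2 1} \<and> y \<in> span {axis 3 1}}"
    unfolding lines_sum_def line1_def line2_def by blast
  moreover have "\<dots> = fd \<Phi> 0 ` {x + y | x y. x \<in> span {axis 2 1} \<and> y \<in> span {axis 3 1}}"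
    unfolding linear_add[OF assms, symmetric] by blast
  ultimately show ?thesis by simp
qed

text \<open>On W at the origin only the coefficients a, s, c of \<open>theta1\<close>,
  \<open>theta2\<close>, \<open>theta3\<close> survive. V sees a, the sum of the lines sees s; if c
  alone is left, the third direction spans the kernel.\<close>

lemma tangent_conditions:
  fixes \<omega> :: "'n::finite form2"
  assumes card: "CARD('n) \<ge> 2" and \<omega>: "symplectic_germ \<omega>" and \<Phi>: "diffeo_germ_onto \<Phi> U8 N"
    and \<eta>: "form1_on UNIV \<eta>" and nf: "has_normal_form \<omega> N (d_form1 \<eta>)"
    and v: "\<And>u v. d_form1 \<eta> 0 u v = a * dx_wedge 1 3 0 u v + s * dx_wedge 2 3 0 u v + c * dx_wedge 1 2 0 u v"
  shows "zero_on \<omega> (V_space \<Phi>) \<longleftrightarrow> a = 0" "zero_on \<omega> (lines_sum \<Phi>) \<longleftrightarrow> s = 0"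
    "a = 0 \<Longrightarrow> s = 0 \<Longrightarrow> c = 0 \<Longrightarrow> zero_on \<omega> (W_space \<Phi>)"
    "a = 0 \<Longrightarrow> s = 0 \<Longrightarrow> c \<noteq> 0 \<Longrightarrow> ker_on \<omega> (W_space \<Phi>) = line2 \<Phi>"
proof -
  obtain \<Phi>' \<Psi>' U V \<beta> where n: "local_diffeo \<Phi>' \<Psi>' U V" "\<Phi>' ` (U8 \<inter> U) = N \<inter> V" "form1_on U \<beta>"
    "\<And>x u v. x \<in> U \<Longrightarrow> pullback \<Phi>' \<omega> x u v = d_form1 (\<lambda>x u. \<eta> x u + \<beta> x u) x u v"
    "\<And>x u. x \<in> U8 \<inter> U \<Longrightarrow> \<beta> x u = 0"
    "\<And>u v. u \<in> W_std \<Longrightarrow> v \<in> W_std \<Longrightarrow> d_form1 (\<lambda>x u. \<eta> x u + \<beta> x u) 0 u v = d_form1 \<eta> 0 u v"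
    "line2 \<Phi> = line2 \<Phi>'" "V_space \<Phi> = V_space \<Phi>'" "W_space \<Phi> = W_space \<Phi>'" "lines_sum \<Phi> = lines_sum \<Phi>'"
    by (rule normal_form_chart[OF card \<omega> \<Phi> \<eta> nf]) blast
  note D = local_diffeoD[OF n(1)] and b = bit0_numerals_distinct[OF card]
  note lin = bounded_linear.linear[OF smooth_on_linear_fd[OF D(7,3)]]
  define \<theta> :: "'n space \<Rightarrow> 'n space \<Rightarrow> real" where
    "\<theta> u v = a * (u $ 1 * v $ 3 - u $ 3 * v $ 1) + s * (u $ 2 * v $ 3 - u $ 3 * v $ 2) + c * (u $ 1 * v $ 2 - u $ 2 * v $ 1)" for u v
  have pb: "pullback \<Phi>' \<omega> 0 u v = \<theta> u v" if "u \<in> W_std" "v \<in> W_std" for u v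
    using n(4)[OF D(3)] n(6)[OF that] by (simp add: v \<theta>_def dx_wedge_def mult_ac)
  have sp: "u $ i = 0" if "u \<in> span {axis 1 1, axis 2 1, axis 3 1}" "i \<noteq> 1" "i \<noteq> 2" "i \<noteq> 3" for u :: "'n space" and i
    using span_axis_zero[of u "{1, 2, 3}" i] that by simp
  have sp13: "u $ i = 0" if "u \<in> span {axis 1 1, axis 3 1}" "i \<noteq> 1" "i \<noteq> 3" for u :: "'n space" and i
    using span_axis_zero[of u "{1, 3}" i] that by simp
  have sp23: "u $ i = 0" if "u \<in> span {axis 2 1, axis 3 1}" "i \<noteq> 2" "i \<noteq> 3" for u :: "'n space" and i
    using span_axis_zero[of u "{2, 3}" i] that by simp
  have ax: "axis 1 1 \<in> span {axis 1 1, axis 3 (1::real)}" "axis 3 1 \<in> span {axis 1 1, axis 3 (1::real)}"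
    "axis 2 1 \<in> span {axis 2 1, axis 3 (1::real)}" "axis 3 1 \<in> span {axis 2 1, axis 3 (1::real)}"
    "axis 1 1 \<in> span {axis 1 1, axis 2 1, axis 3 (1::real)}" "axis 2 1 \<in> span {axis 1 1, axis 2 1, axis 3 (1::real)}"
    by (simp_all add: span_base)
  have W: "span {axis 1 1, axis 2 1, axis 3 1} \<subseteq> (W_std :: 'n space set)" "span {axis 1 1, axis 3 1} \<subseteq> (W_std :: 'n space set)"
    "span {axis 2 1, axis 3 1} \<subseteq> (W_std :: 'n space set)"
    using sp sp13 sp23 by (auto simp: W_std_def)
  have zV: "zero_on \<omega> (V_space \<Phi>) \<longleftrightarrow> (\<forall>u\<in>span {axis 1 1, axis 3 1}. \<forall>v\<in>span {axis 1 1, axis 3 1}. \<theta> u v = 0)"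
    unfolding n(8) unfolding V_space_def by (rule zero_on_chart(1)[OF n(1) pb]) (use W in blast)+
  have zL: "zero_on \<omega> (lines_sum \<Phi>) \<longleftrightarrow> (\<forall>u\<in>span {axis 2 1, axis 3 1}. \<forall>v\<in>span {axis 2 1, axis 3 1}. \<theta> u v = 0)"
    unfolding n(10) lines_sum_eq[OF lin] by (rule zero_on_chart(1)[OF n(1) pb]) (use W in blast)+
  have zW: "zero_on \<omega> (W_space \<Phi>) \<longleftrightarrow> (\<forall>u\<in>span {axis 1 1, axis 2 1, axis 3 1}. \<forall>v\<in>span {axis 1 1, axis 2 1, axis 3 1}. \<theta> u v = 0)"
    unfolding n(9) unfolding W_space_def by (rule zero_on_chart(1)[OF n(1) pb]) (use W in blast)+
  have kW: "ker_on \<omega> (W_space \<Phi>) = fd \<Phi>' 0 ` {u \<in> span {axis 1 1, axis 2 1, axis 3 1}. \<forall>v\<in>span {axis 1 1, axis 2 1, axis 3 1}. \<theta> u v = 0}"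
    unfolding n(9) unfolding W_space_def by (rule zero_on_chart(2)[OF n(1) pb]) (use W in blast)+
  show "zero_on \<omega> (V_space \<Phi>) \<longleftrightarrow> a = 0"
  proof
    assume "zero_on \<omega> (V_space \<Phi>)"
    hence "\<theta> (axis 1 1) (axis 3 1) = 0" using ax(1,2) unfolding zV by blast
    thus "a = 0" using b by (simp add: \<theta>_def axis_def)
  next
    assume "a = 0" thus "zero_on \<omega> (V_space \<Phi>)" unfolding zV using b by (simp add: \<theta>_def sp13)
  qed
  show "zero_on \<omega> (lines_sum \<Phi>) \<longleftrightarrow> s = 0"
  proof
    assume "zero_on \<omega> (lines_sum \<Phi>)"
    hence "\<theta> (axis 2 1) (axis 3 1) = 0" using ax(3,4) unfolding zL by blast
    thus "s = 0" using b by (simp add: \<theta>_def axis_def)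
  next
    assume "s = 0" thus "zero_on \<omega> (lines_sum \<Phi>)" unfolding zL using b by (simp add: \<theta>_def sp23)
  qed
  show "zero_on \<omega> (W_space \<Phi>)" if "a = 0" "s = 0" "c = 0" unfolding zW by (simp add: \<theta>_def that)
  show "ker_on \<omega> (W_space \<Phi>) = line2 \<Phi>" if as: "a = 0" "s = 0" "c \<noteq> 0"
  proof -
    have "{u \<in> span {axis 1 1, axis 2 1, axis 3 1}. \<forall>v\<in>span {axis 1 1, axis 2 1, axis 3 1}. \<theta> u v = 0} = span {axis 3 1 :: 'n space}"
    proof (intro subset_antisym subsetI)
      fix u :: "'n space" assume u: "u \<in> {u \<in> span {axis 1 1, axis 2 1, axis 3 1}. \<forall>v\<in>span {axis 1 1, axis 2 1, axis 3 1}. \<theta> u v = 0}"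
      hence "\<theta> u (axis 1 1) = 0" "\<theta> u (axis 2 1) = 0" using ax(5,6) by blast+
      hence "u $ 1 = 0" "u $ 2 = 0" using as b by (simp_all add: \<theta>_def axis_def)
      moreover have "u $ i = 0" if "i \<notin> {1, 2, 3}" for i using sp[of u i] that u by simp
      ultimately have "u $ i = (u $ 3 *\<^sub>R axis 3 1) $ i" for i
        by (cases "i \<in> {1, 2, 3}") (auto simp: axis_def)
      hence "u = u $ 3 *\<^sub>R axis 3 1" unfolding vec_eq_iff by blast
      moreover have "u $ 3 *\<^sub>R axis 3 1 \<in> span {axis 3 1 :: 'n space}" by (intro span_scale span_base) simp
      ultimately show "u \<in> span {axis 3 1}" by simp
    next
      fix u :: "'n space" assume u: "u \<in> span {axis 3 1}"
      have "span {axis 3 1 :: 'n space} \<subseteq> span {axis 1 1, axis 2 1, axis 3 1}" by (rule span_mono) simp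
      moreover have "u $ 1 = 0" "u $ 2 = 0" using span_axis_zero[of u "{3}"] u b by simp_all
      ultimately show "u \<in> {u \<in> span {axis 1 1, axis 2 1, axis 3 1}. \<forall>v\<in>span {axis 1 1, axis 2 1, axis 3 1}. \<theta> u v = 0}"
        using u by (auto simp: \<theta>_def as)
    qed
    thus ?thesis unfolding kW n(7) unfolding line2_def by simp
  qed
qed

section \<open>The classes\<close>

lemma linear_dx13: "linear (\<lambda>u :: 'n::finite space. p * u $ 3 + q * u $ 1)"
  by (rule linearI) (simp_all add: algebra_simps)

lemma d_form1_dx13:
  fixes P Q :: "'n::finite space \<Rightarrow> real"
  assumes "(P has_derivative (\<lambda>u. P1 * u $ 1 + P2 * u $ 2 + P3 * u $ 3)) (at x)"
    "(Q has_derivative (\<lambda>u. Q1 * u $ 1 + Q2 * u $ 2 + Q3 * u $ 3)) (at x)"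
  shows "d_form1 (\<lambda>x u. P x * u $ 3 + Q x * u $ 1) x u v =
    (P1 - Q3) * dx_wedge 1 3 x u v + P2 * dx_wedge 2 3 x u v - Q2 * dx_wedge 1 2 x u v"
proof -
  have "fd (\<lambda>y. P y * w $ 3 + Q y * w $ 1) x h = (P1 * h $ 1 + P2 * h $ 2 + P3 * h $ 3) * w $ 3 + (Q1 * h $ 1 + Q2 * h $ 2 + Q3 * h $ 3) * w $ 1" for w h :: "'n space"
    by (rule fun_cong[OF fd_eqI]) (auto intro!: derivative_eq_intros assms)
  thus ?thesis by (simp add: d_form1_def dx_wedge_def algebra_simps)
qed

text \<open>Made as far as possible of the functions \<open>x\<^sub>2 + x\<^sub>3\<^sup>2\<close> and \<open>x\<^sub>1\<^sup>2 - x\<^sub>3\<^sup>3\<close>, which vanish on the cuspidal branch;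
  only \<open>a1\<close> and \<open>e\<close> are visible there.\<close>

definition cusp_primitive :: "real \<Rightarrow> real \<Rightarrow> real \<Rightarrow> real \<Rightarrow> real \<Rightarrow> real \<Rightarrow> real \<Rightarrow> real \<Rightarrow> 'n::finite form1" where
  "cusp_primitive a1 s c e a5 a6 a7 a8 x u =
    (a1 * x $ 1 + s * (x $ 2 + (x $ 3)^2) + e * (x $ 1 * x $ 3) + a5 / 2 * ((x $ 1)^2 - (x $ 3)^3)
      + a7 / 2 * (((x $ 1)^2 - (x $ 3)^3) * x $ 3) + a8 / 11 * (((x $ 1)^2 - (x $ 3)^3) * x $ 1)) * u $ 3
    + (- c * (x $ 2 + (x $ 3)^2) + a6 / 3 * ((x $ 1)^2 - (x $ 3)^3) + 3 * a8 / 11 * (((x $ 1)^2 - (x $ 3)^3) * x $ 3)) * u $ 1"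

lemma form1_on_cusp_primitive: "form1_on UNIV (cusp_primitive a1 s c e a5 a6 a7 a8 :: 'n::finite form1)"
  unfolding form1_on_def
proof (intro conjI ballI allI)
  show "linear (cusp_primitive a1 s c e a5 a6 a7 a8 x :: 'n space \<Rightarrow> real)" for x
    unfolding cusp_primitive_def[abs_def] by (rule linear_dx13)
  show "smooth_on UNIV (\<lambda>x. cusp_primitive a1 s c e a5 a6 a7 a8 x u)" for u :: "'n space"
    unfolding cusp_primitive_def by (intro smooth_intros open_UNIV)
qed

text \<open>Origin of the constants: \<open>-(x2 + x3^2) dx1\<close> has differential
  \<open>theta3 + 2 theta4\<close>, hence \<open>e + 2 * c\<close>. In the part with
  \<open>a8\<close> the factors 1/11 and 3/11 make the \<open>x1^2\<close> terms cancel between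
  \<open>3 x1^2 - x3^3\<close> and \<open>3 (x1^2 - 4 x3^3)\<close>, leaving
  \<open>11 x3^3\<close>.\<close>

lemma d_cusp_primitive:
  "d_form1 (cusp_primitive a1 s c e a5 a6 a7 a8) x u v = a1 * theta1 x u v + s * theta2 x u v + c * theta3 x u v
    + (e + 2 * c) * theta4 x u v + a5 * theta5 x u v + a6 * theta6 x u v + a7 * theta7 x u v + a8 * theta8 x u v"
proof -
  have 1: "((\<lambda>x. a1 * x $ 1 + s * (x $ 2 + (x $ 3)^2) + e * (x $ 1 * x $ 3) + a5 / 2 * ((x $ 1)^2 - (x $ 3)^3)
      + a7 / 2 * (((x $ 1)^2 - (x $ 3)^3) * x $ 3) + a8 / 11 * (((x $ 1)^2 - (x $ 3)^3) * x $ 1)) has_derivative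
    (\<lambda>u. (a1 + e * x $ 3 + a5 * x $ 1 + a7 * x $ 1 * x $ 3 + a8 / 11 * (3 * (x $ 1)^2 - (x $ 3)^3)) * u $ 1 + s * u $ 2
      + (2 * s * x $ 3 + e * x $ 1 - 3 / 2 * a5 * (x $ 3)^2 + a7 / 2 * ((x $ 1)^2 - 4 * (x $ 3)^3) - 3 * a8 / 11 * (x $ 3)^2 * x $ 1) * u $ 3))
    (at x)"
    by (auto intro!: derivative_eq_intros bounded_linear.has_derivative[OF bounded_linear_vec_nth]
        simp: fun_eq_iff field_simps eval_nat_numeral)
  have 2: "((\<lambda>x. - c * (x $ 2 + (x $ 3)^2) + a6 / 3 * ((x $ 1)^2 - (x $ 3)^3) + 3 * a8 / 11 * (((x $ 1)^2 - (x $ 3)^3) * x $ 3)) has_derivative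
    (\<lambda>u. (2 / 3 * a6 * x $ 1 + 6 * a8 / 11 * x $ 1 * x $ 3) * u $ 1 + (- c) * u $ 2
      + (- 2 * c * x $ 3 - a6 * (x $ 3)^2 + 3 * a8 / 11 * ((x $ 1)^2 - 4 * (x $ 3)^3)) * u $ 3)) (at x)"
    by (auto intro!: derivative_eq_intros bounded_linear.has_derivative[OF bounded_linear_vec_nth]
        simp: fun_eq_iff field_simps eval_nat_numeral)
  show ?thesis unfolding cusp_primitive_def[abs_def] d_form1_dx13[OF 1 2]
    by (simp add: theta1_def theta2_def theta3_def theta4_def theta5_def theta6_def theta7_def theta8_def dx_wedge_def field_simps)
qed

text \<open>Chosen so as to vanish on both smooth branches.\<close>

definition axes_primitive :: "real \<Rightarrow> real \<Rightarrow> real \<Rightarrow> real \<Rightarrow> real \<Rightarrow> 'n::finite form1" where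
  "axes_primitive a4 a5 a6 a7 a8 x u = x $ 1 * (a4 * x $ 3 + a5 / 2 * x $ 1 + a6 * (x $ 3)^2
    + a7 / 2 * x $ 1 * x $ 3 + a8 * (x $ 3)^3) * u $ 3 + 0 * u $ 1"

lemma form1_on_axes_primitive: "form1_on UNIV (axes_primitive a4 a5 a6 a7 a8 :: 'n::finite form1)"
  unfolding form1_on_def
proof (intro conjI ballI allI)
  show "linear (axes_primitive a4 a5 a6 a7 a8 x :: 'n space \<Rightarrow> real)" for x
    unfolding axes_primitive_def[abs_def] by (rule linear_dx13)
  show "smooth_on UNIV (\<lambda>x. axes_primitive a4 a5 a6 a7 a8 x u)" for u :: "'n space"
    unfolding axes_primitive_def by (intro smooth_intros open_UNIV)
qed

text \<open>The halves come from differentiating \<open>x1^2\<close>. Along the cusp the five terms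
  become t^5, t^6, t^7, t^8, t^9 in the order of the coefficients.\<close>

lemma d_axes_primitive:
  "d_form1 (axes_primitive a4 a5 a6 a7 a8) x u v = a4 * theta4 x u v + a5 * theta5 x u v + a6 * theta6 x u v
    + a7 * theta7 x u v + a8 * theta8 x u v"
proof -
  have 1: "((\<lambda>x. x $ 1 * (a4 * x $ 3 + a5 / 2 * x $ 1 + a6 * (x $ 3)^2 + a7 / 2 * x $ 1 * x $ 3 + a8 * (x $ 3)^3)) has_derivative
    (\<lambda>u. (a4 * x $ 3 + a5 * x $ 1 + a6 * (x $ 3)^2 + a7 * x $ 1 * x $ 3 + a8 * (x $ 3)^3) * u $ 1 + 0 * u $ 2
      + (x $ 1 * (a4 + 2 * a6 * x $ 3 + a7 / 2 * x $ 1 + 3 * a8 * (x $ 3)^2)) * u $ 3)) (at x)"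
    by (auto intro!: derivative_eq_intros bounded_linear.has_derivative[OF bounded_linear_vec_nth]
        simp: fun_eq_iff field_simps eval_nat_numeral)
  have 2: "((\<lambda>x. 0) has_derivative (\<lambda>u. 0 * u $ 1 + 0 * u $ 2 + 0 * u $ 3)) (at x)" by simp
  show ?thesis unfolding axes_primitive_def[abs_def] d_form1_dx13[OF 1 2]
    by (simp add: theta4_def theta5_def theta6_def theta7_def theta8_def dx_wedge_def field_simps)
qed

text \<open>Without \<open>theta1\<close> the plane of the cusp is isotropic at 0, and on the cusp
  the primitive is \<open>e * t ^ 5\<close> times \<open>dx3\<close>. So some Lagrangian germ has
  order at least 5, or infinite order if e = 0, while order 6 forces e = 0 by comparison of
  jets.\<close>

lemma L3_value:
  fixes \<omega> :: "'n::finite form2"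
  assumes card: "CARD('n) \<ge> 2" and \<omega>: "symplectic_germ \<omega>" and \<Phi>: "diffeo_germ_onto \<Phi> U8 N"
    and nf: "has_normal_form \<omega> N (d_form1 (cusp_primitive 0 s c e a5 a6 a7 a8))"
  shows "L3 \<omega> \<Phi> = (if e = 0 then \<infinity> else 5)"
proof -
  let ?\<eta> = "cusp_primitive 0 s c e a5 a6 a7 a8 :: 'n form1"
  note b = bit0_numerals_distinct[OF card] and \<eta> = form1_on_cusp_primitive[of 0 s c e a5 a6 a7 a8]
  obtain \<Phi>' \<Psi>' U V \<beta> where n: "local_diffeo \<Phi>' \<Psi>' U V" "\<Phi>' ` (U8 \<inter> U) = N \<inter> V" "form1_on U \<beta>"
    "\<And>x u v. x \<in> U \<Longrightarrow> pullback \<Phi>' \<omega> x u v = d_form1 (\<lambda>x u. ?\<eta> x u + \<beta> x u) x u v"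
    "\<And>x u. x \<in> U8 \<inter> U \<Longrightarrow> \<beta> x u = 0"
    "\<And>u v. u \<in> W_std \<Longrightarrow> v \<in> W_std \<Longrightarrow> d_form1 (\<lambda>x u. ?\<eta> x u + \<beta> x u) 0 u v = d_form1 ?\<eta> 0 u v"
    "L3 \<omega> \<Phi> = L3 \<omega> \<Phi>'"
    by (rule normal_form_chart[OF card \<omega> \<Phi> \<eta> nf]) blast
  note D = local_diffeoD[OF n(1)]
  have U8_0: "(0 :: 'n space) \<in> U8" by (simp add: U8_def)
  have \<eta>3: "?\<eta> (std3 t) u = e * t ^ 5 * u $ 3" for t u
    by (simp add: cusp_primitive_def std_components[OF card])
  define \<sigma> where "\<sigma> x u = ?\<eta> x u + \<beta> x u" for x u
  have \<sigma>: "form1_on U \<sigma>" unfolding \<sigma>_def by (rule form1_on_add[OF D(1) form1_on_subset[OF \<eta> subset_UNIV] n(3)])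
  have \<sigma>0: "\<sigma> 0 u = 0" for u using n(5)[of 0 u] U8_0 D(3) by (simp add: \<sigma>_def cusp_primitive_def)
  have W: "axis i 1 \<in> (W_std :: 'n space set)" if "i \<in> {1, 2, 3}" for i using that by (auto simp: W_std_def axis_def)
  have iso: "d_form1 \<sigma> 0 (axis 1 1) (axis 3 1) = 0"
    using n(6)[OF W[of 1] W[of 3]] b
    by (simp add: \<sigma>_def[abs_def] d_cusp_primitive theta2_def theta3_def theta4_def theta5_def theta6_def theta7_def theta8_def dx_wedge_def axis_def)
  obtain H where H: "lagrangian_germ \<omega> H"
    "\<And>k. (\<And>u. order_ge k (\<lambda>t. \<sigma> (std3 t) u)) \<Longrightarrow> order_ge k (\<lambda>t. H (\<Phi>' (std3 t)))"
  proof (rule lagrangian_along_std3[OF card \<omega> n(1) \<sigma> n(4)[folded \<sigma>_def] \<sigma>0 iso])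
    fix H assume a: "lagrangian_germ \<omega> H"
      "\<And>k. (\<And>u. order_ge k (\<lambda>t. \<sigma> (std3 t) u)) \<Longrightarrow> order_ge k (\<lambda>t. H (\<Phi>' (std3 t)))"
    show thesis by (rule that[OF a])
  qed
  have H': "enat k \<le> tangency_order (branch3 \<Phi>') H" if k: "e = 0 \<or> k \<le> 5" for k
    unfolding tangency_order_branches(3)[OF H(1) n(1)]
  proof (rule H(2))
    fix u :: "'n space"
    have "order_ge k (\<lambda>t. (e * u $ 3) * t ^ 5)"
      using k order_ge_monomial[of k 5 "e * u $ 3"] order_ge_zero[of "\<lambda>t. (e * u $ 3) * t ^ 5" k] by auto
    moreover have "\<forall>\<^sub>F t in nhds 0. norm (\<sigma> (std3 t) u) \<le> 1 * norm ((e * u $ 3) * t ^ 5)"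
      using smooth_at0_along(2)[OF D(7,1,3) smooth_std(3) std_0(3)]
    proof eventually_elim
      case (elim t)
      have "\<beta> (std3 t) u = 0" by (rule n(5)) (use elim std_in_U8(3)[OF card] in blast)
      thus ?case by (simp add: \<sigma>_def \<eta>3 mult_ac)
    qed
    ultimately show "order_ge k (\<lambda>t. \<sigma> (std3 t) u)" by (rule order_ge_mono)
  qed
  have upper: "tangency_order (branch3 \<Phi>') H' \<le> 5" if e: "e \<noteq> 0" and H': "lagrangian_germ \<omega> H'" for H'
  proof (rule ccontr)
    assume "\<not> tangency_order (branch3 \<Phi>') H' \<le> 5"
    hence "enat 6 \<le> tangency_order (branch3 \<Phi>') H'"
      by (cases "tangency_order (branch3 \<Phi>') H'") (auto simp: numeral_eq_enat)
    hence o: "order_ge 6 (\<lambda>t. H' (\<Phi>' (std3 t)))" by (simp only: tangency_order_branches(3)[OF H' n(1)])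
    obtain r F where F: "r > 0" "smooth_on (ball 0 r) F"
      "\<And>c k u. smooth_on UNIV c \<Longrightarrow> c 0 = 0 \<Longrightarrow> (\<And>t. c t \<in> U8) \<Longrightarrow> order_ge k (\<lambda>t. H' (\<Phi>' (c t))) \<Longrightarrow>
      order_ge k (\<lambda>t. fd F (c t) u + ?\<eta> (c t) u)"
      by (rule potential_of_lagrangian[OF n(1) \<eta> n(3,4,5) H']) blast+
    note F3 = F(3)[OF smooth_std(3) std_0(3) std_in_U8(3)[OF card] o, unfolded \<eta>3]
    have "e = 0"
      by (rule std3_order_bound[OF F(2)]) (use F(1) F3[of "axis 1 1"] F3[of "axis 2 1"] F3[of "axis 3 1"] b in \<open>simp_all add: axis_def\<close>)
    thus False using e by simp
  qed
  show ?thesis unfolding n(7)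
  proof (cases "e = 0")
    case True
    have "tangency_order (branch3 \<Phi>') H = \<infinity>" by (rule enat_infinityI) (simp add: H' True)
    hence "L3 \<omega> \<Phi>' = \<infinity>" unfolding L3_def using H(1) by (intro Greatest_equality) auto
    thus "L3 \<omega> \<Phi>' = (if e = 0 then \<infinity> else 5)" using True by simp
  next
    case False
    have "tangency_order (branch3 \<Phi>') H = 5"
      using H'[of 5] upper[OF False H(1)] by (intro antisym) (simp_all add: numeral_eq_enat)
    hence "L3 \<omega> \<Phi>' = 5" unfolding L3_def using H(1) upper[OF False] by (intro Greatest_equality) auto
    thus "L3 \<omega> \<Phi>' = (if e = 0 then \<infinity> else 5)" using False by simp
  qed
qed

lemma enat_Suc_le_iff: "enat (Suc l) \<le> x \<longleftrightarrow> \<not> x \<le> enat l"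
  by (cases x) auto

lemma order_ge_Suc:
  assumes "order_ge (Suc k) f"
  shows "order_ge k f"
proof -
  obtain C where C: "\<forall>\<^sub>F t in nhds 0. norm (f t) \<le> C * \<bar>t\<bar> ^ Suc k" using assms unfolding order_ge_def by blast
  have "\<forall>\<^sub>F t in nhds 0. \<bar>t::real\<bar> < 1"
    unfolding eventually_nhds_metric by (intro exI[of _ 1]) (simp add: dist_real_def)
  with C have "\<forall>\<^sub>F t in nhds 0. norm (f t) \<le> \<bar>C\<bar> * \<bar>t\<bar> ^ k"
  proof eventually_elim
    case (elim t)
    have "C * \<bar>t\<bar> ^ Suc k \<le> \<bar>C\<bar> * \<bar>t\<bar> ^ k"
      using elim(2) by (intro mult_mono) (simp_all add: mult_left_le_one_le)
    thus ?case using elim(1) by linarith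
  qed
  thus ?thesis unfolding order_ge_def by blast
qed

text \<open>The hypothesis \<open>g\<close> says that \<open>c * t ^ l\<close> is the leading term
  of the primitive on the cusp. The primitive vanishes on the smooth branches, so one Lagrangian
  germ has infinite order along these and order at least l along the cusp; the comparison of jets
  excludes order l + 1 along all three.\<close>

lemma Lt_value:
  fixes \<omega> :: "'n::finite form2"
  assumes card: "CARD('n) \<ge> 2" and \<omega>: "symplectic_germ \<omega>" and \<Phi>: "diffeo_germ_onto \<Phi> U8 N"
    and nf: "has_normal_form \<omega> N (d_form1 (axes_primitive a4 a5 a6 a7 a8))"
    and l: "l \<in> {5, 6, 7, 8, 9}" and c: "c \<noteq> 0"
    and g: "order_ge (Suc l) (\<lambda>t. a4 * t ^ 5 + a5 / 2 * t ^ 6 + a6 * t ^ 7 + a7 / 2 * t ^ 8 + a8 * t ^ 9 - c * t ^ l)"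
  shows "zero_on \<omega> (W_space \<Phi>)" "L12 \<omega> \<Phi> = \<infinity>" "Lt \<omega> \<Phi> = enat l"
proof -
  let ?\<eta> = "axes_primitive a4 a5 a6 a7 a8 :: 'n form1"
  define G where "G t = a4 * t ^ 5 + a5 / 2 * t ^ 6 + a6 * t ^ 7 + a7 / 2 * t ^ 8 + a8 * t ^ 9" for t
  note b = bit0_numerals_distinct[OF card] and \<eta> = form1_on_axes_primitive[of a4 a5 a6 a7 a8]
  have dz: "d_form1 ?\<eta> 0 u v = 0" for u v
    by (simp add: d_axes_primitive theta4_def theta5_def theta6_def theta7_def theta8_def)
  show "zero_on \<omega> (W_space \<Phi>)"
    by (rule tangent_conditions(3)[OF card \<omega> \<Phi> \<eta> nf, of 0 0 0]) (simp_all add: dz)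
  obtain \<Phi>' \<Psi>' U V \<beta> where n: "local_diffeo \<Phi>' \<Psi>' U V" "\<Phi>' ` (U8 \<inter> U) = N \<inter> V" "form1_on U \<beta>"
    "\<And>x u v. x \<in> U \<Longrightarrow> pullback \<Phi>' \<omega> x u v = d_form1 (\<lambda>x u. ?\<eta> x u + \<beta> x u) x u v"
    "\<And>x u. x \<in> U8 \<inter> U \<Longrightarrow> \<beta> x u = 0"
    "\<And>u v. u \<in> W_std \<Longrightarrow> v \<in> W_std \<Longrightarrow> d_form1 (\<lambda>x u. ?\<eta> x u + \<beta> x u) 0 u v = d_form1 ?\<eta> 0 u v"
    "L12 \<omega> \<Phi> = L12 \<omega> \<Phi>'" "Lt \<omega> \<Phi> = Lt \<omega> \<Phi>'"
    by (rule normal_form_chart[OF card \<omega> \<Phi> \<eta> nf]) blast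
  note D = local_diffeoD[OF n(1)]
  have U8_0: "(0 :: 'n space) \<in> U8" by (simp add: U8_def)
  have \<eta>1: "?\<eta> (std1 t) u = 0" "?\<eta> (std2 t) u = 0" for t u
    by (simp_all add: axes_primitive_def std_components[OF card])
  have \<eta>3: "?\<eta> (std3 t) u = G t * u $ 3" for t u
    by (simp add: axes_primitive_def G_def std_components[OF card]) (simp add: field_simps eval_nat_numeral)
  define \<sigma> where "\<sigma> x u = ?\<eta> x u + \<beta> x u" for x u
  have \<sigma>: "form1_on U \<sigma>" unfolding \<sigma>_def by (rule form1_on_add[OF D(1) form1_on_subset[OF \<eta> subset_UNIV] n(3)])
  have \<sigma>0: "\<sigma> 0 u = 0" for u using n(5)[of 0 u] U8_0 D(3) by (simp add: \<sigma>_def axes_primitive_def)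
  have iso: "d_form1 \<sigma> 0 u v = 0" if "u \<in> W_std" "v \<in> W_std" for u v
    using n(6)[OF that] dz by (simp add: \<sigma>_def[abs_def])
  obtain H where H: "lagrangian_germ \<omega> H"
    "\<And>k. (\<And>u. order_ge k (\<lambda>t. \<sigma> (std1 t) u)) \<Longrightarrow> order_ge k (\<lambda>t. H (\<Phi>' (std1 t)))"
    "\<And>k. (\<And>u. order_ge k (\<lambda>t. \<sigma> (std2 t) u)) \<Longrightarrow> order_ge k (\<lambda>t. H (\<Phi>' (std2 t)))"
    "\<And>k. (\<And>u. order_ge k (\<lambda>t. \<sigma> (std3 t) u)) \<Longrightarrow> order_ge k (\<lambda>t. H (\<Phi>' (std3 t)))"
  proof (rule lagrangian_along_W[OF card \<omega> n(1) \<sigma> n(4)[folded \<sigma>_def] \<sigma>0 iso])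
    fix H assume a: "lagrangian_germ \<omega> H"
      "\<And>k. (\<And>u. order_ge k (\<lambda>t. \<sigma> (std1 t) u)) \<Longrightarrow> order_ge k (\<lambda>t. H (\<Phi>' (std1 t)))"
      "\<And>k. (\<And>u. order_ge k (\<lambda>t. \<sigma> (std2 t) u)) \<Longrightarrow> order_ge k (\<lambda>t. H (\<Phi>' (std2 t)))"
      "\<And>k. (\<And>u. order_ge k (\<lambda>t. \<sigma> (std3 t) u)) \<Longrightarrow> order_ge k (\<lambda>t. H (\<Phi>' (std3 t)))"
    show thesis by (rule that[OF a])
  qed
  have ev: "\<forall>\<^sub>F t in nhds 0. \<sigma> (c t) u = ?\<eta> (c t) u"
    if "smooth_on UNIV c" "c 0 = 0" "\<And>t. c t \<in> U8" for c :: "real \<Rightarrow> 'n space" and u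
    by (rule eventually_mono[OF smooth_at0_along(2)[OF D(7,1,3) that(1,2)]]) (use n(5) that(3) in \<open>simp add: \<sigma>_def\<close>)
  have z: "order_ge k (\<lambda>t. \<sigma> (std1 t) u)" "order_ge k (\<lambda>t. \<sigma> (std2 t) u)" for k u
    using ev[OF smooth_std(1) std_0(1) std_in_U8(1)[OF card], of u] ev[OF smooth_std(2) std_0(2) std_in_U8(2)[OF card], of u]
    by (simp_all add: \<eta>1 order_ge_zero)
  have H12: "enat k \<le> tangency_order (branch1 \<Phi>') H" "enat k \<le> tangency_order (branch2 \<Phi>') H" for k
    unfolding tangency_order_branches[OF H(1) n(1)] by (rule H(2)[OF z(1)] H(3)[OF z(2)])+
  have "order_ge l (\<lambda>t. G t - c * t ^ l)" using g unfolding G_def by (rule order_ge_Suc)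
  hence "order_ge l (\<lambda>t. (G t - c * t ^ l) + c * t ^ l)" by (intro order_ge_add order_ge_monomial) simp_all
  hence Gl: "order_ge l G" by simp
  have H3: "enat l \<le> tangency_order (branch3 \<Phi>') H"
    unfolding tangency_order_branches[OF H(1) n(1)]
  proof (rule H(4))
    fix u :: "'n space"
    have "\<forall>\<^sub>F t in nhds 0. norm (\<sigma> (std3 t) u) \<le> \<bar>u $ 3\<bar> * norm (G t)"
      by (rule eventually_mono[OF ev[OF smooth_std(3) std_0(3) std_in_U8(3)[OF card], of u]]) (simp add: \<eta>3 abs_mult)
    thus "order_ge l (\<lambda>t. \<sigma> (std3 t) u)" by (rule order_ge_mono[OF Gl])
  qed
  show "L12 \<omega> \<Phi> = \<infinity>" unfolding n(7) unfolding L12_def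
  proof (rule Greatest_equality)
    show "\<exists>H. lagrangian_germ \<omega> H \<and> \<infinity> = min (tangency_order (branch1 \<Phi>') H) (tangency_order (branch2 \<Phi>') H)"
      using H(1) enat_infinityI[OF H12(1)] enat_infinityI[OF H12(2)] by (intro exI[of _ H]) simp
  qed simp
  have upper: "Min {tangency_order (branch1 \<Phi>') H', tangency_order (branch2 \<Phi>') H', tangency_order (branch3 \<Phi>') H'} \<le> enat l"
    if H': "lagrangian_germ \<omega> H'" for H'
  proof (rule ccontr)
    assume "\<not> ?thesis"
    hence o: "order_ge (Suc l) (\<lambda>t. H' (\<Phi>' (std1 t)))" "order_ge (Suc l) (\<lambda>t. H' (\<Phi>' (std2 t)))"
      "order_ge (Suc l) (\<lambda>t. H' (\<Phi>' (std3 t)))"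
      by (simp_all add: enat_Suc_le_iff min_le_iff_disj flip: tangency_order_branches[OF H' n(1)])
    obtain r F where F: "r > 0" "smooth_on (ball 0 r) F"
      "\<And>c k u. smooth_on UNIV c \<Longrightarrow> c 0 = 0 \<Longrightarrow> (\<And>t. c t \<in> U8) \<Longrightarrow> order_ge k (\<lambda>t. H' (\<Phi>' (c t))) \<Longrightarrow>
      order_ge k (\<lambda>t. fd F (c t) u + ?\<eta> (c t) u)"
      by (rule potential_of_lagrangian[OF n(1) \<eta> n(3,4,5) H']) blast+
    note F1 = F(3)[OF smooth_std(1) std_0(1) std_in_U8(1)[OF card] o(1), unfolded \<eta>1 add_0_right]
    note F2 = F(3)[OF smooth_std(2) std_0(2) std_in_U8(2)[OF card] o(2), unfolded \<eta>1 add_0_right]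
    note F3 = F(3)[OF smooth_std(3) std_0(3) std_in_U8(3)[OF card] o(3), unfolded \<eta>3]
    \<comment> \<open>Terms of order above l are removed, leaving the bare monomial that the
      comparison of jets expects.\<close>
    have "order_ge (Suc l) (\<lambda>t. (fd F (std3 t) (axis 3 1) + G t * (axis 3 1 :: 'n space) $ 3) + (- 1) * (G t - c * t ^ l))"
      using g by (intro order_ge_add[OF F3] order_ge_cmult) (simp add: G_def)
    hence 3: "order_ge (Suc l) (\<lambda>t. fd F (std3 t) (axis 3 1) + c * t ^ l)" by (simp add: axis_def)
    have "c = 0"
      by (rule branches_order_bound[OF F(2) open_ball _ l _ _ 3 F1 F2])
        (use F(1) F3[of "axis 1 1"] F3[of "axis 2 1"] b in \<open>simp_all add: axis_def\<close>)
    thus False using c by simp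
  qed
  show "Lt \<omega> \<Phi> = enat l" unfolding n(8) unfolding Lt_def
  proof (rule Greatest_equality)
    have "enat l = Min {tangency_order (branch1 \<Phi>') H, tangency_order (branch2 \<Phi>') H, tangency_order (branch3 \<Phi>') H}"
      using upper[OF H(1)] H12[of l] H3 by (intro antisym) simp_all
    thus "\<exists>H. lagrangian_germ \<omega> H \<and> enat l = Min {tangency_order (branch1 \<Phi>') H, tangency_order (branch2 \<Phi>') H, tangency_order (branch3 \<Phi>') H}"
      using H(1) by blast
  qed (use upper in blast)
qed

text \<open>Here the primitive is \<beta> alone. It vanishes on \<open>U8\<close> as a set, not
  merely to some order along the branches, so the Lagrangian germ built on W contains N.\<close>

lemma zero_restriction_lagrangian:
  fixes \<omega> :: "'n::finite form2"
  assumes card: "CARD('n) \<ge> 2" and \<omega>: "symplectic_germ \<omega>" and \<Phi>: "diffeo_germ_onto \<Phi> U8 N"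
    and nf: "has_normal_form \<omega> N (\<lambda>x u v. 0)"
  shows "zero_on \<omega> (W_space \<Phi>)" "L12 \<omega> \<Phi> = \<infinity>" "contained_in_lagrangian \<omega> N"
proof -
  let ?\<eta> = "(\<lambda>x u. 0) :: 'n form1"
  have \<eta>: "form1_on UNIV ?\<eta>" by (simp add: form1_on_def linear_zero smooth_on_const)
  have d\<eta>: "d_form1 ?\<eta> = (\<lambda>x u v. 0)" by (simp add: fun_eq_iff d_form1_def fd_eqI[OF has_derivative_const])
  note nf' = nf[folded d\<eta>]
  show "zero_on \<omega> (W_space \<Phi>)"
    by (rule tangent_conditions(3)[OF card \<omega> \<Phi> \<eta> nf', of 0 0 0]) (simp_all add: d\<eta>)
  obtain \<Phi>' \<Psi>' U V \<beta> where n: "local_diffeo \<Phi>' \<Psi>' U V" "\<Phi>' ` (U8 \<inter> U) = N \<inter> V" "form1_on U \<beta>"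
    "\<And>x u v. x \<in> U \<Longrightarrow> pullback \<Phi>' \<omega> x u v = d_form1 (\<lambda>x u. ?\<eta> x u + \<beta> x u) x u v"
    "\<And>x u. x \<in> U8 \<inter> U \<Longrightarrow> \<beta> x u = 0"
    "\<And>u v. u \<in> W_std \<Longrightarrow> v \<in> W_std \<Longrightarrow> d_form1 (\<lambda>x u. ?\<eta> x u + \<beta> x u) 0 u v = d_form1 ?\<eta> 0 u v"
    "L12 \<omega> \<Phi> = L12 \<omega> \<Phi>'"
    by (rule normal_form_chart[OF card \<omega> \<Phi> \<eta> nf']) blast
  note D = local_diffeoD[OF n(1)]
  have \<beta>0: "\<beta> 0 u = 0" for u using n(5)[of 0 u] D(3) by (simp add: U8_def)
  obtain H \<delta> where H: "lagrangian_germ \<omega> H" "\<delta> > 0"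
    "\<And>x. x \<in> W_std \<Longrightarrow> x \<in> ball 0 \<delta> \<Longrightarrow> (\<And>u. \<beta> x u = 0) \<Longrightarrow> H (\<Phi>' x) = 0"
  proof (rule lagrangian_along_W[OF card \<omega> n(1,3) _ \<beta>0])
    show "pullback \<Phi>' \<omega> x u v = d_form1 \<beta> x u v" if "x \<in> U" for x u v using n(4)[OF that] by simp
    show "d_form1 \<beta> 0 u v = 0" if "u \<in> W_std" "v \<in> W_std" for u v using n(6)[OF that] by (simp add: d\<eta>)
    fix H \<delta> assume a: "lagrangian_germ \<omega> H" "\<delta> > 0"
      "\<And>x. x \<in> W_std \<Longrightarrow> x \<in> ball 0 \<delta> \<Longrightarrow> (\<And>u. \<beta> x u = 0) \<Longrightarrow> H (\<Phi>' x) = 0"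
    show thesis by (rule that[OF a])
  qed
  define O' where "O' = U \<inter> ball 0 \<delta>"
  have O: "open O'" "0 \<in> O'" using D(1,3) H(2) by (auto simp: O'_def)
  have H0: "H (\<Phi>' x) = 0" if "x \<in> U8" "x \<in> O'" for x
  proof (rule H(3))
    show "x \<in> W_std" using U8_D(3)[OF that(1)] by (simp add: W_std_def)
  qed (use that n(5) in \<open>auto simp: O'_def\<close>)
  show "contained_in_lagrangian \<omega> N" unfolding contained_in_lagrangian_def
  proof (intro exI conjI)
    show "lagrangian_germ \<omega> H" by (rule H(1))
    have "open (V \<inter> \<Psi>' -` O')"
      by (rule continuous_open_preimage[OF smooth_on_continuous_on[OF D(8)] D(2) O(1)])
    moreover have "0 \<in> V \<inter> \<Psi>' -` O'" using D(4,6) O(2) by simp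
    moreover have "H y = 0" if y: "y \<in> V \<inter> \<Psi>' -` O'" "y \<in> N" for y
    proof -
      have "y \<in> \<Phi>' ` (U8 \<inter> U)" using y n(2) by auto
      then obtain x where x: "x \<in> U8" "x \<in> U" "y = \<Phi>' x" by auto
      hence "x \<in> O'" using y(1) D(11) by simp
      thus ?thesis using H0 x by simp
    qed
    ultimately show "\<forall>\<^sub>F x in nhds 0. x \<in> N \<longrightarrow> H x = 0" unfolding eventually_nhds by blast
  qed
  have o: "order_ge k (\<lambda>t. H (\<Phi>' (c t)))" if "smooth_on UNIV c" "c 0 = 0" "\<And>t. c t \<in> U8" for c k
  proof (rule order_ge_zero)
    have "smooth_on O' \<Phi>'" by (rule smooth_on_subset[OF D(7)]) (simp add: O'_def)
    from smooth_at0_along(2)[OF this O that(1,2)]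
    show "\<forall>\<^sub>F t in nhds 0. H (\<Phi>' (c t)) = 0" by (rule eventually_mono) (rule H0[OF that(3)])
  qed
  note t = tangency_order_branches[OF H(1) n(1)]
  have "tangency_order (branch1 \<Phi>') H = \<infinity>" "tangency_order (branch2 \<Phi>') H = \<infinity>"
    by (rule enat_infinityI, simp only: t, rule o, rule smooth_std, rule std_0, rule std_in_U8, rule card)+
  thus "L12 \<omega> \<Phi> = \<infinity>" unfolding n(7) unfolding L12_def using H(1)
    by (intro Greatest_equality exI[of _ H]) simp_all
qed

theorem theorem4p3:
  fixes \<omega> :: "'n::finite form2" and N :: "'n space set" and \<Phi> :: "'n space \<Rightarrow> 'n space"
  assumes "CARD('n) \<ge> 2"
    and "symplectic_germ \<omega>"
    and "diffeo_germ_onto \<Phi> U8 N"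
  shows
    "(\<forall>c1 c2. c1 \<noteq> 0 \<longrightarrow>
        has_normal_form \<omega> N (\<lambda>x u v. theta1 x u v + c1 * theta2 x u v + c2 * theta3 x u v) \<longrightarrow>
        \<not> zero_on \<omega> (V_space \<Phi>) \<and> \<not> zero_on \<omega> (lines_sum \<Phi>)) \<and>
     (\<forall>c2. has_normal_form \<omega> N (\<lambda>x u v. theta1 x u v + c2 * theta3 x u v) \<longrightarrow>
        \<not> zero_on \<omega> (V_space \<Phi>) \<and> zero_on \<omega> (lines_sum \<Phi>)) \<and>
     (\<forall>s\<in>{1, -1}. \<forall>c1 c2. c2 \<noteq> 2 * c1 \<longrightarrow>
        has_normal_form \<omega> N (\<lambda>x u v. s * theta2 x u v + c1 * theta3 x u v + c2 * theta4 x u v) \<longrightarrow>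
        zero_on \<omega> (V_space \<Phi>) \<and> \<not> zero_on \<omega> (lines_sum \<Phi>) \<and> L3 \<omega> \<Phi> = 5) \<and>
     (\<forall>s\<in>{1, -1}. \<forall>c1.
        has_normal_form \<omega> N (\<lambda>x u v. s * theta2 x u v + c1 * theta3 x u v + 2 * c1 * theta4 x u v) \<longrightarrow>
        zero_on \<omega> (V_space \<Phi>) \<and> \<not> zero_on \<omega> (lines_sum \<Phi>) \<and> L3 \<omega> \<Phi> = \<infinity>) \<and>
     (class_2 \<omega> N \<longrightarrow> ker_on \<omega> (W_space \<Phi>) = line2 \<Phi> \<and> L3 \<omega> \<Phi> = 5) \<and>
     (class_3_0_5 \<omega> N \<longrightarrow> ker_on \<omega> (W_space \<Phi>) = line2 \<Phi> \<and> L3 \<omega> \<Phi> = 5) \<and>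
     (class_3_0_inf \<omega> N \<longrightarrow> ker_on \<omega> (W_space \<Phi>) = line2 \<Phi> \<and> L3 \<omega> \<Phi> = \<infinity>) \<and>
     (class_3_1 \<omega> N \<longrightarrow>
        zero_on \<omega> (W_space \<Phi>) \<and> L12 \<omega> \<Phi> = \<infinity> \<and> Lt \<omega> \<Phi> = 5 \<and> L3 \<omega> \<Phi> = 5) \<and>
     (class_4 \<omega> N \<longrightarrow>
        zero_on \<omega> (W_space \<Phi>) \<and> L12 \<omega> \<Phi> = \<infinity> \<and> Lt \<omega> \<Phi> = 6 \<and> L3 \<omega> \<Phi> = \<infinity>) \<and>
     (class_5 \<omega> N \<longrightarrow>
        zero_on \<omega> (W_space \<Phi>) \<and> L12 \<omega> \<Phi> = \<infinity> \<and> Lt \<omega> \<Phi> = 7 \<and> L3 \<omega> \<Phi> = \<infinity>) \<and>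
     (class_6 \<omega> N \<longrightarrow>
        zero_on \<omega> (W_space \<Phi>) \<and> L12 \<omega> \<Phi> = \<infinity> \<and> Lt \<omega> \<Phi> = 8 \<and> L3 \<omega> \<Phi> = \<infinity>) \<and>
     (class_7 \<omega> N \<longrightarrow>
        zero_on \<omega> (W_space \<Phi>) \<and> L12 \<omega> \<Phi> = \<infinity> \<and> Lt \<omega> \<Phi> = 9 \<and> L3 \<omega> \<Phi> = \<infinity>) \<and>
     (class_8 \<omega> N \<longrightarrow>
        zero_on \<omega> (W_space \<Phi>) \<and> L12 \<omega> \<Phi> = \<infinity> \<and> contained_in_lagrangian \<omega> N)"
proof -
  \<comment> \<open>Parametrized by the coefficient e that the cusp sees: it is the
    \<open>theta4\<close> coefficient minus twice the \<open>theta3\<close> coefficient.\<close>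
  have T: "zero_on \<omega> (V_space \<Phi>) \<longleftrightarrow> a1 = 0" "zero_on \<omega> (lines_sum \<Phi>) \<longleftrightarrow> s = 0"
      "a1 = 0 \<Longrightarrow> s = 0 \<Longrightarrow> c \<noteq> 0 \<Longrightarrow> ker_on \<omega> (W_space \<Phi>) = line2 \<Phi>"
      "a1 = 0 \<Longrightarrow> L3 \<omega> \<Phi> = (if e = 0 then \<infinity> else 5)"
    if nf: "has_normal_form \<omega> N \<theta>" and \<theta>: "\<And>x u v. \<theta> x u v = a1 * theta1 x u v + s * theta2 x u v + c * theta3 x u v
      + (e + 2 * c) * theta4 x u v + a5 * theta5 x u v + a6 * theta6 x u v + a7 * theta7 x u v + a8 * theta8 x u v"
    for \<theta> a1 s c e a5 a6 a7 a8
  proof -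
    have "\<theta> = d_form1 (cusp_primitive a1 s c e a5 a6 a7 a8)" by (simp add: fun_eq_iff \<theta> d_cusp_primitive)
    note nf' = nf[unfolded this]
    have "d_form1 (cusp_primitive a1 s c e a5 a6 a7 a8) 0 u v = a1 * dx_wedge 1 3 0 u v + s * dx_wedge 2 3 0 u v + c * dx_wedge 1 2 0 u v"
      for u v :: "'n space"
      by (simp add: d_cusp_primitive theta1_def theta2_def theta3_def theta4_def theta5_def theta6_def theta7_def theta8_def dx_wedge_def)
    note t = tangent_conditions[OF assms form1_on_cusp_primitive nf' this]
    show "zero_on \<omega> (V_space \<Phi>) \<longleftrightarrow> a1 = 0" "zero_on \<omega> (lines_sum \<Phi>) \<longleftrightarrow> s = 0" by (rule t)+
    show "a1 = 0 \<Longrightarrow> s = 0 \<Longrightarrow> c \<noteq> 0 \<Longrightarrow> ker_on \<omega> (W_space \<Phi>) = line2 \<Phi>" by (rule t(4))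
    show "a1 = 0 \<Longrightarrow> L3 \<omega> \<Phi> = (if e = 0 then \<infinity> else 5)" using nf' by (intro L3_value[OF assms]) simp
  qed
  \<comment> \<open>Forms without \<open>theta1\<close>, \<open>theta2\<close>,
    \<open>theta3\<close> have both kinds of primitive: the one adapted to the axes yields
    \<open>Lt\<close>, the one adapted to the cusp, with e equal to \<open>a4\<close>, yields
    \<open>L3\<close>.\<close>
  have T': "zero_on \<omega> (W_space \<Phi>)" "L12 \<omega> \<Phi> = \<infinity>" "Lt \<omega> \<Phi> = enat l" "L3 \<omega> \<Phi> = (if a4 = 0 then \<infinity> else 5)"
    if nf: "has_normal_form \<omega> N \<theta>" and \<theta>: "\<And>x u v. \<theta> x u v = a4 * theta4 x u v + a5 * theta5 x u v
      + a6 * theta6 x u v + a7 * theta7 x u v + a8 * theta8 x u v" and l: "l \<in> {5, 6, 7, 8, 9}" "k \<noteq> 0"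
      "order_ge (Suc l) (\<lambda>t. a4 * t ^ 5 + a5 / 2 * t ^ 6 + a6 * t ^ 7 + a7 / 2 * t ^ 8 + a8 * t ^ 9 - k * t ^ l)"
    for \<theta> a4 a5 a6 a7 a8 k and l :: nat
  proof -
    have "\<theta> = d_form1 (axes_primitive a4 a5 a6 a7 a8)" by (simp add: fun_eq_iff \<theta> d_axes_primitive)
    note t = Lt_value[OF assms nf[unfolded this] l]
    show "zero_on \<omega> (W_space \<Phi>)" "L12 \<omega> \<Phi> = \<infinity>" "Lt \<omega> \<Phi> = enat l" by (rule t)+
    show "L3 \<omega> \<Phi> = (if a4 = 0 then \<infinity> else 5)"
      by (rule T(4)[OF nf, of 0 0 0 a4 a5 a6 a7 a8]) (simp_all add: \<theta>)
  qed
  show ?thesis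
  proof (intro conjI allI ballI impI)
    fix c1 c2 :: real
    assume nf: "has_normal_form \<omega> N (\<lambda>x u v. theta1 x u v + c1 * theta2 x u v + c2 * theta3 x u v)" "c1 \<noteq> 0"
    \<comment> \<open>The \<open>theta4\<close> coefficient is 0, which forces e to be
      \<open>- 2 * c2\<close>.\<close>
    show "\<not> zero_on \<omega> (V_space \<Phi>)" "\<not> zero_on \<omega> (lines_sum \<Phi>)"
      using T(1,2)[OF nf(1), of 1 c1 c2 "- 2 * c2" 0 0 0 0] nf(2) by simp_all
  next
    fix c2 :: real
    assume nf: "has_normal_form \<omega> N (\<lambda>x u v. theta1 x u v + c2 * theta3 x u v)"
    show "\<not> zero_on \<omega> (V_space \<Phi>)" "zero_on \<omega> (lines_sum \<Phi>)"
      using T(1,2)[OF nf, of 1 0 c2 "- 2 * c2" 0 0 0 0] by simp_all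
  next
    fix s c1 c2 :: real
    assume nf: "has_normal_form \<omega> N (\<lambda>x u v. s * theta2 x u v + c1 * theta3 x u v + c2 * theta4 x u v)" "s \<in> {1, - 1}" "c2 \<noteq> 2 * c1"
    \<comment> \<open>Here e is \<open>c2 - 2 * c1\<close>; whether it vanishes separates the two
      cases of this class.\<close>
    show "zero_on \<omega> (V_space \<Phi>)" "\<not> zero_on \<omega> (lines_sum \<Phi>)" "L3 \<omega> \<Phi> = 5"
      using T(1,2,4)[OF nf(1), of 0 s c1 "c2 - 2 * c1" 0 0 0 0] nf(2,3) by auto
  next
    fix s c1 :: real
    assume nf: "has_normal_form \<omega> N (\<lambda>x u v. s * theta2 x u v + c1 * theta3 x u v + 2 * c1 * theta4 x u v)" "s \<in> {1, - 1}"
    show "zero_on \<omega> (V_space \<Phi>)" "\<not> zero_on \<omega> (lines_sum \<Phi>)" "L3 \<omega> \<Phi> = \<infinity>"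
      using T(1,2,4)[OF nf(1), of 0 s c1 0 0 0 0 0] nf(2) by auto
  next
    assume "class_2 \<omega> N"
    then obtain c1 c2 where nf: "c1 \<noteq> 2" "has_normal_form \<omega> N (\<lambda>x u v. theta3 x u v + c1 * theta4 x u v + c2 * theta5 x u v)"
      unfolding class_2_def by blast
    \<comment> \<open>Here e is \<open>c1 - 2\<close>, nonzero by the condition on
      \<open>c1\<close>.\<close>
    show "ker_on \<omega> (W_space \<Phi>) = line2 \<Phi>" "L3 \<omega> \<Phi> = 5"
      using T(3,4)[OF nf(2), of 0 0 1 "c1 - 2" c2 0 0 0] nf(1) by simp_all
  next
    assume "class_3_0_5 \<omega> N"
    then obtain c1 c2 where nf: "has_normal_form \<omega> N (\<lambda>x u v. theta3 x u v - 1 / 3 * theta4 x u v + c1 * theta5 x u v + c2 * theta6 x u v)"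
      unfolding class_3_0_5_def by blast
    \<comment> \<open>Here e is \<open>- 1 / 3 - 2\<close>, which is nonzero, so the order is
      finite.\<close>
    show "ker_on \<omega> (W_space \<Phi>) = line2 \<Phi>" "L3 \<omega> \<Phi> = 5"
      using T(3,4)[OF nf, of 0 0 1 "- 1 / 3 - 2" c1 c2 0 0] by simp_all
  next
    assume "class_3_0_inf \<omega> N"
    then obtain c1 c2 where nf: "has_normal_form \<omega> N (\<lambda>x u v. theta3 x u v + 2 * theta4 x u v + c1 * theta5 x u v + c2 * theta7 x u v)"
      unfolding class_3_0_inf_def by blast
    show "ker_on \<omega> (W_space \<Phi>) = line2 \<Phi>" "L3 \<omega> \<Phi> = \<infinity>"
      using T(3,4)[OF nf, of 0 0 1 0 c1 0 c2 0] by simp_all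
  next
    assume "class_3_1 \<omega> N"
    then obtain c where nf: "has_normal_form \<omega> N (\<lambda>x u v. theta4 x u v + c * theta5 x u v)"
      unfolding class_3_1_def by blast
    \<comment> \<open>Once the leading t^5 is subtracted, what remains starts at t^6.\<close>
    have g: "order_ge (Suc 5) (\<lambda>t. 1 * t ^ 5 + c / 2 * t ^ 6 + 0 * t ^ 7 + 0 / 2 * t ^ 8 + 0 * t ^ 9 - 1 * t ^ 5)"
      using order_ge_monomial[of 6 6 "c / 2"] by simp
    show "zero_on \<omega> (W_space \<Phi>)" "L12 \<omega> \<Phi> = \<infinity>" "Lt \<omega> \<Phi> = 5" "L3 \<omega> \<Phi> = 5"
      using T'[OF nf _ _ _ g] by (simp_all add: numeral_eq_enat)
  next
    assume "class_4 \<omega> N"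
    then obtain s c where s: "s \<in> {1, - 1}" and nf: "has_normal_form \<omega> N (\<lambda>x u v. s * theta5 x u v + c * theta6 x u v)"
      unfolding class_4_def by blast
    \<comment> \<open>The primitive of \<open>theta5\<close> is half of \<open>x1^2 dx3\<close>, so
      the leading coefficient is \<open>s / 2\<close>, nonzero for either sign.\<close>
    have g: "order_ge (Suc 6) (\<lambda>t. 0 * t ^ 5 + s / 2 * t ^ 6 + c * t ^ 7 + 0 / 2 * t ^ 8 + 0 * t ^ 9 - (s / 2) * t ^ 6)"
      using order_ge_monomial[of 7 7 c] by simp
    show "zero_on \<omega> (W_space \<Phi>)" "L12 \<omega> \<Phi> = \<infinity>" "Lt \<omega> \<Phi> = 6" "L3 \<omega> \<Phi> = \<infinity>"
      using T'[OF nf _ _ _ g] s by (auto simp: numeral_eq_enat)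
  next
    assume "class_5 \<omega> N"
    then obtain c where nf: "has_normal_form \<omega> N (\<lambda>x u v. theta6 x u v + c * theta7 x u v)"
      unfolding class_5_def by blast
    have g: "order_ge (Suc 7) (\<lambda>t. 0 * t ^ 5 + 0 / 2 * t ^ 6 + 1 * t ^ 7 + c / 2 * t ^ 8 + 0 * t ^ 9 - 1 * t ^ 7)"
      using order_ge_monomial[of 8 8 "c / 2"] by simp
    show "zero_on \<omega> (W_space \<Phi>)" "L12 \<omega> \<Phi> = \<infinity>" "Lt \<omega> \<Phi> = 7" "L3 \<omega> \<Phi> = \<infinity>"
      using T'[OF nf _ _ _ g] by (simp_all add: numeral_eq_enat)
  next
    assume "class_6 \<omega> N"
    then obtain s c where s: "s \<in> {1, - 1}" and nf: "has_normal_form \<omega> N (\<lambda>x u v. s * theta7 x u v + c * theta8 x u v)"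
      unfolding class_6_def by blast
    have g: "order_ge (Suc 8) (\<lambda>t. 0 * t ^ 5 + 0 / 2 * t ^ 6 + 0 * t ^ 7 + s / 2 * t ^ 8 + c * t ^ 9 - (s / 2) * t ^ 8)"
      using order_ge_monomial[of 9 9 c] by simp
    show "zero_on \<omega> (W_space \<Phi>)" "L12 \<omega> \<Phi> = \<infinity>" "Lt \<omega> \<Phi> = 8" "L3 \<omega> \<Phi> = \<infinity>"
      using T'[OF nf _ _ _ g] s by (auto simp: numeral_eq_enat)
  next
    assume "class_7 \<omega> N"
    hence nf: "has_normal_form \<omega> N theta8" unfolding class_7_def .
    \<comment> \<open>The primitive of \<open>theta8\<close> is exactly t^9 on the cusp, so the
      remainder is zero.\<close>
    have g: "order_ge (Suc 9) (\<lambda>t. 0 * t ^ 5 + 0 / 2 * t ^ 6 + 0 * t ^ 7 + 0 / 2 * t ^ 8 + 1 * t ^ 9 - 1 * t ^ 9)"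
      using order_ge_zero[of "\<lambda>t. 0 :: real" 10] by simp
    show "zero_on \<omega> (W_space \<Phi>)" "L12 \<omega> \<Phi> = \<infinity>" "Lt \<omega> \<Phi> = 9" "L3 \<omega> \<Phi> = \<infinity>"
      using T'[OF nf _ _ _ g] by (simp_all add: numeral_eq_enat)
  next
    assume "class_8 \<omega> N"
    hence nf: "has_normal_form \<omega> N (\<lambda>x u v. 0)" unfolding class_8_def .
    show "zero_on \<omega> (W_space \<Phi>)" "L12 \<omega> \<Phi> = \<infinity>" "contained_in_lagrangian \<omega> N"
      by (rule zero_restriction_lagrangian[OF assms nf])+
  qed
qed

end
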